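(* Let $\mathcal{S}$ be a nonempty analytic family of planar circles. Then $$\dim_{\mathrm{H}} \bigcup_{S \in \mathcal{S}} S = \min\{\dim_{\mathrm{H}} \mathcal{S} + 1, 2\}.$$
   Context: For $x \in \mathbb{R}^{2}$ and $r > 0$, $S(x,r) = \{y \in \mathbb{R}^{2} : |x-y| = r\}$ is the planar circle with centre $x$ and radius $r$. Planar circles are in one-to-one correspondence with points $(x,r) \in \mathbb{R}^{2}\times(0,\infty) \subset \mathbb{R}^{3}$. A family $\mathcal{S}$ of planar circles is called analytic if $\{(x,r) \in \mathbb{R}^2\times(0,\infty) : S(x,r) \in \mathcal{S}\}$ is an analytic (Suslin) subset of $\mathbb{R}^{3}$, and $\dim_{\mathrm{H}} \mathcal{S} := \dim_{\mathrm{H}} \{(x,r) \in \mathbb{R}^2\times(0,\infty) : S(x,r) \in \mathcal{S}\}$, where $\dim_{\mathrm{H}}$ is Hausdorff dimension. *)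

theory Defs
  imports "HOL-Analysis.Analysis"
begin

section \<open>Hausdorff measure and dimension\<close>

text \<open>
  The term \<open>(diam U)\<^sup>s\<close> of a covering set, with the usual conventions \<open>0\<^sup>0 = 1\<close> and
  \<open>(diam \<emptyset>)\<^sup>s = 0\<close>. The exponent \<open>s = 0\<close> is treated separately because \<open>0 powr 0 = 0\<close> in HOL.
\<close>
definition diameter_pow :: "real \<Rightarrow> 'a::metric_space set \<Rightarrow> ennreal" where
  "diameter_pow s U =
     (if U = {} then 0 else if s = 0 then 1 else ennreal (diameter U powr s))"

text \<open>
  Boundedness is required explicitly because \<^const>\<open>diameter\<close> is real-valued and unspecified on
  unbounded sets. Sequences may contain empty sets, so finite covers are included.
\<close>
definition delta_covers :: "real \<Rightarrow> 'a::metric_space set \<Rightarrow> (nat \<Rightarrow> 'a set) set" where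
  "delta_covers \<delta> A =
     {U. A \<subseteq> (\<Union>i. U i) \<and> (\<forall>i. bounded (U i) \<and> diameter (U i) \<le> \<delta>)}"

definition hausdorff_premeasure :: "real \<Rightarrow> real \<Rightarrow> 'a::metric_space set \<Rightarrow> ennreal" where
  "hausdorff_premeasure s \<delta> A = (INF U\<in>delta_covers \<delta> A. \<Sum>i. diameter_pow s (U i))"

definition hausdorff_measure :: "real \<Rightarrow> 'a::metric_space set \<Rightarrow> ennreal" where
  "hausdorff_measure s A = (SUP \<delta>\<in>{0<..}. hausdorff_premeasure s \<delta> A)"

definition hausdorff_dim :: "'a::metric_space set \<Rightarrow> ennreal" where
  "hausdorff_dim A = (INF s\<in>{s. 0 \<le> s \<and> hausdorff_measure s A = 0}. ennreal s)"


section \<open>Analytic sets\<close>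

text \<open>
  The type \<^typ>\<open>nat \<Rightarrow> nat\<close> carries the product of the discrete topologies, i.e. it is the Baire
  space. The notion is meant for subsets of Polish spaces.
\<close>
definition analytic_set :: "'a::topological_space set \<Rightarrow> bool" where
  "analytic_set A \<longleftrightarrow>
     A = {} \<or> (\<exists>f :: (nat \<Rightarrow> nat) \<Rightarrow> 'a. continuous_on UNIV f \<and> range f = A)"


section \<open>Families of planar circles\<close>

definition planar_circles :: "(real^2) set set" where
  "planar_circles = {sphere x r | x r. 0 < r}"

text \<open>
  The metric of \<^typ>\<open>(real^2) \<times> real\<close> is the Euclidean product metric
  \<open>sqrt (|x - x'|\<^sup>2 + |r - r'|\<^sup>2)\<close>, so this type is Euclidean 3-space.
\<close>
definition circle_parameters :: "(real^2) set set \<Rightarrow> ((real^2) \<times> real) set" where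
  "circle_parameters \<S> = {(x, r). 0 < r \<and> sphere x r \<in> \<S>}"

definition analytic_circle_family :: "(real^2) set set \<Rightarrow> bool" where
  "analytic_circle_family \<S> \<longleftrightarrow>
     \<S> \<subseteq> planar_circles \<and> analytic_set (circle_parameters \<S>)"

definition circle_family_dim :: "(real^2) set set \<Rightarrow> ennreal" where
  "circle_family_dim \<S> = hausdorff_dim (circle_parameters \<S>)"

end

theory Submission
  imports Defs
begin

text \<open>
  Points \<open>(x, r)\<close> of three-space stand for circles, and two circles are internally tangent iff their difference is a
  null vector of the Minkowski form \<open>|x|\<^sup>2 - r\<^sup>2\<close>.

  Upper bound: the circles with parameters in a set of diameter \<open>d\<close> lie in a neighbourhood of a single circle, which is
  covered by about \<open>1/d\<close> discs of radius \<open>d\<close>.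

  Lower bound: take discs covering the union. On every circle some scale \<open>2\<^sup>-\<^sup>k\<close> accounts for a proportion \<open>1/k\<^sup>2\<close> of a
  fixed arc, so for some \<open>k\<close> the circles that are rich at scale \<open>2\<^sup>-\<^sup>k\<close> have Hausdorff content at least about \<open>1/k\<^sup>2\<close>.
  They carry a Frostman measure down to scale \<open>\<delta> = 2\<^sup>-\<^sup>k\<close>, and it suffices to bound the number of discs of this one
  scale from below. By Cauchy-Schwarz few discs force a large overlap energy, most of which comes from pairs of circles
  at one distance \<open>d\<close> and with one value \<open>\<kappa>\<close> of the form. If such pairs are transversal, the Frostman condition is
  enough. If they are nearly tangent, rescale by \<open>d\<close>. The arcs on which a circle overlaps its neighbours then have
  length \<open>\<surd>\<delta>'\<close> with \<open>\<delta>' = \<kappa>/d\<^sup>2\<close>, which bounds the mass \<open>M\<close> of the neighbours in a single direction in terms of the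
  energy. If the average mass of all neighbours is comparable to \<open>M/\<surd>\<delta>'\<close>, then \<open>M\<close> is at most about \<open>\<delta>'\<close>. To see this,
  one counts triples of neighbours of a point in separated directions after a stopping time decomposition into dyadic
  cells. A point is determined, up to the size of the cells, by three cells that it sees in separated directions.
  Conversely, the points adjacent to three given separated points lie in two planks, one for each sign of the
  determinant of the three differences.
\<close>

section \<open>Nearly null vectors of the Minkowski form\<close>

text \<open>Only exponents matter: each pigeonholing over scales, distances, values of the form or
  overlaps costs a fixed power of \<open>k\<close>, and at the end a power of \<open>k\<close> is
  compared with \<open>2 powr (k * \<eta>)\<close> for some \<eta> > 0. Hence the constants are
  crude and the degrees 64, 131 and 527 harmless.

  The obstacle is tangency. Two annuli of width \<delta> whose circles are at distance
  \<open>d\<close> overlap in area at most about \<open>\<delta>^2 / sqrt \<kappa>\<close>, with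
  \<kappa> the size of the form, truncated below at about \<open>\<delta> * d\<close>. The Frostman
  condition pays for this when \<kappa> is comparable to \<open>d^2\<close>, but not when many
  circles are tangent. The counting argument supplies the missing factor. Its exponents balance as
  follows: unless single cells contain many separated neighbours, a typical point sees
  \<open>1 / sqrt \<delta>'\<close> cells in each of three directions, hence
  \<open>\<delta>' powr (-3/2)\<close> triples of cells, whereas three cells determine the point.

  The measures live on finite sets and are built after the rich scale has been selected, so the rich
  circles may form an arbitrary set at each scale.\<close>

text \<open>The system has the Gram matrix of three null vectors, up to sign: zero diagonal and
  off-diagonal entries \<open>g\<close>. Eliminating \<open>d2\<close> and \<open>d3\<close> leaves
  \<open>2 * g12 * g13 * d1\<close>. The triangle-like bound on \<open>g23\<close> keeps the loss at
  \<open>1 / g0\<close>, where otherwise \<open>g23 / g0^2\<close> could occur.\<close>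

lemma zero_diagonal_system_bound1:
  fixes g12 g13 g23 d1 d2 d3 b g0 :: real
  assumes g0: "0 < g0" "g0 \<le> g12" "g0 \<le> g13"
    and tri: "g23 \<le> 2 * (g12 + g13)" "0 \<le> g23"
    and b: "\<bar>g12 * d2 + g13 * d3\<bar> \<le> b" "\<bar>g12 * d1 + g23 * d3\<bar> \<le> b" "\<bar>g13 * d1 + g23 * d2\<bar> \<le> b"
  shows "\<bar>d1\<bar> \<le> 3 * b / g0"
proof -
  have b0: "0 \<le> b" using b(1) by linarith
  have p: "0 < g12" "0 < g13" using g0 by auto
  have "2 * g12 * g13 * d1 = g13 * (g12 * d1 + g23 * d3) + g12 * (g13 * d1 + g23 * d2) - g23 * (g12 * d2 + g13 * d3)"
    by (simp add: algebra_simps)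
  also have "\<bar>\<dots>\<bar> \<le> g13 * b + g12 * b + g23 * b"
  proof -
    have "\<bar>g13 * (g12 * d1 + g23 * d3)\<bar> \<le> g13 * b" using b(2) p by (simp add: abs_mult)
    moreover have "\<bar>g12 * (g13 * d1 + g23 * d2)\<bar> \<le> g12 * b" using b(3) p by (simp add: abs_mult)
    moreover have "\<bar>g23 * (g12 * d2 + g13 * d3)\<bar> \<le> g23 * b" using b(1) tri(2) by (simp add: abs_mult mult_left_mono)
    ultimately show ?thesis by linarith
  qed
  finally have 1: "2 * g12 * g13 * \<bar>d1\<bar> \<le> (g13 + g12 + g23) * b"
    using p by (simp add: abs_mult algebra_simps)
  also have "\<dots> \<le> (3 * (g12 + g13)) * b" using tri b0 by (intro mult_right_mono) auto
  finally have 2: "2 * g12 * g13 * \<bar>d1\<bar> \<le> 3 * b * (g12 + g13)" by (simp add: algebra_simps)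
  have "g0 * (g12 + g13) \<le> 2 * g12 * g13"
  proof -
    have "g0 * g12 \<le> g13 * g12" "g0 * g13 \<le> g12 * g13" using g0 p by (auto intro!: mult_right_mono)
    then show ?thesis by (simp add: algebra_simps)
  qed
  then have "g0 * (g12 + g13) * \<bar>d1\<bar> \<le> 2 * g12 * g13 * \<bar>d1\<bar>" by (intro mult_right_mono) auto
  with 2 have "(g12 + g13) * (g0 * \<bar>d1\<bar>) \<le> (g12 + g13) * (3 * b)" by (simp add: algebra_simps)
  then have "g0 * \<bar>d1\<bar> \<le> 3 * b" using p by simp
  then show ?thesis using g0(1) by (simp add: field_simps)
qed

definition det3 :: "real \<Rightarrow> real \<Rightarrow> real \<Rightarrow> real \<Rightarrow> real \<Rightarrow> real \<Rightarrow> real \<Rightarrow> real \<Rightarrow> real \<Rightarrow> real" where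
  "det3 a1 a2 a3 b1 b2 b3 c1 c2 c3 = a1 * (b2 * c3 - b3 * c2) - a2 * (b1 * c3 - b3 * c1) + a3 * (b1 * c2 - b2 * c1)"

text \<open>Cramer's rule \<open>D * v = D1 * p1 + D2 * p2 + D3 * p3\<close>, paired with
  \<open>(x, y, z)\<close> in the Minkowski form.\<close>

lemma det3_gram:
  "det3 p1 q1 1 p2 q2 1 p3 q3 1 * (x * v1 + y * v2 - z * v3)
   = det3 v1 v2 v3 p2 q2 1 p3 q3 1 * (x * p1 + y * q1 - z)
   + det3 p1 q1 1 v1 v2 v3 p3 q3 1 * (x * p2 + y * q2 - z)
   + det3 p1 q1 1 p2 q2 1 v1 v2 v3 * (x * p3 + y * q3 - z)"
  unfolding det3_def by algebra

lemma det3_scale: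
  "det3 (r1 * p1) (r1 * q1) r1 (r2 * p2) (r2 * q2) r2 (r3 * p3) (r3 * q3) r3 = r1 * r2 * r3 * det3 p1 q1 1 p2 q2 1 p3 q3 1"
  unfolding det3_def by algebra

lemma det3_scale1:
  "det3 v1 v2 v3 (r2 * p2) (r2 * q2) r2 (r3 * p3) (r3 * q3) r3 = r2 * r3 * det3 v1 v2 v3 p2 q2 1 p3 q3 1"
  unfolding det3_def by algebra

lemma det3_scale2:
  "det3 (r1 * p1) (r1 * q1) r1 v1 v2 v3 (r3 * p3) (r3 * q3) r3 = r1 * r3 * det3 p1 q1 1 v1 v2 v3 p3 q3 1"
  unfolding det3_def by algebra

lemma det3_scale3:
  "det3 (r1 * p1) (r1 * q1) r1 (r2 * p2) (r2 * q2) r2 v1 v2 v3 = r1 * r2 * det3 p1 q1 1 p2 q2 1 v1 v2 v3"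
  unfolding det3_def by algebra

text \<open>For unit vectors this is 1 minus their inner product, that is, minus the Minkowski
  product of the null vectors \<open>(p, q, 1)\<close> and \<open>(p', q', 1)\<close>. The error for
  vectors that are only nearly null is recorded in \<open>chord_inner\<close>.\<close>

definition chord :: "real \<Rightarrow> real \<Rightarrow> real \<Rightarrow> real \<Rightarrow> real" where
  "chord p q p' q' = ((p - p')^2 + (q - q')^2) / 2"

lemma chord_commute: "chord p q p' q' = chord p' q' p q"
  unfolding chord_def by (simp add: power2_commute)

lemma chord_nonneg: "0 \<le> chord p q p' q'"
  unfolding chord_def by simp

lemma chord_triangle: "chord p q p'' q'' \<le> 2 * (chord p' q' p q + chord p' q' p'' q'')"
proof -
  have "(p - p'')^2 \<le> 2 * ((p' - p)^2 + (p' - p'')^2)" "(q - q'')^2 \<le> 2 * ((q' - q)^2 + (q' - q'')^2)"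
    using sum_squares_ge_zero[of "p+p''-2*p'" 0] sum_squares_ge_zero[of "q+q''-2*q'" 0]
    by (auto simp: power2_eq_square algebra_simps)
  then show ?thesis unfolding chord_def by (simp add: field_simps)
qed

lemma chord_inner: "p * p' + q * q' - 1 = ((p^2 + q^2 - 1) + (p'^2 + q'^2 - 1)) / 2 - chord p q p' q'"
  unfolding chord_def by (simp add: power2_eq_square field_simps)

lemma abs_comb4_le:
  fixes a :: real
  assumes "a = p + q + r - s" "\<bar>p\<bar> \<le> A" "\<bar>q\<bar> \<le> B" "\<bar>r\<bar> \<le> C" "\<bar>s\<bar> \<le> E"
  shows "\<bar>a\<bar> \<le> A + B + C + E"
  using assms by linarith

lemma abs_half_sum_le:
  fixes a b e :: real
  assumes "\<bar>a\<bar> \<le> e" "\<bar>b\<bar> \<le> e" shows "\<bar>(a + b) / 2\<bar> \<le> e"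
  using assms by (auto simp: abs_le_iff)

lemma abs_half_diff_le:
  fixes a :: real
  assumes "2 * a = p - q" "\<bar>p\<bar> \<le> A" "\<bar>q\<bar> \<le> A"
  shows "\<bar>a\<bar> \<le> A"
  using assms by linarith

text \<open>Pairing Cramer's identity with each of the three near-null vectors gives a system whose
  matrix is the matrix of chords up to sign and entries of size \<epsilon>. These errors contribute
  at most \<open>3 * \<epsilon> * S\<close>, with \<open>S\<close> the largest of the
  \<open>Di\<close>; they are moved to the right-hand side, and
  \<open>18 * \<epsilon> \<le> g0\<close> lets the left-hand side absorb them.\<close>

lemma near_null_cramer_bound:
  fixes p1 q1 p2 q2 p3 q3 v1 v2 v3 \<epsilon> \<beta> g0 :: real
  defines "D \<equiv> det3 p1 q1 1 p2 q2 1 p3 q3 1"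
    and "D1 \<equiv> det3 v1 v2 v3 p2 q2 1 p3 q3 1"
    and "D2 \<equiv> det3 p1 q1 1 v1 v2 v3 p3 q3 1"
    and "D3 \<equiv> det3 p1 q1 1 p2 q2 1 v1 v2 v3"
  assumes n: "\<bar>p1^2 + q1^2 - 1\<bar> \<le> \<epsilon>" "\<bar>p2^2 + q2^2 - 1\<bar> \<le> \<epsilon>" "\<bar>p3^2 + q3^2 - 1\<bar> \<le> \<epsilon>"
    and g: "g0 \<le> chord p1 q1 p2 q2" "g0 \<le> chord p1 q1 p3 q3" "g0 \<le> chord p2 q2 p3 q3"
    and g0: "0 < g0" "18 * \<epsilon> \<le> g0"
    and v: "\<bar>p1 * v1 + q1 * v2 - v3\<bar> \<le> \<beta>" "\<bar>p2 * v1 + q2 * v2 - v3\<bar> \<le> \<beta>" "\<bar>p3 * v1 + q3 * v2 - v3\<bar> \<le> \<beta>"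
  shows "\<bar>D1\<bar> \<le> 6 * \<bar>D\<bar> * \<beta> / g0" "\<bar>D2\<bar> \<le> 6 * \<bar>D\<bar> * \<beta> / g0" "\<bar>D3\<bar> \<le> 6 * \<bar>D\<bar> * \<beta> / g0"
proof -
  define S where "S = max \<bar>D1\<bar> (max \<bar>D2\<bar> \<bar>D3\<bar>)"
  have S: "\<bar>D1\<bar> \<le> S" "\<bar>D2\<bar> \<le> S" "\<bar>D3\<bar> \<le> S" "0 \<le> S" unfolding S_def by auto
  have e0: "0 \<le> \<epsilon>" using n(1) by linarith
  define b where "b = \<bar>D\<bar> * \<beta> + 3 * \<epsilon> * S"
  have main: "\<bar>D2 * chord x y p' q' + D3 * chord x y p'' q''\<bar> \<le> b"
    if eq: "D * (x * v1 + y * v2 - v3) = D1 * (x * x + y * y - 1) + D2 * (x * p' + y * q' - 1) + D3 * (x * p'' + y * q'' - 1)"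
      and nn: "\<bar>x^2 + y^2 - 1\<bar> \<le> \<epsilon>" "\<bar>p'^2 + q'^2 - 1\<bar> \<le> \<epsilon>" "\<bar>p''^2 + q''^2 - 1\<bar> \<le> \<epsilon>"
      and bb: "\<bar>x * v1 + y * v2 - v3\<bar> \<le> \<beta>" and DS: "\<bar>D1\<bar> \<le> S" "\<bar>D2\<bar> \<le> S" "\<bar>D3\<bar> \<le> S"
    for x y p' q' p'' q'' D1 D2 D3
  proof -
    let ?A = "(x^2 + y^2 - 1)" and ?B = "((x^2 + y^2 - 1) + (p'^2 + q'^2 - 1)) / 2" and ?C = "((x^2 + y^2 - 1) + (p''^2 + q''^2 - 1)) / 2"
    have AB: "\<bar>?A\<bar> \<le> \<epsilon>" "\<bar>?B\<bar> \<le> \<epsilon>" "\<bar>?C\<bar> \<le> \<epsilon>" by (rule abs_half_sum_le nn)+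
    have "D2 * chord x y p' q' + D3 * chord x y p'' q'' = D1 * ?A + D2 * ?B + D3 * ?C - D * (x * v1 + y * v2 - v3)"
      unfolding eq chord_inner[of x p' y q'] chord_inner[of x p'' y q''] by (simp add: power2_eq_square algebra_simps)
    moreover have "\<bar>D1 * ?A\<bar> \<le> S * \<epsilon>" "\<bar>D2 * ?B\<bar> \<le> S * \<epsilon>" "\<bar>D3 * ?C\<bar> \<le> S * \<epsilon>"
      unfolding abs_mult by (rule mult_mono DS AB abs_ge_zero S(4))+
    moreover have "\<bar>D * (x * v1 + y * v2 - v3)\<bar> \<le> \<bar>D\<bar> * \<beta>" unfolding abs_mult using bb by (intro mult_left_mono) auto
    ultimately have "\<bar>D2 * chord x y p' q' + D3 * chord x y p'' q''\<bar> \<le> S * \<epsilon> + S * \<epsilon> + S * \<epsilon> + \<bar>D\<bar> * \<beta>"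
      by (rule_tac abs_comb4_le)
    also have "\<dots> = b" unfolding b_def by simp
    finally show ?thesis .
  qed
  have eq1: "D * (p1 * v1 + q1 * v2 - v3) = D1 * (p1 * p1 + q1 * q1 - 1) + D2 * (p1 * p2 + q1 * q2 - 1) + D3 * (p1 * p3 + q1 * q3 - 1)"
    using det3_gram[of p1 q1 p2 q2 p3 q3 p1 v1 q1 v2 1 v3] unfolding D_def D1_def D2_def D3_def by simp
  have eq2: "D * (p2 * v1 + q2 * v2 - v3) = D2 * (p2 * p2 + q2 * q2 - 1) + D1 * (p2 * p1 + q2 * q1 - 1) + D3 * (p2 * p3 + q2 * q3 - 1)"
    using det3_gram[of p1 q1 p2 q2 p3 q3 p2 v1 q2 v2 1 v3] unfolding D_def D1_def D2_def D3_def by simp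
  have eq3: "D * (p3 * v1 + q3 * v2 - v3) = D3 * (p3 * p3 + q3 * q3 - 1) + D1 * (p3 * p1 + q3 * q1 - 1) + D2 * (p3 * p2 + q3 * q2 - 1)"
    using det3_gram[of p1 q1 p2 q2 p3 q3 p3 v1 q3 v2 1 v3] unfolding D_def D1_def D2_def D3_def by simp
  have r1: "\<bar>chord p1 q1 p2 q2 * D2 + chord p1 q1 p3 q3 * D3\<bar> \<le> b"
    using main[OF eq1 n(1) n(2) n(3) v(1) S(1) S(2) S(3)] by (simp only: mult.commute)
  have r2: "\<bar>chord p1 q1 p2 q2 * D1 + chord p2 q2 p3 q3 * D3\<bar> \<le> b"
    using main[OF eq2 n(2) n(1) n(3) v(2) S(2) S(1) S(3)] by (simp only: mult.commute chord_commute[of p2 q2 p1 q1])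
  have r3: "\<bar>chord p1 q1 p3 q3 * D1 + chord p2 q2 p3 q3 * D2\<bar> \<le> b"
    using main[OF eq3 n(3) n(1) n(2) v(3) S(3) S(1) S(2)] by (simp only: mult.commute chord_commute[of p3 q3 p1 q1] chord_commute[of p3 q3 p2 q2])
  have t1: "chord p2 q2 p3 q3 \<le> 2 * (chord p1 q1 p2 q2 + chord p1 q1 p3 q3)" by (rule chord_triangle)
  have t2: "chord p1 q1 p3 q3 \<le> 2 * (chord p1 q1 p2 q2 + chord p2 q2 p3 q3)" using chord_triangle chord_commute by metis
  have t3: "chord p1 q1 p2 q2 \<le> 2 * (chord p1 q1 p3 q3 + chord p2 q2 p3 q3)" using chord_triangle chord_commute by metis
  have "\<bar>D1\<bar> \<le> 3 * b / g0" by (rule zero_diagonal_system_bound1[OF g0(1) g(1,2) t1 chord_nonneg r1 r2 r3])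
  moreover have "\<bar>D2\<bar> \<le> 3 * b / g0"
    by (rule zero_diagonal_system_bound1[OF g0(1) g(1,3) t2 chord_nonneg r2 r1]) (use r3 in \<open>simp add: add.commute\<close>)
  moreover have "\<bar>D3\<bar> \<le> 3 * b / g0"
    by (rule zero_diagonal_system_bound1[OF g0(1) g(2,3) t3 chord_nonneg r3]) (use r1 r2 in \<open>simp_all add: add.commute\<close>)
  ultimately have "S \<le> 3 * b / g0" unfolding S_def by auto
  then have "S * g0 \<le> 3 * b" using g0 by (simp add: field_simps)
  also have "3 * b = 3 * \<bar>D\<bar> * \<beta> + (9 * \<epsilon>) * S" unfolding b_def by (simp add: algebra_simps)
  also have "(9 * \<epsilon>) * S \<le> (g0 / 2) * S" using g0(2) S(4) by (intro mult_right_mono) auto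
  finally have "S * g0 \<le> 6 * \<bar>D\<bar> * \<beta>" by (simp add: field_simps)
  then have "S \<le> 6 * \<bar>D\<bar> * \<beta> / g0" using g0 by (simp add: field_simps)
  then show "\<bar>D1\<bar> \<le> 6 * \<bar>D\<bar> * \<beta> / g0" "\<bar>D2\<bar> \<le> 6 * \<bar>D\<bar> * \<beta> / g0" "\<bar>D3\<bar> \<le> 6 * \<bar>D\<bar> * \<beta> / g0"
    using S by linarith+
qed

lemma near_null_det_nonzero:
  fixes p1 q1 p2 q2 p3 q3 \<epsilon> g0 :: real
  assumes n: "\<bar>p1^2 + q1^2 - 1\<bar> \<le> \<epsilon>" "\<bar>p2^2 + q2^2 - 1\<bar> \<le> \<epsilon>" "\<bar>p3^2 + q3^2 - 1\<bar> \<le> \<epsilon>"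
    and g: "g0 \<le> chord p1 q1 p2 q2" "g0 \<le> chord p1 q1 p3 q3" "g0 \<le> chord p2 q2 p3 q3"
    and g0: "0 < g0" "18 * \<epsilon> \<le> g0"
  shows "det3 p1 q1 1 p2 q2 1 p3 q3 1 \<noteq> 0"
proof
  assume D: "det3 p1 q1 1 p2 q2 1 p3 q3 1 = 0"
  \<comment> \<open>With \<open>D = 0\<close> the bound on \<open>D1\<close> is 0 for every
    \<open>v\<close>, whatever \<beta> is; two unit vectors for \<open>v\<close> then yield
    \<open>q2 = q3\<close> and \<open>p2 = p3\<close>.\<close>
  have z: "det3 v1 v2 v3 p2 q2 1 p3 q3 1 = 0" for v1 v2 v3
    using near_null_cramer_bound(1)[OF n g g0, of v1 v2 v3 "max \<bar>p1 * v1 + q1 * v2 - v3\<bar> (max \<bar>p2 * v1 + q2 * v2 - v3\<bar> \<bar>p3 * v1 + q3 * v2 - v3\<bar>)"]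
    unfolding D by auto
  have "q2 = q3" "p2 = p3" using z[of 1 0 0] z[of 0 1 0] unfolding det3_def by auto
  then show False using g(3) g0(1) unfolding chord_def by simp
qed

text \<open>
  Three points \<open>a\<^sub>i\<close> with two common near-null neighbours \<open>u\<close> and \<open>u + v\<close>: exact null vectors would give
  \<open>det (u + v - a\<^sub>i) = - det (u - a\<^sub>i)\<close> or \<open>v\<close> null, so equal signs of the determinants force \<open>v\<close> to be nearly null.
\<close>
lemma near_null_unique:
  fixes x1 y1 r1 x2 y2 r2 x3 y3 r3 v1 v2 v3 \<delta> g0 :: real
  defines "D \<equiv> det3 x1 y1 r1 x2 y2 r2 x3 y3 r3"
    and "D' \<equiv> det3 (x1 + v1) (y1 + v2) (r1 + v3) (x2 + v1) (y2 + v2) (r2 + v3) (x3 + v1) (y3 + v2) (r3 + v3)"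
  assumes r: "1/2 \<le> \<bar>r1\<bar>" "1/2 \<le> \<bar>r2\<bar>" "1/2 \<le> \<bar>r3\<bar>"
    and n: "\<bar>x1^2 + y1^2 - r1^2\<bar> \<le> \<delta>" "\<bar>x2^2 + y2^2 - r2^2\<bar> \<le> \<delta>" "\<bar>x3^2 + y3^2 - r3^2\<bar> \<le> \<delta>"
    and n': "\<bar>(x1+v1)^2 + (y1+v2)^2 - (r1+v3)^2\<bar> \<le> \<delta>" "\<bar>(x2+v1)^2 + (y2+v2)^2 - (r2+v3)^2\<bar> \<le> \<delta>"
            "\<bar>(x3+v1)^2 + (y3+v2)^2 - (r3+v3)^2\<bar> \<le> \<delta>"
    and g: "144 * \<delta> \<le> chord (x1/r1) (y1/r1) (x2/r2) (y2/r2)" "144 * \<delta> \<le> chord (x1/r1) (y1/r1) (x3/r3) (y3/r3)"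
       "144 * \<delta> \<le> chord (x2/r2) (y2/r2) (x3/r3) (y3/r3)"
    and sgn: "0 < D * D'" and \<delta>: "0 < \<delta>"
  shows "\<bar>v1^2 + v2^2 - v3^2\<bar> \<le> 2 * \<delta>"
proof -
  define Z where "Z = v1^2 + v2^2 - v3^2"
  define b1 where "b1 = x1 * v1 + y1 * v2 - r1 * v3"
  define b2 where "b2 = x2 * v1 + y2 * v2 - r2 * v3"
  define b3 where "b3 = x3 * v1 + y3 * v2 - r3 * v3"
  define D1 where "D1 = det3 v1 v2 v3 x2 y2 r2 x3 y3 r3"
  define D2 where "D2 = det3 x1 y1 r1 v1 v2 v3 x3 y3 r3"
  define D3 where "D3 = det3 x1 y1 r1 x2 y2 r2 v1 v2 v3"
  have nz: "r1 \<noteq> 0" "r2 \<noteq> 0" "r3 \<noteq> 0" using r by auto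
  have b: "\<bar>b1 + Z / 2\<bar> \<le> \<delta>" "\<bar>b2 + Z / 2\<bar> \<le> \<delta>" "\<bar>b3 + Z / 2\<bar> \<le> \<delta>"
  proof -
    have "\<bar>(x * v1 + y * v2 - r * v3) + Z/2\<bar> \<le> \<delta>" if "\<bar>x^2 + y^2 - r^2\<bar> \<le> \<delta>" "\<bar>(x+v1)^2 + (y+v2)^2 - (r+v3)^2\<bar> \<le> \<delta>" for x y r
    proof -
      have "2 * ((x * v1 + y * v2 - r * v3) + Z/2) = ((x+v1)^2 + (y+v2)^2 - (r+v3)^2) - (x^2 + y^2 - r^2)"
        unfolding Z_def by (simp add: power2_eq_square field_simps)
      then show ?thesis using that by (blast intro: abs_half_diff_le)
    qed
    then show "\<bar>b1 + Z / 2\<bar> \<le> \<delta>" "\<bar>b2 + Z / 2\<bar> \<le> \<delta>" "\<bar>b3 + Z / 2\<bar> \<le> \<delta>"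
      unfolding b1_def b2_def b3_def using n n' by blast+
  qed
  have DZ: "D * Z = D1 * b1 + D2 * b2 + D3 * b3"
    unfolding D_def D1_def D2_def D3_def Z_def b1_def b2_def b3_def det3_def by algebra
  have DD: "D' = D + D1 + D2 + D3"
    unfolding D_def D'_def D1_def D2_def D3_def det3_def by algebra
  \<comment> \<open>In the exact case every \<open>bi + Z/2\<close> vanishes and
    \<open>Z * (D + D') = 0\<close> remains, which is the dichotomy behind the lemma.\<close>
  have key: "Z * (D + D') / 2 = D1 * (b1 + Z/2) + D2 * (b2 + Z/2) + D3 * (b3 + Z/2)"
    using DZ unfolding DD by (simp add: field_simps)
  have sl: "\<bar>(x/r)^2 + (y/r)^2 - 1\<bar> \<le> 4 * \<delta>" if "1/2 \<le> \<bar>r\<bar>" "\<bar>x^2+y^2-r^2\<bar> \<le> \<delta>" for x y r :: real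
  proof -
    have r0: "r \<noteq> 0" using that by auto
    have r2: "1/4 \<le> r^2" using that(1) power_mono[of "1/2" "\<bar>r\<bar>" 2] by (simp add: power2_eq_square)
    have "(x/r)^2 + (y/r)^2 - 1 = (x^2+y^2-r^2) / r^2" using r0 by (simp add: field_simps power2_eq_square)
    also have "\<bar>\<dots>\<bar> = \<bar>x^2+y^2-r^2\<bar> / r^2" by (simp add: abs_divide)
    also have "\<dots> \<le> \<delta> / (1/4)" using that r2 by (intro frac_le) auto
    finally show ?thesis by simp
  qed
  have vb: "\<bar>x/r * v1 + y/r * v2 - v3\<bar> \<le> \<bar>Z\<bar> + 2 * \<delta>" if "1/2 \<le> \<bar>r\<bar>" "\<bar>(x * v1 + y * v2 - r * v3) + Z/2\<bar> \<le> \<delta>" for x y r :: real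
  proof -
    have r0: "r \<noteq> 0" using that by auto
    have "x/r * v1 + y/r * v2 - v3 = (x * v1 + y * v2 - r * v3) / r" using r0 by (simp add: field_simps)
    also have "\<bar>\<dots>\<bar> = \<bar>x * v1 + y * v2 - r * v3\<bar> / \<bar>r\<bar>" by (simp add: abs_divide)
    also have "\<dots> \<le> (\<bar>Z\<bar>/2 + \<delta>) / (1/2)" using that by (intro frac_le) auto
    finally show ?thesis by simp
  qed
  define P where "P = r1 * r2 * r3"
  have dets: "D = P * det3 (x1/r1) (y1/r1) 1 (x2/r2) (y2/r2) 1 (x3/r3) (y3/r3) 1"
     "r1 * D1 = P * det3 v1 v2 v3 (x2/r2) (y2/r2) 1 (x3/r3) (y3/r3) 1"
     "r2 * D2 = P * det3 (x1/r1) (y1/r1) 1 v1 v2 v3 (x3/r3) (y3/r3) 1"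
     "r3 * D3 = P * det3 (x1/r1) (y1/r1) 1 (x2/r2) (y2/r2) 1 v1 v2 v3"
    using nz det3_scale[of r1 "x1/r1" "y1/r1" r2 "x2/r2" "y2/r2" r3 "x3/r3" "y3/r3"]
      det3_scale1[of v1 v2 v3 r2 "x2/r2" "y2/r2" r3 "x3/r3" "y3/r3"]
      det3_scale2[of r1 "x1/r1" "y1/r1" v1 v2 v3 r3 "x3/r3" "y3/r3"]
      det3_scale3[of r1 "x1/r1" "y1/r1" r2 "x2/r2" "y2/r2" v1 v2 v3]
    unfolding D_def D1_def D2_def D3_def P_def by simp_all
  \<comment> \<open>The slopes are null up to \<open>4 * \<delta>\<close>, so
    \<open>72 * \<delta>\<close> would be enough for the Cramer bound. The doubled separation
    produces the factor 1/4 in the estimate of \<open>Z * (D + D') / 2\<close>, and only thereby can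
    \<open>\<bar>Z\<bar>\<close> be absorbed.\<close>
  have g0: "0 < 144 * \<delta>" "18 * (4 * \<delta>) \<le> 144 * \<delta>" using \<delta> by auto
  have cr: "\<bar>det3 v1 v2 v3 (x2/r2) (y2/r2) 1 (x3/r3) (y3/r3) 1\<bar> \<le> 6 * \<bar>det3 (x1/r1) (y1/r1) 1 (x2/r2) (y2/r2) 1 (x3/r3) (y3/r3) 1\<bar> * (\<bar>Z\<bar> + 2 * \<delta>) / (144*\<delta>)"
     "\<bar>det3 (x1/r1) (y1/r1) 1 v1 v2 v3 (x3/r3) (y3/r3) 1\<bar> \<le> 6 * \<bar>det3 (x1/r1) (y1/r1) 1 (x2/r2) (y2/r2) 1 (x3/r3) (y3/r3) 1\<bar> * (\<bar>Z\<bar> + 2 * \<delta>) / (144*\<delta>)"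
     "\<bar>det3 (x1/r1) (y1/r1) 1 (x2/r2) (y2/r2) 1 v1 v2 v3\<bar> \<le> 6 * \<bar>det3 (x1/r1) (y1/r1) 1 (x2/r2) (y2/r2) 1 (x3/r3) (y3/r3) 1\<bar> * (\<bar>Z\<bar> + 2 * \<delta>) / (144*\<delta>)"
    by (fact near_null_cramer_bound[OF sl[OF r(1) n(1)] sl[OF r(2) n(2)] sl[OF r(3) n(3)] g g0
          vb[OF r(1) b(1)[unfolded b1_def]] vb[OF r(2) b(2)[unfolded b2_def]] vb[OF r(3) b(3)[unfolded b3_def]]])+
  have bd: "\<bar>E\<bar> \<le> 2 * (\<bar>D\<bar> * (\<bar>Z\<bar> + 2 * \<delta>) / (24*\<delta>))"
    if "1/2 \<le> \<bar>r\<bar>" "r * E = P * e" "\<bar>e\<bar> \<le> 6 * \<bar>det3 (x1/r1) (y1/r1) 1 (x2/r2) (y2/r2) 1 (x3/r3) (y3/r3) 1\<bar> * (\<bar>Z\<bar> + 2 * \<delta>) / (144*\<delta>)" for r E e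
  proof -
    have "\<bar>E\<bar> / 2 \<le> \<bar>r\<bar> * \<bar>E\<bar>" using that(1) mult_right_mono[of "1/2" "\<bar>r\<bar>" "\<bar>E\<bar>"] by simp
    also have "\<dots> = \<bar>P\<bar> * \<bar>e\<bar>" using that(2) by (metis abs_mult)
    also have "\<dots> \<le> \<bar>P\<bar> * (6 * \<bar>det3 (x1/r1) (y1/r1) 1 (x2/r2) (y2/r2) 1 (x3/r3) (y3/r3) 1\<bar> * (\<bar>Z\<bar> + 2 * \<delta>) / (144*\<delta>))"
      using that(3) by (intro mult_left_mono) auto
    also have "\<dots> = \<bar>D\<bar> * (\<bar>Z\<bar> + 2 * \<delta>) / (24*\<delta>)" unfolding dets(1) abs_mult using \<delta> by (simp add: field_simps)
    finally show ?thesis by simp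
  qed
  define X where "X = \<bar>D\<bar> * (\<bar>Z\<bar> + 2 * \<delta>) / (24*\<delta>)"
  have X: "\<bar>D1\<bar> \<le> 2 * X" "\<bar>D2\<bar> \<le> 2 * X" "\<bar>D3\<bar> \<le> 2 * X"
    unfolding X_def using bd[OF r(1) dets(2) cr(1)] bd[OF r(2) dets(3) cr(2)] bd[OF r(3) dets(4) cr(3)] by auto
  have "\<bar>Z * (D + D') / 2\<bar> \<le> \<bar>D1 * (b1 + Z/2)\<bar> + \<bar>D2 * (b2 + Z/2)\<bar> + \<bar>D3 * (b3 + Z/2)\<bar>"
    unfolding key by (intro order_trans[OF abs_triangle_ineq] add_mono order_refl)
  also have "\<dots> \<le> 2 * X * \<delta> + 2 * X * \<delta> + 2 * X * \<delta>"
    unfolding abs_mult using X b by (intro add_mono mult_mono) auto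
  also have "\<dots> = \<bar>D\<bar> * (\<bar>Z\<bar> + 2 * \<delta>) / 4" unfolding X_def using \<delta> by (simp add: field_simps)
  finally have 1: "2 * (\<bar>Z\<bar> * \<bar>D + D'\<bar>) \<le> \<bar>D\<bar> * (\<bar>Z\<bar> + 2 * \<delta>)" by (simp add: abs_mult)
  have "\<bar>D\<bar> \<le> \<bar>D + D'\<bar>" using sgn by (auto simp: zero_less_mult_iff)
  then have "\<bar>Z\<bar> * \<bar>D\<bar> \<le> \<bar>Z\<bar> * \<bar>D + D'\<bar>" by (intro mult_left_mono) auto
  with 1 have "\<bar>D\<bar> * (2 * \<bar>Z\<bar>) \<le> \<bar>D\<bar> * (\<bar>Z\<bar> + 2 * \<delta>)" by (simp add: algebra_simps)
  moreover have "0 < \<bar>D\<bar>" using sgn by auto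
  ultimately have "2 * \<bar>Z\<bar> \<le> \<bar>Z\<bar> + 2 * \<delta>" by (rule mult_left_le_imp_le)
  then have "\<bar>Z\<bar> \<le> 2 * \<delta>" by linarith
  then show ?thesis unfolding Z_def .
qed

text \<open>Three separated near-null vectors are a quantitatively nondegenerate basis: dividing
  Cramer's rule by \<open>D\<close> expresses \<open>v\<close> through them with coefficients at
  most \<open>6 * \<beta> / g0\<close>, and the basis vectors have coordinates at most 2.\<close>

lemma near_null_dual_bound:
  fixes p1 q1 p2 q2 p3 q3 v1 v2 v3 \<epsilon> \<beta> g0 :: real
  assumes n: "\<bar>p1^2 + q1^2 - 1\<bar> \<le> \<epsilon>" "\<bar>p2^2 + q2^2 - 1\<bar> \<le> \<epsilon>" "\<bar>p3^2 + q3^2 - 1\<bar> \<le> \<epsilon>"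
    and g: "g0 \<le> chord p1 q1 p2 q2" "g0 \<le> chord p1 q1 p3 q3" "g0 \<le> chord p2 q2 p3 q3"
    and g0: "0 < g0" "18 * \<epsilon> \<le> g0" and e1: "\<epsilon> \<le> 1"
    and v: "\<bar>p1 * v1 + q1 * v2 - v3\<bar> \<le> \<beta>" "\<bar>p2 * v1 + q2 * v2 - v3\<bar> \<le> \<beta>" "\<bar>p3 * v1 + q3 * v2 - v3\<bar> \<le> \<beta>"
  shows "\<bar>v1\<bar> \<le> 36 * \<beta> / g0" "\<bar>v2\<bar> \<le> 36 * \<beta> / g0" "\<bar>v3\<bar> \<le> 36 * \<beta> / g0"
proof -
  define D where "D = det3 p1 q1 1 p2 q2 1 p3 q3 1"
  define D1 where "D1 = det3 v1 v2 v3 p2 q2 1 p3 q3 1"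
  define D2 where "D2 = det3 p1 q1 1 v1 v2 v3 p3 q3 1"
  define D3 where "D3 = det3 p1 q1 1 p2 q2 1 v1 v2 v3"
  have D: "D \<noteq> 0" unfolding D_def by (rule near_null_det_nonzero[OF n g g0])
  note c = near_null_cramer_bound[OF n g g0 v, folded D_def D1_def D2_def D3_def]
  have b2: "\<bar>p\<bar> \<le> 2" "\<bar>q\<bar> \<le> 2" if "\<bar>p^2 + q^2 - 1\<bar> \<le> \<epsilon>" for p q :: real
  proof -
    have "p^2 + q^2 \<le> 2" using that e1 by linarith
    then have "p^2 \<le> 4" "q^2 \<le> 4" using zero_le_power2[of p] zero_le_power2[of q] by linarith+
    then have "p^2 \<le> 2^2" "q^2 \<le> 2^2" by simp_all
    then show "\<bar>p\<bar> \<le> 2" "\<bar>q\<bar> \<le> 2" by (metis abs_le_square_iff abs_numeral)+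
  qed
  have main: "\<bar>v\<bar> \<le> 36 * \<beta> / g0" if eq: "D * v = D1 * x + D2 * y + D3 * z" and xyz: "\<bar>x\<bar> \<le> 2" "\<bar>y\<bar> \<le> 2" "\<bar>z\<bar> \<le> 2" for v x y z
  proof -
    let ?B = "6 * \<bar>D\<bar> * \<beta> / g0"
    have "\<bar>D\<bar> * \<bar>v\<bar> = \<bar>D1 * x + D2 * y + D3 * z\<bar>" using eq by (metis abs_mult)
    also have "\<dots> \<le> \<bar>D1\<bar> * \<bar>x\<bar> + \<bar>D2\<bar> * \<bar>y\<bar> + \<bar>D3\<bar> * \<bar>z\<bar>"
      by (simp add: abs_mult[symmetric])
    also have "\<dots> \<le> ?B * 2 + ?B * 2 + ?B * 2"
      using c xyz by (intro add_mono mult_mono) (auto intro: order_trans[OF abs_ge_zero])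
    also have "\<dots> = \<bar>D\<bar> * (36 * \<beta> / g0)" by simp
    finally show ?thesis using D by (metis mult_left_le_imp_le zero_less_abs_iff)
  qed
  show "\<bar>v1\<bar> \<le> 36 * \<beta> / g0"
  proof (rule main)
    show "D * v1 = D1 * p1 + D2 * p2 + D3 * p3" unfolding D_def D1_def D2_def D3_def det3_def by algebra
  qed (use b2 n in auto)
  show "\<bar>v2\<bar> \<le> 36 * \<beta> / g0"
  proof (rule main)
    show "D * v2 = D1 * q1 + D2 * q2 + D3 * q3" unfolding D_def D1_def D2_def D3_def det3_def by algebra
  qed (use b2 n in auto)
  show "\<bar>v3\<bar> \<le> 36 * \<beta> / g0"
  proof (rule main)
    show "D * v3 = D1 * 1 + D2 * 1 + D3 * 1" unfolding D_def D1_def D2_def D3_def det3_def by algebra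
  qed auto
qed

section \<open>Dyadic cells\<close>

definition dcell :: "nat \<Rightarrow> real \<times> real \<times> real \<Rightarrow> int \<times> int \<times> int" where
  "dcell k p = (case p of (x, y, z) \<Rightarrow> (\<lfloor>2^k * x\<rfloor>, \<lfloor>2^k * y\<rfloor>, \<lfloor>2^k * z\<rfloor>))"

lemma floor_double: "\<exists>b\<in>{0,1}. \<lfloor>2 * x\<rfloor> = 2 * \<lfloor>x\<rfloor> + b" for x :: real
proof -
  have "\<lfloor>2 * x\<rfloor> - 2 * \<lfloor>x\<rfloor> \<in> {0,1}"
    using floor_correct[of x] floor_correct[of "2*x"] by auto linarith
  then show ?thesis by (metis add.commute diff_add_cancel)
qed

lemma floor_double_cancel: "\<lfloor>2 * x\<rfloor> = \<lfloor>2 * y\<rfloor> \<Longrightarrow> \<lfloor>x\<rfloor> = \<lfloor>y\<rfloor>" for x y :: real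
  using floor_double[of x] floor_double[of y] by auto

lemma dcell_Suc_eq: "dcell (Suc k) p = dcell (Suc k) q \<Longrightarrow> dcell k p = dcell k q"
  unfolding dcell_def by (auto split: prod.splits simp: mult.assoc intro: floor_double_cancel)

lemma dcell_mono_eq: "dcell k p = dcell k q \<Longrightarrow> j \<le> k \<Longrightarrow> dcell j p = dcell j q"
proof (induction k)
  case (Suc k)
  show ?case
  proof (cases "j = Suc k")
    case False
    then have "j \<le> k" using Suc.prems(2) by simp
    then show ?thesis using Suc.IH[OF dcell_Suc_eq[OF Suc.prems(1)]] by blast
  qed (use Suc.prems in blast)
qed (use le_zero_eq in blast)

lemma card_dcell_Suc:
  assumes "finite S"
  shows "card (dcell (Suc k) ` S) \<le> 8 * card (dcell k ` S)"
proof -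
  let ?B = "{0,1} :: int set"
  let ?h = "\<lambda>((a,b,c),(i,j,l)). (2*a+i, 2*b+j, 2*c+l) :: int \<times> int \<times> int"
  have "dcell (Suc k) ` S \<subseteq> ?h ` (dcell k ` S \<times> (?B \<times> ?B \<times> ?B))"
  proof
    fix c assume "c \<in> dcell (Suc k) ` S"
    then obtain x y z where p: "(x,y,z) \<in> S" "c = dcell (Suc k) (x,y,z)" by auto
    obtain i j l where "i \<in> ?B" "\<lfloor>2 * (2^k * x)\<rfloor> = 2 * \<lfloor>2^k * x\<rfloor> + i" "j \<in> ?B" "\<lfloor>2 * (2^k * y)\<rfloor> = 2 * \<lfloor>2^k * y\<rfloor> + j"
      "l \<in> ?B" "\<lfloor>2 * (2^k * z)\<rfloor> = 2 * \<lfloor>2^k * z\<rfloor> + l" using floor_double by metis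
    note b = this
    have "c = ?h (dcell k (x,y,z), (i,j,l))" using p b by (simp add: dcell_def mult.assoc)
    moreover have "(i,j,l) \<in> ?B \<times> ?B \<times> ?B" using b by blast
    moreover have "dcell k (x,y,z) \<in> dcell k ` S" using p by blast
    ultimately have "c = ?h (dcell k (x,y,z), (i,j,l))" "(dcell k (x,y,z), (i,j,l)) \<in> dcell k ` S \<times> (?B \<times> ?B \<times> ?B)"
      by blast+
    then show "c \<in> ?h ` (dcell k ` S \<times> (?B \<times> ?B \<times> ?B))" by blast
  qed
  then have "card (dcell (Suc k) ` S) \<le> card (?h ` (dcell k ` S \<times> (?B \<times> ?B \<times> ?B)))"
    using assms by (intro card_mono) auto
  also have "\<dots> \<le> card (dcell k ` S \<times> (?B \<times> ?B \<times> ?B))" using assms by (intro card_image_le) auto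
  also have "\<dots> = 8 * card (dcell k ` S)" by (simp add: card_cartesian_product)
  finally show ?thesis .
qed

lemma card_dcell_le:
  assumes "finite S"
  shows "card (dcell k ` S) \<le> 8^k * card (dcell 0 ` S)"
proof (induction k)
  case (Suc k)
  then show ?case using card_dcell_Suc[OF assms, of k] by simp
qed simp

lemma dcell_eq_imp_close:
  assumes "dcell k (x,y,z) = dcell k (x',y',z')"
  shows "\<bar>x - x'\<bar> \<le> 1 / 2^k" "\<bar>y - y'\<bar> \<le> 1 / 2^k" "\<bar>z - z'\<bar> \<le> 1 / 2^k"
proof -
  have "\<bar>s - t\<bar> \<le> 1 / 2^k" if "\<lfloor>2^k * s\<rfloor> = \<lfloor>2^k * t\<rfloor>" for s t :: real
  proof -
    have "\<bar>2^k * s - 2^k * t\<bar> \<le> 1" using that by linarith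
    then have "2^k * \<bar>s - t\<bar> \<le> 1" by (simp add: abs_mult right_diff_distrib[symmetric])
    then show ?thesis by (simp add: field_simps)
  qed
  then show "\<bar>x - x'\<bar> \<le> 1 / 2^k" "\<bar>y - y'\<bar> \<le> 1 / 2^k" "\<bar>z - z'\<bar> \<le> 1 / 2^k"
    using assms unfolding dcell_def by auto
qed

lemma card_dcell_close:
  assumes "finite S" and B: "0 \<le> B"
    and "\<And>x y z. (x,y,z) \<in> S \<Longrightarrow> \<bar>x - x0\<bar> \<le> B / 2^k \<and> \<bar>y - y0\<bar> \<le> B / 2^k \<and> \<bar>z - z0\<bar> \<le> B / 2^k"
  shows "real (card (dcell k ` S)) \<le> (2 * B + 5)^3"
proof -
  define b where "b = nat \<lceil>B\<rceil> + 1"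
  let ?J = "\<lambda>t::real. {\<lfloor>2^k * t\<rfloor> - int b .. \<lfloor>2^k * t\<rfloor> + int b}"
  have fl: "\<lfloor>2^k * s\<rfloor> \<in> ?J t" if "\<bar>s - t\<bar> \<le> B / 2^k" for s t :: real
  proof -
    have "2^k * \<bar>s - t\<bar> \<le> B" using that by (simp add: field_simps)
    then have "\<bar>2^k * s - 2^k * t\<bar> \<le> B" by (simp add: abs_mult right_diff_distrib[symmetric])
    then have "\<bar>2^k * s - 2^k * t\<bar> \<le> \<lceil>B\<rceil>" by linarith
    moreover have "int b = \<lceil>B\<rceil> + 1" unfolding b_def using B by simp
    ultimately show ?thesis by simp linarith
  qed
  have "dcell k ` S \<subseteq> ?J x0 \<times> ?J y0 \<times> ?J z0"
  proof
    fix c assume "c \<in> dcell k ` S"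
    then obtain x y z where p: "(x,y,z) \<in> S" "c = dcell k (x,y,z)" by auto
    show "c \<in> ?J x0 \<times> ?J y0 \<times> ?J z0"
      unfolding p(2) dcell_def prod.case mem_Times_iff fst_conv snd_conv using fl assms(3)[OF p(1)] by blast
  qed
  then have "card (dcell k ` S) \<le> card (?J x0 \<times> ?J y0 \<times> ?J z0)" by (intro card_mono) auto
  also have "\<dots> = (2 * b + 1)^3"
  proof -
    have "card (?J t) = 2 * b + 1" for t by simp
    then show ?thesis unfolding card_cartesian_product by (simp only: power3_eq_cube mult.assoc)
  qed
  finally have "real (card (dcell k ` S)) \<le> real ((2 * b + 1)^3)" by (rule of_nat_mono)
  also have "\<dots> = (2 * real b + 1)^3" by (simp only: of_nat_power of_nat_add of_nat_mult of_nat_numeral of_nat_1)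
  also have "\<dots> \<le> (2 * B + 5)^3"
  proof (intro power_mono)
    have "int b = \<lceil>B\<rceil> + 1" unfolding b_def using B by simp
    then have "real b = \<lceil>B\<rceil> + 1" by linarith
    then show "2 * real b + 1 \<le> 2 * B + 5" by linarith
  qed simp
  finally show ?thesis .
qed

section \<open>Tangency graphs\<close>

text \<open>Zero iff the circles \<open>u\<close> and \<open>a\<close> are internally tangent.\<close>
definition qd :: "('i \<Rightarrow> real) \<Rightarrow> ('i \<Rightarrow> real) \<Rightarrow> ('i \<Rightarrow> real) \<Rightarrow> 'i \<Rightarrow> 'i \<Rightarrow> real" where
  "qd X Y R u a = (X u - X a)^2 + (Y u - Y a)^2 - (R u - R a)^2"

lemma qd_commute: "qd X Y R u a = qd X Y R a u"
  unfolding qd_def by (simp add: power2_commute)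

text \<open>Polarisation of the form for the vectors \<open>r * (p, q, 1)\<close> and
  \<open>r' * (p', q', 1)\<close>. For exact null vectors only the last term survives, so the form
  of a difference of null vectors measures the angle between them.\<close>

lemma mink_via_slopes:
  fixes x y r x' y' r' :: real
  assumes "r \<noteq> 0" "r' \<noteq> 0"
  shows "(x' - x)^2 + (y' - y)^2 - (r' - r)^2 = (x^2 + y^2 - r^2) + (x'^2 + y'^2 - r'^2)
    - r * r' * (((x/r)^2 + (y/r)^2 - 1) + ((x'/r')^2 + (y'/r')^2 - 1)) + 2 * r * r' * chord (x/r) (y/r) (x'/r') (y'/r')"
proof -
  define p q p' q' where "p = x/r" "q = y/r" "p' = x'/r'" "q' = y'/r'"
  have e: "x = r * p" "y = r * q" "x' = r' * p'" "y' = r' * q'" using assms unfolding p_q_p'_q'_def by auto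
  show ?thesis unfolding p_q_p'_q'_def[symmetric] unfolding e chord_def
    by (simp add: field_simps power2_eq_square)
qed

lemma near_null_slope:
  fixes x y r \<delta> :: real
  assumes "1/2 \<le> \<bar>r\<bar>" "\<bar>x^2 + y^2 - r^2\<bar> \<le> \<delta>"
  shows "\<bar>(x/r)^2 + (y/r)^2 - 1\<bar> \<le> 4 * \<delta>"
proof -
  have r0: "r \<noteq> 0" using assms by auto
  have r2: "1/4 \<le> r^2" using assms(1) power_mono[of "1/2" "\<bar>r\<bar>" 2] by (simp add: power2_eq_square)
  have "(x/r)^2 + (y/r)^2 - 1 = (x^2+y^2-r^2) / r^2" using r0 by (simp add: field_simps power2_eq_square)
  also have "\<bar>\<dots>\<bar> = \<bar>x^2+y^2-r^2\<bar> / r^2" by (simp add: abs_divide)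
  also have "\<dots> \<le> \<delta> / (1/4)" using assms r2 by (intro frac_le) auto
  finally show ?thesis by simp
qed

lemma abs_mult_le:
  fixes a b :: real
  assumes "\<bar>a\<bar> \<le> A" "\<bar>b\<bar> \<le> B" shows "\<bar>a * b\<bar> \<le> A * B"
  using assms mult_mono[of "\<bar>a\<bar>" A "\<bar>b\<bar>" B] by (simp add: abs_mult)

lemma abs_diff3_le:
  fixes x y z :: real
  assumes "\<bar>x\<bar> \<le> A" "\<bar>y\<bar> \<le> B" "\<bar>z\<bar> \<le> C" shows "\<bar>x - y - z\<bar> \<le> A + B + C"
  using assms by linarith

lemma abs_le_of_near_unit:
  fixes p q \<epsilon> :: real
  assumes "\<bar>p^2 + q^2 - 1\<bar> \<le> \<epsilon>" "\<epsilon> \<le> 4/100"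
  shows "\<bar>p\<bar> \<le> 11/10"
proof -
  have "p^2 \<le> 121/100" using assms zero_le_power2[of q] by linarith
  then have "p^2 \<le> (11/10)^2" by (simp add: power_divide)
  then show ?thesis by (metis abs_le_square_iff abs_of_nonneg divide_nonneg_nonneg zero_le_numeral)
qed

text \<open>On the part of the unit circle with \<open>q \<le> -1/2\<close> the coordinate
  \<open>p\<close> determines the point in a Lipschitz way, because in
  \<open>(q - q') * (q + q')\<close> the second factor stays away from 0. The chart condition of the
  tangency graph exists for this purpose.\<close>

lemma chord_le_of_close:
  fixes p q p' q' r :: real
  assumes r: "0 < r" "r \<le> 1/10"
    and n: "\<bar>p^2 + q^2 - 1\<bar> \<le> 4 * r^2" "\<bar>p'^2 + q'^2 - 1\<bar> \<le> 4 * r^2"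
    and q: "q \<le> -(1/2)" "q' \<le> -(1/2)" and pp: "\<bar>p - p'\<bar> \<le> r"
  shows "chord p q p' q' \<le> 5 * r^2"
proof -
  have rr: "r^2 \<le> r / 10" "0 \<le> r^2" using r by (auto simp: power2_eq_square)
  then have small: "4 * r^2 \<le> 4/100" using r by linarith
  have "\<bar>p + p'\<bar> \<le> 22/10" using abs_le_of_near_unit[OF n(1) small] abs_le_of_near_unit[OF n(2) small] by linarith
  then have "\<bar>(p - p') * (p + p')\<bar> \<le> r * (22/10)" by (rule abs_mult_le[OF pp])
  moreover have "q^2 - q'^2 = (p^2 + q^2 - 1) - (p'^2 + q'^2 - 1) - (p - p') * (p + p')"
    by (simp add: power2_eq_square algebra_simps)
  ultimately have "\<bar>q^2 - q'^2\<bar> \<le> 4 * r^2 + 4 * r^2 + r * (22/10)" using abs_diff3_le[OF n] by metis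
  also have "\<dots> \<le> 3 * r" using rr by linarith
  finally have "\<bar>q - q'\<bar> * \<bar>q + q'\<bar> \<le> 3 * r" unfolding abs_mult[symmetric] by (simp add: power2_eq_square algebra_simps)
  moreover have "1 \<le> \<bar>q + q'\<bar>" using q by linarith
  then have "\<bar>q - q'\<bar> * 1 \<le> \<bar>q - q'\<bar> * \<bar>q + q'\<bar>" by (rule mult_left_mono) simp
  ultimately have "\<bar>q - q'\<bar> \<le> 3 * r" by simp
  then have "(q - q')^2 \<le> (3 * r)^2" using r abs_le_square_iff[of "q - q'" "3 * r"] by simp
  moreover have "(p - p')^2 \<le> r^2" using pp r abs_le_square_iff[of "p - p'" r] by simp
  ultimately show ?thesis unfolding chord_def by (simp add: power_mult_distrib)
qed

text \<open>
  \<open>N\<close> is a graph of nearly tangent pairs at distance about 1; \<open>N_chart\<close> restricts their directions to a part of the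
  light cone on which they are determined by \<open>(X u - X a) / (R u - R a)\<close>. The neighbours of \<open>u\<close> in \<open>plank\<close> are those
  in a plank of size \<open>1 \<times> \<surd>\<delta> \<times> \<delta>\<close>, and \<open>2\<^sup>-\<^sup>L\<close> is about \<open>\<surd>\<delta>\<close>.
\<close>
locale tangency =
  fixes I :: "'i set" and w X Y R :: "'i \<Rightarrow> real" and N :: "('i \<times> 'i) set" and \<delta> M :: real and L :: nat
  assumes finI: "finite I"
    and w_nonneg: "i \<in> I \<Longrightarrow> 0 \<le> w i"
    and w_sum: "sum w I \<le> 1"
    and N_sub: "(u, a) \<in> N \<Longrightarrow> u \<in> I \<and> a \<in> I"
    and N_sym: "(u, a) \<in> N \<Longrightarrow> (a, u) \<in> N"
    and N_le: "(u, a) \<in> N \<Longrightarrow> \<bar>X u - X a\<bar> \<le> 2 \<and> \<bar>Y u - Y a\<bar> \<le> 2 \<and> \<bar>R u - R a\<bar> \<le> 2"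
    and N_ge: "(u, a) \<in> N \<Longrightarrow> 1/2 \<le> \<bar>R u - R a\<bar>"
    and N_tan: "(u, a) \<in> N \<Longrightarrow> \<bar>qd X Y R u a\<bar> \<le> \<delta>"
    and N_chart: "(u, a) \<in> N \<Longrightarrow> (Y u - Y a) / (R u - R a) \<le> - (1/2)"
    and plank: "(u, a) \<in> N \<Longrightarrow> sum w {b. (u, b) \<in> N \<and> \<bar>qd X Y R a b\<bar> \<le> 2000 * \<delta>} \<le> M"
    and roots: "card ((\<lambda>i. dcell 0 (X i, Y i, R i)) ` I) \<le> 125"
    and \<delta>_pos: "0 < \<delta>" and \<delta>_le: "\<delta> \<le> 1/100" and M_pos: "0 < M"
    and L1: "\<delta> \<le> 1 / 2^L" and L2: "3 * (1 / 2^L)^2 \<le> 2000 * \<delta>"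
begin

abbreviation Q :: "'i \<Rightarrow> 'i \<Rightarrow> real" where "Q \<equiv> qd X Y R"

definition s :: "'i \<Rightarrow> 'i \<Rightarrow> real" where "s u a = (X u - X a) / (R u - R a)"
definition t :: "'i \<Rightarrow> 'i \<Rightarrow> real" where "t u a = (Y u - Y a) / (R u - R a)"

definition wt :: "'i set \<Rightarrow> real" where "wt S = sum w S"

lemma nb_sub: "{a. (u,a) \<in> N \<and> P a} \<subseteq> I" using N_sub by blast

lemma wt_mono: "S \<subseteq> T \<Longrightarrow> T \<subseteq> I \<Longrightarrow> wt S \<le> wt T"
  unfolding wt_def using finI w_nonneg by (intro sum_mono2) (auto intro: finite_subset)

lemma wt_nonneg: "S \<subseteq> I \<Longrightarrow> 0 \<le> wt S"
  unfolding wt_def using w_nonneg by (intro sum_nonneg) auto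

lemma wt_le1: "S \<subseteq> I \<Longrightarrow> wt S \<le> 1"
  using wt_mono[of S I] w_sum unfolding wt_def by auto

lemma wt_UN_le:
  assumes "finite A" "\<And>x. x \<in> A \<Longrightarrow> F x \<subseteq> I"
  shows "wt (\<Union>x\<in>A. F x) \<le> (\<Sum>x\<in>A. wt (F x))"
  using assms
proof (induction A rule: finite_induct)
  case (insert x A)
  have "wt (F x \<union> (\<Union>x\<in>A. F x)) \<le> wt (F x) + wt (\<Union>x\<in>A. F x)"
    unfolding wt_def using insert.prems finI w_nonneg
    by (subst sum.union_inter[symmetric]) (auto intro!: sum_nonneg intro: finite_subset)
  then show ?case using insert by force
qed (simp add: wt_def)

lemma slope_null: "(u,a) \<in> N \<Longrightarrow> \<bar>(s u a)^2 + (t u a)^2 - 1\<bar> \<le> 4 * \<delta>"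
  unfolding s_def t_def using N_ge N_tan by (intro near_null_slope) (auto simp: qd_def)

lemma Q_via_slopes:
  assumes "(u,a) \<in> N" "(u,b) \<in> N"
  shows "Q a b = Q u a + Q u b - (R u - R a) * (R u - R b) * (((s u a)^2 + (t u a)^2 - 1) + ((s u b)^2 + (t u b)^2 - 1))
     + 2 * (R u - R a) * (R u - R b) * chord (s u a) (t u a) (s u b) (t u b)"
proof -
  have "R u - R a \<noteq> 0" "R u - R b \<noteq> 0" using N_ge assms by force+
  from mink_via_slopes[OF this, of "X u - X b" "X u - X a" "Y u - Y b" "Y u - Y a"]
  show ?thesis unfolding s_def t_def qd_def by simp
qed

lemma prod_le4:
  assumes "(u,a) \<in> N" "(u,b) \<in> N"
  shows "\<bar>(R u - R a) * (R u - R b)\<bar> \<le> 4"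
  using mult_mono[of "\<bar>R u - R a\<bar>" 2 "\<bar>R u - R b\<bar>" 2] N_le assms by (auto simp: abs_mult)

text \<open>The form of \<open>a - b\<close> is controlled by the angle under which \<open>u\<close>
  sees the two points. The constant 34 collects 2 from the two tangencies with \<open>u\<close> and
  \<open>4 * 8\<close> from the slopes.\<close>

lemma Q_slope_le:
  assumes "(u,a) \<in> N" "(u,b) \<in> N"
  shows "\<bar>Q a b\<bar> \<le> 34 * \<delta> + 8 * chord (s u a) (t u a) (s u b) (t u b)"
proof -
  define p e c where "p = (R u - R a) * (R u - R b)"
    and "e = ((s u a)^2 + (t u a)^2 - 1) + ((s u b)^2 + (t u b)^2 - 1)" and "c = chord (s u a) (t u a) (s u b) (t u b)"
  have "\<bar>e\<bar> \<le> 4 * \<delta> + 4 * \<delta>"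
    unfolding e_def by (intro order_trans[OF abs_triangle_ineq] add_mono slope_null assms)
  moreover have p: "\<bar>p\<bar> \<le> 4" unfolding p_def by (rule prod_le4[OF assms])
  ultimately have "\<bar>p * e\<bar> \<le> 4 * (4 * \<delta> + 4 * \<delta>)" by (rule abs_mult_le[rotated])
  moreover have "\<bar>p * c\<bar> \<le> 4 * c" using abs_mult_le[OF p, of c c] chord_nonneg unfolding c_def by simp
  moreover have "Q a b = Q u a + Q u b - p * e + 2 * (p * c)"
    using Q_via_slopes[OF assms] unfolding p_def e_def c_def by (simp only: mult.assoc)
  moreover have "\<bar>q\<bar> \<le> 2 * d + x' + 2 * y'" if "\<bar>x\<bar> \<le> x'" "\<bar>y\<bar> \<le> y'" "q = a + b - x + 2 * y" "\<bar>a\<bar> \<le> d" "\<bar>b\<bar> \<le> d"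
    for q a b x y x' y' d :: real using that by linarith
  ultimately have "\<bar>Q a b\<bar> \<le> 2 * \<delta> + 4 * (4 * \<delta> + 4 * \<delta>) + 2 * (4 * c)"
    using N_tan[OF assms(1)] N_tan[OF assms(2)] by blast
  then show ?thesis unfolding c_def by simp
qed

text \<open>The directional resolution is \<open>sqrt \<delta>\<close>: for closer directions the
  chord is of order \<delta>, so the two neighbours lie in one plank.\<close>

lemma close_slope:
  assumes "(u,a) \<in> N" "(u,b) \<in> N" and st: "\<bar>s u a - s u b\<bar> \<le> sqrt \<delta>"
  shows "\<bar>Q a b\<bar> \<le> 2000 * \<delta>"
proof -
  have "0 < sqrt \<delta>" "sqrt \<delta> \<le> 1/10" "(sqrt \<delta>)^2 = \<delta>"
    using \<delta>_pos \<delta>_le real_sqrt_le_mono[of \<delta> "1/100"] by (auto simp: real_sqrt_divide)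
  moreover have "t u a \<le> -(1/2)" "t u b \<le> -(1/2)" using N_chart assms unfolding t_def by auto
  ultimately have "chord (s u a) (t u a) (s u b) (t u b) \<le> 5 * (sqrt \<delta>)^2"
    using slope_null[OF assms(1)] slope_null[OF assms(2)] st by (intro chord_le_of_close) simp_all
  then show ?thesis using Q_slope_le[OF assms(1,2)] \<delta>_pos by simp
qed

text \<open>Origin of the constant 2000: \<open>(2000 - 34) / 8\<close> exceeds 144, the separation
  required by \<open>near_null_unique\<close>. In the opposite direction \<open>close_slope\<close>
  needs only \<open>34 + 8 * 5\<close>.\<close>

lemma far_slope:
  assumes "(u,a) \<in> N" "(u,b) \<in> N" and "2000 * \<delta> < \<bar>Q a b\<bar>"
  shows "144 * \<delta> \<le> chord (s u a) (t u a) (s u b) (t u b)"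
  using Q_slope_le[OF assms(1,2)] assms(3) \<delta>_pos by linarith

definition nbr_det :: "'i \<Rightarrow> 'i \<Rightarrow> 'i \<Rightarrow> 'i \<Rightarrow> real" where
  "nbr_det u a b c = det3 (X u - X a) (Y u - Y a) (R u - R a) (X u - X b) (Y u - Y b) (R u - R b) (X u - X c) (Y u - Y c) (R u - R c)"

lemma nbr_det_nonzero:
  assumes "(u,a) \<in> N" "(u,b) \<in> N" "(u,c) \<in> N"
    "2000 * \<delta> < \<bar>Q a b\<bar>" "2000 * \<delta> < \<bar>Q a c\<bar>" "2000 * \<delta> < \<bar>Q b c\<bar>"
  shows "nbr_det u a b c \<noteq> 0"
proof -
  have nz: "R u - R a \<noteq> 0" "R u - R b \<noteq> 0" "R u - R c \<noteq> 0" using N_ge assms by force+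
  have "nbr_det u a b c = (R u - R a) * (R u - R b) * (R u - R c) * det3 (s u a) (t u a) 1 (s u b) (t u b) 1 (s u c) (t u c) 1"
    unfolding nbr_det_def det3_scale[symmetric] s_def t_def using nz by simp
  moreover have "det3 (s u a) (t u a) 1 (s u b) (t u b) 1 (s u c) (t u c) 1 \<noteq> 0"
    by (rule near_null_det_nonzero[OF slope_null slope_null slope_null far_slope far_slope far_slope]) (use assms \<delta>_pos in auto)
  ultimately show ?thesis using nz by simp
qed

lemma common_neighbours_near_null:
  assumes u: "(u,a) \<in> N" "(u,b) \<in> N" "(u,c) \<in> N" and v: "(v,a) \<in> N" "(v,b) \<in> N" "(v,c) \<in> N"
    and far: "2000 * \<delta> < \<bar>Q a b\<bar>" "2000 * \<delta> < \<bar>Q a c\<bar>" "2000 * \<delta> < \<bar>Q b c\<bar>"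
    and sgn: "0 < nbr_det u a b c * nbr_det v a b c"
  shows "\<bar>Q u v\<bar> \<le> 2 * \<delta>"
proof -
  have e: "f u - f d + (f v - f u) = f v - f d" for f :: "'i \<Rightarrow> real" and d by simp
  have "\<bar>Q v u\<bar> \<le> 2 * \<delta>"
    by (rule near_null_unique[of "R u - R a" "R u - R b" "R u - R c" "X u - X a" "Y u - Y a" \<delta> "X u - X b" "Y u - Y b" "X u - X c" "Y u - Y c"
          "X v - X u" "Y v - Y u" "R v - R u", unfolded e, folded qd_def s_def t_def nbr_det_def,
        OF N_ge[OF u(1)] N_ge[OF u(2)] N_ge[OF u(3)] N_tan[OF u(1)] N_tan[OF u(2)] N_tan[OF u(3)]
           N_tan[OF v(1)] N_tan[OF v(2)] N_tan[OF v(3)] far_slope[OF u(1,2) far(1)] far_slope[OF u(1,3) far(2)] far_slope[OF u(2,3) far(3)]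
           sgn \<delta>_pos])
  then show ?thesis by (simp only: qd_commute)
qed

text \<open>Fix \<open>u\<close> in the class of one sign. Every \<open>v\<close> in it has
  \<open>\<bar>Q u v\<bar> \<le> 2 * \<delta>\<close>, and both are neighbours of \<open>a\<close>
  by the symmetry of \<open>N\<close>, so the class lies in a plank seen from \<open>a\<close>.
  Determinant 0 does not occur because of the separation.\<close>

lemma common_neighbours_mass:
  assumes far: "2000 * \<delta> < \<bar>Q a b\<bar>" "2000 * \<delta> < \<bar>Q a c\<bar>" "2000 * \<delta> < \<bar>Q b c\<bar>"
  shows "wt {u. (u,a) \<in> N \<and> (u,b) \<in> N \<and> (u,c) \<in> N} \<le> 2 * M"
proof -
  let ?V = "{u. (u,a) \<in> N \<and> (u,b) \<in> N \<and> (u,c) \<in> N}"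
  define C where "C \<sigma> = {u \<in> ?V. 0 < \<sigma> * nbr_det u a b c}" for \<sigma> :: real
  have CI: "C \<sigma> \<subseteq> I" for \<sigma> unfolding C_def using N_sub by auto
  have "wt (C \<sigma>) \<le> M" for \<sigma>
  proof (cases "C \<sigma> = {}")
    case True then show ?thesis using M_pos by (simp add: wt_def)
  next
    case False
    then obtain u where u: "u \<in> C \<sigma>" by auto
    have "C \<sigma> \<subseteq> {v. (a,v) \<in> N \<and> \<bar>Q u v\<bar> \<le> 2000 * \<delta>}"
    proof
      fix v assume v: "v \<in> C \<sigma>"
      have "0 < nbr_det u a b c * nbr_det v a b c" using u v unfolding C_def by (auto simp: zero_less_mult_iff)
      then have "\<bar>Q u v\<bar> \<le> 2 * \<delta>" using common_neighbours_near_null[of u a b c v] u v far unfolding C_def by auto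
      then show "v \<in> {v. (a,v) \<in> N \<and> \<bar>Q u v\<bar> \<le> 2000 * \<delta>}" using v N_sym \<delta>_pos unfolding C_def by auto
    qed
    then have "wt (C \<sigma>) \<le> wt {v. (a,v) \<in> N \<and> \<bar>Q u v\<bar> \<le> 2000 * \<delta>}" by (intro wt_mono nb_sub)
    also have "\<dots> \<le> M" unfolding wt_def using u N_sym unfolding C_def by (intro plank) auto
    finally show ?thesis .
  qed
  moreover have "?V = (\<Union>\<sigma>\<in>{1,-1}. C \<sigma>)"
    using nbr_det_nonzero far unfolding C_def by (force simp: neq_iff)
  then have "wt ?V \<le> (\<Sum>\<sigma>\<in>{1,-1}. wt (C \<sigma>))" using wt_UN_le[of "{1,-1::real}" C] CI by simp
  ultimately show ?thesis by (smt (verit) finite.intros insert_iff singletonD sum.empty sum.insert)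
qed

lemma slot_mass: "wt {a. (u,a) \<in> N \<and> \<lfloor>s u a / sqrt \<delta>\<rfloor> = z} \<le> M"
proof (cases "\<exists>a. (u,a) \<in> N \<and> \<lfloor>s u a / sqrt \<delta>\<rfloor> = z")
  case True
  then obtain a where a: "(u,a) \<in> N" "\<lfloor>s u a / sqrt \<delta>\<rfloor> = z" by auto
  have "{b. (u,b) \<in> N \<and> \<lfloor>s u b / sqrt \<delta>\<rfloor> = z} \<subseteq> {b. (u,b) \<in> N \<and> \<bar>Q a b\<bar> \<le> 2000 * \<delta>}"
  proof safe
    fix b assume b: "(u,b) \<in> N" "z = \<lfloor>s u b / sqrt \<delta>\<rfloor>"
    then have "\<bar>s u a / sqrt \<delta> - s u b / sqrt \<delta>\<bar> \<le> 1" using a(2) by linarith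
    then have "\<bar>s u a - s u b\<bar> \<le> sqrt \<delta>" using \<delta>_pos by (simp add: diff_divide_distrib[symmetric] field_simps)
    then show "\<bar>Q a b\<bar> \<le> 2000 * \<delta>" using close_slope a b by auto
  qed
  then have "wt {b. (u,b) \<in> N \<and> \<lfloor>s u b / sqrt \<delta>\<rfloor> = z} \<le> wt {b. (u,b) \<in> N \<and> \<bar>Q a b\<bar> \<le> 2000 * \<delta>}" by (intro wt_mono nb_sub)
  also have "\<dots> \<le> M" unfolding wt_def using plank a by auto
  finally show ?thesis .
next
  case False
  then have "{a. (u,a) \<in> N \<and> \<lfloor>s u a / sqrt \<delta>\<rfloor> = z} = {}" by blast
  then show ?thesis using M_pos by (simp only: wt_def sum.empty)
qed

lemma slice_mass:
  assumes "0 \<le> l"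
  shows "wt {a. (u,a) \<in> N \<and> c \<le> s u a \<and> s u a \<le> c + l} \<le> (l / sqrt \<delta> + 2) * M"
proof -
  let ?Z = "{\<lfloor>c / sqrt \<delta>\<rfloor> .. \<lfloor>(c + l) / sqrt \<delta>\<rfloor>}"
  have sd: "0 < sqrt \<delta>" using \<delta>_pos by simp
  have "{a. (u,a) \<in> N \<and> c \<le> s u a \<and> s u a \<le> c + l} \<subseteq> (\<Union>z\<in>?Z. {a. (u,a) \<in> N \<and> \<lfloor>s u a / sqrt \<delta>\<rfloor> = z})"
    using sd by (auto intro!: floor_mono divide_right_mono)
  then have "wt {a. (u,a) \<in> N \<and> c \<le> s u a \<and> s u a \<le> c + l} \<le> wt (\<Union>z\<in>?Z. {a. (u,a) \<in> N \<and> \<lfloor>s u a / sqrt \<delta>\<rfloor> = z})"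
    using nb_sub by (intro wt_mono) auto
  also have "\<dots> \<le> (\<Sum>z\<in>?Z. wt {a. (u,a) \<in> N \<and> \<lfloor>s u a / sqrt \<delta>\<rfloor> = z})" using nb_sub by (intro wt_UN_le) auto
  also have "\<dots> \<le> (\<Sum>z\<in>?Z. M)" by (intro sum_mono slot_mass)
  also have "\<dots> = real (card ?Z) * M" by simp
  also have "\<dots> \<le> (l / sqrt \<delta> + 2) * M"
  proof (intro mult_right_mono)
    have "c / sqrt \<delta> \<le> (c + l) / sqrt \<delta>" using sd assms by (intro divide_right_mono) auto
    then have "real (card ?Z) = \<lfloor>(c + l) / sqrt \<delta>\<rfloor> - \<lfloor>c / sqrt \<delta>\<rfloor> + 1" by (simp add: floor_mono)
    also have "\<dots> \<le> (c + l) / sqrt \<delta> - c / sqrt \<delta> + 2" by linarith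
    also have "\<dots> = l / sqrt \<delta> + 2" by (simp add: add_divide_distrib)
    finally show "real (card ?Z) \<le> l / sqrt \<delta> + 2" .
  qed (use M_pos in simp)
  finally show ?thesis .
qed

lemma slope_le: "(u,a) \<in> N \<Longrightarrow> \<bar>s u a\<bar> \<le> 11/10"
proof -
  assume "(u,a) \<in> N"
  then show ?thesis using \<delta>_le by (intro abs_le_of_near_unit[OF slope_null]) auto
qed

text \<open>Slopes fill an interval of length \<open>22/10\<close>, cut into slots of length
  \<open>sqrt \<delta>\<close> of mass at most \<open>M\<close>. The main estimate concerns the case
  where this trivial bound is nearly attained on average.\<close>

lemma nb_mass: "wt {a. (u,a) \<in> N} \<le> 5 * M / sqrt \<delta>"
proof -
  have sd: "0 < sqrt \<delta>" "sqrt \<delta> \<le> 1/10" using \<delta>_pos \<delta>_le real_sqrt_le_mono[of \<delta> "1/100"] by (auto simp: real_sqrt_divide)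
  have "wt {a. (u,a) \<in> N} = wt {a. (u,a) \<in> N \<and> -(11/10) \<le> s u a \<and> s u a \<le> -(11/10) + 22/10}"
  proof -
    have "-(11/10) \<le> s u a \<and> s u a \<le> -(11/10) + 22/10" if "(u,a) \<in> N" for a using slope_le[OF that] by linarith
    then show ?thesis by (intro arg_cong[of _ _ wt] Collect_cong) blast
  qed
  also have "\<dots> \<le> (22/10 / sqrt \<delta> + 2) * M" by (intro slice_mass) auto
  also have "\<dots> \<le> (5 / sqrt \<delta>) * M" using sd M_pos by (intro mult_right_mono) (auto simp: field_simps)
  finally show ?thesis by simp
qed

end

section \<open>Heavy cells and the stopping time decomposition\<close>

lemma card_heavy_fibres:
  fixes w :: "'i \<Rightarrow> real"
  assumes "finite I" "\<And>i. i \<in> I \<Longrightarrow> 0 \<le> w i" "sum w I \<le> 1" "0 < m"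
  shows "real (card {c \<in> f ` I. m < sum w {i \<in> I. f i = c}}) \<le> 1 / m"
proof -
  let ?H = "{c \<in> f ` I. m < sum w {i \<in> I. f i = c}}"
  have fin: "finite ?H" using assms by auto
  have "real (card ?H) * m = (\<Sum>c\<in>?H. m)" by simp
  also have "\<dots> \<le> (\<Sum>c\<in>?H. sum w {i \<in> I. f i = c})" by (intro sum_mono) auto
  also have "\<dots> \<le> (\<Sum>c\<in>f ` I. sum w {i \<in> I. f i = c})" using assms by (intro sum_mono2) (auto intro: sum_nonneg)
  also have "\<dots> = sum w I" using assms(1) by (simp add: sum.image_gen[symmetric])
  finally show ?thesis using assms(3,4) by (simp add: field_simps)
qed

lemma abs_inner3_le:
  fixes x y z a b c :: real
  assumes "\<bar>x\<bar> \<le> A" "\<bar>y\<bar> \<le> A" "\<bar>z\<bar> \<le> A" "\<bar>a\<bar> \<le> B" "\<bar>b\<bar> \<le> B" "\<bar>c\<bar> \<le> B"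
  shows "\<bar>x * a + y * b - z * c\<bar> \<le> 3 * (A * B)"
  using abs_mult_le[OF assms(1,4)] abs_mult_le[OF assms(2,5)] abs_mult_le[OF assms(3,6)] by linarith

lemma mink_le:
  fixes a b c :: real
  assumes "\<bar>a\<bar> \<le> B" "\<bar>b\<bar> \<le> B" "\<bar>c\<bar> \<le> B"
  shows "\<bar>a^2 + b^2 - c^2\<bar> \<le> 2 * B^2"
proof -
  have "a^2 \<le> B^2" "b^2 \<le> B^2" "c^2 \<le> B^2"
    using assms power_mono[of "\<bar>a\<bar>" B 2] power_mono[of "\<bar>b\<bar>" B 2] power_mono[of "\<bar>c\<bar>" B 2] by auto
  moreover have "0 \<le> a^2" "0 \<le> b^2" "0 \<le> c^2" by auto
  ultimately show ?thesis unfolding abs_le_iff by linarith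
qed

text \<open>Read \<open>(x, y, r)\<close> as \<open>u - a\<close>, \<open>(x', y', r')\<close> as
  \<open>v - b\<close>, and the other two vectors as \<open>v - u\<close> and \<open>b - a\<close>.
  Both differences are nearly null, so expanding the form of \<open>v - a\<close> in two ways
  isolates the product of \<open>v - u\<close> with \<open>u - a\<close>. The square
  \<open>t^2\<close> stays on the right because \<open>v - u\<close> is not yet known to be
  small.\<close>

lemma near_null_pair:
  fixes x y r v1 v2 v3 a1 a2 a3 x' y' r' \<delta> \<rho> t :: real
  assumes n: "\<bar>x^2 + y^2 - r^2\<bar> \<le> \<delta>" and r: "1/2 \<le> \<bar>r\<bar>"
    and n': "\<bar>x'^2 + y'^2 - r'^2\<bar> \<le> \<delta>" and b: "\<bar>x'\<bar> \<le> 2" "\<bar>y'\<bar> \<le> 2" "\<bar>r'\<bar> \<le> 2"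
    and a: "\<bar>a1\<bar> \<le> \<rho>" "\<bar>a2\<bar> \<le> \<rho>" "\<bar>a3\<bar> \<le> \<rho>"
    and v: "\<bar>v1\<bar> \<le> t" "\<bar>v2\<bar> \<le> t" "\<bar>v3\<bar> \<le> t"
    and eq: "x + v1 = x' + a1" "y + v2 = y' + a2" "r + v3 = r' + a3"
    and \<rho>: "\<delta> \<le> \<rho>" "\<rho> \<le> 1"
  shows "\<bar>x / r * v1 + y / r * v2 - v3\<bar> \<le> 16 * \<rho> + 2 * t^2"
proof -
  have r0: "r \<noteq> 0" using r by auto
  have \<rho>0: "0 \<le> \<rho>" using a(1) by linarith
  define p where "p = x * v1 + y * v2 - r * v3"
  define q where "q = x' * a1 + y' * a2 - r' * a3"
  have "2 * p = (x + v1)^2 + (y + v2)^2 - (r + v3)^2 - (x^2 + y^2 - r^2) - (v1^2 + v2^2 - v3^2)"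
    unfolding p_def by (simp add: power2_eq_square algebra_simps)
  also have "(x + v1)^2 + (y + v2)^2 - (r + v3)^2 = (x'^2 + y'^2 - r'^2) + 2 * q + (a1^2 + a2^2 - a3^2)"
    unfolding eq q_def by (simp add: power2_eq_square algebra_simps)
  finally have 1: "2 * p = (x'^2 + y'^2 - r'^2) + 2 * q + (a1^2 + a2^2 - a3^2) - (x^2 + y^2 - r^2) - (v1^2 + v2^2 - v3^2)" .
  have q: "\<bar>q\<bar> \<le> 3 * (2 * \<rho>)" unfolding q_def by (rule abs_inner3_le[OF b a])
  have a2: "\<bar>a1^2 + a2^2 - a3^2\<bar> \<le> 2 * \<rho>^2" by (rule mink_le[OF a])
  have v2: "\<bar>v1^2 + v2^2 - v3^2\<bar> \<le> 2 * t^2" by (rule mink_le[OF v])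
  have "\<rho>^2 \<le> \<rho>" using \<rho> \<rho>0 by (simp add: power2_eq_square mult_left_le)
  have "2 * \<bar>p\<bar> \<le> \<delta> + 2 * (3 * (2 * \<rho>)) + 2 * \<rho>^2 + \<delta> + 2 * t^2"
  proof -
    have "2 * \<bar>P\<bar> \<le> A + 2 * B + C + D + E" if "2 * P = a + 2 * b + c - d - e" "\<bar>a\<bar> \<le> A" "\<bar>b\<bar> \<le> B" "\<bar>c\<bar> \<le> C" "\<bar>d\<bar> \<le> D" "\<bar>e\<bar> \<le> E"
      for P a b c d e A B C D E :: real using that by linarith
    from this[OF 1 n' q a2 n v2] show ?thesis .
  qed
  then have p: "\<bar>p\<bar> \<le> 8 * \<rho> + t^2" using \<open>\<rho>^2 \<le> \<rho>\<close> \<rho> by linarith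
  have "x / r * v1 + y / r * v2 - v3 = p / r" unfolding p_def using r0 by (simp add: field_simps)
  then have "\<bar>x / r * v1 + y / r * v2 - v3\<bar> = \<bar>p\<bar> / \<bar>r\<bar>" by (simp add: abs_divide)
  also have "\<dots> \<le> (8 * \<rho> + t^2) / (1/2)" using p r by (intro frac_le) auto
  finally show ?thesis by simp
qed

lemma chord_ge_of_floor:
  assumes "\<bar>\<lfloor>p / \<zeta>\<rfloor> - \<lfloor>p' / \<zeta>\<rfloor>\<bar> \<ge> 2" "0 < \<zeta>"
  shows "\<zeta>^2 / 2 \<le> chord p q p' q'"
proof -
  have "1 \<le> \<bar>p / \<zeta> - p' / \<zeta>\<bar>" using assms(1) by linarith
  also have "\<bar>p / \<zeta> - p' / \<zeta>\<bar> = \<bar>p - p'\<bar> / \<zeta>" using assms(2) by (simp add: diff_divide_distrib[symmetric] abs_divide)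
  finally have "\<zeta> \<le> \<bar>p - p'\<bar>" using assms(2) by (simp add: field_simps)
  then have "\<zeta>^2 \<le> (p - p')^2" using assms(2) by (simp add: abs_le_square_iff[symmetric])
  then show ?thesis unfolding chord_def using zero_le_power2[of "q - q'"] by (intro divide_right_mono) linarith+
qed

context tangency
begin

definition cl :: "nat \<Rightarrow> 'i \<Rightarrow> int \<times> int \<times> int" where "cl k u = dcell k (X u, Y u, R u)"

definition cell_mass :: "nat \<Rightarrow> 'i \<Rightarrow> real" where "cell_mass k u = wt {v\<in>I. cl k v = cl k u}"

text \<open>Cells are refined until they are light. Level \<open>L\<close>, where the side is about
  \<open>sqrt \<delta>\<close>, ends the refinement in any case; by \<open>bottom_block_mass\<close>
  the part of such a cell that one point sees is contained in a plank.\<close>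

definition stop_level :: "real \<Rightarrow> 'i \<Rightarrow> nat" where "stop_level m u = (LEAST k. k = L \<or> cell_mass k u \<le> m)"

text \<open>The level is part of the name because index triples of different levels can
  coincide.\<close>

definition block :: "real \<Rightarrow> 'i \<Rightarrow> nat \<times> int \<times> int \<times> int" where "block m u = (stop_level m u, cl (stop_level m u) u)"

definition block_mass :: "real \<Rightarrow> nat \<times> int \<times> int \<times> int \<Rightarrow> real" where "block_mass m B = wt {v\<in>I. block m v = B}"

lemma stop_level_le: "stop_level m u \<le> L" unfolding stop_level_def by (intro Least_le) auto

lemma stop_level_cases: "stop_level m u = L \<or> cell_mass (stop_level m u) u \<le> m"
  unfolding stop_level_def by (rule LeastI[of _ L]) simp

lemma cl_mono: "cl k u = cl k v \<Longrightarrow> j \<le> k \<Longrightarrow> cl j u = cl j v"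
  unfolding cl_def by (rule dcell_mono_eq)

lemma cell_mass_cong: "cl k u = cl k v \<Longrightarrow> cell_mass k u = cell_mass k v" unfolding cell_mass_def by simp

text \<open>The stopping rule consults only the masses of cells around the point at levels up to the
  stopping level, and all points of the stopping cell share these. Hence the blocks partition
  \<open>I\<close>.\<close>

lemma stop_level_cong:
  assumes "cl (stop_level m u) v = cl (stop_level m u) u"
  shows "stop_level m v = stop_level m u"
proof -
  have eq: "cell_mass j v = cell_mass j u" if "j \<le> stop_level m u" for j using cell_mass_cong[OF cl_mono[OF assms that]] .
  have "stop_level m v \<le> stop_level m u" unfolding stop_level_def[of m v]
    using stop_level_cases[of m u] eq by (intro Least_le) auto
  moreover have "stop_level m u \<le> stop_level m v" unfolding stop_level_def[of m u]
    using stop_level_cases[of m v] eq[OF calculation] by (intro Least_le) auto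
  ultimately show ?thesis by simp
qed

lemma block_eq_iff: "block m v = block m u \<longleftrightarrow> cl (stop_level m u) v = cl (stop_level m u) u"
proof
  assume "cl (stop_level m u) v = cl (stop_level m u) u"
  moreover from stop_level_cong[OF this] have "stop_level m v = stop_level m u" .
  ultimately show "block m v = block m u" unfolding block_def by simp
next
  assume "block m v = block m u"
  then have e: "stop_level m v = stop_level m u \<and> cl (stop_level m v) v = cl (stop_level m u) u" unfolding block_def prod.inject .
  show "cl (stop_level m u) v = cl (stop_level m u) u" using conjunct2[OF e] unfolding conjunct1[OF e] .
qed

lemma block_mass_block: "block_mass m (block m u) = cell_mass (stop_level m u) u"
  unfolding block_mass_def cell_mass_def block_eq_iff ..

lemma stop_level_Suc_heavy: "stop_level m u = Suc k \<Longrightarrow> m < cell_mass k u"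
proof -
  assume "stop_level m u = Suc k"
  then have "k < stop_level m u" by simp
  then have "\<not> (k = L \<or> cell_mass k u \<le> m)" unfolding stop_level_def by (rule not_less_Least)
  then show ?thesis by simp
qed

text \<open>A block below level 0 has a parent heavier than \<open>m\<close>. Each of the
  \<open>L\<close> levels has at most \<open>1 / m\<close> heavy cells, each with 8 children, and
  there are at most 125 roots. So up to a factor \<open>L\<close> there are no more blocks than if
  each of them had mass \<open>m\<close>.\<close>

lemma card_blocks:
  assumes m: "0 < m" "m \<le> 1"
  shows "real (card (block m ` I)) \<le> (125 + 8 * real L) / m"
proof -
  let ?F = "\<lambda>k. {u\<in>I. stop_level m u = k}"
  have "u \<in> I \<longleftrightarrow> u \<in> (\<Union>k\<in>{..L}. ?F k)" for u using stop_level_le[of m u] by simp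
  then have "I = (\<Union>k\<in>{..L}. ?F k)" by (rule set_eqI)
  from arg_cong[OF this, of "image (block m)"] have "block m ` I = (\<Union>k\<in>{..L}. block m ` ?F k)"
    by (simp only: image_UN)
  then have "card (block m ` I) \<le> (\<Sum>k\<in>{..L}. card (block m ` ?F k))" by (simp add: card_UN_le)
  also have "\<dots> = card (block m ` ?F 0) + (\<Sum>k<L. card (block m ` ?F (Suc k)))"
    by (rule sum.atMost_shift)
  finally have 1: "real (card (block m ` I)) \<le> real (card (block m ` ?F 0)) + (\<Sum>k<L. real (card (block m ` ?F (Suc k))))"
    unfolding of_nat_sum[symmetric] of_nat_add[symmetric] of_nat_le_iff .
  have bl: "card (block m ` ?F k) \<le> card (dcell k ` (\<lambda>u. (X u, Y u, R u)) ` ?F k)" for k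
  proof -
    have "block m ` ?F k \<subseteq> Pair k ` (dcell k ` (\<lambda>u. (X u, Y u, R u)) ` ?F k)" unfolding block_def cl_def by auto
    then have "card (block m ` ?F k) \<le> card (Pair k ` (dcell k ` (\<lambda>u. (X u, Y u, R u)) ` ?F k))" using finI by (intro card_mono) auto
    also have "\<dots> \<le> card (dcell k ` (\<lambda>u. (X u, Y u, R u)) ` ?F k)" using finI by (intro card_image_le) auto
    finally show ?thesis .
  qed
  have "card (block m ` ?F 0) \<le> card ((\<lambda>u. dcell 0 (X u, Y u, R u)) ` I)"
    by (rule order_trans[OF bl], rule card_mono) (use finI in auto)
  then have "real (card (block m ` ?F 0)) \<le> 125" using roots by linarith
  also have "\<dots> \<le> 125 / m" using m by (simp add: field_simps)
  finally have 2: "real (card (block m ` ?F 0)) \<le> 125 / m" .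
  have 3: "real (card (block m ` ?F (Suc k))) \<le> 8 / m" for k
  proof -
    let ?S = "(\<lambda>u. (X u, Y u, R u)) ` ?F (Suc k)"
    let ?H = "{c \<in> cl k ` I. m < sum w {i \<in> I. cl k i = c}}"
    have "dcell k ` ?S \<subseteq> ?H"
    proof
      fix c assume "c \<in> dcell k ` ?S"
      then obtain u where u: "u \<in> I" "stop_level m u = Suc k" "c = cl k u" unfolding cl_def by auto
      then show "c \<in> ?H" using stop_level_Suc_heavy[OF u(2)] unfolding cell_mass_def wt_def by auto
    qed
    then have "card (dcell k ` ?S) \<le> card ?H" using finI by (intro card_mono) auto
    moreover have "card (block m ` ?F (Suc k)) \<le> card (dcell (Suc k) ` ?S)" by (rule bl)
    moreover have "card (dcell (Suc k) ` ?S) \<le> 8 * card (dcell k ` ?S)" using finI by (intro card_dcell_Suc) auto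
    ultimately have "card (block m ` ?F (Suc k)) \<le> 8 * card ?H" by linarith
    then have "real (card (block m ` ?F (Suc k))) \<le> 8 * real (card ?H)" by linarith
    moreover have "real (card ?H) \<le> 1 / m" using card_heavy_fibres[of I w m "cl k"] finI w_nonneg w_sum m by auto
    ultimately show ?thesis by linarith
  qed
  have "(\<Sum>k<L. real (card (block m ` ?F (Suc k)))) \<le> (\<Sum>k<L. 8 / m)" by (intro sum_mono 3)
  also have "\<dots> = 8 * real L / m" by simp
  finally have "real (card (block m ` I)) \<le> 125 / m + 8 * real L / m" using 1 2 by linarith
  then show ?thesis by (simp only: add_divide_distrib)
qed

lemma sum_block_mass: "sum (block_mass m) (block m ` I) \<le> 1"
proof -
  have "sum (block_mass m) (block m ` I) = (\<Sum>B\<in>block m ` I. sum w {v\<in>I. block m v = B})" unfolding block_mass_def wt_def ..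
  also have "\<dots> = sum w I" by (rule sum.image_gen[symmetric, OF finI])
  finally show ?thesis using w_sum by simp
qed

lemma block_mass_nonneg: "0 \<le> block_mass m B" unfolding block_mass_def by (intro wt_nonneg) auto

text \<open>Every edge is counted from one end only, chosen such that \<open>precedes_mass\<close> holds.\<close>
definition precedes :: "real \<Rightarrow> 'i \<Rightarrow> 'i \<Rightarrow> bool" where
  "precedes m a u \<longleftrightarrow> stop_level m u < stop_level m a \<or> stop_level m a = stop_level m u \<and> block_mass m (block m u) \<le> block_mass m (block m a)"

lemma precedes_total: "precedes m a u \<or> precedes m u a" unfolding precedes_def by auto

text \<open>If the cell of \<open>u\<close> is heavier than \<open>m\<close>, it is a bottom block.
  Then \<open>a\<close>, which stops no earlier, is at the bottom as well, and the tie has been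
  broken in favour of the heavier block.\<close>

lemma precedes_mass:
  assumes "precedes m a u" "u \<in> I"
  shows "cell_mass (stop_level m u) u \<le> max m (block_mass m (block m a))"
proof (cases "cell_mass (stop_level m u) u \<le> m")
  case False
  then have "stop_level m u = L" using stop_level_cases by auto
  then have "stop_level m a = stop_level m u" "block_mass m (block m u) \<le> block_mass m (block m a)" using assms stop_level_le[of m a] unfolding precedes_def by auto
  then show ?thesis using block_mass_block by auto
qed auto

lemma precedes_stop_level: "precedes m a u \<Longrightarrow> stop_level m u \<le> stop_level m a" unfolding precedes_def by auto

text \<open>By \<open>near_null_pair\<close> the displacement \<open>v - u\<close>, of size
  \<open>h\<close>, is orthogonal to three separated near-null vectors up to
  \<open>16 * \<rho> + 2 * h^2\<close>, so \<open>near_null_dual_bound\<close> yields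
  \<open>h * \<zeta>^2 \<le> 72 * (16 * \<rho> + 2 * h^2)\<close>. The a priori bound
  \<open>h \<le> \<zeta>^2 / 288\<close> turns the quadratic term into half of the left-hand
  side.\<close>

lemma coarse_close:
  assumes u: "(u,a1) \<in> N" "(u,a2) \<in> N" "(u,a3) \<in> N" and v: "(v,b1) \<in> N" "(v,b2) \<in> N" "(v,b3) \<in> N"
    and z: "\<bar>\<lfloor>s u a1 / \<zeta>\<rfloor> - \<lfloor>s u a2 / \<zeta>\<rfloor>\<bar> \<ge> 2" "\<bar>\<lfloor>s u a1 / \<zeta>\<rfloor> - \<lfloor>s u a3 / \<zeta>\<rfloor>\<bar> \<ge> 2" "\<bar>\<lfloor>s u a2 / \<zeta>\<rfloor> - \<lfloor>s u a3 / \<zeta>\<rfloor>\<bar> \<ge> 2"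
    and \<zeta>: "0 < \<zeta>" "144 * \<delta> \<le> \<zeta>^2" and \<rho>: "\<delta> \<le> \<rho>" "\<rho> \<le> 1"
    and ab: "\<And>a b. (a,b) \<in> {(a1,b1),(a2,b2),(a3,b3)} \<Longrightarrow> \<bar>X b - X a\<bar> \<le> \<rho> \<and> \<bar>Y b - Y a\<bar> \<le> \<rho> \<and> \<bar>R b - R a\<bar> \<le> \<rho>"
    and uv: "\<bar>X v - X u\<bar> \<le> \<zeta>^2 / 288" "\<bar>Y v - Y u\<bar> \<le> \<zeta>^2 / 288" "\<bar>R v - R u\<bar> \<le> \<zeta>^2 / 288"
  shows "\<bar>X v - X u\<bar> \<le> 2304 / \<zeta>^2 * \<rho> \<and> \<bar>Y v - Y u\<bar> \<le> 2304 / \<zeta>^2 * \<rho> \<and> \<bar>R v - R u\<bar> \<le> 2304 / \<zeta>^2 * \<rho>"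
proof -
  define h where "h = max \<bar>X v - X u\<bar> (max \<bar>Y v - Y u\<bar> \<bar>R v - R u\<bar>)"
  have h: "\<bar>X v - X u\<bar> \<le> h" "\<bar>Y v - Y u\<bar> \<le> h" "\<bar>R v - R u\<bar> \<le> h" "h \<le> \<zeta>^2 / 288" "0 \<le> h"
    unfolding h_def using uv by (auto simp: le_max_iff_disj)
  define \<beta> where "\<beta> = 16 * \<rho> + 2 * h^2"
  have pr: "\<bar>s u a * (X v - X u) + t u a * (Y v - Y u) - (R v - R u)\<bar> \<le> \<beta>"
    if "(u,a) \<in> N" "(v,b) \<in> N" "\<bar>X b - X a\<bar> \<le> \<rho> \<and> \<bar>Y b - Y a\<bar> \<le> \<rho> \<and> \<bar>R b - R a\<bar> \<le> \<rho>" for a b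
    unfolding s_def t_def \<beta>_def
  proof (rule near_null_pair)
    show "\<bar>(X u - X a)^2 + (Y u - Y a)^2 - (R u - R a)^2\<bar> \<le> \<delta>" using N_tan[OF that(1)] unfolding qd_def .
    show "\<bar>(X v - X b)^2 + (Y v - Y b)^2 - (R v - R b)^2\<bar> \<le> \<delta>" using N_tan[OF that(2)] unfolding qd_def .
    show "X u - X a + (X v - X u) = X v - X b + (X b - X a)" "Y u - Y a + (Y v - Y u) = Y v - Y b + (Y b - Y a)"
      "R u - R a + (R v - R u) = R v - R b + (R b - R a)" by auto
  qed (use N_ge[OF that(1)] N_le[OF that(2)] that(3) h \<rho> in blast)+
  have g0: "0 < \<zeta>^2 / 2" "18 * (4 * \<delta>) \<le> \<zeta>^2 / 2" "4 * \<delta> \<le> 1" using \<zeta> \<delta>_le by auto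
  have pr1: "\<bar>s u a1 * (X v - X u) + t u a1 * (Y v - Y u) - (R v - R u)\<bar> \<le> \<beta>" by (rule pr[OF u(1) v(1) ab]) blast
  have pr2: "\<bar>s u a2 * (X v - X u) + t u a2 * (Y v - Y u) - (R v - R u)\<bar> \<le> \<beta>" by (rule pr[OF u(2) v(2) ab]) blast
  have pr3: "\<bar>s u a3 * (X v - X u) + t u a3 * (Y v - Y u) - (R v - R u)\<bar> \<le> \<beta>" by (rule pr[OF u(3) v(3) ab]) blast
  note d = near_null_dual_bound[OF slope_null[OF u(1)] slope_null[OF u(2)] slope_null[OF u(3)]
     chord_ge_of_floor[OF z(1) \<zeta>(1)] chord_ge_of_floor[OF z(2) \<zeta>(1)] chord_ge_of_floor[OF z(3) \<zeta>(1)] g0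
     pr1 pr2 pr3]
  have z2: "0 < \<zeta>^2" using \<zeta>(1) by simp
  have "h \<le> 36 * \<beta> / (\<zeta>^2 / 2)" unfolding h_def using d by (intro max.boundedI)
  then have "h * \<zeta>^2 \<le> 72 * \<beta>" using z2 by (simp add: field_simps)
  also have "72 * \<beta> = 1152 * \<rho> + 144 * (h * h)" unfolding \<beta>_def by (simp add: power2_eq_square)
  also have "144 * (h * h) \<le> 144 * (h * (\<zeta>^2 / 288))" using h by (intro mult_left_mono) auto
  finally have "h * \<zeta>^2 \<le> 2304 * \<rho>" by simp
  then have "h \<le> 2304 / \<zeta>^2 * \<rho>" using z2 by (simp add: field_simps)
  then show ?thesis using h by linarith
qed

end

section \<open>Triples of blocks in separated directions\<close>

text \<open>Values below \<open>S / (4 * n)\<close> add up to at most \<open>S / 4\<close> and no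
  value exceeds \<open>S / 16\<close>, so at least 12 indices are heavy. The smallest, the largest
  and a heavy index not adjacent to either have gaps of at least 2; such a gap between integer parts
  separates the slopes themselves.\<close>

lemma three_separated_heavy:
  fixes g :: "int \<Rightarrow> real"
  assumes fin: "finite Z" and n: "real (card Z) \<le> n" "0 < n" and S: "0 < S" "S \<le> (\<Sum>z\<in>Z. g z)"
    and small: "\<And>z. z \<in> Z \<Longrightarrow> g z \<le> S / 16"
  obtains z1 z2 z3 where "z1 \<in> Z" "z2 \<in> Z" "z3 \<in> Z" "2 \<le> \<bar>z1 - z2\<bar>" "2 \<le> \<bar>z1 - z3\<bar>" "2 \<le> \<bar>z2 - z3\<bar>"
    "S / (4 * n) \<le> g z1" "S / (4 * n) \<le> g z2" "S / (4 * n) \<le> g z3"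
proof -
  define H where "H = {z\<in>Z. S / (4 * n) \<le> g z}"
  have HZ: "H \<subseteq> Z" and finH: "finite H" unfolding H_def using fin by auto
  have "(\<Sum>z\<in>Z. g z) = (\<Sum>z\<in>Z - H. g z) + (\<Sum>z\<in>H. g z)" using sum.subset_diff[OF HZ fin] .
  also have "(\<Sum>z\<in>Z - H. g z) \<le> (\<Sum>z\<in>Z - H. S / (4 * n))" by (intro sum_mono) (auto simp: H_def)
  also have "\<dots> = real (card (Z - H)) * (S / (4 * n))" by simp
  also have "\<dots> \<le> n * (S / (4 * n))"
  proof (intro mult_right_mono)
    have "card (Z - H) \<le> card Z" using fin by (intro card_mono) auto
    then show "real (card (Z - H)) \<le> n" using n by linarith
  qed (use S n in simp)
  also have "n * (S / (4 * n)) = S / 4" using n by simp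
  also have "(\<Sum>z\<in>H. g z) \<le> (\<Sum>z\<in>H. S / 16)" using HZ small by (intro sum_mono) auto
  also have "\<dots> = real (card H) * (S / 16)" by simp
  finally have "S \<le> S / 4 + real (card H) * (S / 16)" using S(2) by linarith
  then have "S * 12 \<le> S * real (card H)" by (simp add: field_simps)
  then have "12 \<le> real (card H)" using S(1) by simp
  then have c12: "12 \<le> card H" by linarith
  then have ne: "H \<noteq> {}" by auto
  define a b where "a = Min H" and "b = Max H"
  have ab: "a \<in> H" "b \<in> H" "H \<subseteq> {a..b}" unfolding a_def b_def using ne finH by auto
  have "card H \<le> card {a..b}" using ab(3) by (intro card_mono) auto
  then have ba: "a + 11 \<le> b" using c12 by simp
  have "\<not> H \<subseteq> {a, a+1, b-1, b}"
  proof
    assume "H \<subseteq> {a, a+1, b-1, b}"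
    then have "card H \<le> card {a, a+1, b-1, b}" by (intro card_mono) auto
    also have "\<dots> \<le> 4" by (simp add: card_insert_if)
    finally show False using c12 by simp
  qed
  then obtain c where c: "c \<in> H" "c \<notin> {a, a+1, b-1, b}" by blast
  then have "a \<le> c" "c \<le> b" using ab(3) by auto
  then have "2 \<le> \<bar>a - c\<bar>" "2 \<le> \<bar>c - b\<bar>" "2 \<le> \<bar>a - b\<bar>" using c(2) ba by auto
  then show thesis using that[of a c b] ab c HZ unfolding H_def by auto
qed

lemma weight_pigeonhole:
  fixes w :: "'i \<Rightarrow> real"
  assumes "finite S" "finite T" "f ` S \<subseteq> T" "real (card T) \<le> n" "0 < n" "0 \<le> W" "W \<le> sum w S" "S \<noteq> {}"
  obtains t where "t \<in> T" "W / n \<le> sum w {x\<in>S. f x = t}"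
proof -
  have T: "T \<noteq> {}" using assms by auto
  have "\<exists>t\<in>T. W / n \<le> sum w {x\<in>S. f x = t}"
  proof (rule ccontr)
    assume "\<not> ?thesis"
    then have lt: "\<And>t. t \<in> T \<Longrightarrow> sum w {x\<in>S. f x = t} < W / n" by auto
    have "sum w S = (\<Sum>t\<in>T. sum w {x\<in>S. f x = t})" using sum.group[OF assms(1-3), of w] by simp
    also have "\<dots> < (\<Sum>t\<in>T. W / n)" using lt T assms(2) by (intro sum_strict_mono) auto
    also have "\<dots> = real (card T) * (W / n)" by simp
    also have "\<dots> \<le> n * (W / n)" using assms by (intro mult_right_mono) auto
    finally show False using assms by simp
  qed
  then show thesis using that by blast
qed

lemma sum_product3:
  fixes f g h :: "'b \<Rightarrow> real"
  shows "(\<Sum>a\<in>A. f a) * (\<Sum>b\<in>A. g b) * (\<Sum>c\<in>A. h c) = (\<Sum>a\<in>A. \<Sum>b\<in>A. \<Sum>c\<in>A. f a * g b * h c)"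
proof -
  have "(\<Sum>a\<in>A. f a) * (\<Sum>b\<in>A. g b) * (\<Sum>c\<in>A. h c) = (\<Sum>a\<in>A. f a * (\<Sum>b\<in>A. g b) * (\<Sum>c\<in>A. h c))"
    by (simp only: sum_distrib_right)
  also have "\<dots> = (\<Sum>a\<in>A. \<Sum>b\<in>A. f a * g b * (\<Sum>c\<in>A. h c))"
    by (intro sum.cong refl) (simp only: sum_distrib_left[of "f _" g] sum_distrib_right)
  also have "\<dots> = (\<Sum>a\<in>A. \<Sum>b\<in>A. \<Sum>c\<in>A. f a * g b * h c)"
    by (simp only: sum_distrib_left)
  finally show ?thesis .
qed

context tangency
begin

definition slice_nbrs :: "real \<Rightarrow> real \<Rightarrow> int \<Rightarrow> 'i \<Rightarrow> 'i set" where
  "slice_nbrs m \<zeta> z u = {a. (u,a) \<in> N \<and> precedes m a u \<and> \<lfloor>s u a / \<zeta>\<rfloor> = z}"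

lemma slice_nbrs_sub: "slice_nbrs m \<zeta> z u \<subseteq> I" unfolding slice_nbrs_def using N_sub by blast

text \<open>Let \<open>k\<close> be the coarsest level of the three blocks. By
  \<open>coarse_close\<close> the points that see all three lie within a multiple of
  \<open>1 / 2^k\<close> of each other, hence in a number of cells of level \<open>k\<close> that
  depends on \<zeta> only. Since \<open>u\<close> stops no later than its neighbours, its cell of
  level \<open>k\<close> is contained in its block, whose mass \<open>precedes_mass\<close> compares
  with that of \<open>B1\<close>.\<close>

lemma coarse_triple_mass:
  assumes P: "P \<subseteq> I" "\<And>u v. u \<in> P \<Longrightarrow> v \<in> P \<Longrightarrow> \<bar>X v - X u\<bar> \<le> \<zeta>^2 / 288 \<and> \<bar>Y v - Y u\<bar> \<le> \<zeta>^2 / 288 \<and> \<bar>R v - R u\<bar> \<le> \<zeta>^2 / 288"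
    and z: "2 \<le> \<bar>z1 - z2\<bar>" "2 \<le> \<bar>z1 - z3\<bar>" "2 \<le> \<bar>z2 - z3\<bar>"
    and \<zeta>: "0 < \<zeta>" "144 * \<delta> \<le> \<zeta>^2" and m: "0 < m"
  shows "wt {u\<in>P. B1 \<in> block m ` slice_nbrs m \<zeta> z1 u \<and> B2 \<in> block m ` slice_nbrs m \<zeta> z2 u \<and> B3 \<in> block m ` slice_nbrs m \<zeta> z3 u}
    \<le> (2 * (2304 / \<zeta>^2) + 5)^3 * max m (block_mass m B1)" (is "wt ?V \<le> ?C * ?b")
proof -
  define k where "k = min (fst B1) (min (fst B2) (fst B3))"
  have V: "?V \<subseteq> I" using P(1) by blast
  have finV: "finite ?V" by (rule finite_subset[OF V finI])
  have kL: "k \<le> L" if u: "u \<in> ?V" for u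
  proof -
    from u obtain a1 where "block m a1 = B1" by blast
    then have "fst B1 = stop_level m a1" unfolding block_def by auto
    then show ?thesis using stop_level_le[of m a1] unfolding k_def by simp
  qed
  have "wt ?V = (\<Sum>c\<in>cl k ` ?V. wt {u\<in>?V. cl k u = c})" unfolding wt_def by (rule sum.image_gen[OF finV])
  also have "\<dots> \<le> (\<Sum>c\<in>cl k ` ?V. ?b)"
  proof (intro sum_mono)
    fix c assume "c \<in> cl k ` ?V"
    then obtain u where u: "u \<in> ?V" "c = cl k u" by blast
    from u(1) obtain a1 a2 a3 where a: "a1 \<in> slice_nbrs m \<zeta> z1 u" "block m a1 = B1" "a2 \<in> slice_nbrs m \<zeta> z2 u" "block m a2 = B2" "a3 \<in> slice_nbrs m \<zeta> z3 u" "block m a3 = B3" by blast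
    have f: "fst B1 = stop_level m a1" "fst B2 = stop_level m a2" "fst B3 = stop_level m a3" using a unfolding block_def by auto
    have l: "precedes m a1 u" "precedes m a2 u" "precedes m a3 u" using a unfolding slice_nbrs_def by auto
    have "stop_level m u \<le> k" unfolding k_def f using precedes_stop_level[OF l(1)] precedes_stop_level[OF l(2)] precedes_stop_level[OF l(3)] by simp
    then have "wt {v\<in>?V. cl k v = c} \<le> wt {v\<in>I. cl (stop_level m u) v = cl (stop_level m u) u}"
      unfolding u(2) using V by (intro wt_mono) (auto intro: cl_mono)
    also have "\<dots> = cell_mass (stop_level m u) u" unfolding cell_mass_def ..
    also have "\<dots> \<le> max m (block_mass m (block m a1))" using precedes_mass[OF l(1)] u(1) P(1) by blast
    finally show "wt {v\<in>?V. cl k v = c} \<le> ?b" unfolding a(2) .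
  qed
  also have "\<dots> = real (card (cl k ` ?V)) * ?b" by simp
  also have "\<dots> \<le> ?C * ?b"
  proof (intro mult_right_mono)
    show "real (card (cl k ` ?V)) \<le> ?C"
    proof (cases "?V = {}")
      case True
      have "0 \<le> ?C" by simp
      moreover have "real (card (cl k ` ?V)) = 0" unfolding True by simp
      ultimately show ?thesis by linarith
    next
      case False
      then obtain u where u: "u \<in> ?V" by blast
      from u obtain a1 a2 a3 where a: "a1 \<in> slice_nbrs m \<zeta> z1 u" "block m a1 = B1" "a2 \<in> slice_nbrs m \<zeta> z2 u" "block m a2 = B2" "a3 \<in> slice_nbrs m \<zeta> z3 u" "block m a3 = B3" by blast
      have close: "\<bar>X v - X u\<bar> \<le> 2304 / \<zeta>^2 / 2^k \<and> \<bar>Y v - Y u\<bar> \<le> 2304 / \<zeta>^2 / 2^k \<and> \<bar>R v - R u\<bar> \<le> 2304 / \<zeta>^2 / 2^k" if v: "v \<in> ?V" for v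
      proof -
        from v obtain b1 b2 b3 where b: "b1 \<in> slice_nbrs m \<zeta> z1 v" "block m b1 = B1" "b2 \<in> slice_nbrs m \<zeta> z2 v" "block m b2 = B2" "b3 \<in> slice_nbrs m \<zeta> z3 v" "block m b3 = B3" by blast
        have bl: "\<bar>X b - X a\<bar> \<le> 1 / 2^k \<and> \<bar>Y b - Y a\<bar> \<le> 1 / 2^k \<and> \<bar>R b - R a\<bar> \<le> 1 / 2^k" if "block m b = block m a" "k \<le> fst (block m a)" for a b
        proof -
          have "cl (stop_level m a) b = cl (stop_level m a) a" using that(1) block_eq_iff by blast
          moreover have "k \<le> stop_level m a" using that(2) unfolding block_def by simp
          ultimately have "cl k b = cl k a" by (rule cl_mono)
          from dcell_eq_imp_close[OF this[unfolded cl_def]] show ?thesis by (intro conjI)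
        qed
        have kk: "k \<le> fst B1" "k \<le> fst B2" "k \<le> fst B3" unfolding k_def by auto
        have ab: "\<bar>X b - X a\<bar> \<le> 1 / 2^k \<and> \<bar>Y b - Y a\<bar> \<le> 1 / 2^k \<and> \<bar>R b - R a\<bar> \<le> 1 / 2^k" if "(a,b) \<in> {(a1,b1),(a2,b2),(a3,b3)}" for a b
          using that bl[of b1 a1] bl[of b2 a2] bl[of b3 a3] a b kk by auto
        have "(1::real) / 2^L \<le> 1 / 2^k" using kL[OF u] by (intro divide_left_mono) auto
        then have \<rho>: "\<delta> \<le> 1 / 2^k" "1 / 2^k \<le> (1::real)" using L1 by auto
        have "\<bar>X v - X u\<bar> \<le> 2304 / \<zeta>^2 * (1 / 2^k) \<and> \<bar>Y v - Y u\<bar> \<le> 2304 / \<zeta>^2 * (1 / 2^k) \<and> \<bar>R v - R u\<bar> \<le> 2304 / \<zeta>^2 * (1 / 2^k)"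
        proof (rule coarse_close[of u a1 a2 a3 v b1 b2 b3])
          show "\<And>a b. (a,b) \<in> {(a1,b1),(a2,b2),(a3,b3)} \<Longrightarrow> \<bar>X b - X a\<bar> \<le> 1 / 2^k \<and> \<bar>Y b - Y a\<bar> \<le> 1 / 2^k \<and> \<bar>R b - R a\<bar> \<le> 1 / 2^k" by (rule ab)
          show "\<bar>X v - X u\<bar> \<le> \<zeta>^2 / 288" "\<bar>Y v - Y u\<bar> \<le> \<zeta>^2 / 288" "\<bar>R v - R u\<bar> \<le> \<zeta>^2 / 288" using P(2)[of u v] u v by auto
        qed (use a b z \<zeta> \<rho> in \<open>auto simp: slice_nbrs_def\<close>)
        then show ?thesis by simp
      qed
      have "real (card (dcell k ` (\<lambda>u. (X u, Y u, R u)) ` ?V)) \<le> ?C"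
      proof (rule card_dcell_close[where ?x0.0="X u" and ?y0.0="Y u" and ?z0.0="R u"])
        show "finite ((\<lambda>u. (X u, Y u, R u)) ` ?V)" using finV by (rule finite_imageI)
        show "\<bar>x - X u\<bar> \<le> 2304 / \<zeta>^2 / 2^k \<and> \<bar>y - Y u\<bar> \<le> 2304 / \<zeta>^2 / 2^k \<and> \<bar>z - R u\<bar> \<le> 2304 / \<zeta>^2 / 2^k"
          if "(x,y,z) \<in> (\<lambda>u. (X u, Y u, R u)) ` ?V" for x y z
        proof -
          from that obtain v where "v \<in> ?V" "x = X v" "y = Y v" "z = R v" by blast
          then show ?thesis using close by blast
        qed
      qed simp
      moreover have "cl k ` ?V = dcell k ` (\<lambda>u. (X u, Y u, R u)) ` ?V" unfolding cl_def image_image ..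
      ultimately show ?thesis by (simp only:)
    qed
  qed (use m in auto)
  finally show ?thesis .
qed

text \<open>The product counts triples of blocks seen in the three directions. After exchanging the
  sums, two blocks are free, which gives \<open>n^2\<close>, and the sum of
  \<open>m + block_mass m B1\<close> over the first is at most \<open>n * m + 1\<close>. With
  \<open>n\<close> of order \<open>L / m\<close> the result is of order \<open>1 / m^2\<close>, up
  to powers of \<open>L\<close>, and not \<open>1 / m^3\<close>.\<close>

lemma coarse_product_sum:
  assumes P: "P \<subseteq> I" "\<And>u v. u \<in> P \<Longrightarrow> v \<in> P \<Longrightarrow> \<bar>X v - X u\<bar> \<le> \<zeta>^2 / 288 \<and> \<bar>Y v - Y u\<bar> \<le> \<zeta>^2 / 288 \<and> \<bar>R v - R u\<bar> \<le> \<zeta>^2 / 288"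
    and z: "2 \<le> \<bar>z1 - z2\<bar>" "2 \<le> \<bar>z1 - z3\<bar>" "2 \<le> \<bar>z2 - z3\<bar>"
    and \<zeta>: "0 < \<zeta>" "144 * \<delta> \<le> \<zeta>^2" and m: "0 < m"
  defines "K \<equiv> \<lambda>z u. real (card (block m ` slice_nbrs m \<zeta> z u))"
    and "n \<equiv> real (card (block m ` I))"
  shows "(\<Sum>u\<in>P. w u * (K z1 u * K z2 u * K z3 u)) \<le> (2 * (2304 / \<zeta>^2) + 5)^3 * n^2 * (n * m + 1)"
proof -
  let ?Q = "block m ` I" and ?C = "(2 * (2304 / \<zeta>^2) + 5)^3"
  define \<eta> where "\<eta> z u B = (of_bool (B \<in> block m ` slice_nbrs m \<zeta> z u) :: real)" for z u B
  have finQ: "finite ?Q" using finI by simp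
  have K: "K z u = (\<Sum>B\<in>?Q. \<eta> z u B)" for z u
  proof -
    have "block m ` slice_nbrs m \<zeta> z u \<subseteq> ?Q" using slice_nbrs_sub by (rule image_mono)
    then show ?thesis unfolding K_def \<eta>_def using finQ by (simp add: sum.If_cases of_bool_def Int_absorb1 Int_def[symmetric] Collect_mem_eq)
  qed
  have "(\<Sum>u\<in>P. w u * (K z1 u * K z2 u * K z3 u)) = (\<Sum>u\<in>P. \<Sum>B1\<in>?Q. \<Sum>B2\<in>?Q. \<Sum>B3\<in>?Q. w u * (\<eta> z1 u B1 * \<eta> z2 u B2 * \<eta> z3 u B3))"
    unfolding K unfolding sum_product3 unfolding sum_distrib_left ..
  also have "\<dots> = (\<Sum>B1\<in>?Q. \<Sum>u\<in>P. \<Sum>B2\<in>?Q. \<Sum>B3\<in>?Q. w u * (\<eta> z1 u B1 * \<eta> z2 u B2 * \<eta> z3 u B3))"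
    by (rule sum.swap)
  also have "\<dots> = (\<Sum>B1\<in>?Q. \<Sum>B2\<in>?Q. \<Sum>u\<in>P. \<Sum>B3\<in>?Q. w u * (\<eta> z1 u B1 * \<eta> z2 u B2 * \<eta> z3 u B3))"
    by (intro sum.cong refl sum.swap)
  also have "\<dots> = (\<Sum>B1\<in>?Q. \<Sum>B2\<in>?Q. \<Sum>B3\<in>?Q. \<Sum>u\<in>P. w u * (\<eta> z1 u B1 * \<eta> z2 u B2 * \<eta> z3 u B3))"
    by (intro sum.cong refl sum.swap)
  also have "\<dots> \<le> (\<Sum>B1\<in>?Q. \<Sum>B2\<in>?Q. \<Sum>B3\<in>?Q. ?C * (m + block_mass m B1))"
  proof (intro sum_mono)
    fix B1 B2 B3
    let ?V = "{u\<in>P. B1 \<in> block m ` slice_nbrs m \<zeta> z1 u \<and> B2 \<in> block m ` slice_nbrs m \<zeta> z2 u \<and> B3 \<in> block m ` slice_nbrs m \<zeta> z3 u}"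
    have "(\<Sum>u\<in>P. w u * (\<eta> z1 u B1 * \<eta> z2 u B2 * \<eta> z3 u B3)) = wt ?V"
      unfolding wt_def \<eta>_def using finite_subset[OF P(1) finI]
      by (subst sum.inter_filter) (auto intro!: sum.cong)
    also have "\<dots> \<le> ?C * max m (block_mass m B1)" by (rule coarse_triple_mass[OF P z \<zeta> m])
    also have "\<dots> \<le> ?C * (m + block_mass m B1)" using m block_mass_nonneg by (intro mult_left_mono) auto
    finally show "(\<Sum>u\<in>P. w u * (\<eta> z1 u B1 * \<eta> z2 u B2 * \<eta> z3 u B3)) \<le> ?C * (m + block_mass m B1)" .
  qed
  also have "\<dots> = ?C * n^2 * (\<Sum>B1\<in>?Q. m + block_mass m B1)"
    unfolding n_def by (simp only: sum_constant sum_distrib_left power2_eq_square mult.assoc mult.left_commute)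
  also have "(\<Sum>B1\<in>?Q. m + block_mass m B1) = n * m + sum (block_mass m) ?Q" unfolding n_def by (simp only: sum.distrib sum_constant)
  also have "?C * n^2 * (n * m + sum (block_mass m) ?Q) \<le> ?C * n^2 * (n * m + 1)"
    using sum_block_mass[of m] by (intro mult_left_mono) auto
  finally show ?thesis .
qed

end

section \<open>Triples of neighbours inside one block\<close>

lemma sum_mult_of_bool:
  fixes f :: "'a \<Rightarrow> real"
  assumes "finite A"
  shows "(\<Sum>x\<in>A. f x * of_bool (P x)) = sum f {x\<in>A. P x}"
  unfolding sum.inter_filter[OF assms] by (intro sum.cong) auto

context tangency
begin

definition far3 :: "'i \<Rightarrow> 'i \<Rightarrow> 'i \<Rightarrow> bool" where
  "far3 a b c \<longleftrightarrow> 2000 * \<delta> < \<bar>Q a b\<bar> \<and> 2000 * \<delta> < \<bar>Q a c\<bar> \<and> 2000 * \<delta> < \<bar>Q b c\<bar>"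

text \<open>Quadruples are counted from the side of \<open>a\<close>, \<open>b\<close> and
  \<open>c\<close>: a separated triple has common neighbours of mass at most
  \<open>2 * M\<close>.\<close>

lemma fine_triple_sum:
  assumes J: "J \<subseteq> I"
  shows "(\<Sum>u\<in>I. w u * (\<Sum>a\<in>J. \<Sum>b\<in>J. \<Sum>c\<in>J. w a * w b * w c * of_bool (far3 a b c \<and> (u,a) \<in> N \<and> (u,b) \<in> N \<and> (u,c) \<in> N)))
    \<le> 2 * M * (wt J)^3"
proof -
  define \<eta> where "\<eta> u a b c = (of_bool (far3 a b c \<and> (u,a) \<in> N \<and> (u,b) \<in> N \<and> (u,c) \<in> N) :: real)" for u a b c
  have "(\<Sum>u\<in>I. w u * (\<Sum>a\<in>J. \<Sum>b\<in>J. \<Sum>c\<in>J. w a * w b * w c * \<eta> u a b c))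
      = (\<Sum>u\<in>I. \<Sum>a\<in>J. \<Sum>b\<in>J. \<Sum>c\<in>J. w u * (w a * w b * w c * \<eta> u a b c))"
    by (simp only: sum_distrib_left)
  also have "\<dots> = (\<Sum>a\<in>J. \<Sum>u\<in>I. \<Sum>b\<in>J. \<Sum>c\<in>J. w u * (w a * w b * w c * \<eta> u a b c))"
    by (rule sum.swap)
  also have "\<dots> = (\<Sum>a\<in>J. \<Sum>b\<in>J. \<Sum>u\<in>I. \<Sum>c\<in>J. w u * (w a * w b * w c * \<eta> u a b c))"
    by (intro sum.cong refl sum.swap)
  also have "\<dots> = (\<Sum>a\<in>J. \<Sum>b\<in>J. \<Sum>c\<in>J. \<Sum>u\<in>I. w u * (w a * w b * w c * \<eta> u a b c))"
    by (intro sum.cong refl sum.swap)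
  also have "\<dots> \<le> (\<Sum>a\<in>J. \<Sum>b\<in>J. \<Sum>c\<in>J. w a * w b * w c * (2 * M))"
  proof (intro sum_mono)
    fix a b c assume abc: "a \<in> J" "b \<in> J" "c \<in> J"
    have wn: "0 \<le> w a * w b * w c" using abc J w_nonneg by (intro mult_nonneg_nonneg) auto
    have "(\<Sum>u\<in>I. w u * (w a * w b * w c * \<eta> u a b c)) = w a * w b * w c * (\<Sum>u\<in>I. w u * \<eta> u a b c)"
      by (simp add: sum_distrib_left algebra_simps)
    also have "\<dots> \<le> w a * w b * w c * (2 * M)"
    proof (rule mult_left_mono[OF _ wn])
      show "(\<Sum>u\<in>I. w u * \<eta> u a b c) \<le> 2 * M"
      proof (cases "far3 a b c")
        case True
        have "(\<Sum>u\<in>I. w u * \<eta> u a b c) = wt {u\<in>I. (u,a) \<in> N \<and> (u,b) \<in> N \<and> (u,c) \<in> N}"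
          unfolding wt_def \<eta>_def using True by (simp add: sum_mult_of_bool[OF finI])
        also have "{u\<in>I. (u,a) \<in> N \<and> (u,b) \<in> N \<and> (u,c) \<in> N} = {u. (u,a) \<in> N \<and> (u,b) \<in> N \<and> (u,c) \<in> N}" using N_sub by blast
        also have "wt {u. (u,a) \<in> N \<and> (u,b) \<in> N \<and> (u,c) \<in> N} \<le> 2 * M" using True unfolding far3_def by (intro common_neighbours_mass) auto
        finally show ?thesis .
      next
        case False
        then show ?thesis using M_pos by (simp add: \<eta>_def)
      qed
    qed
    finally show "(\<Sum>u\<in>I. w u * (w a * w b * w c * \<eta> u a b c)) \<le> w a * w b * w c * (2 * M)" .
  qed
  also have "\<dots> = 2 * M * (\<Sum>a\<in>J. \<Sum>b\<in>J. \<Sum>c\<in>J. w a * w b * w c)"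
    unfolding sum_distrib_left by (simp only: mult_ac)
  also have "\<dots> = 2 * M * (wt J)^3" unfolding sum_product3[symmetric] wt_def by (simp only: power3_eq_cube)
  finally show ?thesis unfolding \<eta>_def .
qed

text \<open>Counted from \<open>u\<close>, the triples with a close pair have weight at most
  \<open>3 * M * (wt S)^2\<close>, since the neighbours close to a given one lie in a plank. For
  \<open>8 * M \<le> wt S\<close> this is at most 3/8 of the weight of all triples.\<close>

lemma fine_triple_lower:
  assumes S: "S \<subseteq> {a\<in>J. (u,a) \<in> N}" and J: "J \<subseteq> I" and big: "8 * M \<le> wt S"
  shows "(wt S)^3 \<le> 2 * (\<Sum>a\<in>J. \<Sum>b\<in>J. \<Sum>c\<in>J. w a * w b * w c * of_bool (far3 a b c \<and> (u,a) \<in> N \<and> (u,b) \<in> N \<and> (u,c) \<in> N))"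
proof -
  define nr where "nr a b = (of_bool (\<bar>Q a b\<bar> \<le> 2000 * \<delta>) :: real)" for a b
  have SI: "S \<subseteq> I" "S \<subseteq> J" using S J by auto
  have finJ: "finite J" "finite S" using finite_subset[OF J finI] finite_subset[OF SI(1) finI] by auto
  have w0: "0 \<le> w a" if "a \<in> J" for a using that J w_nonneg by blast
  have nrM: "(\<Sum>b\<in>S. w b * nr a b) \<le> M" if "a \<in> S" for a
  proof -
    have "(\<Sum>b\<in>S. w b * nr a b) = wt {b\<in>S. \<bar>Q a b\<bar> \<le> 2000 * \<delta>}"
      unfolding wt_def nr_def by (rule sum_mult_of_bool[OF finJ(2)])
    also have "\<dots> \<le> wt {b. (u,b) \<in> N \<and> \<bar>Q a b\<bar> \<le> 2000 * \<delta>}" using S by (intro wt_mono nb_sub) auto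
    also have "\<dots> \<le> M" unfolding wt_def using S that by (intro plank) auto
    finally show ?thesis .
  qed
  have W: "0 \<le> wt S" by (rule wt_nonneg[OF SI(1)])
  have s12: "(\<Sum>a\<in>S. \<Sum>b\<in>S. w a * w b * nr a b) \<le> wt S * M"
  proof -
    have "(\<Sum>a\<in>S. \<Sum>b\<in>S. w a * w b * nr a b) = (\<Sum>a\<in>S. w a * (\<Sum>b\<in>S. w b * nr a b))" by (simp only: sum_distrib_left mult.assoc)
    also have "\<dots> \<le> (\<Sum>a\<in>S. w a * M)" using nrM w0 SI by (intro sum_mono mult_left_mono) auto
    also have "\<dots> = wt S * M" unfolding wt_def by (simp only: sum_distrib_right)
    finally show ?thesis .
  qed
  have e1: "(\<Sum>a\<in>S. \<Sum>b\<in>S. \<Sum>c\<in>S. w a * w b * w c * nr a b) = (\<Sum>a\<in>S. \<Sum>b\<in>S. w a * w b * nr a b) * wt S"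
  proof -
    have "(\<Sum>c\<in>S. w a * w b * w c * nr a b) = w a * w b * nr a b * wt S" for a b
      unfolding wt_def sum_distrib_left by (simp only: mult_ac)
    then show ?thesis by (simp only: sum_distrib_right)
  qed
  have e2: "(\<Sum>a\<in>S. \<Sum>b\<in>S. \<Sum>c\<in>S. w a * w b * w c * nr a c) = (\<Sum>a\<in>S. \<Sum>c\<in>S. w a * w c * nr a c) * wt S"
  proof -
    have "(\<Sum>a\<in>S. \<Sum>b\<in>S. \<Sum>c\<in>S. w a * w b * w c * nr a c) = (\<Sum>a\<in>S. \<Sum>c\<in>S. \<Sum>b\<in>S. w a * w b * w c * nr a c)"
      by (intro sum.cong refl sum.swap)
    moreover have "(\<Sum>b\<in>S. w a * w b * w c * nr a c) = w a * w c * nr a c * wt S" for a c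
      unfolding wt_def sum_distrib_left by (simp only: mult_ac)
    ultimately show ?thesis by (simp only: sum_distrib_right)
  qed
  have e3: "(\<Sum>a\<in>S. \<Sum>b\<in>S. \<Sum>c\<in>S. w a * w b * w c * nr b c) = wt S * (\<Sum>b\<in>S. \<Sum>c\<in>S. w b * w c * nr b c)"
  proof -
    have "(\<Sum>b\<in>S. \<Sum>c\<in>S. w a * w b * w c * nr b c) = w a * (\<Sum>b\<in>S. \<Sum>c\<in>S. w b * w c * nr b c)" for a
      unfolding sum_distrib_left by (simp only: mult.assoc)
    then show ?thesis unfolding wt_def by (simp only: sum_distrib_right)
  qed
  have e0: "(\<Sum>a\<in>S. \<Sum>b\<in>S. \<Sum>c\<in>S. w a * w b * w c) = (wt S)^3"
    unfolding sum_product3[symmetric] wt_def by (simp only: power3_eq_cube)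
  have "(\<Sum>a\<in>S. \<Sum>b\<in>S. \<Sum>c\<in>S. w a * w b * w c) - (\<Sum>a\<in>S. \<Sum>b\<in>S. \<Sum>c\<in>S. w a * w b * w c * nr a b)
      - (\<Sum>a\<in>S. \<Sum>b\<in>S. \<Sum>c\<in>S. w a * w b * w c * nr a c) - (\<Sum>a\<in>S. \<Sum>b\<in>S. \<Sum>c\<in>S. w a * w b * w c * nr b c)
     = (\<Sum>a\<in>S. \<Sum>b\<in>S. \<Sum>c\<in>S. w a * w b * w c - w a * w b * w c * nr a b - w a * w b * w c * nr a c - w a * w b * w c * nr b c)"
    by (simp only: sum_subtractf)
  also have "\<dots> \<le> (\<Sum>a\<in>S. \<Sum>b\<in>S. \<Sum>c\<in>S. w a * w b * w c * of_bool (far3 a b c \<and> (u,a) \<in> N \<and> (u,b) \<in> N \<and> (u,c) \<in> N))"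
  proof (intro sum_mono)
    fix a b c assume abc: "a \<in> S" "b \<in> S" "c \<in> S"
    then have N: "(u,a) \<in> N" "(u,b) \<in> N" "(u,c) \<in> N" using S by auto
    have wn: "0 \<le> w a * w b * w c" using abc SI w0 by (intro mult_nonneg_nonneg) auto
    have "1 - nr a b - nr a c - nr b c \<le> of_bool (far3 a b c \<and> (u,a) \<in> N \<and> (u,b) \<in> N \<and> (u,c) \<in> N)"
      unfolding nr_def far3_def using N by auto
    from mult_left_mono[OF this wn]
    show "w a * w b * w c - w a * w b * w c * nr a b - w a * w b * w c * nr a c - w a * w b * w c * nr b c
      \<le> w a * w b * w c * of_bool (far3 a b c \<and> (u,a) \<in> N \<and> (u,b) \<in> N \<and> (u,c) \<in> N)" by (simp only: right_diff_distrib mult_1_right)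
  qed
  also have "\<dots> \<le> (\<Sum>a\<in>J. \<Sum>b\<in>J. \<Sum>c\<in>J. w a * w b * w c * of_bool (far3 a b c \<and> (u,a) \<in> N \<and> (u,b) \<in> N \<and> (u,c) \<in> N))" (is "_ \<le> ?T")
  proof -
    have nn: "0 \<le> w a * w b * w c * of_bool P" if "a \<in> J" "b \<in> J" "c \<in> J" for a b c P
      using that w0 by (intro mult_nonneg_nonneg) auto
    have "(\<Sum>a\<in>S. \<Sum>b\<in>S. \<Sum>c\<in>S. w a * w b * w c * of_bool (far3 a b c \<and> (u,a) \<in> N \<and> (u,b) \<in> N \<and> (u,c) \<in> N))
      \<le> (\<Sum>a\<in>S. \<Sum>b\<in>J. \<Sum>c\<in>J. w a * w b * w c * of_bool (far3 a b c \<and> (u,a) \<in> N \<and> (u,b) \<in> N \<and> (u,c) \<in> N))"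
      using nn SI(2) by (intro sum_mono order_trans[OF sum_mono[OF sum_mono2[OF finJ(1) SI(2)]] sum_mono2[OF finJ(1) SI(2)]] sum_nonneg) blast+
    also have "\<dots> \<le> ?T" using nn by (intro sum_mono2[OF finJ(1) SI(2)] sum_nonneg) blast+
    finally show ?thesis .
  qed
  finally have "(wt S)^3 - wt S * M * wt S - wt S * M * wt S - wt S * (wt S * M) \<le> ?T"
    unfolding e0 e1 e2 e3 using s12 mult_right_mono[OF s12 W] mult_left_mono[OF s12 W] by linarith
  moreover define y where "y = M * (wt S * wt S)"
  have "wt S * M * wt S = y" "wt S * (wt S * M) = y" unfolding y_def by (simp_all only: mult_ac)
  moreover have "8 * M * (wt S * wt S) \<le> wt S * (wt S * wt S)" using big W by (intro mult_right_mono) auto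
  then have "8 * y \<le> (wt S)^3" unfolding y_def power3_eq_cube by (simp only: mult_ac)
  moreover have "0 \<le> (wt S)^3" using W by simp
  ultimately show ?thesis by linarith
qed

text \<open>On the difference of two points of a cell of side \<open>1 / 2^L\<close> the form is at
  most \<open>2 * (1 / 2^L)^2\<close>, which is of order \<delta> in whatever direction the
  difference points. So the neighbours of \<open>u\<close> in the cell lie in one plank.\<close>

lemma bottom_block_mass:
  assumes "stop_level m b = L"
  shows "wt {a. (u,a) \<in> N \<and> block m a = block m b} \<le> M"
proof (cases "\<exists>a. (u,a) \<in> N \<and> block m a = block m b")
  case True
  then obtain a where a: "(u,a) \<in> N" "block m a = block m b" by blast
  have "{a'. (u,a') \<in> N \<and> block m a' = block m b} \<subseteq> {a'. (u,a') \<in> N \<and> \<bar>Q a a'\<bar> \<le> 2000 * \<delta>}"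
  proof safe
    fix a' assume a': "(u,a') \<in> N" "block m a' = block m b"
    have "cl L a = cl L a'" using a(2) a'(2) assms unfolding block_eq_iff by simp
    from dcell_eq_imp_close[OF this[unfolded cl_def]]
    have "\<bar>Q a a'\<bar> \<le> 2 * (1 / 2^L)^2" unfolding qd_def by (rule mink_le)
    also have "\<dots> \<le> 3 * (1 / 2^L)^2" by (intro mult_right_mono) auto
    finally show "\<bar>Q a a'\<bar> \<le> 2000 * \<delta>" using L2 by linarith
  qed
  then have "wt {a'. (u,a') \<in> N \<and> block m a' = block m b} \<le> wt {a'. (u,a') \<in> N \<and> \<bar>Q a a'\<bar> \<le> 2000 * \<delta>}" by (intro wt_mono nb_sub)
  also have "\<dots> \<le> M" unfolding wt_def by (rule plank[OF a(1)])
  finally show ?thesis .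
next
  case False
  then have "{a. (u,a) \<in> N \<and> block m a = block m b} = {}" by blast
  then show ?thesis using M_pos by (simp only: wt_def sum.empty)
qed

text \<open>A piece heavier than \<open>8 * M\<close> cannot belong to a block heavier than
  \<open>m\<close>, which would be a bottom block and show at most \<open>M\<close>. For each
  remaining block the two ways of counting triples give \<open>4 * M * (block_mass m B)^3\<close>,
  and the block masses add up to at most 1.\<close>

lemma fine_cube_sum:
  assumes x: "8 * M \<le> x" and m: "0 < m" and P: "P \<subseteq> I"
    and A: "\<And>u. A u \<subseteq> {a. (u,a) \<in> N}"
  shows "(\<Sum>u\<in>P. w u * (\<Sum>B\<in>block m ` I. if x < wt {a\<in>A u. block m a = B} then (wt {a\<in>A u. block m a = B})^3 else 0)) \<le> 4 * M * m^2"
proof -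
  let ?Q = "block m ` I" and ?J = "\<lambda>B. {a\<in>I. block m a = B}"
  define T where "T u B = (\<Sum>a\<in>?J B. \<Sum>b\<in>?J B. \<Sum>c\<in>?J B. w a * w b * w c * of_bool (far3 a b c \<and> (u,a) \<in> N \<and> (u,b) \<in> N \<and> (u,c) \<in> N))" for u B
  have T0: "0 \<le> T u B" for u B unfolding T_def using w_nonneg by (intro sum_nonneg mult_nonneg_nonneg) auto
  let ?Qm = "{B\<in>?Q. block_mass m B \<le> m}"
  have finQ: "finite ?Q" using finI by simp
  have fP: "finite P" using finite_subset[OF P finI] .
  have pt: "(if x < wt {a\<in>A u. block m a = B} then (wt {a\<in>A u. block m a = B})^3 else 0) \<le> (if block_mass m B \<le> m then 2 * T u B else 0)" if B: "B \<in> ?Q" for u B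
  proof (cases "x < wt {a\<in>A u. block m a = B}")
    case True
    have S: "{a\<in>A u. block m a = B} \<subseteq> {a\<in>?J B. (u,a) \<in> N}" using A[of u] N_sub by blast
    have "(wt {a\<in>A u. block m a = B})^3 \<le> 2 * T u B" unfolding T_def
      by (rule fine_triple_lower[OF S]) (use True x in auto)
    moreover have "block_mass m B \<le> m"
    proof (rule ccontr)
      assume nm: "\<not> block_mass m B \<le> m"
      from B obtain b where b: "B = block m b" by blast
      then have "stop_level m b = L" using nm stop_level_cases[of m b] unfolding b block_mass_block by auto
      from bottom_block_mass[OF this, of u] have "wt {a. (u,a) \<in> N \<and> block m a = B} \<le> M" unfolding b .
      moreover have "wt {a\<in>A u. block m a = B} \<le> wt {a. (u,a) \<in> N \<and> block m a = B}" using A[of u] by (intro wt_mono nb_sub) blast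
      ultimately show False using True x M_pos by linarith
    qed
    ultimately show ?thesis using True by simp
  next
    case False
    then show ?thesis using T0 by simp
  qed
  have "(\<Sum>u\<in>P. w u * (\<Sum>B\<in>?Q. if x < wt {a\<in>A u. block m a = B} then (wt {a\<in>A u. block m a = B})^3 else 0))
      \<le> (\<Sum>u\<in>P. w u * (\<Sum>B\<in>?Q. if block_mass m B \<le> m then 2 * T u B else 0))"
    using P w_nonneg by (intro sum_mono mult_left_mono pt) auto
  also have "\<dots> = (\<Sum>u\<in>P. w u * (\<Sum>B\<in>?Qm. 2 * T u B))" using finQ by (simp only: sum.inter_filter)
  also have "\<dots> = (\<Sum>u\<in>P. \<Sum>B\<in>?Qm. 2 * (w u * T u B))" by (simp only: sum_distrib_left mult.left_commute)
  also have "\<dots> = (\<Sum>B\<in>?Qm. \<Sum>u\<in>P. 2 * (w u * T u B))" by (rule sum.swap)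
  also have "\<dots> \<le> (\<Sum>B\<in>?Qm. 4 * M * m^2 * block_mass m B)"
  proof (intro sum_mono)
    fix B assume B: "B \<in> ?Qm"
    have "(\<Sum>u\<in>P. 2 * (w u * T u B)) \<le> (\<Sum>u\<in>I. 2 * (w u * T u B))" using P finI T0 w_nonneg by (intro sum_mono2) auto
    also have "\<dots> = 2 * (\<Sum>u\<in>I. w u * T u B)" by (simp only: sum_distrib_left)
    also have "\<dots> \<le> 2 * (2 * M * (wt (?J B))^3)" unfolding T_def by (intro mult_left_mono fine_triple_sum) auto
    also have "(wt (?J B))^3 = (block_mass m B)^2 * block_mass m B" unfolding block_mass_def by (simp add: power3_eq_cube power2_eq_square)
    also have "2 * (2 * M * ((block_mass m B)^2 * block_mass m B)) \<le> 2 * (2 * M * (m^2 * block_mass m B))"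
      using B block_mass_nonneg[of m B] M_pos by (intro mult_left_mono mult_right_mono power_mono) auto
    finally show "(\<Sum>u\<in>P. 2 * (w u * T u B)) \<le> 4 * M * m^2 * block_mass m B" by simp
  qed
  also have "\<dots> = 4 * M * m^2 * (\<Sum>B\<in>?Qm. block_mass m B)" by (simp only: sum_distrib_left)
  also have "\<dots> \<le> 4 * M * m^2 * 1"
  proof (intro mult_left_mono)
    have "(\<Sum>B\<in>?Qm. block_mass m B) \<le> sum (block_mass m) ?Q" using finQ block_mass_nonneg by (intro sum_mono2) auto
    then show "(\<Sum>B\<in>?Qm. block_mass m B) \<le> 1" using sum_block_mass[of m] by linarith
  qed (use M_pos in auto)
  finally show ?thesis by simp
qed

end

section \<open>Rich points and the bound on the mass of a plank\<close>

lemma pow2_between: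
  fixes x :: real
  assumes "1 \<le> x"
  obtains k where "x \<le> 2^k" "2^k \<le> 2 * x"
proof -
  define k where "k = (LEAST k. x \<le> 2^k)"
  obtain n where "x < 2^n" using real_arch_pow[of 2 x] by auto
  then have k: "x \<le> 2^k" unfolding k_def by (intro LeastI[of "\<lambda>k. x \<le> 2^k" n]) simp
  have "2^k \<le> 2 * x"
  proof (cases k)
    case 0
    then show ?thesis using assms by simp
  next
    case (Suc j)
    then have "j < k" by simp
    then have "\<not> x \<le> 2^j" unfolding k_def by (rule not_less_Least)
    then show ?thesis unfolding Suc by simp
  qed
  with k show thesis by (rule that)
qed

context tangency
begin

lemma N_mass_swap:
  "(\<Sum>u\<in>I. w u * wt {a. (u,a) \<in> N \<and> P u a}) = (\<Sum>u\<in>I. \<Sum>a\<in>I. w u * (w a * of_bool ((u,a) \<in> N \<and> P u a)))"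
proof -
  have "wt {a. (u,a) \<in> N \<and> P u a} = (\<Sum>a\<in>I. w a * of_bool ((u,a) \<in> N \<and> P u a))" for u
  proof -
    have "{a. (u,a) \<in> N \<and> P u a} = {a\<in>I. (u,a) \<in> N \<and> P u a}" using N_sub by blast
    then show ?thesis unfolding wt_def by (simp only: sum_mult_of_bool[OF finI])
  qed
  then show ?thesis by (simp only: sum_distrib_left)
qed

text \<open>Every edge is kept from at least one of its ends, and exchanging the ends does not
  change the sum.\<close>

lemma half_mass:
  "(\<Sum>u\<in>I. w u * wt {a. (u,a) \<in> N}) \<le> 2 * (\<Sum>u\<in>I. w u * wt {a. (u,a) \<in> N \<and> precedes m a u})"
proof -
  let ?F = "\<lambda>P. \<Sum>u\<in>I. \<Sum>a\<in>I. w u * (w a * of_bool ((u,a) \<in> N \<and> P u a))"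
  have "?F (\<lambda>u a. True) \<le> (\<Sum>u\<in>I. \<Sum>a\<in>I. w u * (w a * of_bool ((u,a) \<in> N \<and> precedes m a u)) + w u * (w a * of_bool ((u,a) \<in> N \<and> precedes m u a)))"
  proof (intro sum_mono)
    fix u a assume "u \<in> I" "a \<in> I"
    then have "0 \<le> w u" "0 \<le> w a" using w_nonneg by auto
    then show "w u * (w a * of_bool ((u,a) \<in> N \<and> True)) \<le> w u * (w a * of_bool ((u,a) \<in> N \<and> precedes m a u)) + w u * (w a * of_bool ((u,a) \<in> N \<and> precedes m u a))"
      using precedes_total[of m a u] by auto
  qed
  also have "\<dots> = ?F (\<lambda>u a. precedes m a u) + ?F (\<lambda>u a. precedes m u a)" by (simp only: sum.distrib)
  also have "?F (\<lambda>u a. precedes m u a) = ?F (\<lambda>u a. precedes m a u)"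
  proof -
    have "?F (\<lambda>u a. precedes m u a) = (\<Sum>a\<in>I. \<Sum>u\<in>I. w u * (w a * of_bool ((u,a) \<in> N \<and> precedes m u a)))" by (rule sum.swap)
    also have "\<dots> = ?F (\<lambda>u a. precedes m a u)"
    proof (intro sum.cong refl)
      fix a u
      have "((u,a) \<in> N) = ((a,u) \<in> N)" using N_sym by blast
      then show "w u * (w a * of_bool ((u,a) \<in> N \<and> precedes m u a)) = w a * (w u * of_bool ((a,u) \<in> N \<and> precedes m u a))"
        by (simp only: mult.left_commute)
    qed
    finally show ?thesis .
  qed
  finally show ?thesis using N_mass_swap[of "\<lambda>u a. True"] N_mass_swap[of "\<lambda>u a. precedes m a u"] by simp
qed

lemma sum_wt_le: "P \<subseteq> I \<Longrightarrow> (\<And>u. u \<in> P \<Longrightarrow> f u \<le> c) \<Longrightarrow> (\<Sum>u\<in>P. w u * f u) \<le> wt P * c"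
  unfolding wt_def sum_distrib_right using w_nonneg by (intro sum_mono mult_left_mono) auto

lemma sum_wt_ge: "P \<subseteq> I \<Longrightarrow> (\<And>u. u \<in> P \<Longrightarrow> c \<le> f u) \<Longrightarrow> wt P * c \<le> (\<Sum>u\<in>P. w u * f u)"
  unfolding wt_def sum_distrib_right using w_nonneg by (intro sum_mono mult_left_mono) auto

text \<open>By \<open>nb_mass\<close> no point contributes more than five times
  \<open>M / sqrt \<delta>\<close>, so an average of at least \<open>1 / A\<close> times this value
  cannot come from a set of small mass.\<close>

lemma rich_points:
  assumes A: "1 \<le> A" and tot: "M / sqrt \<delta> / A \<le> (\<Sum>u\<in>I. w u * wt {a. (u,a) \<in> N})"
  shows "1 / (20 * A) \<le> wt {u\<in>I. M / sqrt \<delta> / A / 4 \<le> wt {a. (u,a) \<in> N \<and> precedes m a u}}"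
proof -
  define T where "T = M / sqrt \<delta>"
  define q where "q = T / A / 4"
  define f where "f u = wt {a. (u,a) \<in> N \<and> precedes m a u}" for u
  let ?P = "{u\<in>I. q \<le> f u}"
  have T: "0 < T" unfolding T_def using M_pos \<delta>_pos by simp
  have q: "0 < q" "T / A = 4 * q" unfolding q_def using T A by auto
  have "f u \<le> 5 * T" for u
  proof -
    have "f u \<le> wt {a. (u,a) \<in> N}" unfolding f_def using nb_sub[of u "\<lambda>_. True"] by (intro wt_mono) auto
    then show ?thesis using nb_mass[of u] unfolding T_def by simp
  qed
  then have 1: "(\<Sum>u\<in>?P. w u * f u) \<le> wt ?P * (5 * T)" by (intro sum_wt_le) auto
  have "(\<Sum>u\<in>I - ?P. w u * f u) \<le> wt (I - ?P) * q" by (intro sum_wt_le) auto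
  also have "\<dots> \<le> 1 * q" using wt_le1[of "I - ?P"] q by (intro mult_right_mono) auto
  finally have 2: "(\<Sum>u\<in>I - ?P. w u * f u) \<le> q" by simp
  have 3: "(\<Sum>u\<in>I. w u * f u) = (\<Sum>u\<in>I - ?P. w u * f u) + (\<Sum>u\<in>?P. w u * f u)" using finI by (intro sum.subset_diff) auto
  have "T / A \<le> 2 * (\<Sum>u\<in>I. w u * f u)" using tot half_mass[of m] unfolding T_def f_def by linarith
  then have "4 * q \<le> 2 * q + 2 * (wt ?P * (5 * T))" using 1 2 3 q(2) by linarith
  then have "q \<le> 5 * T * wt ?P" by simp
  then have "T * (1 / (20 * A)) \<le> T * wt ?P" using A T unfolding q_def by (simp add: field_simps)
  then have "1 / (20 * A) \<le> wt ?P" using mult_le_cancel_left_pos[OF T] by blast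
  then show ?thesis unfolding T_def f_def q_def .
qed

text \<open>The width \<zeta> makes every slice small: with \<open>T = M / sqrt \<delta>\<close> the
  hypothesis provides mass \<open>S = 32 * \<zeta> * T\<close>, and a slice has mass at most
  \<open>2 * \<zeta> * T\<close>, which is the \<open>S / 16\<close> of
  \<open>three_separated_heavy\<close>. There are at most \<open>3 / \<zeta>\<close> slices.\<close>

lemma three_slices:
  assumes A: "1 \<le> A" and \<zeta>: "\<zeta> = 1 / (128 * A)" and d: "12 * sqrt \<delta> \<le> \<zeta>"
    and u: "M / sqrt \<delta> / A / 4 \<le> wt {a. (u,a) \<in> N \<and> precedes m a u}"
  obtains z1 z2 z3 where "2 \<le> \<bar>z1 - z2\<bar>" "2 \<le> \<bar>z1 - z3\<bar>" "2 \<le> \<bar>z2 - z3\<bar>"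
    "z1 \<in> {- \<lceil>11/10 / \<zeta>\<rceil> .. \<lceil>11/10 / \<zeta>\<rceil>}" "z2 \<in> {- \<lceil>11/10 / \<zeta>\<rceil> .. \<lceil>11/10 / \<zeta>\<rceil>}" "z3 \<in> {- \<lceil>11/10 / \<zeta>\<rceil> .. \<lceil>11/10 / \<zeta>\<rceil>}"
    "2 * \<zeta>^2 * (M / sqrt \<delta>) \<le> wt (slice_nbrs m \<zeta> z1 u)" "2 * \<zeta>^2 * (M / sqrt \<delta>) \<le> wt (slice_nbrs m \<zeta> z2 u)" "2 * \<zeta>^2 * (M / sqrt \<delta>) \<le> wt (slice_nbrs m \<zeta> z3 u)"
proof -
  define T where "T = M / sqrt \<delta>"
  have sd: "0 < sqrt \<delta>" using \<delta>_pos by simp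
  have T: "0 < T" "M = T * sqrt \<delta>" unfolding T_def using M_pos \<delta>_pos by simp_all
  have \<zeta>0: "0 < \<zeta>" "\<zeta> \<le> 1/128" "A = 1 / (128 * \<zeta>)" using A unfolding \<zeta> by (auto simp: field_simps)
  define S where "S = T / A / 4"
  have S: "S = 32 * \<zeta> * T" unfolding S_def \<zeta>0(3) using \<zeta>0(1) by (simp add: field_simps)
  define y where "y = 11/10 / \<zeta>"
  have n0: "0 \<le> y" unfolding y_def using \<zeta>0 by simp
  let ?n0 = "\<lceil>y\<rceil>"
  let ?Z = "{- ?n0 .. ?n0}"
  have n0': "0 \<le> ?n0" using n0 by linarith
  have cZ: "real (card ?Z) \<le> 3 / \<zeta>"
  proof -
    have "real (card ?Z) = 2 * real_of_int ?n0 + 1" using n0' by simp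
    also have "\<dots> \<le> 2 * y + 3" by linarith
    also have "\<dots> \<le> 3 / \<zeta>" unfolding y_def using \<zeta>0 by (simp add: field_simps)
    finally show ?thesis .
  qed
  have "S \<le> wt {a. (u,a) \<in> N \<and> precedes m a u}" using u unfolding S_def T_def .
  also have "{a. (u,a) \<in> N \<and> precedes m a u} = (\<Union>z\<in>?Z. slice_nbrs m \<zeta> z u)"
  proof -
    have "\<lfloor>s u a / \<zeta>\<rfloor> \<in> ?Z" if "(u,a) \<in> N" for a
    proof -
      have "\<bar>s u a / \<zeta>\<bar> \<le> y" unfolding y_def abs_divide using slope_le[OF that] \<zeta>0 by (intro frac_le) auto
      then show ?thesis unfolding atLeastAtMost_iff by linarith
    qed
    then show ?thesis unfolding slice_nbrs_def by blast
  qed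
  also have "wt (\<Union>z\<in>?Z. slice_nbrs m \<zeta> z u) \<le> (\<Sum>z\<in>?Z. wt (slice_nbrs m \<zeta> z u))" by (intro wt_UN_le slice_nbrs_sub) auto
  finally have tot: "S \<le> (\<Sum>z\<in>?Z. wt (slice_nbrs m \<zeta> z u))" .
  have small: "wt (slice_nbrs m \<zeta> z u) \<le> S / 16" for z
  proof -
    have "slice_nbrs m \<zeta> z u \<subseteq> {a. (u,a) \<in> N \<and> z * \<zeta> \<le> s u a \<and> s u a \<le> z * \<zeta> + \<zeta>}"
    proof
      fix a assume a: "a \<in> slice_nbrs m \<zeta> z u"
      then have "real_of_int z \<le> s u a / \<zeta>" "s u a / \<zeta> \<le> real_of_int z + 1" unfolding slice_nbrs_def by (simp, linarith)+
      then show "a \<in> {a. (u,a) \<in> N \<and> z * \<zeta> \<le> s u a \<and> s u a \<le> z * \<zeta> + \<zeta>}" using a \<zeta>0 unfolding slice_nbrs_def by (auto simp: field_simps)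
    qed
    then have "wt (slice_nbrs m \<zeta> z u) \<le> wt {a. (u,a) \<in> N \<and> z * \<zeta> \<le> s u a \<and> s u a \<le> z * \<zeta> + \<zeta>}" by (intro wt_mono nb_sub)
    also have "\<dots> \<le> (\<zeta> / sqrt \<delta> + 2) * M" using \<zeta>0 by (intro slice_mass) simp
    also have "\<dots> = \<zeta> * T + 2 * sqrt \<delta> * T" unfolding T(2) using sd by (simp add: field_simps)
    also have "2 * sqrt \<delta> * T \<le> \<zeta> * T" using d T sd by (intro mult_right_mono) linarith+
    finally show ?thesis unfolding S by simp
  qed
  have S0: "0 < S" "0 < 3 / \<zeta>" unfolding S using \<zeta>0 T by auto
  have thr: "2 * \<zeta>^2 * T \<le> S / (4 * (3 / \<zeta>))" unfolding S using \<zeta>0 T by (simp add: field_simps power2_eq_square)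
  obtain z1 z2 z3 where z: "z1 \<in> ?Z" "z2 \<in> ?Z" "z3 \<in> ?Z" "2 \<le> \<bar>z1 - z2\<bar>" "2 \<le> \<bar>z1 - z3\<bar>" "2 \<le> \<bar>z2 - z3\<bar>"
    "S / (4 * (3 / \<zeta>)) \<le> wt (slice_nbrs m \<zeta> z1 u)" "S / (4 * (3 / \<zeta>)) \<le> wt (slice_nbrs m \<zeta> z2 u)" "S / (4 * (3 / \<zeta>)) \<le> wt (slice_nbrs m \<zeta> z3 u)"
    using three_separated_heavy[of ?Z "3 / \<zeta>" S "\<lambda>z. wt (slice_nbrs m \<zeta> z u)"] cZ S0 tot small by auto
  show thesis
    by (rule that[of z1 z2 z3]) (use z thr in \<open>auto simp: T_def y_def\<close>)
qed

text \<open>Pigeonholing over the choice of slices and over cells of side at most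
  \<open>\<zeta>^2 / 288\<close>, which supplies the closeness from which
  \<open>coarse_close\<close> starts. The exponent 10 is the sum of 1 from the rich mass, 3 from the
  slices and 6 from the cells.\<close>

lemma spread_points:
  assumes A: "1 \<le> A" and \<zeta>: "\<zeta> = 1 / (128 * A)" and d: "12 * sqrt \<delta> \<le> \<zeta>"
    and tot: "M / sqrt \<delta> / A \<le> (\<Sum>u\<in>I. w u * wt {a. (u,a) \<in> N})"
  obtains P z1 z2 z3 where "P \<subseteq> I"
    "\<And>u v. u \<in> P \<Longrightarrow> v \<in> P \<Longrightarrow> \<bar>X v - X u\<bar> \<le> \<zeta>^2 / 288 \<and> \<bar>Y v - Y u\<bar> \<le> \<zeta>^2 / 288 \<and> \<bar>R v - R u\<bar> \<le> \<zeta>^2 / 288"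
    "2 \<le> \<bar>z1 - z2\<bar>" "2 \<le> \<bar>z1 - z3\<bar>" "2 \<le> \<bar>z2 - z3\<bar>"
    "\<zeta>^10 / 10^12 \<le> wt P"
    "\<And>u z. u \<in> P \<Longrightarrow> z \<in> {z1,z2,z3} \<Longrightarrow> 2 * \<zeta>^2 * (M / sqrt \<delta>) \<le> wt (slice_nbrs m \<zeta> z u)"
proof -
  have \<zeta>0: "0 < \<zeta>" "\<zeta> \<le> 1/128" "A = 1 / (128 * \<zeta>)" using A unfolding \<zeta> by (auto simp: field_simps)
  let ?P0 = "{u\<in>I. M / sqrt \<delta> / A / 4 \<le> wt {a. (u,a) \<in> N \<and> precedes m a u}}"
  let ?Z = "{- \<lceil>11/10 / \<zeta>\<rceil> .. \<lceil>11/10 / \<zeta>\<rceil>}"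
  define good where "good u z \<longleftrightarrow> (case z of (z1,z2,z3) \<Rightarrow> 2 \<le> \<bar>z1 - z2\<bar> \<and> 2 \<le> \<bar>z1 - z3\<bar> \<and> 2 \<le> \<bar>z2 - z3\<bar> \<and>
     2 * \<zeta>^2 * (M / sqrt \<delta>) \<le> wt (slice_nbrs m \<zeta> z1 u) \<and> 2 * \<zeta>^2 * (M / sqrt \<delta>) \<le> wt (slice_nbrs m \<zeta> z2 u) \<and> 2 * \<zeta>^2 * (M / sqrt \<delta>) \<le> wt (slice_nbrs m \<zeta> z3 u))" for u z
  have "\<exists>z. z \<in> ?Z \<times> ?Z \<times> ?Z \<and> good u z" if "u \<in> ?P0" for u
  proof -
    have "M / sqrt \<delta> / A / 4 \<le> wt {a. (u,a) \<in> N \<and> precedes m a u}" using that by blast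
    from three_slices[OF A \<zeta> d this] obtain z1 z2 z3 where "2 \<le> \<bar>z1 - z2\<bar>" "2 \<le> \<bar>z1 - z3\<bar>" "2 \<le> \<bar>z2 - z3\<bar>"
    "z1 \<in> ?Z" "z2 \<in> ?Z" "z3 \<in> ?Z"
    "2 * \<zeta>^2 * (M / sqrt \<delta>) \<le> wt (slice_nbrs m \<zeta> z1 u)" "2 * \<zeta>^2 * (M / sqrt \<delta>) \<le> wt (slice_nbrs m \<zeta> z2 u)" "2 * \<zeta>^2 * (M / sqrt \<delta>) \<le> wt (slice_nbrs m \<zeta> z3 u)" .
    then have "(z1,z2,z3) \<in> ?Z \<times> ?Z \<times> ?Z \<and> good u (z1,z2,z3)" unfolding good_def by simp
    then show ?thesis by blast
  qed
  then have "\<forall>u\<in>?P0. \<exists>z. z \<in> ?Z \<times> ?Z \<times> ?Z \<and> good u z" by (rule ballI)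
  from bchoice[OF this] obtain zz where "\<forall>u\<in>?P0. zz u \<in> ?Z \<times> ?Z \<times> ?Z \<and> good u (zz u)" by (rule exE)
  then have zz: "zz u \<in> ?Z \<times> ?Z \<times> ?Z \<and> good u (zz u)" if "u \<in> ?P0" for u using that by (rule bspec)
  have "1 \<le> 288 / \<zeta>^2" using \<zeta>0 power_mono[of \<zeta> 1 2] by (simp add: field_simps)
  then obtain k where k: "288 / \<zeta>^2 \<le> 2^k" "2^k \<le> 2 * (288 / \<zeta>^2)" by (rule pow2_between)
  let ?T = "(?Z \<times> ?Z \<times> ?Z) \<times> cl k ` I"
  define n where "n = (3 / \<zeta>)^3 * (125 * (576 / \<zeta>^2)^3)"
  have n0: "0 < n" unfolding n_def using \<zeta>0 by simp
  have P0w: "1 / (20 * A) \<le> wt ?P0" by (rule rich_points[OF A tot])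
  have ne: "?P0 \<noteq> {}"
  proof
    assume e: "?P0 = {}"
    from e have "wt ?P0 = wt {}" by (rule arg_cong)
    then have "wt ?P0 = 0" by (simp only: wt_def sum.empty)
    moreover have "0 < 1 / (20 * A)" using A by simp
    ultimately show False using P0w by linarith
  qed
  have cT: "real (card ?T) \<le> n"
  proof -
    define y where "y = 11/10 / \<zeta>"
    have y: "0 \<le> y" unfolding y_def using \<zeta>0 by simp
    have "real (card ?Z) = 2 * real_of_int \<lceil>y\<rceil> + 1" unfolding y_def[symmetric] using y by simp
    also have "\<dots> \<le> 2 * y + 3" by linarith
    also have "\<dots> \<le> 3 / \<zeta>" unfolding y_def using \<zeta>0 by (simp add: field_simps)
    finally have cZ: "real (card ?Z) \<le> 3 / \<zeta>" .
    have e: "cl k ` I = dcell k ` (\<lambda>u. (X u, Y u, R u)) ` I" unfolding cl_def image_image ..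
    have "card (cl k ` I) \<le> 8^k * card (dcell 0 ` (\<lambda>u. (X u, Y u, R u)) ` I)"
      unfolding e by (rule card_dcell_le[OF finite_imageI[OF finI]])
    also have "\<dots> \<le> 8^k * 125" using roots unfolding image_image by (rule mult_left_mono) simp
    finally have "real (card (cl k ` I)) \<le> real (8^k * 125)" by (rule of_nat_mono)
    also have "\<dots> = 125 * (2^k)^3" by (simp add: power_mult[symmetric] power_mult_distrib mult.commute[of k] power_mult)
    also have "\<dots> \<le> 125 * (576 / \<zeta>^2)^3" using k(2) by (intro mult_left_mono power_mono) auto
    finally have cI: "real (card (cl k ` I)) \<le> 125 * (576 / \<zeta>^2)^3" .
    have "real (card ?T) = (real (card ?Z))^3 * real (card (cl k ` I))"
      unfolding card_cartesian_product of_nat_mult power3_eq_cube mult.assoc ..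
    also have "\<dots> \<le> n" unfolding n_def using cZ cI \<zeta>0 by (intro mult_mono power_mono) auto
    finally show ?thesis .
  qed
  have im: "(\<lambda>u. (zz u, cl k u)) ` ?P0 \<subseteq> ?T" using zz by blast
  have fin: "finite ?P0" "finite ?T" using finI by simp_all
  have W0: "0 \<le> 1 / (20 * A)" using A by simp
  obtain t where t: "t \<in> ?T" "1 / (20 * A) / n \<le> sum w {u\<in>?P0. (zz u, cl k u) = t}"
    by (rule weight_pigeonhole[OF fin im cT n0 W0 P0w[unfolded wt_def[of ?P0]] ne])
  obtain z1 z2 z3 c where tc: "t = ((z1,z2,z3),c)" by (metis prod.collapse)
  define P where "P = {u\<in>?P0. (zz u, cl k u) = t}"
  show thesis
  proof (rule that[of P z1 z2 z3])
    show "P \<subseteq> I" unfolding P_def by blast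
    have g: "good u (z1,z2,z3)" if "u \<in> P" for u
      using that zz[of u] unfolding P_def tc by auto
    have "P \<noteq> {}"
    proof
      assume e: "P = {}"
      have "0 < 1 / (20 * A) / n" using A n0 by simp
      then show False using t(2) unfolding P_def[symmetric] e by simp
    qed
    then obtain u0 where u0: "u0 \<in> P" by blast
    show "2 \<le> \<bar>z1 - z2\<bar>" "2 \<le> \<bar>z1 - z3\<bar>" "2 \<le> \<bar>z2 - z3\<bar>" using g[OF u0] unfolding good_def by auto
    show "2 * \<zeta>^2 * (M / sqrt \<delta>) \<le> wt (slice_nbrs m \<zeta> z u)" if "u \<in> P" "z \<in> {z1,z2,z3}" for u z
      using g[OF that(1)] that(2) unfolding good_def by auto
    show "\<bar>X v - X u\<bar> \<le> \<zeta>^2 / 288 \<and> \<bar>Y v - Y u\<bar> \<le> \<zeta>^2 / 288 \<and> \<bar>R v - R u\<bar> \<le> \<zeta>^2 / 288" if "u \<in> P" "v \<in> P" for u v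
    proof -
      have "cl k v = cl k u" using that unfolding P_def tc by auto
      note c = dcell_eq_imp_close[OF this[unfolded cl_def]]
      have "1 / 2^k \<le> \<zeta>^2 / 288" using k(1) \<zeta>0 by (simp add: field_simps)
      with c show ?thesis by linarith
    qed
    have "\<zeta>^10 / 10^12 \<le> 1 / (20 * A) / n"
    proof -
      have "1 / (20 * A) / n = (128 / (20 * 3^3 * 125 * 576^3)) * \<zeta>^10"
        unfolding n_def \<zeta>0(3) using \<zeta>0(1) by (simp add: field_simps power_divide power_mult[symmetric] power_add[symmetric] power_Suc[symmetric] del: power_Suc)
      also have "(1 / 10^12) * \<zeta>^10 \<le> \<dots>" using \<zeta>0 by (intro mult_right_mono) auto
      finally show ?thesis by simp
    qed
    then show "\<zeta>^10 / 10^12 \<le> wt P" using t(2) unfolding P_def wt_def[of "{u\<in>?P0. (zz u, cl k u) = t}"] by linarith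
  qed
qed

end

lemma three_factor_small:
  fixes a b c :: real
  assumes "a * b * c \<le> k^3" "0 \<le> k" "0 \<le> a" "0 \<le> b" "0 \<le> c"
  shows "a \<le> k \<or> b \<le> k \<or> c \<le> k"
proof (rule ccontr)
  assume "\<not> ?thesis"
  then have "k < a" "k < b" "k < c" by auto
  then have "k * k < a * b" using assms by (intro mult_strict_mono') auto
  then have "k * k * k < a * b * c" using mult_strict_mono'[of "k * k" "a * b" k c] \<open>k < c\<close> assms(2) by simp
  then show False using assms(1) by (simp add: power3_eq_cube)
qed

context tangency
begin

lemma wt_Un_le:
  assumes "S \<subseteq> I" "S' \<subseteq> I"
  shows "wt (S \<union> S') \<le> wt S + wt S'"
proof -
  have f: "finite S" "finite S'" using assms finI finite_subset by blast+
  have "0 \<le> sum w (S \<inter> S')" using assms w_nonneg by (intro sum_nonneg) blast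
  then show ?thesis using sum.union_inter[OF f, of w] unfolding wt_def by linarith
qed

lemma wt_blocks:
  assumes "S \<subseteq> I"
  shows "wt S = (\<Sum>B\<in>block m ` S. wt {a\<in>S. block m a = B})"
  unfolding wt_def by (rule sum.image_gen) (rule finite_subset[OF assms finI])

text \<open>The choice of \<open>m\<close> ensures that, outside a set of mass \<open>p / 2\<close>,
  the product of the three block counts is at most \<open>k^3\<close>; so for points of mass
  \<open>p / 6\<close> one and the same direction has at most \<open>k\<close> blocks. In that
  direction the pieces of mass at most \<open>8 * M\<close> contribute at most
  \<open>8 * M * k\<close>, by the choice of \<open>k\<close> half of what is there. The heavier
  pieces supply the rest and are bounded through their cubes. In orders of magnitude,
  \<open>k\<close> is \<open>1 / sqrt \<delta>\<close> and \<open>m^2\<close> is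
  \<open>1 / k^3\<close>, so the conclusion reads \<open>M^2 \<le> \<delta>^2\<close>.\<close>

lemma tangency_main:
  assumes A: "1 \<le> A" and \<zeta>: "\<zeta> = 1 / (128 * A)" and d: "12 * sqrt \<delta> \<le> \<zeta>" and L: "1 \<le> L"
    and tot: "M / sqrt \<delta> / A \<le> (\<Sum>u\<in>I. w u * wt {a. (u,a) \<in> N})"
    and p: "p = \<zeta>^10 / 10^12" and G: "G = 10^18 * real L^3 / \<zeta>^6"
    and k: "k = p * \<zeta>^2 / (48 * sqrt \<delta>)" and m: "0 < m" "m \<le> 1" "m^2 = 2 * G / (p * k^3)"
  shows "p * \<zeta>^2 * (M / sqrt \<delta>) / 6 \<le> m^2 / (16 * M)"
proof -
  define T where "T = M / sqrt \<delta>"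
  have T: "0 < T" unfolding T_def using M_pos \<delta>_pos by simp
  have \<zeta>0: "0 < \<zeta>" "\<zeta> \<le> 1/128" using A unfolding \<zeta> by (auto simp: field_simps)
  have p0: "0 < p" unfolding p using \<zeta>0 by simp
  have k0: "0 < k" unfolding k using p0 \<zeta>0 \<delta>_pos by simp
  have \<zeta>\<delta>: "144 * \<delta> \<le> \<zeta>^2"
  proof -
    have "(12 * sqrt \<delta>)^2 \<le> \<zeta>^2" using d \<delta>_pos by (intro power_mono) auto
    then show ?thesis using \<delta>_pos by (simp add: power_mult_distrib)
  qed
  obtain P z1 z2 z3 where P: "P \<subseteq> I"
    "\<And>u v. u \<in> P \<Longrightarrow> v \<in> P \<Longrightarrow> \<bar>X v - X u\<bar> \<le> \<zeta>^2 / 288 \<and> \<bar>Y v - Y u\<bar> \<le> \<zeta>^2 / 288 \<and> \<bar>R v - R u\<bar> \<le> \<zeta>^2 / 288"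
    and z: "2 \<le> \<bar>z1 - z2\<bar>" "2 \<le> \<bar>z1 - z3\<bar>" "2 \<le> \<bar>z2 - z3\<bar>"
    and Pw: "\<zeta>^10 / 10^12 \<le> wt P"
    and rich: "\<And>u z. u \<in> P \<Longrightarrow> z \<in> {z1,z2,z3} \<Longrightarrow> 2 * \<zeta>^2 * (M / sqrt \<delta>) \<le> wt (slice_nbrs m \<zeta> z u)"
    using spread_points[OF A \<zeta> d tot] by metis
  define K where "K z u = real (card (block m ` slice_nbrs m \<zeta> z u))" for z u
  define n where "n = real (card (block m ` I))"
  have nL: "n \<le> 133 * real L / m"
  proof -
    have "n \<le> (125 + 8 * real L) / m" unfolding n_def by (rule card_blocks[OF m(1,2)])
    also have "\<dots> \<le> 133 * real L / m" using m L by (intro divide_right_mono) auto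
    finally show ?thesis .
  qed
  have n0: "0 \<le> n" unfolding n_def by simp
  have finP: "finite P" using finite_subset[OF P(1) finI] .
  have sumK: "(\<Sum>u\<in>P. w u * (K z1 u * K z2 u * K z3 u)) \<le> G / m^2"
  proof -
    have "(\<Sum>u\<in>P. w u * (K z1 u * K z2 u * K z3 u)) \<le> (2 * (2304 / \<zeta>^2) + 5)^3 * n^2 * (n * m + 1)"
      unfolding K_def n_def by (rule coarse_product_sum[OF P z \<zeta>0(1) \<zeta>\<delta> m(1)])
    also have "\<dots> \<le> (5000 / \<zeta>^2)^3 * (133 * real L / m)^2 * (134 * real L)"
    proof (intro mult_mono power_mono nL n0)
      have "5 * \<zeta>^2 \<le> 5 * (1/128)^2" using \<zeta>0 by (intro mult_left_mono power_mono) auto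
      also have "\<dots> \<le> 392" by (simp add: power2_eq_square)
      finally have "4608 + 5 * \<zeta>^2 \<le> 5000" by simp
      then have "(4608 + 5 * \<zeta>^2) / \<zeta>^2 \<le> 5000 / \<zeta>^2" using \<zeta>0 by (intro divide_right_mono) auto
      then show "2 * (2304 / \<zeta>^2) + 5 \<le> 5000 / \<zeta>^2" using \<zeta>0 by (simp add: add_divide_distrib)
      have "n * m \<le> 133 * real L / m * m" using nL m by (intro mult_right_mono) auto
      then show "n * m + 1 \<le> 134 * real L" using m L by simp
    qed (use n0 m in auto)
    also have "\<dots> = (5000^3 * 133^2 * 134) * (real L^3 / \<zeta>^6 / m^2)"
    proof -
      have "(5000 / \<zeta>^2)^3 = 5000^3 / \<zeta>^6" "(133 * real L / m)^2 = 133^2 * real L^2 / m^2"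
        by (simp_all add: power_divide power_mult[symmetric] power_mult_distrib)
      then show ?thesis by (simp add: power2_eq_square power3_eq_cube)
    qed
    also have "\<dots> \<le> 10^18 * (real L^3 / \<zeta>^6 / m^2)"
      using \<zeta>0 m(1) by (intro mult_right_mono divide_nonneg_nonneg) simp_all
    finally show ?thesis unfolding G by simp
  qed
  let ?B = "{u\<in>P. \<not> K z1 u * K z2 u * K z3 u \<le> k^3}"
  have K0: "0 \<le> K z u" for z u unfolding K_def by simp
  have bad: "wt ?B \<le> p / 2"
  proof -
    have BI: "?B \<subseteq> I" using P(1) by blast
    have "wt ?B * k^3 \<le> (\<Sum>u\<in>?B. w u * (K z1 u * K z2 u * K z3 u))" using BI by (intro sum_wt_ge) auto
    also have "\<dots> \<le> (\<Sum>u\<in>P. w u * (K z1 u * K z2 u * K z3 u))"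
      using finP K0 w_nonneg P(1) by (intro sum_mono2) (auto intro!: mult_nonneg_nonneg)
    also have "\<dots> \<le> G / m^2" by (rule sumK)
    also have "\<dots> = p / 2 * k^3"
    proof -
      have "G \<noteq> 0" unfolding G using L \<zeta>0 by simp
      then show ?thesis unfolding m(3) using p0 k0 by (simp add: field_simps)
    qed
    finally show ?thesis using k0 by simp
  qed
  have "P = ?B \<union> (\<Union>z\<in>{z1,z2,z3}. {u\<in>P. K z u \<le> k})"
    using three_factor_small[of "K z1 _" "K z2 _" "K z3 _" k] K0 k0 by fastforce
  then have "wt P = wt (?B \<union> (\<Union>z\<in>{z1,z2,z3}. {u\<in>P. K z u \<le> k}))" by (rule arg_cong)
  also have "\<dots> \<le> wt ?B + wt (\<Union>z\<in>{z1,z2,z3}. {u\<in>P. K z u \<le> k})"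
    using P(1) by (intro wt_Un_le) blast+
  also have "wt (\<Union>z\<in>{z1,z2,z3}. {u\<in>P. K z u \<le> k}) \<le> (\<Sum>z\<in>{z1,z2,z3}. wt {u\<in>P. K z u \<le> k})"
    using P(1) by (intro wt_UN_le) auto
  finally have sum3: "p / 2 \<le> (\<Sum>z\<in>{z1,z2,z3}. wt {u\<in>P. K z u \<le> k})" using bad Pw unfolding p by linarith
  have "\<exists>z\<in>{z1,z2,z3}. p / 6 \<le> wt {u\<in>P. K z u \<le> k}"
  proof (rule ccontr)
    assume "\<not> ?thesis"
    then have "(\<Sum>z\<in>{z1,z2,z3}. wt {u\<in>P. K z u \<le> k}) < (\<Sum>z\<in>{z1,z2,z3}. p / 6)" by (intro sum_strict_mono) auto
    also have "\<dots> = real (card {z1,z2,z3}) * (p / 6)" by simp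
    also have "card {z1,z2,z3} = 3"
    proof -
      have "z1 \<noteq> z2" "z1 \<noteq> z3" "z2 \<noteq> z3" using z by fastforce+
      then show ?thesis by simp
    qed
    finally show False using sum3 by simp
  qed
  then obtain z where zin: "z \<in> {z1,z2,z3}" and zP: "p / 6 \<le> wt {u\<in>P. K z u \<le> k}" by blast
  let ?P = "{u\<in>P. K z u \<le> k}"
  have PI: "?P \<subseteq> I" using P(1) by blast
  define J where "J u B = wt {a\<in>slice_nbrs m \<zeta> z u. block m a = B}" for u B
  have JI: "{a\<in>slice_nbrs m \<zeta> z u. block m a = B} \<subseteq> I" for u B using slice_nbrs_sub by blast
  have J0: "0 \<le> J u B" for u B unfolding J_def by (intro wt_nonneg JI)
  let ?x = "8 * M"
  have x0: "0 < ?x" using M_pos by simp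
  \<comment> \<open>The pieces are cut at \<open>8 * M\<close>, the threshold of
    \<open>fine_triple_lower\<close>. A piece \<open>J\<close> above it satisfies
    \<open>J \<le> J^3 / (8 * M)^2\<close>.\<close>
  have up: "wt (slice_nbrs m \<zeta> z u) \<le> ?x * K z u + (\<Sum>B\<in>block m ` I. if ?x < J u B then (J u B)^3 else 0) / ?x^2" for u
  proof -
    have "wt (slice_nbrs m \<zeta> z u) = (\<Sum>B\<in>block m ` slice_nbrs m \<zeta> z u. J u B)" unfolding J_def by (rule wt_blocks[OF slice_nbrs_sub])
    also have "\<dots> \<le> (\<Sum>B\<in>block m ` slice_nbrs m \<zeta> z u. ?x + (if ?x < J u B then (J u B)^3 else 0) / ?x^2)"
    proof (intro sum_mono)
      fix B
      have "J u B \<le> (J u B)^3 / ?x^2" if "?x < J u B"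
      proof -
        have "J u B * ?x^2 \<le> J u B * (J u B)^2" using that x0 by (intro mult_left_mono power_mono) auto
        then show ?thesis using x0 by (simp add: field_simps power3_eq_cube power2_eq_square)
      qed
      then show "J u B \<le> ?x + (if ?x < J u B then (J u B)^3 else 0) / ?x^2" using x0 by (cases "?x < J u B") auto
    qed
    also have "\<dots> = ?x * K z u + (\<Sum>B\<in>block m ` slice_nbrs m \<zeta> z u. if ?x < J u B then (J u B)^3 else 0) / ?x^2"
      unfolding sum.distrib sum_divide_distrib K_def by simp
    also have "(\<Sum>B\<in>block m ` slice_nbrs m \<zeta> z u. if ?x < J u B then (J u B)^3 else 0) / ?x^2 \<le> (\<Sum>B\<in>block m ` I. if ?x < J u B then (J u B)^3 else 0) / ?x^2"
    proof (intro divide_right_mono sum_mono2)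
      show "block m ` slice_nbrs m \<zeta> z u \<subseteq> block m ` I" using slice_nbrs_sub by (rule image_mono)
    qed (use finI J0 in auto)
    finally show ?thesis by simp
  qed
  have "p / 6 * (2 * \<zeta>^2 * T) \<le> wt ?P * (2 * \<zeta>^2 * T)" using zP \<zeta>0 T by (intro mult_right_mono) auto
  also have "\<dots> \<le> (\<Sum>u\<in>?P. w u * wt (slice_nbrs m \<zeta> z u))" using PI rich zin unfolding T_def by (intro sum_wt_ge) auto
  also have "\<dots> \<le> (\<Sum>u\<in>?P. w u * (?x * k + (\<Sum>B\<in>block m ` I. if ?x < J u B then (J u B)^3 else 0) / ?x^2))"
  proof (intro sum_mono mult_left_mono)
    fix u assume u: "u \<in> ?P"
    show "0 \<le> w u" using u PI w_nonneg by blast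
    have "?x * K z u \<le> ?x * k" using u x0 by (intro mult_left_mono) auto
    then show "wt (slice_nbrs m \<zeta> z u) \<le> ?x * k + (\<Sum>B\<in>block m ` I. if ?x < J u B then (J u B)^3 else 0) / ?x^2" using up[of u] by linarith
  qed
  also have "\<dots> = wt ?P * (?x * k) + (\<Sum>u\<in>?P. w u * (\<Sum>B\<in>block m ` I. if ?x < J u B then (J u B)^3 else 0)) / ?x^2"
    (is "(\<Sum>u\<in>?P. w u * (?x * k + ?h u / ?x^2)) = _")
  proof -
    have "(\<Sum>u\<in>?P. w u * (c + h u / d)) = wt ?P * c + (\<Sum>u\<in>?P. w u * h u) / d" for c d :: real and h
      by (simp add: wt_def distrib_left sum.distrib sum_distrib_right sum_divide_distrib)
    then show ?thesis .
  qed
  also have "wt ?P * (?x * k) \<le> 1 * (?x * k)" using wt_le1[OF PI] x0 k0 by (intro mult_right_mono) auto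
  also have "(\<Sum>u\<in>?P. w u * (\<Sum>B\<in>block m ` I. if ?x < J u B then (J u B)^3 else 0)) / ?x^2 \<le> 4 * M * m^2 / ?x^2"
  proof (rule divide_right_mono)
    show "(\<Sum>u\<in>?P. w u * (\<Sum>B\<in>block m ` I. if ?x < J u B then (J u B)^3 else 0)) \<le> 4 * M * m^2"
      unfolding J_def by (rule fine_cube_sum[OF _ m(1) PI]) (auto simp: slice_nbrs_def)
  qed simp
  finally have f: "p / 6 * (2 * \<zeta>^2 * T) \<le> 1 * (?x * k) + 4 * M * m^2 / ?x^2" by simp
  have "?x * k = p * \<zeta>^2 * T / 6" unfolding k T_def by (simp add: mult_ac)
  moreover have "4 * M * m^2 / ?x^2 = m^2 / (16 * M)" using M_pos by (simp add: power2_eq_square field_simps)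
  moreover have "p / 6 * (2 * \<zeta>^2 * T) = p * \<zeta>^2 * T / 6 + p * \<zeta>^2 * T / 6" by (simp add: field_simps)
  moreover have "c \<le> d" if "a \<le> 1 * x + y" "x = c" "y = d" "a = c + c" for a x y c d :: real using that by linarith
  ultimately show ?thesis using f unfolding T_def by metis
qed

text \<open>The total mass alone gives \<open>M \<le> A * sqrt \<delta>\<close>. This settles the
  cases to which \<open>tangency_main\<close> does not apply: \<open>12 * sqrt \<delta>\<close>
  larger than \<zeta>, where \<delta> is bounded below in terms of \<open>A\<close>, and
  \<open>m\<close> larger than 1.\<close>

theorem tangency_bound:
  assumes A: "1 \<le> A" and L: "1 \<le> L"
    and tot: "M / sqrt \<delta> / A \<le> (\<Sum>u\<in>I. w u * wt {a. (u,a) \<in> N})"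
  shows "M^2 \<le> 10^90 * 128^64 * A^64 * real L^3 * \<delta>^2"
proof -
  define \<zeta> where "\<zeta> = 1 / (128 * A)"
  define r where "r = sqrt \<delta>"
  have \<zeta>0: "0 < \<zeta>" "\<zeta> \<le> 1/128" "A * \<zeta> = 1/128" using A unfolding \<zeta>_def by (auto simp: field_simps)
  have r: "0 < r" "r \<le> 1" "\<delta> = r^2" unfolding r_def using \<delta>_pos \<delta>_le by auto
  have "(\<Sum>u\<in>I. w u * wt {a. (u,a) \<in> N}) \<le> wt I * 1"
    using nb_sub[of _ "\<lambda>_. True"] by (intro sum_wt_le wt_le1) auto
  then have "M / r / A \<le> 1" using tot wt_le1[of I] unfolding r_def by simp
  then have "M \<le> A * r" using A r by (simp add: field_simps)
  then have triv: "M^2 \<le> A^2 * r^2" using M_pos power_mono[of M "A * r" 2] by (simp add: power_mult_distrib)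
  have L3: "1 \<le> real L^3" using L by (simp add: one_le_power)
  show ?thesis
  proof (cases "12 * r \<le> \<zeta>")
    case False
    then have "1 \<le> 1536 * A * r" using A unfolding \<zeta>_def by (simp add: field_simps)
    then have "1^2 \<le> (1536 * A * r)^2" by (intro power_mono) auto
    then have 1: "1 \<le> 1536^2 * A^2 * r^2" by (simp only: power_mult_distrib power_one)
    have "M^2 \<le> A^2 * r^2 * 1" using triv by simp
    also have "\<dots> \<le> A^2 * r^2 * (1536^2 * A^2 * r^2)" using 1 by (intro mult_left_mono) auto
    also have "\<dots> = 1536^2 * (A^4 * (r^2)^2)" by (simp add: power2_eq_square power4_eq_xxxx)
    also have "\<dots> \<le> (10^90 * 128^64) * ((A^64 * real L^3) * (r^2)^2)"
    proof (intro mult_mono)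
      have "A^4 * 1 \<le> A^64 * real L^3" using A L3 by (intro mult_mono power_increasing) auto
      then show "A^4 \<le> A^64 * real L^3" by simp
    qed auto
    finally show ?thesis unfolding r(3) by (simp only: mult.assoc)
  next
    case True
    define p where "p = \<zeta>^10 / 10^12"
    define G where "G = 10^18 * real L^3 / \<zeta>^6"
    define k where "k = p * \<zeta>^2 / (48 * r)"
    define m where "m = sqrt (2 * G / (p * k^3))"
    have p0: "0 < p" "p \<le> 1" unfolding p_def using \<zeta>0 power_le_one[of \<zeta> 10] by auto
    have G0: "0 < G" unfolding G_def using L \<zeta>0 by simp
    have k0: "0 < k" unfolding k_def using p0 \<zeta>0 r by simp
    have m0: "0 < m" unfolding m_def using G0 p0 k0 by simp
    have m2: "m^2 = 2 * G / (p * k^3)" unfolding m_def using G0 p0 k0 by simp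
    have z2: "0 < \<zeta>^2" using \<zeta>0 by simp
    have main: "p * \<zeta>^2 * M^2 * 16 \<le> 6 * r * m^2"
    proof (cases "m \<le> 1")
      case True
      have "p * \<zeta>^2 * (M / r) / 6 \<le> m^2 / (16 * M)"
        unfolding r_def by (rule tangency_main[OF A \<zeta>_def \<open>12 * r \<le> \<zeta>\<close>[unfolded r_def] L tot p_def G_def k_def[unfolded r_def] m0 True m2])
      then have "p * \<zeta>^2 * (M / r) / 6 * (16 * M) \<le> m^2" using M_pos by (simp add: field_simps)
      then have "p * \<zeta>^2 * (M / r) / 6 * (16 * M) * (6 * r) \<le> m^2 * (6 * r)" using r by (intro mult_right_mono) auto
      moreover have "p * \<zeta>^2 * (M / r) / 6 * (16 * M) * (6 * r) = p * \<zeta>^2 * M^2 * 16" using r by (simp add: power2_eq_square field_simps)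
      ultimately show ?thesis by (simp only: mult_ac)
    next
      case False
      then have m1: "1 \<le> m^2" using power_mono[of 1 m 2] by simp
      have "p * \<zeta>^2 * M^2 * 16 \<le> 1 * \<zeta>^2 * (A^2 * r^2) * 16" using p0 triv by (intro mult_mono) auto
      also have "\<dots> = (A * \<zeta>)^2 * 16 * (r * r)" by (simp add: power2_eq_square)
      also have "\<dots> \<le> 1 * (r * 1)" unfolding \<zeta>0(3) using r by (intro mult_mono) (auto simp: power2_eq_square)
      also have "\<dots> \<le> 6 * r * 1" using r by simp
      also have "\<dots> \<le> 6 * r * m^2" using m1 r by (intro mult_left_mono) auto
      finally show ?thesis .
    qed
    have "M^2 \<le> 6 * r * m^2 / (p * \<zeta>^2 * 16)" using main p0 z2 by (simp add: field_simps)
    also have "\<dots> = 82944 * G * (r^2)^2 / (p^5 * \<zeta>^8)"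
    proof -
      have k3: "k^3 = p^3 * \<zeta>^6 / (48^3 * r^3)" unfolding k_def by (simp add: power_divide power_mult_distrib power_mult[symmetric])
      have "6 * r * m^2 / (p * \<zeta>^2 * 16) = (6 * 2 * 48^3 / 16) * G * (r * r^3) / ((p * p * p^3) * (\<zeta>^2 * \<zeta>^6))"
        unfolding m2 k3 using p0 \<zeta>0 r by (simp add: field_simps)
      also have "r * r^3 = (r^2)^2" by (simp add: power2_eq_square power3_eq_cube)
      also have "p * p * p^3 = p^5" by (simp add: eval_nat_numeral)
      also have "\<zeta>^2 * \<zeta>^6 = \<zeta>^8" by (simp only: power_add[symmetric]) simp
      finally show ?thesis by simp
    qed
    \<comment> \<open>Degree count in \<open>1 / \<zeta>\<close>: 6 from \<open>G\<close>, 50 from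
      \<open>p^5\<close> and 8 explicitly. As \<open>\<zeta> = 1 / (128 * A)\<close>, the factor
      \<open>128^64 * A^64\<close> results.\<close>
    also have "\<dots> = (82944 * 10^78) * (real L^3 * (r^2)^2) / \<zeta>^64"
    proof -
      have "p^5 = \<zeta>^50 / 10^60" unfolding p_def by (simp add: power_divide power_mult[symmetric])
      moreover have "\<zeta>^64 = \<zeta>^6 * \<zeta>^50 * \<zeta>^8" by (simp only: power_add[symmetric]) simp
      moreover have "82944 * (10^18 * l / a) * q / (b / 10^60 * c) = (82944 * 10^78) * (l * q) / (a * b * c)" for l a q b c :: real
        by simp
      ultimately show ?thesis unfolding G_def by (simp only:)
    qed
    also have "\<dots> = (82944 * 10^78 * 128^64) * (A^64 * real L^3 * (r^2)^2)"
    proof -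
      have "1 / \<zeta>^64 = 128^64 * A^64" unfolding \<zeta>_def by (simp only: power_divide power_one power_mult_distrib divide_divide_eq_right)
      then show ?thesis by (simp only: divide_inverse mult_1_left mult_ac)
    qed
    also have "\<dots> \<le> (10^90 * 128^64) * (A^64 * real L^3 * (r^2)^2)" using A L3 by (intro mult_right_mono) auto
    finally show ?thesis unfolding r(3) by (simp only: mult.assoc)
  qed
qed

end

section \<open>Intersections of annuli\<close>

text \<open>Up to the factor \<open>2 * Rp\<close> the expression is the power of the point
  \<open>(s, c)\<close> of the first circle with respect to the second, and this power is small for
  a point within \<open>2 * \<delta>\<close> of the second circle.\<close>

lemma near_circle_inner:
  fixes x1 x2 s c s' c' Rp Rq \<delta> :: real
  assumes e: "s^2 + c^2 = 1" "s'^2 + c'^2 = 1" and R: "1 \<le> Rp" "1 \<le> Rq" "Rq \<le> 17/16"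
    and \<delta>: "0 \<le> \<delta>" "\<delta> \<le> 1/8"
    and near: "(x1 + Rp * s - Rq * s')^2 + (x2 + Rp * c - Rq * c')^2 \<le> (2 * \<delta>)^2"
  shows "\<bar>x1 * s + x2 * c + (Rp - Rq) + (x1^2 + x2^2 - (Rp - Rq)^2) / (2 * Rp)\<bar> \<le> 3 * \<delta>"
proof -
  define u1 u2 where "u1 = x1 + Rp * s - Rq * s'" and "u2 = x2 + Rp * c - Rq * c'"
  define t where "t = u1 * s' + u2 * c'"
  have u: "u1^2 + u2^2 \<le> (2 * \<delta>)^2" using near unfolding u1_def u2_def .
  have "t^2 \<le> (u1^2 + u2^2) * (s'^2 + c'^2)"
    unfolding t_def using zero_le_power2[of "u1 * c' - u2 * s'"] by (simp add: power2_eq_square algebra_simps)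
  then have "t^2 \<le> (2 * \<delta>)^2" using u e by simp
  then have t: "\<bar>t\<bar> \<le> 2 * \<delta>" using \<delta> abs_le_square_iff[of t "2 * \<delta>"] by simp
  define E where "E = 2 * Rp * (x1 * s + x2 * c + (Rp - Rq)) + (x1^2 + x2^2 - (Rp - Rq)^2)"
  have E: "E = (u1^2 + u2^2) + 2 * (Rq * t)"
  proof -
    have "E = (u1^2 + u2^2) + 2 * (Rq * t) + Rp^2 * (1 - (s^2 + c^2)) + Rq^2 * ((s'^2 + c'^2) - 1)"
      unfolding E_def t_def u1_def u2_def by (simp add: power2_eq_square algebra_simps)
    then show ?thesis using e by simp
  qed
  have "\<bar>Rq * t\<bar> \<le> (17/16) * (2 * \<delta>)" using t R by (intro abs_mult_le) auto
  moreover have "(2 * \<delta>)^2 \<le> \<delta> / 2" using \<delta> mult_right_mono[of \<delta> "1/8" \<delta>] by (simp add: power2_eq_square)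
  moreover have "0 \<le> u1^2 + u2^2" by simp
  ultimately have "\<bar>E\<bar> \<le> 6 * \<delta>" unfolding E using u \<delta> by linarith
  moreover have "x1 * s + x2 * c + (Rp - Rq) + (x1^2 + x2^2 - (Rp - Rq)^2) / (2 * Rp) = E / (2 * Rp)"
    unfolding E_def using R by (simp add: field_simps)
  moreover have "\<bar>E / (2 * Rp)\<bar> \<le> 6 * \<delta> / 2" unfolding abs_divide using R \<open>\<bar>E\<bar> \<le> 6 * \<delta>\<close> by (intro frac_le) auto
  ultimately show ?thesis by simp
qed

lemma orthogonal_pair_identity:
  fixes x1 x2 u1 u2 v1 v2 :: real
  assumes "u1 * v1 + u2 * v2 = 0"
  shows "(x1 * u1 + x2 * u2)^2 * (v1^2 + v2^2) = (u1^2 + u2^2) * (- x1 * v2 + x2 * v1)^2"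
  using assms by algebra

text \<open>Up to sign, \<open>- x1 * c + x2 * s\<close> is the derivative of
  \<open>x1 * s + x2 * c\<close> in the angle. Sum and difference of two unit vectors are
  orthogonal, so the difference of the levels is expressed exactly through the sum of the two
  derivatives, which replaces a mean value argument.\<close>

lemma steep_level_set:
  fixes x1 x2 s c s' c' b d0 :: real
  assumes e: "s^2 + c^2 = 1" "s'^2 + c'^2 = 1" and b: "0 < b"
    and steep: "b \<le> - x1 * c + x2 * s" "b \<le> - x1 * c' + x2 * s'"
    and lev: "\<bar>(x1 * s + x2 * c) - (x1 * s' + x2 * c')\<bar> \<le> d0"
  shows "\<bar>s - s'\<bar> \<le> d0 / b"
proof -
  define u1 u2 v1 v2 where "u1 = s - s'" and "u2 = c - c'" and "v1 = s + s'" and "v2 = c + c'"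
  have o: "u1 * v1 + u2 * v2 = 0" unfolding u1_def u2_def v1_def v2_def using e by (simp add: power2_eq_square algebra_simps)
  have v4: "v1^2 + v2^2 \<le> 4"
    using zero_le_power2[of u1] zero_le_power2[of u2] e unfolding u1_def u2_def v1_def v2_def by (simp add: power2_eq_square algebra_simps)
  have d0: "0 \<le> d0" using lev by linarith
  have 2: "2 * b \<le> - x1 * v2 + x2 * v1" using steep unfolding v1_def v2_def by (simp add: algebra_simps)
  have "u1^2 * (2 * b)^2 \<le> (u1^2 + u2^2) * (- x1 * v2 + x2 * v1)^2"
    using 2 b by (intro mult_mono power_mono) auto
  also have "\<dots> = (x1 * u1 + x2 * u2)^2 * (v1^2 + v2^2)" by (rule orthogonal_pair_identity[OF o, symmetric])
  also have "\<dots> \<le> d0^2 * 4"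
  proof (intro mult_mono v4)
    have "\<bar>x1 * u1 + x2 * u2\<bar> \<le> d0" using lev unfolding u1_def u2_def by (simp add: algebra_simps)
    then show "(x1 * u1 + x2 * u2)^2 \<le> d0^2" using d0 by (simp add: abs_le_square_iff[symmetric])
  qed auto
  finally have "(u1 * b)^2 \<le> d0^2" by (simp add: power_mult_distrib)
  then have "\<bar>u1\<bar> * b \<le> d0" using d0 b by (simp add: abs_le_square_iff[symmetric] abs_mult)
  then show ?thesis unfolding u1_def using b by (simp add: field_simps)
qed

text \<open>The right-hand side is the sine of the difference of the angles. It controls the
  difference of the sines because the cosines are at least 0.86 on this arc.\<close>

lemma arc_sine_lower:
  fixes s c s' c' :: real
  assumes e: "s^2 + c^2 = 1" "s'^2 + c'^2 = 1" and s: "\<bar>s\<bar> \<le> 1/2" "\<bar>s'\<bar> \<le> 1/2" and c: "0 \<le> c" "0 \<le> c'"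
  shows "\<bar>s - s'\<bar> / 2 \<le> \<bar>s' * c - s * c'\<bar>"
proof -
  have cg: "86/100 \<le> y" if "x^2 + y^2 = 1" "\<bar>x\<bar> \<le> 1/2" "0 \<le> y" for x y :: real
  proof (rule ccontr)
    assume "\<not> ?thesis"
    then have "y^2 < (86/100)^2" using that by (intro power_strict_mono) auto
    moreover have "x^2 \<le> (1/2)^2" using that(2) abs_le_square_iff[of x "1/2"] by simp
    ultimately show False using that(1) by (simp add: power2_eq_square)
  qed
  have cc: "86/100 \<le> c" "86/100 \<le> c'" using cg e s c by auto
  have "(c - c') * (c + c') = (s' - s) * (s' + s)" using e by (simp add: power2_eq_square algebra_simps)
  then have "\<bar>c - c'\<bar> * \<bar>c + c'\<bar> = \<bar>s' - s\<bar> * \<bar>s' + s\<bar>" by (metis abs_mult)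
  moreover have "\<bar>s' - s\<bar> * \<bar>s' + s\<bar> \<le> \<bar>s' - s\<bar> * 1" using s by (intro mult_left_mono) auto
  moreover have "\<bar>c - c'\<bar> * (172/100) \<le> \<bar>c - c'\<bar> * \<bar>c + c'\<bar>" using cc by (intro mult_left_mono) auto
  ultimately have d: "\<bar>c - c'\<bar> * (172/100) \<le> \<bar>s' - s\<bar>" by linarith
  have sc: "\<bar>s * (c - c')\<bar> \<le> 1/2 * \<bar>c - c'\<bar>" using s by (intro abs_mult_le) auto
  have "\<bar>(s' - s) * c\<bar> = \<bar>s' - s\<bar> * c" using cc by (simp add: abs_mult)
  moreover have "\<bar>s' - s\<bar> * (86/100) \<le> \<bar>s' - s\<bar> * c" using cc by (intro mult_left_mono) auto
  moreover have "s' * c - s * c' = (s' - s) * c + s * (c - c')" by (simp add: algebra_simps)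
  moreover have "\<bar>a\<bar> - \<bar>b\<bar> \<le> \<bar>a + b\<bar>" for a b :: real by linarith
  ultimately have "\<bar>s' - s\<bar> * (86/100) - 1/2 * \<bar>c - c'\<bar> \<le> \<bar>s' * c - s * c'\<bar>" using sc by (smt (verit))
  moreover have "0 \<le> \<bar>s' - s\<bar>" by simp
  moreover have "x / 2 \<le> z" if "x * (86/100) - 1/2 * y \<le> z" "y * (172/100) \<le> x" "0 \<le> x" for x y z :: real
    using that by linarith
  ultimately have "\<bar>s' - s\<bar> / 2 \<le> \<bar>s' * c - s * c'\<bar>" using d by blast
  then show ?thesis by (simp add: abs_minus_commute)
qed

text \<open>The derivative \<open>f\<close> and the level \<open>g\<close> are the components of
  \<open>x\<close> in a rotating frame. If the derivative is small at two angles, rotating one frame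
  into the other bounds \<open>g\<close> times the sine of the angle difference by
  \<open>2 * b\<close>, while \<open>\<bar>g\<bar>\<close> is at least \<open>\<rho> / 2\<close>. On
  an arc with positive cosine a small sine means close angles.\<close>

lemma flat_level_set:
  fixes x1 x2 s c s' c' b \<rho> :: real
  assumes e: "s^2 + c^2 = 1" "s'^2 + c'^2 = 1" and s: "\<bar>s\<bar> \<le> 1/2" "\<bar>s'\<bar> \<le> 1/2" and c: "0 \<le> c" "0 \<le> c'"
    and flat: "\<bar>- x1 * c + x2 * s\<bar> \<le> b" "\<bar>- x1 * c' + x2 * s'\<bar> \<le> b"
    and \<rho>: "0 < \<rho>" "2 * b \<le> \<rho>" "\<rho>^2 \<le> x1^2 + x2^2"
  shows "\<bar>s - s'\<bar> \<le> 8 * b / \<rho>"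
proof -
  define f g where "f = - x1 * c + x2 * s" and "g = x1 * s + x2 * c"
  have fg: "f^2 + g^2 = x1^2 + x2^2"
  proof -
    have "f^2 + g^2 = (x1^2 + x2^2) * (s^2 + c^2)" unfolding f_def g_def by (simp add: power2_eq_square algebra_simps)
    then show ?thesis using e by simp
  qed
  have b0: "0 \<le> b" using flat(1) by linarith
  have "f^2 \<le> b^2" using flat(1) b0 unfolding f_def[symmetric] by (simp add: abs_le_square_iff[symmetric])
  also have "b^2 \<le> (\<rho> / 2)^2" using \<rho> b0 by (intro power_mono) auto
  finally have "f^2 \<le> \<rho>^2 / 4" by (simp add: power_divide)
  then have "\<rho>^2 / 4 \<le> g^2" using fg \<rho>(3) zero_le_power2[of \<rho>] by linarith
  then have "(\<rho> / 2)^2 \<le> g^2" by (simp add: power_divide)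
  then have g: "\<rho> / 2 \<le> \<bar>g\<bar>" using \<rho> by (simp add: abs_le_square_iff[symmetric])
  have "g * (s' * c - s * c') = (- x1 * c' + x2 * s') - f * (s * s' + c * c')"
  proof -
    have "g * (s' * c - s * c') = (- x1 * c' + x2 * s') * (s^2 + c^2) - f * (s * s' + c * c')"
      unfolding f_def g_def by (simp add: power2_eq_square algebra_simps)
    then show ?thesis using e by simp
  qed
  moreover have "\<bar>f * (s * s' + c * c')\<bar> \<le> b * 1"
  proof (intro abs_mult_le)
    show "\<bar>f\<bar> \<le> b" using flat(1) unfolding f_def .
    have "2 * \<bar>s * s' + c * c'\<bar> \<le> (s^2 + c^2) + (s'^2 + c'^2)"
      using zero_le_power2[of "s - s'"] zero_le_power2[of "c - c'"] zero_le_power2[of "s + s'"] zero_le_power2[of "c + c'"]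
      unfolding abs_le_iff abs_if by (auto simp: power2_eq_square algebra_simps)
    then show "\<bar>s * s' + c * c'\<bar> \<le> 1" using e by simp
  qed
  moreover have "\<bar>p - q\<bar> \<le> A + B" if "\<bar>p\<bar> \<le> A" "\<bar>q\<bar> \<le> B" for p q A B :: real using that by linarith
  ultimately have "\<bar>g * (s' * c - s * c')\<bar> \<le> b + b * 1" using flat(2) by metis
  moreover have "\<rho> / 2 * (\<bar>s - s'\<bar> / 2) \<le> \<bar>g\<bar> * \<bar>s' * c - s * c'\<bar>"
    using g arc_sine_lower[OF e s c] \<rho> by (intro mult_mono) auto
  ultimately have "\<rho> * \<bar>s - s'\<bar> \<le> 8 * b" by (simp add: abs_mult)
  then show ?thesis using \<rho> by (simp add: field_simps)
qed

text \<open>Internally tangent circles touch on the line of centres, in direction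
  \<open>-x / \<rho>\<close>. In the squared distance of \<open>(s, c)\<close> from this vector the
  main terms cancel, and only the form and the level remain, divided by \<open>\<rho>^2\<close> and
  \<rho>.\<close>

lemma tangent_direction:
  fixes x1 x2 \<rho> s c Rp \<kappa> \<delta> d :: real
  assumes e: "s^2 + c^2 = 1" and Rp: "1 \<le> Rp" and Q: "\<bar>x1^2 + x2^2 - \<rho>^2\<bar> \<le> \<kappa>"
    and d: "0 < d" "d \<le> 1" "d / 2 \<le> \<bar>\<rho>\<bar>" and \<delta>: "108 * \<delta> * d \<le> \<kappa>" "0 \<le> \<delta>"
    and lev: "\<bar>x1 * s + x2 * c + \<rho> + (x1^2 + x2^2 - \<rho>^2) / (2 * Rp)\<bar> \<le> 3 * \<delta>"
  shows "(s + x1 / \<rho>)^2 + (c + x2 / \<rho>)^2 \<le> 18 * \<kappa> / d^2"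
proof -
  have \<rho>0: "\<rho> \<noteq> 0" using d by auto
  define q where "q = x1^2 + x2^2 - \<rho>^2"
  define r where "r = x1 * s + x2 * c + \<rho> + q / (2 * Rp)"
  have \<kappa>0: "0 \<le> \<kappa>" using Q by linarith
  have "(s + x1 / \<rho>)^2 + (c + x2 / \<rho>)^2 = (s^2 + c^2) + (x1^2 + x2^2) / \<rho>^2 + 2 * (x1 * s + x2 * c) / \<rho>"
    unfolding power2_sum power_divide by (simp add: add_divide_distrib algebra_simps)
  also have "\<dots> = 1 + (q + \<rho>^2) / \<rho>^2 + 2 * (r - \<rho> - q / (2 * Rp)) / \<rho>"
    unfolding e r_def by (simp add: q_def)
  also have "\<dots> = q / \<rho>^2 + (2 * r - q / Rp) / \<rho>" using \<rho>0 Rp by (simp add: field_simps power2_eq_square)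
  also have "\<dots> \<le> \<bar>q\<bar> / \<rho>^2 + (2 * \<bar>r\<bar> + \<bar>q\<bar> / Rp) / \<bar>\<rho>\<bar>"
  proof (intro add_mono)
    show "q / \<rho>^2 \<le> \<bar>q\<bar> / \<rho>^2" by (intro divide_right_mono) auto
    have "(2 * r - q / Rp) / \<rho> \<le> \<bar>(2 * r - q / Rp) / \<rho>\<bar>" by (rule abs_ge_self)
    also have "\<dots> = \<bar>2 * r - q / Rp\<bar> / \<bar>\<rho>\<bar>" by (rule abs_divide)
    also have "\<dots> \<le> (2 * \<bar>r\<bar> + \<bar>q\<bar> / Rp) / \<bar>\<rho>\<bar>"
    proof (intro divide_right_mono)
      have "\<bar>2 * r - q / Rp\<bar> \<le> \<bar>2 * r\<bar> + \<bar>q / Rp\<bar>" by (rule abs_triangle_ineq4)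
      also have "\<dots> = 2 * \<bar>r\<bar> + \<bar>q\<bar> / Rp" using Rp by (simp add: abs_divide)
      finally show "\<bar>2 * r - q / Rp\<bar> \<le> 2 * \<bar>r\<bar> + \<bar>q\<bar> / Rp" .
    qed simp
    finally show "(2 * r - q / Rp) / \<rho> \<le> (2 * \<bar>r\<bar> + \<bar>q\<bar> / Rp) / \<bar>\<rho>\<bar>" .
  qed
  also have "\<dots> \<le> \<kappa> / (d/2)^2 + (6 * \<delta> + \<kappa>) / (d/2)"
  proof (rule add_mono; rule frac_le)
    show "(d/2)^2 \<le> \<rho>^2" using d by (simp add: abs_le_square_iff[symmetric])
    have "\<bar>q\<bar> / Rp \<le> \<kappa> / 1" using Q Rp unfolding q_def by (intro frac_le) auto
    moreover have "\<bar>r\<bar> \<le> 3 * \<delta>" using lev unfolding r_def q_def .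
    moreover have "2 * x + y \<le> 6 * \<delta> + \<kappa>" if "y \<le> \<kappa> / 1" "x \<le> 3 * \<delta>" for x y :: real using that by linarith
    ultimately show "2 * \<bar>r\<bar> + \<bar>q\<bar> / Rp \<le> 6 * \<delta> + \<kappa>" by blast
  qed (use Q d \<kappa>0 \<delta> in \<open>auto simp: q_def\<close>)
  also have "\<dots> = (4 * \<kappa> + 2 * \<kappa> * d + 12 * \<delta> * d) / d^2" using d by (simp add: field_simps power2_eq_square)
  also have "\<dots> \<le> 18 * \<kappa> / d^2"
  proof (intro divide_right_mono)
    have "\<kappa> * d \<le> \<kappa> * 1" using d \<kappa>0 by (intro mult_left_mono) auto
    then show "4 * \<kappa> + 2 * \<kappa> * d + 12 * \<delta> * d \<le> 18 * \<kappa>" using \<delta>(1) \<kappa>0 by (simp only: mult.assoc)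
  qed simp
  finally show ?thesis .
qed

lemma card_nat_diam:
  fixes S :: "nat set"
  assumes "finite S" "0 \<le> x" "\<And>i j. i \<in> S \<Longrightarrow> j \<in> S \<Longrightarrow> \<bar>real i - real j\<bar> \<le> x"
  shows "real (card S) \<le> x + 1"
proof (cases "S = {}")
  case False
  let ?a = "Min S" and ?b = "Max S"
  have m: "?a \<in> S" "?b \<in> S" "S \<subseteq> {?a..?b}" using assms(1) False by auto
  have "card S \<le> card {?a..?b}" using m(3) by (intro card_mono) auto
  also have "\<dots> = ?b - ?a + 1" using m by auto
  finally have "real (card S) \<le> real (?b - ?a + 1)" by (rule of_nat_mono)
  also have "\<dots> \<le> \<bar>real ?b - real ?a\<bar> + 1" by (simp add: of_nat_diff)
  finally show ?thesis using assms(3)[OF m(2,1)] by linarith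
qed (use assms in simp)

section \<open>Incidences at a single scale\<close>

text \<open>The points are equidistant in the sine, so a proportion of indices is an extent in the
  coordinate that the arc estimates bound. On this arc the cosine is at least 0.86, which places all
  touching directions in the chart of a tangency graph.\<close>

definition grid_sin :: "nat \<Rightarrow> nat \<Rightarrow> real" where "grid_sin J j = real j / real J - 1/2"
definition grid_cos :: "nat \<Rightarrow> nat \<Rightarrow> real" where "grid_cos J j = sqrt (1 - (grid_sin J j)^2)"

lemma grid_sin_bound: "j < J \<Longrightarrow> \<bar>grid_sin J j\<bar> \<le> 1/2"
proof -
  assume "j < J"
  then have "0 \<le> real j / real J" "real j / real J \<le> 1" by auto
  then show ?thesis unfolding grid_sin_def abs_le_iff by linarith
qed

lemma power2_sum_le: "(x + y)^2 \<le> 2 * x^2 + 2 * (y::real)^2"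
  using zero_le_power2[of "x - y"] by (simp add: power2_sum power2_diff)

lemma abs_le_of_power2_le: "x^2 \<le> b^2 \<Longrightarrow> 0 \<le> b \<Longrightarrow> \<bar>x\<bar> \<le> (b::real)"
  using abs_le_square_iff[of x b] by simp

lemma power2_le_of_abs_le: "\<bar>x\<bar> \<le> b \<Longrightarrow> x^2 \<le> (b::real)^2"
  using abs_le_square_iff[of x b] by simp

lemma power2_le_of_sum: "a^2 + b^2 \<le> c \<Longrightarrow> a^2 \<le> (c::real)"
  using zero_le_power2[of b] by linarith

lemma grid_sin_sq: "j < J \<Longrightarrow> (grid_sin J j)^2 \<le> 1/4"
  using grid_sin_bound[of j J] abs_le_square_iff[of "grid_sin J j" "1/2"] by (simp add: power_divide)

lemma grid_unit: "j < J \<Longrightarrow> (grid_sin J j)^2 + (grid_cos J j)^2 = 1"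
  using grid_sin_sq[of j J] unfolding grid_cos_def by simp

lemma grid_cos_lower: "j < J \<Longrightarrow> 86/100 \<le> grid_cos J j"
  using grid_sin_sq[of j J] unfolding grid_cos_def by (intro real_le_rsqrt) (simp add: power_divide)

text \<open>
  The set \<open>inc p i\<close> consists of (the indices of) those points of a grid on an arc of the circle \<open>p\<close> that are assigned to
  the disc \<open>i\<close>, and \<open>frost\<close> is the Frostman condition with exponent \<open>t\<close>.
\<close>
locale circle_scale =
  fixes P :: "'p set" and w X Y R :: "'p \<Rightarrow> real" and k J :: nat and B :: "'i set"
    and inc :: "'p \<Rightarrow> 'i \<Rightarrow> nat set" and z1 z2 :: "'i \<Rightarrow> real" and t CF :: real
  assumes finP: "finite P" and finB: "finite B"
    and w0: "p \<in> P \<Longrightarrow> 0 \<le> w p" and w1: "sum w P \<le> 1"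
    and box: "p \<in> P \<Longrightarrow> q \<in> P \<Longrightarrow> \<bar>X p - X q\<bar> \<le> 1/8 \<and> \<bar>Y p - Y q\<bar> \<le> 1/8 \<and> \<bar>R p - R q\<bar> \<le> 1/16"
    and Rr: "p \<in> P \<Longrightarrow> 1 \<le> R p \<and> R p \<le> 17/16"
    and k3: "3 \<le> k" and J: "2^k \<le> J"
    and inc_sub: "p \<in> P \<Longrightarrow> i \<in> B \<Longrightarrow> inc p i \<subseteq> {..<J}"
    and inc_disj: "p \<in> P \<Longrightarrow> i \<in> B \<Longrightarrow> i' \<in> B \<Longrightarrow> i \<noteq> i' \<Longrightarrow> inc p i \<inter> inc p i' = {}"
    and inc_near: "p \<in> P \<Longrightarrow> i \<in> B \<Longrightarrow> j \<in> inc p i \<Longrightarrow>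
      (X p + R p * grid_sin J j - z1 i)^2 + (Y p + R p * grid_cos J j - z2 i)^2 \<le> (1/2^k)^2"
    and frost: "j \<le> k \<Longrightarrow> p \<in> P \<Longrightarrow>
      sum w {q\<in>P. dcell j (X q, Y q, R q) = dcell j (X p, Y p, R p)} \<le> CF * (1/2^j) powr t"
    and t: "0 \<le> t" "t \<le> 1" and CF: "0 \<le> CF"
begin

abbreviation sg :: "nat \<Rightarrow> real" where "sg \<equiv> grid_sin J"
abbreviation cg :: "nat \<Rightarrow> real" where "cg \<equiv> grid_cos J"
abbreviation Q :: "'p \<Rightarrow> 'p \<Rightarrow> real" where "Q \<equiv> qd X Y R"
abbreviation cl :: "nat \<Rightarrow> 'p \<Rightarrow> int \<times> int \<times> int" where "cl j p \<equiv> dcell j (X p, Y p, R p)"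
definition \<delta> :: real where "\<delta> = 1/2^k"
definition fr :: "nat set \<Rightarrow> real" where "fr S = real (card S) / real J"
definition Wt :: "'p \<Rightarrow> 'i \<Rightarrow> real" where "Wt p i = fr (inc p i)"
text \<open>Small if the \<open>j\<close>-th point of the circle \<open>p\<close> is near the circle \<open>q\<close>.\<close>
definition lev :: "'p \<Rightarrow> 'p \<Rightarrow> nat \<Rightarrow> real" where
  "lev p q j = (X p - X q) * sg j + (Y p - Y q) * cg j + (R p - R q) + Q p q / (2 * R p)"
definition D2 :: "'p \<Rightarrow> 'p \<Rightarrow> real" where "D2 p q = (X p - X q)^2 + (Y p - Y q)^2 + (R p - R q)^2"

lemma \<delta>: "0 < \<delta>" "\<delta> \<le> 1/8"
proof -
  have "(2::real)^3 \<le> 2^k" using k3 by (intro power_increasing) auto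
  then show "0 < \<delta>" "\<delta> \<le> 1/8" unfolding \<delta>_def by (auto simp: field_simps)
qed

lemma J0: "0 < real J" "1 / real J \<le> \<delta>"
proof -
  have "(2::real)^k \<le> real J" using J by (metis of_nat_le_iff of_nat_numeral of_nat_power)
  moreover have "(0::real) < 2^k" by simp
  ultimately show "0 < real J" by linarith
  show "1 / real J \<le> \<delta>" unfolding \<delta>_def using \<open>2^k \<le> real J\<close> by (intro frac_le) auto
qed

lemma fr_nonneg: "0 \<le> fr S" unfolding fr_def by simp

lemma fr_mono: "S \<subseteq> T \<Longrightarrow> T \<subseteq> {..<J} \<Longrightarrow> fr S \<le> fr T"
  unfolding fr_def by (intro divide_right_mono) (auto intro!: card_mono intro: finite_subset)

lemma fr_Un_le: "fr (S \<union> T) \<le> fr S + fr T"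
proof -
  have "real (card (S \<union> T)) \<le> real (card S + card T)" using card_Un_le by (intro of_nat_mono)
  then show ?thesis unfolding fr_def using J0 by (simp add: add_divide_distrib[symmetric] divide_right_mono)
qed

lemma fr_le_1: "S \<subseteq> {..<J} \<Longrightarrow> fr S \<le> 1"
  using fr_mono[of S "{..<J}"] J0 unfolding fr_def by simp

text \<open>A set of consecutive indices has one element more than steps; the summand \<delta> pays
  for it, since the spacing \<open>1 / J\<close> is at most \<delta>.\<close>

lemma fr_diam:
  assumes S: "S \<subseteq> {..<J}" and x: "0 \<le> x" and "\<And>j j'. j \<in> S \<Longrightarrow> j' \<in> S \<Longrightarrow> \<bar>sg j - sg j'\<bar> \<le> x"
  shows "fr S \<le> x + \<delta>"
proof -
  have "\<bar>real j - real j'\<bar> \<le> x * real J" if "j \<in> S" "j' \<in> S" for j j'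
  proof -
    have "sg j - sg j' = (real j - real j') / real J" unfolding grid_sin_def by (simp add: diff_divide_distrib)
    then have "\<bar>real j - real j'\<bar> / real J \<le> x" using assms(3)[OF that] by (simp add: abs_divide)
    then show ?thesis using J0 by (simp add: field_simps)
  qed
  then have "real (card S) \<le> x * real J + 1" using S x by (intro card_nat_diam) (auto intro: finite_subset)
  then have "fr S \<le> (x * real J + 1) / real J" unfolding fr_def by (intro divide_right_mono) auto
  also have "\<dots> = x + 1 / real J" using J0 by (simp add: add_divide_distrib)
  finally show ?thesis using J0 by linarith
qed

lemma inc_fin: "p \<in> P \<Longrightarrow> i \<in> B \<Longrightarrow> finite (inc p i)"
  using inc_sub finite_subset by (metis finite_lessThan)

lemma Wt_nonneg: "0 \<le> Wt p i" unfolding Wt_def by (rule fr_nonneg)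

lemma Wt_sum:
  assumes "p \<in> P" "D \<subseteq> B"
  shows "(\<Sum>i\<in>D. Wt p i) = fr (\<Union>i\<in>D. inc p i)"
proof -
  have "finite D" using assms finB finite_subset by blast
  then have "card (\<Union>i\<in>D. inc p i) = (\<Sum>i\<in>D. card (inc p i))"
    using assms inc_fin inc_disj by (intro card_UN_disjoint) (auto simp: subset_iff)
  then show ?thesis unfolding Wt_def fr_def by (simp add: sum_divide_distrib)
qed

lemma power2_diff_sum_le:
  fixes x :: real
  assumes "a^2 + b^2 \<le> x^2" "c^2 + d^2 \<le> (x::real)^2"
  shows "(a - c)^2 + (b - d)^2 \<le> (2 * x)^2"
  using assms zero_le_power2[of "a + c"] zero_le_power2[of "b + d"]
  by (simp add: power2_eq_square algebra_simps)

lemma inc_pair: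
  assumes "p \<in> P" "q \<in> P" "i \<in> B" "j \<in> inc p i" "j' \<in> inc q i"
  shows "((X p - X q) + R p * sg j - R q * sg j')^2 + ((Y p - Y q) + R p * cg j - R q * cg j')^2 \<le> (2 * \<delta>)^2"
proof -
  have "((X p + R p * sg j - z1 i) - (X q + R q * sg j' - z1 i))^2 + ((Y p + R p * cg j - z2 i) - (Y q + R q * cg j' - z2 i))^2 \<le> (2 * \<delta>)^2"
    using inc_near[OF assms(1,3,4)] inc_near[OF assms(2,3,5)] unfolding \<delta>_def by (rule power2_diff_sum_le)
  then show ?thesis by (simp add: algebra_simps)
qed

lemma Wt_le: assumes "p \<in> P" "i \<in> B" shows "Wt p i \<le> 3 * \<delta>"
proof -
  have "\<bar>sg j - sg j'\<bar> \<le> 2 * \<delta>" if "j \<in> inc p i" "j' \<in> inc p i" for j j'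
  proof -
    have "(R p * (sg j - sg j'))^2 \<le> (2 * \<delta>)^2"
      using inc_pair[OF assms(1) assms(1) assms(2) that] power2_le_of_sum by (simp add: right_diff_distrib)
    then have "\<bar>R p * (sg j - sg j')\<bar> \<le> 2 * \<delta>" using \<delta> by (intro abs_le_of_power2_le) auto
    then have "R p * \<bar>sg j - sg j'\<bar> \<le> 2 * \<delta>" using Rr[OF assms(1)] by (simp add: abs_mult)
    moreover have "1 * \<bar>sg j - sg j'\<bar> \<le> R p * \<bar>sg j - sg j'\<bar>" using Rr[OF assms(1)] by (intro mult_right_mono) auto
    ultimately show ?thesis unfolding mult_1_left by (rule order_trans[rotated])
  qed
  then have "Wt p i \<le> 2 * \<delta> + \<delta>" unfolding Wt_def using inc_sub[OF assms] \<delta> by (intro fr_diam) auto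
  then show ?thesis by simp
qed

lemma lev_le:
  assumes "p \<in> P" "q \<in> P" "i \<in> B" "j \<in> inc p i" "inc q i \<noteq> {}"
  shows "\<bar>lev p q j\<bar> \<le> 3 * \<delta>"
proof -
  obtain j' where j': "j' \<in> inc q i" using assms by auto
  have l: "j < J" "j' < J" using inc_sub assms j' by auto
  show ?thesis unfolding lev_def qd_def
    by (rule near_circle_inner[OF grid_unit[OF l(1)] grid_unit[OF l(2)] _ _ _ _ _ inc_pair[OF assms(1-4) j']])
      (use Rr[OF assms(1)] Rr[OF assms(2)] \<delta> in auto)
qed

lemma box_Q:
  assumes "p \<in> P" "q \<in> P"
  shows "D2 p q \<le> 1/16" "\<bar>Q p q\<bar> \<le> D2 p q" "\<bar>R p - R q\<bar> \<le> 1/16"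
proof -
  have sq: "x^2 \<le> b^2" if "\<bar>x\<bar> \<le> b" for x b :: real using that abs_le_square_iff[of x b] by simp
  have "(X p - X q)^2 \<le> (1/8)^2" "(Y p - Y q)^2 \<le> (1/8)^2" "(R p - R q)^2 \<le> (1/16)^2" using box[OF assms] sq by auto
  then show "D2 p q \<le> 1/16" unfolding D2_def by (simp add: power_divide)
  show "\<bar>Q p q\<bar> \<le> D2 p q" unfolding D2_def qd_def
    using zero_le_power2[of "X p - X q"] zero_le_power2[of "Y p - Y q"] zero_le_power2[of "R p - R q"] by linarith
  show "\<bar>R p - R q\<bar> \<le> 1/16" using box[OF assms] by auto
qed

lemma D2_comm: "D2 p q = D2 q p" unfolding D2_def by (simp add: power2_commute)

section \<open>Overlap of two circles\<close>

text \<open>Where the circles are close, the level is \<open>g = - \<rho> - h\<close> with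
  controlled \<open>h\<close>, and \<open>f^2 + g^2 = x1^2 + x2^2\<close> becomes
  \<open>f^2 = Q - 2 * \<rho> * h - h^2\<close>. So the squared angular derivative is
  \<open>Q\<close> up to an error of at most half its size. In particular a very negative
  \<open>Q\<close>, as for nested circles, excludes close points.\<close>

lemma grad_sq:
  fixes p q :: 'p and j :: nat
  assumes pq: "p \<in> P" "q \<in> P" "j < J" and d: "\<delta> \<le> d" "D2 p q \<le> 4 * d^2"
    and lev: "\<bar>lev p q j\<bar> \<le> 3 * \<delta>" and Q: "108 * \<delta> * d \<le> \<bar>Q p q\<bar>"
  shows "\<bar>Q p q\<bar> / 2 \<le> (- (X p - X q) * cg j + (Y p - Y q) * sg j)^2 \<and> 0 < Q p q"
proof -
  define x1 x2 \<rho> s c where "x1 = X p - X q" and "x2 = Y p - Y q" and "\<rho> = R p - R q" and "s = sg j" and "c = cg j"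
  define f g where "f = - x1 * c + x2 * s" and "g = x1 * s + x2 * c"
  have e: "s^2 + c^2 = 1" unfolding s_def c_def by (rule grid_unit[OF pq(3)])
  have fg: "f^2 + g^2 = x1^2 + x2^2"
  proof -
    have "f^2 + g^2 = (x1^2 + x2^2) * (s^2 + c^2)" unfolding f_def g_def by (simp add: power2_eq_square algebra_simps)
    then show ?thesis using e by simp
  qed
  define q0 where "q0 = Q p q"
  have q0: "q0 = x1^2 + x2^2 - \<rho>^2" unfolding q0_def qd_def x1_def x2_def \<rho>_def ..
  define h where "h = q0 / (2 * R p) - lev p q j"
  have g: "g = - \<rho> - h" unfolding h_def lev_def q0_def g_def x1_def x2_def \<rho>_def s_def c_def by simp
  have R: "1 \<le> R p" using Rr pq by auto
  have qa: "\<bar>q0\<bar> \<le> 1/16" "\<bar>\<rho>\<bar> \<le> 1/16" using box_Q[OF pq(1,2)] unfolding q0_def \<rho>_def by auto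
  have "\<bar>q0 / (2 * R p)\<bar> \<le> \<bar>q0\<bar> / 2" unfolding abs_divide using R by (intro frac_le) auto
  moreover have "\<bar>x - y\<bar> \<le> a + b" if "\<bar>x\<bar> \<le> a" "\<bar>y\<bar> \<le> b" for x y a b :: real using that by linarith
  ultimately have h: "\<bar>h\<bar> \<le> \<bar>q0\<bar> / 2 + 3 * \<delta>" unfolding h_def using lev by blast
  have "\<rho>^2 \<le> 4 * d^2" using d(2) zero_le_power2[of "X p - X q"] zero_le_power2[of "Y p - Y q"] unfolding D2_def \<rho>_def by linarith
  then have "\<rho>^2 \<le> (2 * d)^2" by (simp add: power_mult_distrib)
  then have \<rho>d: "\<bar>\<rho>\<bar> \<le> 2 * d" using \<delta> d by (intro abs_le_of_power2_le) auto
  have "\<bar>2 * \<rho> * h\<bar> = \<bar>\<rho>\<bar> * (2 * \<bar>h\<bar>)" by (simp add: abs_mult)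
  also have "\<dots> \<le> \<bar>\<rho>\<bar> * (\<bar>q0\<bar> + 6 * \<delta>)" using h by (intro mult_left_mono) auto
  also have "\<dots> = \<bar>\<rho>\<bar> * \<bar>q0\<bar> + \<bar>\<rho>\<bar> * (6 * \<delta>)" by (simp add: distrib_left)
  also have "\<dots> \<le> 1/16 * \<bar>q0\<bar> + (2 * d) * (6 * \<delta>)" using qa \<rho>d \<delta> by (intro add_mono mult_right_mono) auto
  finally have t1: "\<bar>2 * \<rho> * h\<bar> \<le> 1/16 * \<bar>q0\<bar> + 12 * (\<delta> * d)" by (simp add: mult_ac)
  have "h^2 \<le> (\<bar>q0\<bar> / 2 + 3 * \<delta>)^2" using h abs_le_square_iff[of h "\<bar>q0\<bar> / 2 + 3 * \<delta>"] \<delta> by simp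
  also have "\<dots> \<le> 2 * (\<bar>q0\<bar> / 2)^2 + 2 * (3 * \<delta>)^2" by (rule power2_sum_le)
  also have "\<dots> = \<bar>q0\<bar> * \<bar>q0\<bar> / 2 + 18 * (\<delta> * \<delta>)" by (simp add: power2_eq_square)
  also have "\<dots> \<le> \<bar>q0\<bar> * (1/16) / 2 + 18 * (\<delta> * d)"
    using qa \<delta> d by (intro add_mono divide_right_mono mult_left_mono) auto
  finally have t2: "h^2 \<le> \<bar>q0\<bar> / 32 + 18 * (\<delta> * d)" by simp
  have f: "f^2 = q0 - 2 * \<rho> * h - h^2"
  proof -
    have "g^2 = \<rho>^2 + 2 * \<rho> * h + h^2" unfolding g by (simp add: power2_eq_square algebra_simps)
    then show ?thesis using fg q0 by linarith
  qed
  have t3: "108 * (\<delta> * d) \<le> \<bar>q0\<bar>" using Q unfolding q0_def by (simp add: mult.assoc)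
  have fin: "\<bar>q\<bar> / 2 \<le> f2 \<and> 0 < q" if "f2 = q - b - h2" "0 \<le> f2" "\<bar>b\<bar> \<le> 1/16 * \<bar>q\<bar> + 12 * z" "0 \<le> h2" "h2 \<le> \<bar>q\<bar> / 32 + 18 * z" "108 * z \<le> \<bar>q\<bar>" "0 < z"
    for q f2 b h2 z :: real using that by linarith
  have "0 < \<delta> * d" using \<delta> d by simp
  with fin[OF f zero_le_power2 t1 zero_le_power2 t2 t3] show ?thesis
    unfolding f_def s_def c_def x1_def x2_def q0_def by blast
qed

text \<open>The set splits into two steep parts, one for each sign of the derivative and each of
  length of order \<open>\<delta> / sqrt \<kappa>\<close>, and a flat part. If \<kappa> is
  comparable to \<open>\<bar>Q\<bar>\<close>, the flat part is empty by \<open>grad_sq\<close>. At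
  the floor \<open>\<kappa> = 108 * \<delta> * d\<close> its length is of order
  \<open>sqrt \<kappa> / d\<close>, which is again of order
  \<open>\<delta> / sqrt \<kappa>\<close>.\<close>

lemma near_frac:
  assumes pq: "p \<in> P" "q \<in> P" and d: "d^2 \<le> D2 p q" "D2 p q \<le> 4 * d^2" "2^15 * \<delta> \<le> d"
    and \<kappa>: "\<bar>Q p q\<bar> \<le> \<kappa>" "\<kappa> = 108 * \<delta> * d \<or> 216 * \<delta> * d \<le> \<kappa> \<and> \<kappa> < 2 * \<bar>Q p q\<bar>"
    and S: "S \<subseteq> {..<J}" "\<And>j. j \<in> S \<Longrightarrow> \<bar>lev p q j\<bar> \<le> 3 * \<delta>"
  shows "fr S \<le> 900 * \<delta> / sqrt \<kappa>"
proof -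
  define x1 x2 where "x1 = X p - X q" and "x2 = Y p - Y q"
  define f where "f j = - x1 * cg j + x2 * sg j" for j
  \<comment> \<open>Away from the floor, \<open>grad_sq\<close> and
    \<open>\<kappa> < 2 * \<bar>Q p q\<bar>\<close> make the squared derivative on close points
    larger than \<open>\<kappa> / 4 = b^2\<close>.\<close>
  define b where "b = sqrt \<kappa> / 2"
  have d0: "0 < d" "\<delta> \<le> d" using d(3) \<delta> by auto
  have dd: "0 < \<delta> * d" using \<delta> d0 by simp
  have \<kappa>0: "0 < \<kappa>" using \<kappa>(2) dd by (auto simp: mult.assoc)
  then have b0: "0 < b" "b^2 = \<kappa> / 4" unfolding b_def by (auto simp: power_divide)
  have d4: "d \<le> 1/4" using power2_le_imp_le[of d "1/4"] d(1) box_Q(1)[OF pq] by (simp add: power_divide)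
  have small: "108 * (\<delta> * d) \<le> d^2 / 4"
  proof -
    have "2^15 * \<delta> * d \<le> d * d" using d(3) d0 by (intro mult_right_mono) auto
    then show ?thesis using dd by (simp add: power2_eq_square)
  qed
  have lv: "\<bar>(x1 * sg i + x2 * cg i) - (x1 * sg j + x2 * cg j)\<bar> \<le> 6 * \<delta>" if "i \<in> S" "j \<in> S" for i j
  proof -
    have "\<bar>a - b\<bar> \<le> 6 * \<delta>" if "\<bar>a + r + q\<bar> \<le> 3 * \<delta>" "\<bar>b + r + q\<bar> \<le> 3 * \<delta>" for a b r q :: real using that by linarith
    from this[OF S(2)[OF that(1), unfolded lev_def] S(2)[OF that(2), unfolded lev_def]]
    show ?thesis unfolding x1_def x2_def .
  qed
  define S1 S2 S3 where "S1 = {j\<in>S. b \<le> f j}" and "S2 = {j\<in>S. b \<le> - f j}" and "S3 = {j\<in>S. \<bar>f j\<bar> < b}"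
  have "fr S1 \<le> 6 * \<delta> / b + \<delta>"
  proof (rule fr_diam)
    fix i j assume ij: "i \<in> S1" "j \<in> S1"
    then have "i < J" "j < J" using S(1) unfolding S1_def by auto
    note g = grid_unit[OF this(1)] grid_unit[OF this(2)]
    show "\<bar>sg i - sg j\<bar> \<le> 6 * \<delta> / b"
      by (rule steep_level_set[OF g b0(1) _ _ lv]) (use ij in \<open>auto simp: S1_def f_def\<close>)
  qed (use S(1) b0 \<delta> in \<open>auto simp: S1_def\<close>)
  moreover have "fr S2 \<le> 6 * \<delta> / b + \<delta>"
  proof (rule fr_diam)
    fix i j assume ij: "i \<in> S2" "j \<in> S2"
    then have "i < J" "j < J" using S(1) unfolding S2_def by auto
    note g = grid_unit[OF this(1)] grid_unit[OF this(2)]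
    have nl: "\<bar>(- x1 * sg i + - x2 * cg i) - (- x1 * sg j + - x2 * cg j)\<bar> \<le> 6 * \<delta>"
    proof -
      have "\<bar>(- x1 * sg i + - x2 * cg i) - (- x1 * sg j + - x2 * cg j)\<bar> = \<bar>(x1 * sg i + x2 * cg i) - (x1 * sg j + x2 * cg j)\<bar>"
        by (simp add: abs_if)
      then show ?thesis using lv[of i j] ij unfolding S2_def by simp
    qed
    show "\<bar>sg i - sg j\<bar> \<le> 6 * \<delta> / b"
      by (rule steep_level_set[OF g b0(1) _ _ nl]) (use ij in \<open>auto simp: S2_def f_def\<close>)
  qed (use S(1) b0 \<delta> in \<open>auto simp: S2_def\<close>)
  moreover have "fr S3 \<le> 864 * \<delta> / sqrt \<kappa> + \<delta>"
  proof (cases "\<kappa> = 108 * \<delta> * d")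
    case True
    have "fr S3 \<le> 8 * b / (d/2) + \<delta>"
    proof (rule fr_diam)
      fix i j assume ij: "i \<in> S3" "j \<in> S3"
      then have l: "i < J" "j < J" using S(1) unfolding S3_def by auto
      note g = grid_unit[OF l(1)] grid_unit[OF l(2)]
      have c: "0 \<le> cg i" "0 \<le> cg j" using grid_cos_lower[OF l(1)] grid_cos_lower[OF l(2)] by auto
      have fl: "\<bar>- x1 * cg i + x2 * sg i\<bar> \<le> b" "\<bar>- x1 * cg j + x2 * sg j\<bar> \<le> b"
        using ij unfolding S3_def f_def by auto
      have \<kappa>': "\<kappa> \<le> d^2 / 4" using small True by (simp only: mult.assoc)
      have "(2 * b)^2 \<le> (d/2)^2" using \<kappa>' b0(2) by (simp add: power_mult_distrib power_divide)
      then have b2: "2 * b \<le> d/2" by (rule power2_le_imp_le) (use d0 in auto)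
      have xd: "(d/2)^2 \<le> x1^2 + x2^2"
      proof -
        have half: "d^2 / 4 \<le> a" if "d^2 \<le> a + r" "\<bar>a - r\<bar> \<le> d^2 / 4" for a r :: real using that zero_le_power2[of d] by linarith
        have Q4: "\<bar>Q p q\<bar> \<le> d^2 / 4" using \<kappa>(1) \<kappa>' by linarith
        have "d^2 / 4 \<le> x1^2 + x2^2"
          unfolding x1_def x2_def by (rule half[OF d(1)[unfolded D2_def] Q4[unfolded qd_def]])
        then show ?thesis by (simp add: power_divide)
      qed
      show "\<bar>sg i - sg j\<bar> \<le> 8 * b / (d/2)"
        by (rule flat_level_set[OF g grid_sin_bound[OF l(1)] grid_sin_bound[OF l(2)] c fl _ b2 xd]) (use d0 in auto)
    qed (use S(1) b0 d0 in \<open>auto simp: S3_def\<close>)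
    also have "8 * b / (d/2) = 864 * \<delta> / sqrt \<kappa>"
    proof -
      have gen: "8 * (r / 2) / (d / 2) = 864 * \<delta> / r" if "r * r = 108 * \<delta> * d" "0 < r" "0 < d" for r d :: real
        using that by (simp add: frac_eq_eq)
      have "sqrt \<kappa> * sqrt \<kappa> = 108 * \<delta> * d" using \<kappa>0 True by simp
      then show ?thesis unfolding b_def using d0 \<kappa>0 by (intro gen) auto
    qed
    finally show ?thesis .
  next
    case False
    then have \<kappa>': "216 * \<delta> * d \<le> \<kappa>" "\<kappa> < 2 * \<bar>Q p q\<bar>" using \<kappa>(2) by auto
    have "S3 = {}"
    proof (rule ccontr)
      assume "S3 \<noteq> {}"
      then obtain j where j: "j \<in> S" "\<bar>f j\<bar> < b" unfolding S3_def by auto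
      have Qb: "108 * \<delta> * d \<le> \<bar>Q p q\<bar>" using \<kappa>' by simp
      have "\<bar>Q p q\<bar> / 2 \<le> (f j)^2"
        using grad_sq[OF pq _ d0(2) d(2) S(2)[OF j(1)] Qb] S(1) j(1) unfolding f_def x1_def x2_def by auto
      moreover have "(f j)^2 \<le> b^2" using j(2) by (intro power2_le_of_abs_le) simp
      ultimately show False using b0(2) \<kappa>'(2) by linarith
    qed
    then show ?thesis unfolding fr_def using \<delta> \<kappa>0 by simp
  qed
  moreover have "fr S \<le> fr S1 + fr S2 + fr S3"
  proof -
    have "S = (S1 \<union> S2) \<union> S3" unfolding S1_def S2_def S3_def by (auto simp: abs_if)
    then have "fr S \<le> fr (S1 \<union> S2) + fr S3" using fr_Un_le by metis
    then show ?thesis using fr_Un_le[of S1 S2] by linarith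
  qed
  moreover have "\<delta> \<le> \<delta> / sqrt \<kappa>"
  proof -
    have "\<kappa> \<le> 1"
      using \<kappa>(2)
    proof
      assume "\<kappa> = 108 * \<delta> * d"
      then have "\<kappa> \<le> d^2 / 4" using small by (simp only: mult.assoc)
      moreover have "d^2 \<le> 1^2" using d4 d0 by (intro power_mono) auto
      ultimately show ?thesis by simp
    qed (use box_Q(1,2)[OF pq] in linarith)
    then have "sqrt \<kappa> \<le> 1" by simp
    then have "\<delta> / 1 \<le> \<delta> / sqrt \<kappa>" using \<kappa>0 \<delta> by (intro divide_left_mono) auto
    then show ?thesis by simp
  qed
  moreover have "6 * \<delta> / b = 12 * (\<delta> / sqrt \<kappa>)" unfolding b_def by simp
  ultimately show ?thesis using divide_nonneg_nonneg[of \<delta> "sqrt \<kappa>"] \<delta> \<kappa>0 by simp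
qed

text \<open>The contribution of one pair of circles to the energy, which is the sum over the discs
  in \<open>E\<close> of the squared average share.\<close>

definition Wp :: "'i set \<Rightarrow> 'p \<Rightarrow> 'p \<Rightarrow> real" where "Wp E p q = (\<Sum>i\<in>E. Wt p i * Wt q i)"

lemma Wp_comm: "Wp E p q = Wp E q p" unfolding Wp_def by (simp add: mult.commute)

text \<open>A disc counts only if \<open>q\<close> meets it too, and then all points of
  \<open>p\<close> assigned to it are near \<open>q\<close>. The factor for \<open>q\<close> is
  bounded by \<open>3 * \<delta>\<close>, and the shares of \<open>p\<close> add up by
  disjointness.\<close>

lemma Wp_le_fr:
  assumes "p \<in> P" "q \<in> P" "E \<subseteq> B"
  shows "Wp E p q \<le> 3 * \<delta> * fr (\<Union>i\<in>{i\<in>E. inc q i \<noteq> {}}. inc p i)"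
proof -
  let ?D = "{i\<in>E. inc q i \<noteq> {}}"
  have fE: "finite E" using assms finB finite_subset by blast
  have "Wp E p q = (\<Sum>i\<in>?D. Wt p i * Wt q i)"
    unfolding Wp_def using fE by (intro sum.mono_neutral_right) (auto simp: Wt_def fr_def)
  also have "\<dots> \<le> (\<Sum>i\<in>?D. Wt p i * (3 * \<delta>))"
    using assms by (intro sum_mono mult_left_mono Wt_le Wt_nonneg) auto
  also have "\<dots> = 3 * \<delta> * (\<Sum>i\<in>?D. Wt p i)" by (simp add: sum_distrib_left mult.commute)
  also have "(\<Sum>i\<in>?D. Wt p i) = fr (\<Union>i\<in>?D. inc p i)" using assms by (intro Wt_sum) auto
  finally show ?thesis .
qed

lemma Wp_le_near:
  assumes "p \<in> P" "q \<in> P" "E \<subseteq> B"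
  shows "Wp E p q \<le> 3 * \<delta>"
proof -
  have "fr (\<Union>i\<in>{i\<in>E. inc q i \<noteq> {}}. inc p i) \<le> 1" using inc_sub[OF assms(1)] assms(3) by (intro fr_le_1) blast
  then have "3 * \<delta> * fr (\<Union>i\<in>{i\<in>E. inc q i \<noteq> {}}. inc p i) \<le> 3 * \<delta> * 1" using \<delta> by (intro mult_left_mono) auto
  then show ?thesis using Wp_le_fr[OF assms] by linarith
qed

lemma Wp_le:
  assumes pq: "p \<in> P" "q \<in> P" and E: "E \<subseteq> B" and d: "d^2 \<le> D2 p q" "D2 p q \<le> 4 * d^2" "2^15 * \<delta> \<le> d"
    and \<kappa>: "\<bar>Q p q\<bar> \<le> \<kappa>" "\<kappa> = 108 * \<delta> * d \<or> 216 * \<delta> * d \<le> \<kappa> \<and> \<kappa> < 2 * \<bar>Q p q\<bar>"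
  shows "Wp E p q \<le> 2700 * \<delta>^2 / sqrt \<kappa>"
proof -
  have "fr (\<Union>i\<in>{i\<in>E. inc q i \<noteq> {}}. inc p i) \<le> 900 * \<delta> / sqrt \<kappa>"
  proof (rule near_frac[OF pq d \<kappa>])
    show "(\<Union>i\<in>{i\<in>E. inc q i \<noteq> {}}. inc p i) \<subseteq> {..<J}" using inc_sub[OF pq(1)] E by blast
    fix j assume "j \<in> (\<Union>i\<in>{i\<in>E. inc q i \<noteq> {}}. inc p i)"
    then show "\<bar>lev p q j\<bar> \<le> 3 * \<delta>" using lev_le[OF pq] E by blast
  qed
  then have "3 * \<delta> * fr (\<Union>i\<in>{i\<in>E. inc q i \<noteq> {}}. inc p i) \<le> 3 * \<delta> * (900 * \<delta> / sqrt \<kappa>)"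
    using \<delta> by (intro mult_left_mono) auto
  then show ?thesis using Wp_le_fr[OF pq E] by (simp add: power2_eq_square)
qed

lemma ball_mass:
  assumes p: "p \<in> P" and j: "j \<le> k" and b: "0 \<le> b"
    and S: "S \<subseteq> P" "\<And>q. q \<in> S \<Longrightarrow> \<bar>X q - X p\<bar> \<le> b / 2^j \<and> \<bar>Y q - Y p\<bar> \<le> b / 2^j \<and> \<bar>R q - R p\<bar> \<le> b / 2^j"
  shows "sum w S \<le> (2 * b + 5)^3 * (CF * (1/2^j) powr t)"
proof -
  have fS: "finite S" using S finP finite_subset by blast
  let ?T = "(\<lambda>q. (X q, Y q, R q)) ` S"
  have "sum w S = (\<Sum>c\<in>cl j ` S. sum w {q\<in>S. cl j q = c})"
    using sum.group[OF fS finite_imageI[OF fS] subset_refl, of w "cl j"] by simp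
  also have "\<dots> \<le> (\<Sum>c\<in>cl j ` S. CF * (1/2^j) powr t)"
  proof (rule sum_mono)
    fix c assume "c \<in> cl j ` S"
    then obtain q where q: "q \<in> S" "c = cl j q" by auto
    have "sum w {q\<in>S. cl j q = c} \<le> sum w {q'\<in>P. cl j q' = cl j q}"
      using S(1) finP w0 unfolding q(2) by (intro sum_mono2) auto
    also have "\<dots> \<le> CF * (1/2^j) powr t" using frost[OF j] S(1) q(1) by auto
    finally show "sum w {q\<in>S. cl j q = c} \<le> CF * (1/2^j) powr t" .
  qed
  also have "\<dots> = real (card (cl j ` S)) * (CF * (1/2^j) powr t)" by simp
  also have "\<dots> \<le> (2 * b + 5)^3 * (CF * (1/2^j) powr t)"
  proof (rule mult_right_mono)
    have "cl j ` S = dcell j ` ?T" by (simp add: image_image)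
    moreover have "real (card (dcell j ` ?T)) \<le> (2 * b + 5)^3"
      using S(2) fS b by (intro card_dcell_close[where ?x0.0 = "X p" and ?y0.0 = "Y p" and ?z0.0 = "R p"]) auto
    ultimately show "real (card (cl j ` S)) \<le> (2 * b + 5)^3" by simp
  qed (use CF in simp)
  finally show ?thesis .
qed

end

section \<open>Localisation to one distance and the tangential case\<close>

fun near_cell :: "int \<times> int \<times> int \<Rightarrow> int \<times> int \<times> int \<Rightarrow> bool" where
  "near_cell (a,b,c) (a',b',c') \<longleftrightarrow> \<bar>a - a'\<bar> \<le> 2 \<and> \<bar>b - b'\<bar> \<le> 2 \<and> \<bar>c - c'\<bar> \<le> 2"

lemma near_cell_commute: "near_cell c c' \<longleftrightarrow> near_cell c' c"
  by (cases c; cases c') auto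

lemma near_cell_refl: "near_cell c c" by (cases c) auto

lemma card_near_cell: "finite {c'. near_cell c c'}" "card {c'. near_cell c c'} \<le> 125"
proof -
  obtain a b e where c: "c = (a,b,e)" by (cases c)
  let ?S = "{a-2..a+2} \<times> {b-2..b+2} \<times> {e-2..e+2}"
  have sub: "{c'. near_cell c c'} \<subseteq> ?S" unfolding c by auto
  have "card ?S = 125" by (simp add: card_cartesian_product)
  then show "finite {c'. near_cell c c'}" "card {c'. near_cell c c'} \<le> 125"
    using sub card_mono[OF _ sub] finite_subset[OF sub] by auto
qed

lemma near_cell_dcell:
  assumes "\<bar>x - x'\<bar> < 2 / 2^j" "\<bar>y - y'\<bar> < 2 / 2^j" "\<bar>z - z'\<bar> < 2 / 2^j"
  shows "near_cell (dcell j (x,y,z)) (dcell j (x',y',z'))"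
proof -
  have "\<bar>\<lfloor>2^j * s\<rfloor> - \<lfloor>2^j * t\<rfloor>\<bar> \<le> 2" if "\<bar>s - t\<bar> < 2 / 2^j" for s t :: real
  proof -
    have "\<bar>2^j * s - 2^j * t\<bar> = 2^j * \<bar>s - t\<bar>" by (simp add: abs_mult right_diff_distrib[symmetric])
    also have "\<dots> < 2^j * (2 / 2^j)" using that by (intro mult_strict_left_mono) auto
    finally have "\<bar>2^j * s - 2^j * t\<bar> < 2" by simp
    then show ?thesis by linarith
  qed
  then show ?thesis using assms unfolding dcell_def by simp
qed

lemma near_cell_imp_close:
  assumes "near_cell (dcell j (x,y,z)) (dcell j (x',y',z'))"
  shows "\<bar>x - x'\<bar> \<le> 3 / 2^j" "\<bar>y - y'\<bar> \<le> 3 / 2^j" "\<bar>z - z'\<bar> \<le> 3 / 2^j"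
proof -
  have "\<bar>s - t\<bar> \<le> 3 / 2^j" if "\<bar>\<lfloor>2^j * s\<rfloor> - \<lfloor>2^j * t\<rfloor>\<bar> \<le> 2" for s t :: real
  proof -
    have "\<bar>2^j * s - 2^j * t\<bar> \<le> 3" using that by linarith
    moreover have "\<bar>2^j * s - 2^j * t\<bar> = 2^j * \<bar>s - t\<bar>" by (simp add: abs_mult right_diff_distrib[symmetric])
    ultimately show ?thesis by (simp add: field_simps)
  qed
  then show "\<bar>x - x'\<bar> \<le> 3 / 2^j" "\<bar>y - y'\<bar> \<le> 3 / 2^j" "\<bar>z - z'\<bar> \<le> 3 / 2^j" using assms unfolding dcell_def by auto
qed

text \<open>The masses \<mu> of the neighbourhoods of all cells add up to at most 125, so some cell
  has at least the share \<open>\<mu> / 125\<close> of the total. When the weights near this cell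
  are normalised by \<mu>, the pair sum is divided by \<open>\<mu>^2\<close> and thus exceeds the
  original one by a factor \<open>1 / (125 * \<mu>)\<close> at least.\<close>

lemma localise_pairs:
  fixes w :: "'p \<Rightarrow> real" and cl :: "'p \<Rightarrow> int \<times> int \<times> int" and F :: "'p \<Rightarrow> real"
  assumes P: "finite P" "\<And>p. p \<in> P \<Longrightarrow> 0 \<le> w p" "sum w P \<le> 1" and F: "\<And>p. p \<in> P \<Longrightarrow> 0 \<le> F p"
    and T: "0 < (\<Sum>u\<in>P. w u * F u)"
  obtains c where "c \<in> cl ` P" "0 < sum w {b\<in>P. near_cell c (cl b)}"
    "(\<Sum>u\<in>P. w u * F u) * sum w {b\<in>P. near_cell c (cl b)} \<le> 125 * (\<Sum>u\<in>{u\<in>P. cl u = c}. w u * F u)"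
proof -
  define S where "S c = (\<Sum>u\<in>{u\<in>P. cl u = c}. w u * F u)" for c
  define \<mu> where "\<mu> c = sum w {b\<in>P. near_cell c (cl b)}" for c
  define T0 where "T0 = (\<Sum>u\<in>P. w u * F u)"
  \<comment> \<open>Dropping cells without contribution ensures that the selected neighbourhood has
    positive mass, by which the weights are divided later.\<close>
  define C where "C = {c\<in>cl ` P. 0 < S c}"
  have S0: "0 \<le> S c" for c unfolding S_def using P F by (intro sum_nonneg) auto
  have "T0 = sum S (cl ` P)" unfolding T0_def S_def by (rule sum.group[OF P(1) finite_imageI[OF P(1)] subset_refl, symmetric])
  also have "\<dots> = sum S C" unfolding C_def using P(1) S0 by (intro sum.mono_neutral_right) (auto simp: order.strict_iff_order)
  finally have TS: "T0 = sum S C" .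
  have fC: "finite C" unfolding C_def using P by simp
  have ne: "C \<noteq> {}" using TS T unfolding T0_def by auto
  have "sum \<mu> C = (\<Sum>c\<in>C. \<Sum>b\<in>P. w b * of_bool (near_cell c (cl b)))"
    unfolding \<mu>_def by (rule sum.cong[OF refl]) (rule sum_mult_of_bool[OF P(1), symmetric])
  also have "\<dots> = (\<Sum>b\<in>P. \<Sum>c\<in>C. w b * of_bool (near_cell c (cl b)))" by (rule sum.swap)
  also have "\<dots> \<le> (\<Sum>b\<in>P. w b * 125)"
  proof (rule sum_mono)
    fix b assume b: "b \<in> P"
    have "(\<Sum>c\<in>C. w b * of_bool (near_cell c (cl b))) = w b * (\<Sum>c\<in>C. of_bool (near_cell c (cl b)))" by (simp add: sum_distrib_left)
    also have "(\<Sum>c\<in>C. of_bool (near_cell c (cl b)) :: real) = real (card {c\<in>C. near_cell c (cl b)})"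
      using fC by (simp add: sum.inter_filter[symmetric] of_bool_def)
    also have "\<dots> \<le> real (card {c'. near_cell (cl b) c'})"
      using card_near_cell(1) by (intro of_nat_mono card_mono) (auto dest: near_cell_commute[THEN iffD1])
    also have "\<dots> \<le> 125" using card_near_cell(2)[of "cl b"] by simp
    finally show "(\<Sum>c\<in>C. w b * of_bool (near_cell c (cl b))) \<le> w b * 125" using P(2)[OF b] by (simp add: mult_left_mono)
  qed
  also have "\<dots> \<le> 125" using P(3) by (simp add: sum_distrib_right[symmetric])
  finally have \<mu>s: "sum \<mu> C \<le> 125" .
  have "\<exists>c\<in>C. T0 * \<mu> c \<le> 125 * S c"
  proof (rule ccontr)
    assume "\<not> ?thesis"
    then have "(\<Sum>c\<in>C. 125 * S c) < (\<Sum>c\<in>C. T0 * \<mu> c)" using fC ne by (intro sum_strict_mono) auto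
    then have "125 * T0 < T0 * sum \<mu> C" unfolding TS by (simp add: sum_distrib_left)
    also have "\<dots> \<le> T0 * 125" using \<mu>s T unfolding T0_def by (intro mult_left_mono) auto
    finally show False by simp
  qed
  then obtain c where c: "c \<in> C" "T0 * \<mu> c \<le> 125 * S c" by auto
  have "0 < \<mu> c"
  proof -
    have "\<exists>u\<in>{u\<in>P. cl u = c}. w u * F u \<noteq> 0"
      using c(1) unfolding C_def S_def by (metis (mono_tags, lifting) mem_Collect_eq order_less_irrefl sum.neutral)
    then obtain u where u: "u \<in> P" "cl u = c" "w u \<noteq> 0" by auto
    then have "0 < w u" using P(2) by (simp add: order.strict_iff_order)
    also have "w u \<le> \<mu> c" unfolding \<mu>_def using u P near_cell_refl by (intro member_le_sum) auto
    finally show ?thesis .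
  qed
  then show ?thesis using that[of c] c unfolding C_def T0_def \<mu>_def S_def by auto
qed

text \<open>By polarisation the inner product of \<open>x\<close> and \<open>y\<close> is determined
  by the forms of \<open>x\<close>, \<open>y\<close> and \<open>y - x\<close> together with \<rho>
  and \<sigma>. If the three forms are of order \<kappa>, the touching directions differ by the
  square root of \<open>\<kappa> / d^2\<close>. The constant is
  \<open>8016 = 4 * (1 + 1 + 2002)\<close>.\<close>

lemma tangent_directions_close:
  fixes x1 x2 y1 y2 \<rho> \<sigma> \<kappa> d :: real
  assumes d: "0 < d" "d / 2 \<le> \<bar>\<rho>\<bar>" "d / 2 \<le> \<bar>\<sigma>\<bar>"
    and q: "\<bar>x1^2 + x2^2 - \<rho>^2\<bar> \<le> \<kappa>" "\<bar>y1^2 + y2^2 - \<sigma>^2\<bar> \<le> \<kappa>"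
    and q': "\<bar>(y1 - x1)^2 + (y2 - x2)^2 - (\<sigma> - \<rho>)^2\<bar> \<le> 2000 * \<kappa>"
  shows "(x1 / \<rho> - y1 / \<sigma>)^2 + (x2 / \<rho> - y2 / \<sigma>)^2 \<le> 8016 * (\<kappa> / d^2)"
proof -
  define a b e where "a = x1^2 + x2^2 - \<rho>^2" and "b = y1^2 + y2^2 - \<sigma>^2" and "e = (y1 - x1)^2 + (y2 - x2)^2 - (\<sigma> - \<rho>)^2"
  have nz: "\<rho> \<noteq> 0" "\<sigma> \<noteq> 0" using d by auto
  have dot: "2 * (x1 * y1 + x2 * y2) = 2 * (\<rho> * \<sigma>) + (a + b - e)"
    unfolding a_def b_def e_def by (simp add: power2_eq_square algebra_simps)
  have "(x1 / \<rho> - y1 / \<sigma>)^2 + (x2 / \<rho> - y2 / \<sigma>)^2 = (x1^2 + x2^2) / \<rho>^2 + (y1^2 + y2^2) / \<sigma>^2 - 2 * (x1 * y1 + x2 * y2) / (\<rho> * \<sigma>)"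
    unfolding power2_diff power_divide by (simp add: add_divide_distrib algebra_simps)
  also have "(x1^2 + x2^2) / \<rho>^2 = 1 + a / \<rho>^2" unfolding a_def using nz by (simp add: diff_divide_distrib)
  also have "(y1^2 + y2^2) / \<sigma>^2 = 1 + b / \<sigma>^2" unfolding b_def using nz by (simp add: diff_divide_distrib)
  also have "2 * (x1 * y1 + x2 * y2) / (\<rho> * \<sigma>) = 2 + (a + b - e) / (\<rho> * \<sigma>)" unfolding dot using nz by (simp add: add_divide_distrib)
  also have "1 + a / \<rho>^2 + (1 + b / \<sigma>^2) - (2 + (a + b - e) / (\<rho> * \<sigma>)) \<le> \<bar>a\<bar> / \<bar>\<rho>^2\<bar> + \<bar>b\<bar> / \<bar>\<sigma>^2\<bar> + \<bar>a + b - e\<bar> / \<bar>\<rho> * \<sigma>\<bar>"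
    unfolding abs_divide[symmetric] by linarith
  also have "\<dots> \<le> \<kappa> / (d^2 / 4) + \<kappa> / (d^2 / 4) + (2002 * \<kappa>) / (d^2 / 4)"
  proof -
    have r: "d^2 / 4 \<le> \<bar>x * y\<bar>" if "d / 2 \<le> \<bar>x\<bar>" "d / 2 \<le> \<bar>y\<bar>" for x y :: real
    proof -
      have "(d/2) * (d/2) \<le> \<bar>x\<bar> * \<bar>y\<bar>" using that d by (intro mult_mono) auto
      then show ?thesis by (simp add: abs_mult power2_eq_square)
    qed
    have rr: "d^2 / 4 \<le> \<bar>\<rho>^2\<bar>" "d^2 / 4 \<le> \<bar>\<sigma>^2\<bar>" "d^2 / 4 \<le> \<bar>\<rho> * \<sigma>\<bar>"
      using r[OF d(2,2)] r[OF d(3,3)] r[OF d(2,3)] by (auto simp: power2_eq_square)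
    have "\<bar>a + b - e\<bar> \<le> 2002 * \<kappa>" using q q' unfolding a_def[symmetric] b_def[symmetric] e_def[symmetric] by linarith
    moreover have "0 \<le> \<kappa>" using q(1) by linarith
    ultimately show ?thesis using q d rr unfolding a_def[symmetric] b_def[symmetric] by (intro add_mono frac_le) auto
  qed
  also have "\<dots> = 8016 * (\<kappa> / d^2)" by simp
  finally show ?thesis .
qed

context circle_scale
begin

text \<open>As the form is at most \<open>d^2 / 200\<close>, distance of centres and difference of
  radii are almost equal, so the latter is at least \<open>d / 2\<close> and the touching direction
  is well defined.\<close>

lemma tangent_incidence:
  assumes pq: "p \<in> P" "q \<in> P" and i: "i \<in> B" "j \<in> inc p i" "inc q i \<noteq> {}"
    and d: "0 < d" "d \<le> 1" "d^2 \<le> D2 p q" and \<kappa>: "\<bar>Q p q\<bar> \<le> \<kappa>" "108 * \<delta> * d \<le> \<kappa>" "\<kappa> \<le> d^2 / 200"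
  shows "(sg j + (X p - X q) / (R p - R q))^2 + (cg j + (Y p - Y q) / (R p - R q))^2 \<le> 18 * \<kappa> / d^2"
    and "d / 2 \<le> \<bar>R p - R q\<bar>"
proof -
  have j: "j < J" using inc_sub[OF pq(1) i(1)] i(2) by auto
  have "d^2 / 4 \<le> \<rho>" if "d^2 \<le> a + \<rho>" "\<bar>a - \<rho>\<bar> \<le> \<kappa>" for a \<rho> using that \<kappa>(3) zero_le_power2[of d] by linarith
  from this[OF d(3)[unfolded D2_def] \<kappa>(1)[unfolded qd_def]] have "(d/2)^2 \<le> (R p - R q)^2" by (simp add: power_divide)
  then show \<rho>: "d / 2 \<le> \<bar>R p - R q\<bar>" using abs_le_square_iff[of "d/2" "R p - R q"] d(1) by simp
  show "(sg j + (X p - X q) / (R p - R q))^2 + (cg j + (Y p - Y q) / (R p - R q))^2 \<le> 18 * \<kappa> / d^2"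
    by (rule tangent_direction[OF grid_unit[OF j] _ \<kappa>(1)[unfolded qd_def] d(1,2) \<rho> \<kappa>(2) _ lev_le[OF pq i, unfolded lev_def qd_def]])
      (use Rr[OF pq(1)] \<delta> in auto)
qed

text \<open>Wherever \<open>u\<close> meets some \<open>b\<close> in \<open>S\<close>, the direction
  is within a multiple of \<open>sqrt \<kappa> / d\<close> of the one in which \<open>u\<close>
  touches \<open>a\<close>, so only discs on a short arc of \<open>u\<close> count. After exchanging
  the sums, each of these discs has average share at most \<open>m1\<close>, whereas each pair
  contributes at least \<open>Wv\<close>.\<close>

lemma plank_bound:
  assumes E: "E \<subseteq> B" and m: "\<And>i. i \<in> E \<Longrightarrow> (\<Sum>p\<in>P. w p * Wt p i) \<le> m1"
    and m10: "0 \<le> m1" and d: "0 < d" "d \<le> 1" and \<kappa>: "108 * \<delta> * d \<le> \<kappa>" "\<kappa> \<le> d^2 / 200" and Wv: "0 < Wv"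
    and ua: "u \<in> P" "a \<in> P" "d^2 \<le> D2 u a" "\<bar>Q u a\<bar> \<le> \<kappa>" "d / 2 \<le> \<bar>R u - R a\<bar>"
    and S: "\<And>b. b \<in> S \<Longrightarrow> b \<in> P \<and> d^2 \<le> D2 u b \<and> \<bar>Q u b\<bar> \<le> \<kappa> \<and> Wv \<le> Wp E u b \<and> \<bar>Q a b\<bar> \<le> 2000 * \<kappa>"
  shows "sum w S \<le> 200 * m1 * (sqrt \<kappa> / d) / Wv"
proof -
  define \<omega> where "\<omega> = sqrt \<kappa> / d"
  have "0 < \<delta> * d" using \<delta> d by simp
  then have \<kappa>0: "0 < \<kappa>" using \<kappa>(1) by (simp add: mult.assoc)
  have \<omega>0: "0 < \<omega>" "\<omega>^2 = \<kappa> / d^2" unfolding \<omega>_def using \<kappa>0 d by (auto simp: power_divide)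
  have SP: "S \<subseteq> P" using S by auto
  have fS: "finite S" using SP finP finite_subset by blast
  have fE: "finite E" using E finB finite_subset by blast
  define D where "D = {i\<in>E. \<exists>b\<in>S. inc b i \<noteq> {}}"
  define nu where "nu = (X u - X a) / (R u - R a)"
  have close: "\<bar>sg j + nu\<bar> \<le> 95 * \<omega>" if i: "i \<in> D" "j \<in> inc u i" for i j
  proof -
    obtain b where b: "b \<in> S" "inc b i \<noteq> {}" "i \<in> E" using i unfolding D_def by auto
    define nb where "nb = (X u - X b) / (R u - R b)"
    have bS: "b \<in> P" "d^2 \<le> D2 u b" "\<bar>Q u b\<bar> \<le> \<kappa>" "\<bar>Q a b\<bar> \<le> 2000 * \<kappa>" using S[OF b(1)] by auto
    have iB: "i \<in> B" using b E by auto
    note ti = tangent_incidence[OF ua(1) bS(1) iB i(2) b(2) d bS(2,3) \<kappa>]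
    have "(sg j + nb)^2 \<le> 18 * \<kappa> / d^2" unfolding nb_def by (rule power2_le_of_sum[OF ti(1)])
    also have "\<dots> = 18 * \<omega>^2" using \<omega>0 by simp
    also have "\<dots> \<le> (5 * \<omega>)^2" by (simp add: power_mult_distrib)
    finally have 1: "\<bar>sg j + nb\<bar> \<le> 5 * \<omega>" using \<omega>0 by (intro abs_le_of_power2_le) auto
    have "(nu - nb)^2 \<le> 8016 * (\<kappa> / d^2)"
      unfolding nu_def nb_def
    proof (rule power2_le_of_sum[OF tangent_directions_close[OF d(1) ua(5) ti(2)]])
      show "\<bar>(X u - X a)^2 + (Y u - Y a)^2 - (R u - R a)^2\<bar> \<le> \<kappa>" using ua(4) unfolding qd_def .
      show "\<bar>(X u - X b)^2 + (Y u - Y b)^2 - (R u - R b)^2\<bar> \<le> \<kappa>" using bS(3) unfolding qd_def .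
      show "\<bar>(X u - X b - (X u - X a))^2 + (Y u - Y b - (Y u - Y a))^2 - (R u - R b - (R u - R a))^2\<bar> \<le> 2000 * \<kappa>"
        using bS(4) unfolding qd_def by simp
    qed
    also have "\<dots> = 8016 * \<omega>^2" using \<omega>0 by simp
    also have "\<dots> \<le> (90 * \<omega>)^2" by (simp add: power_mult_distrib)
    finally have 2: "\<bar>nu - nb\<bar> \<le> 90 * \<omega>" using \<omega>0 by (intro abs_le_of_power2_le) auto
    from 1 2 show ?thesis by linarith
  qed
  have "fr (\<Union>i\<in>D. inc u i) \<le> 190 * \<omega> + \<delta>"
  proof (rule fr_diam)
    show "(\<Union>i\<in>D. inc u i) \<subseteq> {..<J}" using inc_sub[OF ua(1)] E unfolding D_def by blast
    fix j j' assume "j \<in> (\<Union>i\<in>D. inc u i)" "j' \<in> (\<Union>i\<in>D. inc u i)"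
    then have "\<bar>sg j + nu\<bar> \<le> 95 * \<omega>" "\<bar>sg j' + nu\<bar> \<le> 95 * \<omega>" using close by auto
    then show "\<bar>sg j - sg j'\<bar> \<le> 190 * \<omega>" by linarith
  qed (use \<omega>0 in simp)
  moreover have "\<delta> \<le> \<omega>"
  proof -
    have "\<delta> * \<delta> * (d * d) \<le> \<delta> * 1 * (d * 1)" using \<delta> d by (intro mult_mono) auto
    also have "\<dots> \<le> \<kappa>" using \<kappa>(1) \<open>0 < \<delta> * d\<close> by (simp add: mult.assoc)
    finally have "\<delta>^2 \<le> \<omega>^2" unfolding \<omega>0(2) using d by (simp add: power2_eq_square field_simps)
    then show ?thesis by (rule power2_le_imp_le) (use \<omega>0 in auto)
  qed
  ultimately have frD: "fr (\<Union>i\<in>D. inc u i) \<le> 200 * \<omega>" using \<omega>0 by linarith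
  have "Wv * sum w S = (\<Sum>b\<in>S. w b * Wv)" by (simp add: sum_distrib_left mult.commute)
  also have "\<dots> \<le> (\<Sum>b\<in>S. w b * Wp E u b)" using S w0 by (intro sum_mono mult_left_mono) auto
  also have "\<dots> = (\<Sum>b\<in>S. w b * (\<Sum>i\<in>D. Wt u i * Wt b i))"
  proof (intro sum.cong refl arg_cong2[of _ _ _ _ "(*)"])
    fix b assume "b \<in> S"
    then show "Wp E u b = (\<Sum>i\<in>D. Wt u i * Wt b i)"
      unfolding Wp_def using fE by (intro sum.mono_neutral_right) (auto simp: Wt_def fr_def D_def)
  qed
  also have "\<dots> = (\<Sum>i\<in>D. Wt u i * (\<Sum>b\<in>S. w b * Wt b i))"
    unfolding sum_distrib_left by (subst sum.swap) (simp add: mult_ac)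
  also have "\<dots> \<le> (\<Sum>i\<in>D. Wt u i * m1)"
  proof (intro sum_mono mult_left_mono Wt_nonneg)
    fix i assume "i \<in> D"
    have "(\<Sum>b\<in>S. w b * Wt b i) \<le> (\<Sum>b\<in>P. w b * Wt b i)" using SP finP w0 Wt_nonneg by (intro sum_mono2) auto
    also have "\<dots> \<le> m1" using m \<open>i \<in> D\<close> unfolding D_def by auto
    finally show "(\<Sum>b\<in>S. w b * Wt b i) \<le> m1" .
  qed
  also have "\<dots> = fr (\<Union>i\<in>D. inc u i) * m1"
    unfolding sum_distrib_right[symmetric] using Wt_sum[OF ua(1), of D] E unfolding D_def by auto
  also have "\<dots> \<le> 200 * \<omega> * m1"
    using frD m10 by (rule mult_right_mono)
  finally have "sum w S * Wv \<le> 200 * m1 * \<omega>" by (simp add: mult_ac)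
  then show ?thesis unfolding \<omega>_def[symmetric] using Wv by (simp add: pos_le_divide_eq)
qed

text \<open>After dilation by \<open>1 / d\<close> and division of the weights by the mass \<mu>
  near one cell, \<open>plank_bound\<close> provides
  \<open>M = 200 * m1 * \<omega> / (Wv * \<mu>)\<close> with
  \<open>\<omega> = sqrt \<kappa> / d\<close>, and \<open>tangency_bound\<close> makes
  \<open>M\<close> at most of order \<open>\<omega>^2\<close>. So \<open>m1\<close> is at most of
  order \<open>\<omega> * Wv * \<mu>\<close>. Inserting the overlap bound
  \<open>\<delta>^2 / sqrt \<kappa>\<close> for \<open>Wv\<close> and \<open>CF * d powr t\<close>
  for \<mu> leaves \<open>CF * \<delta>^2 * d powr (t - 1)\<close>. The factor 25000 is 200 times
  the 125 of the localisation.\<close>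

lemma tangential_bound:
  assumes E: "E \<subseteq> B" and m: "\<And>i. i \<in> E \<Longrightarrow> (\<Sum>p\<in>P. w p * Wt p i) \<le> m1"
    and m10: "0 < m1" and j: "j \<le> k" and d: "d = 1 / 2^j" "2^15 * \<delta> \<le> d"
    and \<kappa>: "108 * \<delta> * d \<le> \<kappa>" "\<kappa> \<le> d^2 / 200" and Wv: "0 < Wv"
    and N: "\<And>p q. (p,q) \<in> N \<Longrightarrow> p \<in> P \<and> q \<in> P \<and> d^2 \<le> D2 p q \<and> D2 p q < 4 * d^2 \<and> \<bar>Q p q\<bar> \<le> \<kappa> \<and>
      (\<kappa> = 108 * \<delta> * d \<or> 216 * \<delta> * d \<le> \<kappa> \<and> \<kappa> < 2 * \<bar>Q p q\<bar>) \<and> Wv < Wp E p q"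
    and sym: "\<And>p q. (p,q) \<in> N \<Longrightarrow> (q,p) \<in> N"
    and A: "1 \<le> A" and tot: "25000 * m1 / Wv / A \<le> (\<Sum>u\<in>P. w u * sum w {a. (u,a) \<in> N})"
  shows "m1^2 \<le> 10^99 * 128^64 * A^64 * real (k+1)^3 * (CF * \<delta> powr (1 + t))^2"
proof -
  define \<omega> where "\<omega> = sqrt \<kappa> / d"
  define \<eta> where "\<eta> = \<kappa> / d^2"
  have d0: "0 < d" "d \<le> 1" unfolding d(1) by auto
  have "0 < \<delta> * d" using \<delta> d0 by simp
  then have \<kappa>0: "0 < \<kappa>" using \<kappa>(1) by (simp add: mult.assoc)
  have \<omega>0: "0 < \<omega>" "\<omega>^2 = \<eta>" unfolding \<omega>_def \<eta>_def using \<kappa>0 d0 by (auto simp: power_divide)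
  have \<eta>0: "0 < \<eta>" "\<eta> \<le> 1/200" unfolding \<eta>_def using \<kappa>0 d0 \<kappa>(2) by (auto simp: field_simps)
  have sq\<eta>: "sqrt \<eta> = \<omega>" using \<omega>0 by (metis abs_of_pos real_sqrt_abs)
  define T where "T = (\<Sum>u\<in>P. w u * sum w {a. (u,a) \<in> N})"
  have T0: "0 < T"
  proof -
    have "0 < 25000 * m1 / Wv / A" using m10 Wv A by simp
    then show ?thesis using tot unfolding T_def by linarith
  qed
  have nbP: "{a. (u,a) \<in> N} \<subseteq> P" for u using N by blast
  have F0: "0 \<le> sum w {a. (u,a) \<in> N}" for u using nbP w0 by (intro sum_nonneg) blast
  obtain c where c: "c \<in> cl j ` P" "0 < sum w {b\<in>P. near_cell c (cl j b)}"
    "T * sum w {b\<in>P. near_cell c (cl j b)} \<le> 125 * (\<Sum>u\<in>{u\<in>P. cl j u = c}. w u * sum w {a. (u,a) \<in> N})"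
    unfolding T_def by (rule localise_pairs[OF finP w0 w1 F0 T0[unfolded T_def], of "cl j"])
  define I where "I = {b\<in>P. near_cell c (cl j b)}"
  define \<mu> where "\<mu> = sum w I"
  have \<mu>0: "0 < \<mu>" using c(2) unfolding \<mu>_def I_def .
  have IP: "I \<subseteq> P" and fI: "finite I" unfolding I_def using finP by auto
  define N' where "N' = {(u,a). (u,a) \<in> N \<and> u \<in> I \<and> a \<in> I}"
  define w' where "w' p = w p / \<mu>" for p
  have N_cell: "near_cell (cl j p) (cl j q)" "\<bar>X p - X q\<bar> < 2 * d" "\<bar>Y p - Y q\<bar> < 2 * d" "\<bar>R p - R q\<bar> < 2 * d" if "(p,q) \<in> N" for p q
  proof -
    have lt: "\<bar>x\<bar> < 2 * d" if "x^2 \<le> D2 p q" for x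
    proof -
      have "x^2 < (2 * d)^2" using that N[OF \<open>(p,q) \<in> N\<close>] by (simp add: power_mult_distrib)
      then show ?thesis using power2_less_imp_less[of "\<bar>x\<bar>" "2 * d"] d0 by simp
    qed
    show b: "\<bar>X p - X q\<bar> < 2 * d" "\<bar>Y p - Y q\<bar> < 2 * d" "\<bar>R p - R q\<bar> < 2 * d" by (rule lt; simp add: D2_def)+
    show "near_cell (cl j p) (cl j q)" using b unfolding d by (intro near_cell_dcell) auto
  qed
  have SI: "(\<Sum>u\<in>{u\<in>P. cl j u = c}. w u * sum w {a. (u,a) \<in> N}) \<le> (\<Sum>u\<in>I. w u * sum w {a. (u,a) \<in> N'})"
  proof -
    have "(\<Sum>u\<in>{u\<in>P. cl j u = c}. w u * sum w {a. (u,a) \<in> N}) = (\<Sum>u\<in>{u\<in>P. cl j u = c}. w u * sum w {a. (u,a) \<in> N'})"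
    proof (intro sum.cong refl arg_cong2[of _ _ _ _ "(*)"] arg_cong[of _ _ "sum w"])
      fix u assume "u \<in> {u\<in>P. cl j u = c}"
      then have u: "u \<in> P" "cl j u = c" by auto
      show "{a. (u,a) \<in> N} = {a. (u,a) \<in> N'}"
      proof
        show "{a. (u,a) \<in> N} \<subseteq> {a. (u,a) \<in> N'}"
        proof clarify
          fix a assume a: "(u,a) \<in> N"
          then show "(u,a) \<in> N'" using N_cell(1)[OF a] N[OF a] u near_cell_refl unfolding N'_def I_def by auto
        qed
        show "{a. (u,a) \<in> N'} \<subseteq> {a. (u,a) \<in> N}" unfolding N'_def by auto
      qed
    qed
    also have "\<dots> \<le> (\<Sum>u\<in>I. w u * sum w {a. (u,a) \<in> N'})"
    proof (intro sum_mono2 fI)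
      show "{u\<in>P. cl j u = c} \<subseteq> I" unfolding I_def by (auto simp: near_cell_refl)
      fix u assume "u \<in> I - {u\<in>P. cl j u = c}"
      then have "u \<in> P" using IP by auto
      moreover have "0 \<le> sum w {a. (u,a) \<in> N'}" using IP w0 unfolding N'_def by (intro sum_nonneg) auto
      ultimately show "0 \<le> w u * sum w {a. (u,a) \<in> N'}" using w0 by simp
    qed
    finally show ?thesis .
  qed
  \<comment> \<open>Here \<open>1331 = (2 * 3 + 5)^3\<close>, as near cells stay within three side
    lengths.\<close>
  have \<mu>_le: "\<mu> \<le> 1331 * (CF * d powr t)"
  proof -
    obtain p0 where p0: "p0 \<in> P" "c = cl j p0" using c(1) by auto
    have "sum w I \<le> (2 * 3 + 5)^3 * (CF * (1/2^j) powr t)"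
    proof (rule ball_mass[OF p0(1) j _ IP])
      fix q assume "q \<in> I"
      then have "near_cell (cl j q) (cl j p0)" unfolding I_def p0(2) using near_cell_commute by auto
      from near_cell_imp_close[OF this]
      show "\<bar>X q - X p0\<bar> \<le> 3 / 2^j \<and> \<bar>Y q - Y p0\<bar> \<le> 3 / 2^j \<and> \<bar>R q - R p0\<bar> \<le> 3 / 2^j" by auto
    qed simp
    then show ?thesis unfolding \<mu>_def d by simp
  qed
  have \<omega>14: "\<omega> \<le> 1/14"
  proof (rule power2_le_imp_le)
    show "\<omega>^2 \<le> (1/14)^2" unfolding \<omega>0(2) using \<eta>0(2) by (simp add: power_divide)
  qed simp
  have inv: "1 \<le> 1 / \<omega>" using \<omega>0 \<omega>14 by (simp add: field_simps)
  \<comment> \<open>The bottom level: \<open>1 / 2^L\<close> lies between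
    \<open>\<omega> / 2\<close> and \<omega>, the directional resolution after rescaling.\<close>
  obtain L where L: "1 / \<omega> \<le> 2^L" "2^L \<le> 2 * (1 / \<omega>)" by (rule pow2_between[OF inv])
  define M where "M = 200 * m1 * \<omega> / Wv / \<mu>"
  have M0: "0 < M" unfolding M_def using m10 \<omega>0 Wv \<mu>0 by simp
  have qds: "qd (\<lambda>p. 2^j * X p) (\<lambda>p. 2^j * Y p) (\<lambda>p. 2^j * R p) u a = Q u a / d^2" for u a
  proof -
    have "(c * x - c * x')^2 + (c * y - c * y')^2 - (c * z - c * z')^2 = ((x - x')^2 + (y - y')^2 - (z - z')^2) / (1 / c)^2"
      for c x x' y y' z z' :: real
      by (simp add: power_divide power2_eq_square algebra_simps)
    then show ?thesis unfolding qd_def d .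
  qed
  have pairI: "p \<in> P \<and> q \<in> P \<and> d^2 \<le> D2 p q \<and> D2 p q < 4 * d^2 \<and> \<bar>Q p q\<bar> \<le> \<kappa> \<and> Wv < Wp E p q" if "(p,q) \<in> N" for p q
    using N[OF that] by auto
  have ex: "\<exists>i\<in>E. inc p i \<noteq> {} \<and> inc q i \<noteq> {}" if "(p,q) \<in> N" for p q
  proof (rule ccontr)
    assume "\<not> ?thesis"
    then have "Wt p i * Wt q i = 0" if "i \<in> E" for i using that unfolding Wt_def fr_def by auto
    then have "Wp E p q = 0" unfolding Wp_def by (intro sum.neutral) auto
    then show False using pairI[OF that] Wv by simp
  qed
  have \<rho>: "d / 2 \<le> \<bar>R p - R q\<bar>" "(Y p - Y q) / (R p - R q) \<le> - (1/2)" if pq: "(p,q) \<in> N" for p q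
  proof -
    obtain i l where i: "i \<in> E" "l \<in> inc p i" "inc q i \<noteq> {}" using ex[OF pq] by auto
    have iB: "i \<in> B" using i E by auto
    note h = pairI[OF pq]
    have ti: "(sg l + (X p - X q) / (R p - R q))^2 + (cg l + (Y p - Y q) / (R p - R q))^2 \<le> 18 * \<kappa> / d^2" "d / 2 \<le> \<bar>R p - R q\<bar>"
      by (rule tangent_incidence[OF _ _ iB i(2,3) d0 _ _ \<kappa>]; use h in blast)+
    show "d / 2 \<le> \<bar>R p - R q\<bar>" by (rule ti(2))
    have lJ: "l < J" using inc_sub iB i h by blast
    have "(cg l + (Y p - Y q) / (R p - R q))^2 \<le> 18 * \<eta>" unfolding \<eta>_def
      using ti(1) zero_le_power2[of "sg l + (X p - X q) / (R p - R q)"] by (simp only: times_divide_eq_right)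
    also have "\<dots> \<le> (36/100)^2" using \<eta>0 by (simp add: power_divide)
    finally have "\<bar>cg l + (Y p - Y q) / (R p - R q)\<bar> \<le> 36/100" by (intro abs_le_of_power2_le) auto
    then show "(Y p - Y q) / (R p - R q) \<le> - (1/2)" using grid_cos_lower[OF lJ] by linarith
  qed
  have \<mu>w: "sum w' S = sum w S / \<mu>" for S unfolding w'_def by (simp add: sum_divide_distrib)
  have tang: "tangency I w' (\<lambda>p. 2^j * X p) (\<lambda>p. 2^j * Y p) (\<lambda>p. 2^j * R p) N' \<eta> M L"
  proof unfold_locales
    show "finite I" by (rule fI)
    show "0 \<le> w' i" if "i \<in> I" for i unfolding w'_def using w0 IP that \<mu>0 by auto
    show "sum w' I \<le> 1" unfolding \<mu>w \<mu>_def[symmetric] using \<mu>0 by simp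
    show "u \<in> I \<and> a \<in> I" if "(u,a) \<in> N'" for u a using that unfolding N'_def by auto
    show "(a,u) \<in> N'" if "(u,a) \<in> N'" for u a using that sym unfolding N'_def by auto
    have sc: "\<bar>2^j * x - 2^j * y\<bar> = \<bar>x - y\<bar> / d" for x y :: real
      unfolding d by (simp add: right_diff_distrib[symmetric] abs_mult)
    show "\<bar>2^j * X u - 2^j * X a\<bar> \<le> 2 \<and> \<bar>2^j * Y u - 2^j * Y a\<bar> \<le> 2 \<and> \<bar>2^j * R u - 2^j * R a\<bar> \<le> 2" if "(u,a) \<in> N'" for u a
    proof -
      have "(u,a) \<in> N" using that unfolding N'_def by auto
      from N_cell(2-4)[OF this] show ?thesis unfolding sc using d0 by (simp add: field_simps)
    qed
    show "1/2 \<le> \<bar>2^j * R u - 2^j * R a\<bar>" if "(u,a) \<in> N'" for u a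
    proof -
      have "(u,a) \<in> N" using that unfolding N'_def by auto
      from \<rho>(1)[OF this] show ?thesis unfolding sc using d0 by (simp add: field_simps)
    qed
    show "\<bar>qd (\<lambda>p. 2^j * X p) (\<lambda>p. 2^j * Y p) (\<lambda>p. 2^j * R p) u a\<bar> \<le> \<eta>" if "(u,a) \<in> N'" for u a
    proof -
      have "\<bar>Q u a\<bar> \<le> \<kappa>" using pairI[of u a] that unfolding N'_def by auto
      then show ?thesis unfolding qds \<eta>_def abs_divide using d0 by (simp add: divide_right_mono)
    qed
    show "(2^j * Y u - 2^j * Y a) / (2^j * R u - 2^j * R a) \<le> - (1/2)" if "(u,a) \<in> N'" for u a
    proof -
      have "(u,a) \<in> N" using that unfolding N'_def by auto
      from \<rho>(2)[OF this] show ?thesis by (simp add: right_diff_distrib[symmetric])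
    qed
    show "sum w' {b. (u,b) \<in> N' \<and> \<bar>qd (\<lambda>p. 2^j * X p) (\<lambda>p. 2^j * Y p) (\<lambda>p. 2^j * R p) a b\<bar> \<le> 2000 * \<eta>} \<le> M" if "(u,a) \<in> N'" for u a
    proof -
      have ua: "(u,a) \<in> N" using that unfolding N'_def by auto
      note h = pairI[OF ua]
      have "sum w {b. (u,b) \<in> N' \<and> \<bar>Q a b / d^2\<bar> \<le> 2000 * \<eta>} \<le> 200 * m1 * (sqrt \<kappa> / d) / Wv"
      proof (rule plank_bound[OF E m _ d0 \<kappa> Wv, of u a])
        fix b assume "b \<in> {b. (u,b) \<in> N' \<and> \<bar>Q a b / d^2\<bar> \<le> 2000 * \<eta>}"
        then have b: "(u,b) \<in> N" "\<bar>Q a b\<bar> / d^2 \<le> 2000 * \<kappa> / d^2" unfolding N'_def \<eta>_def abs_divide by auto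
        then have "\<bar>Q a b\<bar> \<le> 2000 * \<kappa>" using d0 by (simp add: divide_le_cancel)
        then show "b \<in> P \<and> d^2 \<le> D2 u b \<and> \<bar>Q u b\<bar> \<le> \<kappa> \<and> Wv \<le> Wp E u b \<and> \<bar>Q a b\<bar> \<le> 2000 * \<kappa>"
          using pairI[OF b(1)] by auto
      qed (use h m10 \<rho>(1)[OF ua] in auto)
      then show ?thesis unfolding qds \<mu>w M_def \<omega>_def[symmetric] using \<mu>0 by (intro divide_right_mono) auto
    qed
    show "card ((\<lambda>i. dcell 0 (2^j * X i, 2^j * Y i, 2^j * R i)) ` I) \<le> 125"
    proof -
      have "(\<lambda>i. dcell 0 (2^j * X i, 2^j * Y i, 2^j * R i)) ` I \<subseteq> {c'. near_cell c c'}"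
        unfolding I_def by (auto simp: dcell_def)
      from card_mono[OF card_near_cell(1) this] show ?thesis using card_near_cell(2)[of c] by linarith
    qed
    show "0 < \<eta>" "\<eta> \<le> 1/100" "0 < M" using \<eta>0 M0 by auto
    have "1 \<le> \<omega> * 2^L" using L(1) \<omega>0 by (simp add: field_simps)
    then have "1^2 \<le> (\<omega> * 2^L)^2" by (intro power_mono) auto
    then have o2: "1 \<le> \<eta> * (2^L)^2" by (simp add: power_mult_distrib \<omega>0(2))
    have o1: "\<omega> * 2^L \<le> 2" using L(2) \<omega>0 by (simp add: field_simps)
    have "\<eta> * 2^L = \<omega> * (\<omega> * 2^L)" unfolding \<omega>0(2)[symmetric] by (simp add: power2_eq_square)
    also have "\<dots> \<le> 1/14 * 2" using \<omega>14 o1 \<omega>0 by (intro mult_mono) auto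
    finally show "\<eta> \<le> 1 / 2^L" by (simp add: field_simps)
    have "(1 / 2^L)^2 \<le> \<eta>" unfolding power_divide using o2 by (simp add: pos_divide_le_eq)
    then show "3 * (1 / 2^L)^2 \<le> 2000 * \<eta>" using \<eta>0 by linarith
  qed
  have L1: "1 \<le> L"
  proof (rule ccontr)
    assume "\<not> 1 \<le> L"
    then have "1 / \<omega> \<le> 1" using L(1) by (simp add: not_le)
    then show False using \<omega>14 \<omega>0 by (simp add: field_simps)
  qed
  \<comment> \<open>The resolution \<omega> is never finer than \<delta>, so the number of levels
    costs only a power of \<open>k\<close>.\<close>
  have Lk: "L \<le> k + 1"
  proof -
    have "\<delta> \<le> \<omega>"
    proof (rule power2_le_imp_le)
      have "\<delta> * \<delta> * (d * d) \<le> \<delta> * 1 * (d * 1)" using \<delta> d0 by (intro mult_mono) auto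
      also have "\<dots> \<le> \<kappa>" using \<kappa>(1) \<open>0 < \<delta> * d\<close> by (simp add: mult.assoc)
      finally show "\<delta>^2 \<le> \<omega>^2" unfolding \<omega>0(2) \<eta>_def using d0 by (simp add: power2_eq_square field_simps)
    qed (use \<omega>0 in simp)
    then have "1 / \<omega> \<le> 1 / \<delta>" using \<delta> by (intro divide_left_mono) auto
    then have "2^L \<le> 2 * (1 / \<delta>)" using L(2) by linarith
    then have "(2::real)^L \<le> 2^(k+1)" unfolding \<delta>_def by simp
    then show ?thesis by (simp only: power_increasing_iff one_less_numeral_iff semiring_norm)
  qed
  have "M / sqrt \<eta> / A \<le> (\<Sum>u\<in>I. w' u * sum w' {a. (u,a) \<in> N'})"
  proof -
    have "25000 * m1 / Wv / A * \<mu> \<le> T * \<mu>" using tot \<mu>0 unfolding T_def[symmetric] by (intro mult_right_mono) auto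
    also have "\<dots> \<le> 125 * (\<Sum>u\<in>I. w u * sum w {a. (u,a) \<in> N'})"
      using c(3) SI unfolding I_def[symmetric] \<mu>_def[symmetric] by linarith
    finally have "200 * m1 / Wv / A * \<mu> \<le> (\<Sum>u\<in>I. w u * sum w {a. (u,a) \<in> N'})" by simp
    then have "200 * m1 / Wv / A * \<mu> / (\<mu> * \<mu>) \<le> (\<Sum>u\<in>I. w u * sum w {a. (u,a) \<in> N'}) / (\<mu> * \<mu>)"
      using \<mu>0 by (intro divide_right_mono) auto
    also have "(\<Sum>u\<in>I. w u * sum w {a. (u,a) \<in> N'}) / (\<mu> * \<mu>) = (\<Sum>u\<in>I. w' u * sum w' {a. (u,a) \<in> N'})"
      unfolding \<mu>w by (subst sum_divide_distrib) (simp add: w'_def)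
    also have "200 * m1 / Wv / A * \<mu> / (\<mu> * \<mu>) = M / sqrt \<eta> / A"
      unfolding M_def sq\<eta> using \<mu>0 \<omega>0 by (simp add: field_simps)
    finally show ?thesis .
  qed
  then have "M^2 \<le> 10^90 * 128^64 * A^64 * real L^3 * \<eta>^2"
    using tangency.tangency_bound[OF tang A L1] unfolding tangency.wt_def[OF tang] by blast
  then have "M^2 \<le> 10^90 * 128^64 * A^64 * real (k+1)^3 * \<eta>^2"
  proof (rule order_trans)
    have "real L^3 \<le> real (k+1)^3" using Lk by (intro power_mono) auto
    then show "10^90 * 128^64 * A^64 * real L^3 * \<eta>^2 \<le> 10^90 * 128^64 * A^64 * real (k+1)^3 * \<eta>^2"
      using A by (intro mult_right_mono mult_left_mono) auto
  qed
  moreover define Z where "Z = 10^90 * 128^64 * A^64 * real (k+1)^3"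
  ultimately have MZ: "M^2 \<le> Z * \<eta>^2" by simp
  have Z0: "0 \<le> Z" unfolding Z_def using A by simp
  \<comment> \<open>One pair in \<open>N\<close> suffices to compare \<open>Wv\<close> with the
    largest possible overlap.\<close>
  have "N \<noteq> {}"
  proof
    assume "N = {}"
    then have "T = 0" unfolding T_def by simp
    then show False using T0 by simp
  qed
  then obtain p q where pq: "(p,q) \<in> N" by auto
  have "Wp E p q \<le> 2700 * \<delta>^2 / sqrt \<kappa>"
    using N[OF pq] E d(2) by (intro Wp_le[where d = d]) auto
  then have W1: "Wv \<le> 2700 * \<delta>^2 / sqrt \<kappa>" using pairI[OF pq] by linarith
  define e where "e = CF * (\<delta>^2 * (d powr t / d))"
  have e: "0 \<le> e" "e \<le> CF * \<delta> powr (1 + t)"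
  proof -
    show "0 \<le> e" unfolding e_def using CF d0 by simp
    have "d powr t / d = d powr (t - 1)" using d0 by (simp add: powr_diff)
    \<comment> \<open>Here \<open>t \<le> 1\<close> enters: the exponent is not positive, so the
      smallest distance is the worst.\<close>
    also have "\<dots> \<le> \<delta> powr (t - 1)" using t \<delta> d(2) by (intro powr_mono2') auto
    finally have "\<delta>^2 * (d powr t / d) \<le> \<delta>^2 * \<delta> powr (t - 1)" by (rule mult_left_mono) simp
    also have "\<delta>^2 * \<delta> powr (t - 1) = \<delta> powr 2 * \<delta> powr (t - 1)" using \<delta> by simp
    also have "\<dots> = \<delta> powr (1 + t)" by (simp add: powr_add[symmetric])
    finally show "e \<le> CF * \<delta> powr (1 + t)" unfolding e_def using CF by (intro mult_left_mono) auto
  qed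
  have "Wv * \<mu> \<le> (2700 * \<delta>^2 / sqrt \<kappa>) * (1331 * (CF * d powr t))"
    using W1 \<mu>_le Wv \<mu>0 \<kappa>0 by (intro mult_mono) auto
  also have "\<dots> = 3593700 * e / \<omega>" unfolding e_def \<omega>_def using d0 by (simp add: field_simps)
  finally have "(Wv * \<mu>)^2 \<le> (3593700 * e / \<omega>)^2" using Wv \<mu>0 by (intro power_mono) auto
  also have "\<dots> = 3593700^2 * e^2 / \<eta>" unfolding \<omega>0(2)[symmetric] by (simp only: power_divide power_mult_distrib)
  finally have W2: "\<eta> * (Wv * \<mu>)^2 \<le> 3593700^2 * e^2" using \<eta>0 by (simp add: field_simps)
  have "200 * m1 * \<omega> = M * (Wv * \<mu>)" unfolding M_def using Wv \<mu>0 by simp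
  from arg_cong[OF this, of "\<lambda>x. x^2"] have "40000 * (m1^2 * \<eta>) = M^2 * (Wv * \<mu>)^2"
    unfolding \<omega>0(2)[symmetric] by (simp only: power_mult_distrib) simp
  also have "\<dots> \<le> Z * \<eta>^2 * (Wv * \<mu>)^2" using MZ by (intro mult_right_mono) auto
  finally have "(40000 * m1^2) * \<eta> \<le> (Z * (\<eta> * (Wv * \<mu>)^2)) * \<eta>" by (simp only: power2_eq_square mult_ac)
  then have "40000 * m1^2 \<le> Z * (\<eta> * (Wv * \<mu>)^2)" using \<eta>0 by (simp only: mult_le_cancel_right_pos)
  also have "\<dots> \<le> Z * (3593700^2 * e^2)" using W2 Z0 by (intro mult_left_mono)
  finally have "m1^2 \<le> (3593700^2 / 40000) * (Z * e^2)" by simp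
  also have "\<dots> \<le> 10^9 * (Z * e^2)" using Z0 by (intro mult_right_mono) auto
  also have "\<dots> \<le> 10^9 * (Z * (CF * \<delta> powr (1 + t))^2)" using e Z0 by (intro mult_left_mono power_mono) auto
  also have "\<dots> = (10^9 * 10^90) * 128^64 * A^64 * real (k+1)^3 * (CF * \<delta> powr (1 + t))^2" unfolding Z_def by (simp only: mult.assoc)
  also have "10^9 * 10^90 = (10^99 :: real)" by simp
  finally show ?thesis .
qed

end

section \<open>Dyadic classes of pairs and the bound for one scale\<close>

definition dyadic_level :: "real \<Rightarrow> nat" where "dyadic_level x = (LEAST v. 1 / 2^(v+1) < x)"

lemma dyadic_level:
  assumes "0 < x" "x \<le> 1"
  shows "1 / 2^(dyadic_level x + 1) < x" "x \<le> 1 / 2^(dyadic_level x)"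
proof -
  obtain n where "(1/2)^n < x" using real_arch_pow_inv[of x "1/2"] assms by auto
  moreover have "(1/2::real)^(n+1) \<le> (1/2)^n" by simp
  ultimately have ex: "1 / 2^(n+1) < x" by (simp add: power_divide)
  show "1 / 2^(dyadic_level x + 1) < x" unfolding dyadic_level_def by (rule LeastI[of _ n]) (rule ex)
  show "x \<le> 1 / 2^(dyadic_level x)"
  proof (cases "dyadic_level x")
    case (Suc v)
    then have "v < (LEAST v. 1 / 2^(v+1) < x)" unfolding dyadic_level_def by simp
    from not_less_Least[OF this] show ?thesis unfolding Suc by simp
  qed (use assms in simp)
qed

lemma dyadic_level_le: "1 / 2^(n+1) < x \<Longrightarrow> dyadic_level x \<le> n"
  unfolding dyadic_level_def by (rule Least_le)

lemma sum_prod_relation: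
  fixes w :: "'p \<Rightarrow> real"
  assumes "finite P" "N \<subseteq> P \<times> P"
  shows "(\<Sum>x\<in>N. w (fst x) * w (snd x)) = (\<Sum>u\<in>P. w u * sum w {a. (u,a) \<in> N})"
proof -
  have N: "N = Sigma P (\<lambda>u. {a. (u,a) \<in> N})" using assms(2) by auto
  have f: "finite {a. (u,a) \<in> N}" for u
    by (rule finite_subset[OF _ assms(1)]) (use assms(2) in auto)
  have "(\<Sum>x\<in>N. w (fst x) * w (snd x)) = (\<Sum>u\<in>P. \<Sum>a\<in>{a. (u,a) \<in> N}. w u * w a)"
  proof -
    have "(\<Sum>u\<in>P. \<Sum>a\<in>{a. (u,a) \<in> N}. w u * w a) = (\<Sum>(u,a)\<in>Sigma P (\<lambda>u. {a. (u,a) \<in> N}). w u * w a)"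
      using assms(1) f by (intro sum.Sigma) auto
    then show ?thesis unfolding N[symmetric] by (simp add: case_prod_unfold)
  qed
  then show ?thesis by (simp add: sum_distrib_left)
qed

text \<open>Square root of the constant of \<open>tangential_bound\<close> for
  \<open>A = 16000000 * (K^4 / lam)\<close>, with \<open>10^99\<close> rounded up to a square;
  \<open>16000000 = 2 * 320 * 25000\<close>.\<close>

definition scale_const :: real where "scale_const = 10^50 * 128^32 * 16000000^32"

lemma scale_const_lower: "10^40 \<le> scale_const" unfolding scale_const_def by simp

context circle_scale
begin

lemma sum_near_pairs:
  assumes N: "N \<subseteq> P \<times> P" and U: "\<And>x. x \<in> N \<Longrightarrow> Wp E (fst x) (snd x) \<le> V" and V: "0 \<le> V"
    and F: "\<And>u. u \<in> P \<Longrightarrow> sum w {a. (u,a) \<in> N} \<le> F" and F0: "0 \<le> F"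
  shows "(\<Sum>x\<in>N. w (fst x) * w (snd x) * Wp E (fst x) (snd x)) \<le> V * F"
proof -
  have "(\<Sum>x\<in>N. w (fst x) * w (snd x) * Wp E (fst x) (snd x)) \<le> (\<Sum>x\<in>N. w (fst x) * w (snd x) * V)"
    using N U w0 by (intro sum_mono mult_left_mono mult_nonneg_nonneg) auto
  also have "\<dots> = (\<Sum>u\<in>P. w u * sum w {a. (u,a) \<in> N}) * V"
    unfolding sum_distrib_right[symmetric] sum_prod_relation[OF finP N] ..
  also have "\<dots> \<le> (\<Sum>u\<in>P. w u * F) * V" using F w0 V by (intro mult_right_mono sum_mono mult_left_mono) auto
  also have "\<dots> = sum w P * (F * V)" by (simp add: sum_distrib_right mult.assoc)
  also have "\<dots> \<le> 1 * (F * V)" using w1 F0 V by (intro mult_right_mono) auto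
  finally show ?thesis by (simp add: mult.commute)
qed

lemma D2_coord:
  assumes "D2 p q \<le> b^2" "0 \<le> b"
  shows "\<bar>X q - X p\<bar> \<le> b" "\<bar>Y q - Y p\<bar> \<le> b" "\<bar>R q - R p\<bar> \<le> b"
proof -
  have "\<bar>x\<bar> \<le> b" if "x^2 \<le> D2 p q" for x using that assms by (intro abs_le_of_power2_le) auto
  then have "\<bar>X p - X q\<bar> \<le> b" "\<bar>Y p - Y q\<bar> \<le> b" "\<bar>R p - R q\<bar> \<le> b" by (auto simp: D2_def)
  then show "\<bar>X q - X p\<bar> \<le> b" "\<bar>Y q - Y p\<bar> \<le> b" "\<bar>R q - R p\<bar> \<le> b" by (simp_all add: abs_minus_commute)
qed

definition dist_level :: "'p \<times> 'p \<Rightarrow> nat" where "dist_level x = (LEAST j. (1/2^j)^2 \<le> D2 (fst x) (snd x))"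
definition tangency_level :: "'p \<times> 'p \<Rightarrow> nat" where
  "tangency_level x = (LEAST l. \<bar>Q (fst x) (snd x)\<bar> \<le> 2^l * (108 * \<delta> * (1/2^(dist_level x))))"

lemma dist_level:
  assumes "fst x \<in> P" "snd x \<in> P" "(2^16 * \<delta>)^2 \<le> D2 (fst x) (snd x)"
  shows "dist_level x \<le> k" "(1/2^(dist_level x))^2 \<le> D2 (fst x) (snd x)" "D2 (fst x) (snd x) < 4 * (1/2^(dist_level x))^2" "2^15 * \<delta> \<le> 1/2^(dist_level x)"
proof -
  let ?D = "D2 (fst x) (snd x)"
  have "(1/2^k)^2 \<le> (2^16 * \<delta>)^2" unfolding \<delta>_def by (intro power_mono) (auto intro: divide_right_mono)
  then have ex: "(1/2^k)^2 \<le> ?D" using assms(3) by linarith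
  show "dist_level x \<le> k" unfolding dist_level_def by (rule Least_le) (rule ex)
  show P: "(1/2^(dist_level x))^2 \<le> ?D" unfolding dist_level_def by (rule LeastI[of "\<lambda>j. (1/2^j)^2 \<le> ?D"]) (rule ex)
  show l: "?D < 4 * (1/2^(dist_level x))^2"
  proof (cases "dist_level x")
    case 0
    then show ?thesis using box_Q(1)[OF assms(1,2)] by simp
  next
    case (Suc j)
    then have "j < (LEAST j. (1/2^j)^2 \<le> ?D)" unfolding dist_level_def by simp
    from not_less_Least[OF this] have "?D < (1/2^j)^2" by simp
    then show ?thesis unfolding Suc by (simp add: power_divide power_mult_distrib)
  qed
  have "(2^16 * \<delta>)^2 \<le> (2 * (1/2^(dist_level x)))^2" unfolding power_mult_distrib[of 2 "1/2^(dist_level x)"] using l assms(3) by simp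
  then have "2^16 * \<delta> \<le> 2 * (1/2^(dist_level x))" by (rule power2_le_imp_le) simp
  then show "2^15 * \<delta> \<le> 1/2^(dist_level x)" by simp
qed

text \<open>The form is at most \<open>4 * d^2\<close>, which level \<open>k\<close> certainly
  exceeds because \<open>2^k * \<delta> = 1\<close>. So there are only \<open>k + 1\<close> levels,
  and above the lowest one \<kappa> is within a factor 2 of the form.\<close>

lemma tangency_level:
  assumes x: "fst x \<in> P" "snd x \<in> P" "(2^16 * \<delta>)^2 \<le> D2 (fst x) (snd x)"
    and \<kappa>: "\<kappa> = 2^(tangency_level x) * (108 * \<delta> * (1/2^(dist_level x)))"
  shows "tangency_level x \<le> k" "\<bar>Q (fst x) (snd x)\<bar> \<le> \<kappa>"
    "\<kappa> = 108 * \<delta> * (1/2^(dist_level x)) \<or> 216 * \<delta> * (1/2^(dist_level x)) \<le> \<kappa> \<and> \<kappa> < 2 * \<bar>Q (fst x) (snd x)\<bar>"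
proof -
  define d where "d = 1 / (2::real)^(dist_level x)"
  have d0: "0 < d" "d \<le> 1" unfolding d_def by auto
  have "\<bar>Q (fst x) (snd x)\<bar> \<le> 4 * d^2" using box_Q(2)[OF x(1,2)] dist_level(3)[OF x] unfolding d_def by linarith
  also have "\<dots> \<le> 108 * d" using d0 mult_left_mono[of d 1 d] by (simp add: power2_eq_square)
  also have "\<dots> = 2^k * (108 * \<delta> * d)" unfolding \<delta>_def by simp
  finally have ex: "\<bar>Q (fst x) (snd x)\<bar> \<le> 2^k * (108 * \<delta> * d)" .
  show "tangency_level x \<le> k" unfolding tangency_level_def d_def[symmetric] by (rule Least_le) (rule ex)
  show "\<bar>Q (fst x) (snd x)\<bar> \<le> \<kappa>"
    unfolding \<kappa> tangency_level_def d_def[symmetric] by (rule LeastI[of "\<lambda>l. \<bar>Q (fst x) (snd x)\<bar> \<le> 2^l * (108 * \<delta> * d)"]) (rule ex)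
  show "\<kappa> = 108 * \<delta> * (1/2^(dist_level x)) \<or> 216 * \<delta> * (1/2^(dist_level x)) \<le> \<kappa> \<and> \<kappa> < 2 * \<bar>Q (fst x) (snd x)\<bar>"
  proof (cases "tangency_level x")
    case (Suc l)
    then have "l < (LEAST l. \<bar>Q (fst x) (snd x)\<bar> \<le> 2^l * (108 * \<delta> * d))" unfolding tangency_level_def d_def by simp
    from not_less_Least[OF this] have "2^l * (108 * \<delta> * d) < \<bar>Q (fst x) (snd x)\<bar>" by simp
    moreover have "\<kappa> = 2 * (2^l * (108 * \<delta> * d))" unfolding \<kappa> Suc d_def by simp
    moreover have "1 * (108 * \<delta> * d) \<le> 2^l * (108 * \<delta> * d)" using \<delta> d0 by (intro mult_right_mono) auto
    ultimately show ?thesis unfolding d_def[symmetric] by linarith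
  qed (simp add: \<kappa>)
qed

lemma Q_comm: "Q p q = Q q p" by (rule qd_commute)

text \<open>On discs whose average shares are all at least \<open>m1 / 2\<close> the Cauchy-Schwarz
  step is termwise: one factor of each square is replaced by \<open>m1 / 2\<close>.\<close>

lemma level_energy:
  assumes E: "E \<subseteq> B" and lo: "\<And>i. i \<in> E \<Longrightarrow> m1 / 2 \<le> (\<Sum>p\<in>P. w p * Wt p i)" and m10: "0 < m1"
  shows "m1 / 2 * (\<Sum>i\<in>E. \<Sum>p\<in>P. w p * Wt p i) \<le> (\<Sum>x\<in>P\<times>P. w (fst x) * w (snd x) * Wp E (fst x) (snd x))"
proof -
  let ?m = "\<lambda>i. \<Sum>p\<in>P. w p * Wt p i"
  have m0: "0 \<le> ?m i" for i using w0 Wt_nonneg by (intro sum_nonneg) auto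
  have "m1 / 2 * (\<Sum>i\<in>E. ?m i) = (\<Sum>i\<in>E. m1 / 2 * ?m i)" by (simp add: sum_distrib_left)
  also have "\<dots> \<le> (\<Sum>i\<in>E. ?m i * ?m i)" using lo m0 by (intro sum_mono mult_right_mono) auto
  also have "\<dots> = (\<Sum>i\<in>E. \<Sum>x\<in>P\<times>P. w (fst x) * w (snd x) * (Wt (fst x) i * Wt (snd x) i))"
    unfolding sum_product sum.cartesian_product by (intro sum.cong refl) (auto simp: mult_ac)
  also have "\<dots> = (\<Sum>x\<in>P\<times>P. \<Sum>i\<in>E. w (fst x) * w (snd x) * (Wt (fst x) i * Wt (snd x) i))" by (rule sum.swap)
  also have "\<dots> = (\<Sum>x\<in>P\<times>P. w (fst x) * w (snd x) * Wp E (fst x) (snd x))"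
    unfolding Wp_def by (simp add: sum_distrib_left)
  finally show ?thesis .
qed

text \<open>The class \<open>None\<close> collects the pairs at distance comparable to \<open>\<delta>\<close>.\<close>
lemma class_bound:
  assumes E: "E \<subseteq> B" and m: "\<And>i. i \<in> E \<Longrightarrow> (\<Sum>p\<in>P. w p * Wt p i) \<le> m1" and m10: "0 < m1"
    and N: "N \<subseteq> P \<times> P" "\<And>x. x \<in> N \<Longrightarrow> 0 < Wp E (fst x) (snd x)"
    and cls: "\<And>x. x \<in> N \<Longrightarrow> (if D2 (fst x) (snd x) < (2^16 * \<delta>)^2 then None else Some (dist_level x, tangency_level x, dyadic_level (Wp E (fst x) (snd x)))) = c"
    and sym: "\<And>p q. (p,q) \<in> N \<Longrightarrow> (q,p) \<in> N"
    and K: "K = real (k + 1)" and lam: "0 < lam" "lam \<le> 1"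
    and tot: "m1 * lam / (320 * K^4) \<le> (\<Sum>x\<in>N. w (fst x) * w (snd x) * Wp E (fst x) (snd x))"
  shows "m1 \<le> scale_const * (K / lam)^130 * (CF * \<delta> powr (1 + t))"
proof -
  define G where "G = CF * \<delta> powr (1 + t)"
  define H where "H = K / lam"
  define S where "S = (\<Sum>x\<in>N. w (fst x) * w (snd x) * Wp E (fst x) (snd x))"
  have K1: "1 \<le> K" unfolding K by simp
  have H1: "1 \<le> H" unfolding H_def using K1 lam by simp
  have G0: "0 \<le> G" unfolding G_def using CF by simp
  \<comment> \<open>For the classes in which the Frostman condition alone bounds the energy.\<close>
  have triv: "m1 \<le> scale_const * H^130 * G" if S: "S \<le> 10^18 * G"
  proof -
    have "m1 * lam / (320 * K^4) \<le> 10^18 * G" using tot S unfolding S_def by linarith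
    then have "m1 \<le> 320 * K^4 / lam * (10^18 * G)" using K1 lam by (simp add: field_simps)
    also have "\<dots> = 320 * 10^18 * (K^4 / lam) * G" by simp
    also have "\<dots> \<le> scale_const * H^130 * G"
    proof (intro mult_right_mono G0 mult_mono)
      have "lam^4 \<le> lam^1" using lam by (intro power_decreasing) auto
      then have "K^4 / lam \<le> K^4 / lam^4" using K1 lam by (intro divide_left_mono) auto
      also have "\<dots> = H^4" unfolding H_def by (simp add: power_divide)
      also have "\<dots> \<le> H^130" using H1 by (intro power_increasing) auto
      finally show "K^4 / lam \<le> H^130" .
    qed (use scale_const_lower K1 lam H1 in auto)
    finally show ?thesis .
  qed
  have Wp1: "Wp E (fst x) (snd x) \<le> 1" "fst x \<in> P" "snd x \<in> P" if "x \<in> N" for x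
  proof -
    show xP: "fst x \<in> P" "snd x \<in> P" using N that by auto
    show "Wp E (fst x) (snd x) \<le> 1" using Wp_le_near[OF xP E] \<delta> by linarith
  qed
  have main: "m1 \<le> scale_const * H^130 * G"
  proof (cases c)
    case None
    have near: "D2 (fst x) (snd x) \<le> (2^16 / 2^k)^2" if "x \<in> N" for x
      using cls[OF that] None unfolding \<delta>_def by (auto split: if_splits)
    have "S \<le> 3 * \<delta> * ((2 * 2^16 + 5)^3 * (CF * (1/2^k) powr t))"
      unfolding S_def
    proof (rule sum_near_pairs[OF N(1)])
      show "Wp E (fst x) (snd x) \<le> 3 * \<delta>" if "x \<in> N" for x using Wp_le_near Wp1 E that by auto
      show "sum w {a. (u,a) \<in> N} \<le> (2 * 2^16 + 5)^3 * (CF * (1/2^k) powr t)" if "u \<in> P" for u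
      proof (rule ball_mass[OF that order_refl])
        fix q assume "q \<in> {a. (u,a) \<in> N}"
        then have "D2 u q \<le> (2^16 / 2^k)^2" using near[of "(u,q)"] by simp
        from D2_coord[OF this] show "\<bar>X q - X u\<bar> \<le> 2^16 / 2^k \<and> \<bar>Y q - Y u\<bar> \<le> 2^16 / 2^k \<and> \<bar>R q - R u\<bar> \<le> 2^16 / 2^k" by auto
      qed (use N in auto)
    qed (use \<delta> CF in auto)
    also have "\<dots> = (3 * (2 * 2^16 + 5)^3) * (CF * (\<delta> * \<delta> powr t))" unfolding \<delta>_def by simp
    also have "\<delta> * \<delta> powr t = \<delta> powr (1 + t)" using \<delta> by (simp add: powr_add)
    finally have "S \<le> (3 * (2 * 2^16 + 5)^3) * G" unfolding G_def .
    also have "\<dots> \<le> 10^18 * G" using G0 by (intro mult_right_mono) auto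
    finally show ?thesis by (rule triv)
  next
    case (Some c')
    obtain j l v where c': "c' = (j,l,v)" by (cases c')
    define d where "d = 1 / (2::real)^j"
    define \<kappa> where "\<kappa> = 2^l * (108 * \<delta> * d)"
    define Wv where "Wv = 1 / (2::real)^(v+1)"
    have d0: "0 < d" "d \<le> 1" unfolding d_def by auto
    have \<kappa>0: "0 < \<kappa>" "108 * \<delta> * d \<le> \<kappa>"
    proof -
      have p: "0 < 108 * \<delta> * d" using \<delta> d0 by simp
      show "0 < \<kappa>" unfolding \<kappa>_def using p by simp
      have "1 * (108 * \<delta> * d) \<le> 2^l * (108 * \<delta> * d)" using p by (intro mult_right_mono) auto
      then show "108 * \<delta> * d \<le> \<kappa>" unfolding \<kappa>_def by simp
    qed
    have x: "j \<le> k \<and> d^2 \<le> D2 (fst x) (snd x) \<and> D2 (fst x) (snd x) < 4 * d^2 \<and> 2^15 * \<delta> \<le> d \<and> \<bar>Q (fst x) (snd x)\<bar> \<le> \<kappa> \<and>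
       (\<kappa> = 108 * \<delta> * d \<or> 216 * \<delta> * d \<le> \<kappa> \<and> \<kappa> < 2 * \<bar>Q (fst x) (snd x)\<bar>) \<and> Wv < Wp E (fst x) (snd x) \<and> Wp E (fst x) (snd x) \<le> 2 * Wv"
      if "x \<in> N" for x
    proof -
      have "(if D2 (fst x) (snd x) < (2^16 * \<delta>)^2 then None else Some (dist_level x, tangency_level x, dyadic_level (Wp E (fst x) (snd x)))) = Some (j,l,v)"
        using cls[OF that] unfolding Some c' .
      then have c: "(2^16 * \<delta>)^2 \<le> D2 (fst x) (snd x)" "dist_level x = j" "tangency_level x = l" "dyadic_level (Wp E (fst x) (snd x)) = v"
        by (auto split: if_splits)
      note a = dist_level[OF Wp1(2,3)[OF that] c(1), unfolded c(2), folded d_def]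
      note b = tangency_level[OF Wp1(2,3)[OF that] c(1), unfolded c(2,3), folded d_def, OF \<kappa>_def]
      note e = dyadic_level[OF N(2)[OF that] Wp1(1)[OF that], unfolded c(4)]
      have "Wp E (fst x) (snd x) \<le> 2 * Wv" using e(2) unfolding Wv_def by simp
      then show ?thesis using a b e(1) unfolding Wv_def by blast
    qed
    have x': "j \<le> k" "d^2 \<le> D2 p q" "D2 p q < 4 * d^2" "2^15 * \<delta> \<le> d" "\<bar>Q p q\<bar> \<le> \<kappa>"
       "\<kappa> = 108 * \<delta> * d \<or> 216 * \<delta> * d \<le> \<kappa> \<and> \<kappa> < 2 * \<bar>Q p q\<bar>" "Wv < Wp E p q" "Wp E p q \<le> 2 * Wv"
      if "(p,q) \<in> N" for p q
      using x[OF that] unfolding fst_conv snd_conv by blast+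
    have "S \<noteq> 0"
    proof -
      have "0 < m1 * lam / (320 * K^4)" using m10 lam K1 by simp
      then show ?thesis using tot unfolding S_def by linarith
    qed
    then have ne: "N \<noteq> {}" unfolding S_def by auto
    then have jk: "j \<le> k" and dd: "2^15 * \<delta> \<le> d" using x by blast+
    show ?thesis
    proof (cases "\<kappa> \<le> d^2 / 200")
      \<comment> \<open>Transversal pairs: with \<kappa> at least of order \<open>d^2\<close>, two
        circles overlap by at most a multiple of \<open>\<delta>^2 / d\<close>, and the circles at
        distance about \<open>d\<close> from a given one have mass at most a multiple of
        \<open>CF * d powr t\<close>.\<close>
      case False
      have sq: "d / 15 \<le> sqrt \<kappa>"
      proof (rule real_le_rsqrt)
        show "(d/15)^2 \<le> \<kappa>" using False \<kappa>0(1) by (simp add: power_divide)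
      qed
      have "S \<le> (2700 * \<delta>^2 / (d / 15)) * ((2 * 2 + 5)^3 * (CF * (1/2^j) powr t))"
        unfolding S_def
      proof (rule sum_near_pairs[OF N(1)])
        show "Wp E (fst x) (snd x) \<le> 2700 * \<delta>^2 / (d / 15)" if "x \<in> N" for x
        proof -
          have h: "(fst x, snd x) \<in> N" using that by simp
          have "Wp E (fst x) (snd x) \<le> 2700 * \<delta>^2 / sqrt \<kappa>"
            by (rule Wp_le[OF Wp1(2,3)[OF that] E x'(2)[OF h] less_imp_le[OF x'(3)[OF h]] x'(4,5,6)[OF h]])
          also have "\<dots> \<le> 2700 * \<delta>^2 / (d / 15)" using sq d0 \<kappa>0 by (intro divide_left_mono) auto
          finally show ?thesis .
        qed
        show "sum w {a. (u,a) \<in> N} \<le> (2 * 2 + 5)^3 * (CF * (1/2^j) powr t)" if "u \<in> P" for u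
        proof (rule ball_mass[OF that jk])
          fix q assume "q \<in> {a. (u,a) \<in> N}"
          then have "D2 u q \<le> (2 / 2^j)^2" using x'(3)[of u q] unfolding d_def by (simp add: power_divide)
          from D2_coord[OF this] show "\<bar>X q - X u\<bar> \<le> 2 / 2^j \<and> \<bar>Y q - Y u\<bar> \<le> 2 / 2^j \<and> \<bar>R q - R u\<bar> \<le> 2 / 2^j" by auto
        qed (use N in auto)
      qed (use d0 CF in auto)
      also have "\<dots> = 29524500 * (CF * (\<delta>^2 * (d powr t / d)))" unfolding d_def by simp
      also have "\<dots> \<le> 29524500 * G" unfolding G_def
      proof (intro mult_left_mono CF)
        have "d powr t / d = d powr (t - 1)" using d0 by (simp add: powr_diff)
        also have "\<dots> \<le> \<delta> powr (t - 1)" using t \<delta> dd by (intro powr_mono2') auto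
        finally have "\<delta>^2 * (d powr t / d) \<le> \<delta>^2 * \<delta> powr (t - 1)" by (rule mult_left_mono) simp
        also have "\<delta>^2 * \<delta> powr (t - 1) = \<delta> powr 2 * \<delta> powr (t - 1)" using \<delta> by simp
        also have "\<dots> = \<delta> powr (1 + t)" by (simp add: powr_add[symmetric])
        finally show "\<delta>^2 * (d powr t / d) \<le> \<delta> powr (1 + t)" .
      qed simp
      also have "\<dots> \<le> 10^18 * G" using G0 by (intro mult_right_mono) auto
      finally show ?thesis by (rule triv)
    next
      case True
      \<comment> \<open>The lower bound on the energy of the class, divided by \<open>2 * Wv\<close>
        to pass from overlaps to pairs, then has exactly the form that
        \<open>tangential_bound\<close> requires.\<close>
      define A where "A = 16000000 * (K^4 / lam)"
      have Wv0: "0 < Wv" unfolding Wv_def by simp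
      have KL: "1 \<le> K^4 / lam" "K^4 / lam \<le> H^4"
      proof -
        have "lam^4 \<le> lam^1" using lam by (intro power_decreasing) auto
        then have "K^4 / lam \<le> K^4 / lam^4" using K1 lam by (intro divide_left_mono) auto
        also have "\<dots> = H^4" unfolding H_def by (simp add: power_divide)
        finally show "K^4 / lam \<le> H^4" .
        have "1 \<le> K^4" using K1 by simp
        then have "1 / 1 \<le> K^4 / lam" using lam by (intro frac_le) auto
        then show "1 \<le> K^4 / lam" by simp
      qed
      have A1: "1 \<le> A" unfolding A_def using KL by simp
      have "m1^2 \<le> 10^99 * 128^64 * A^64 * real (k+1)^3 * (CF * \<delta> powr (1 + t))^2"
      proof (rule tangential_bound[OF E m m10 jk d_def dd \<kappa>0(2) True Wv0 _ sym A1])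
        have "S \<le> (\<Sum>x\<in>N. w (fst x) * w (snd x) * (2 * Wv))"
          unfolding S_def using N(1) w0 x by (intro sum_mono mult_left_mono mult_nonneg_nonneg) auto
        also have "\<dots> = (\<Sum>u\<in>P. w u * sum w {a. (u,a) \<in> N}) * (2 * Wv)"
          unfolding sum_distrib_right[symmetric] sum_prod_relation[OF finP N(1)] ..
        finally have "m1 * lam / (320 * K^4) \<le> (\<Sum>u\<in>P. w u * sum w {a. (u,a) \<in> N}) * (2 * Wv)"
          using tot unfolding S_def by linarith
        then have "m1 * lam / (320 * K^4) / (2 * Wv) \<le> (\<Sum>u\<in>P. w u * sum w {a. (u,a) \<in> N})"
          by (subst pos_divide_le_eq) (use Wv0 in auto)
        moreover have "25000 * m1 / Wv / A = m1 * lam / (320 * K^4) / (2 * Wv)"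
          unfolding A_def using Wv0 lam K1 by (simp add: field_simps)
        ultimately show "25000 * m1 / Wv / A \<le> (\<Sum>u\<in>P. w u * sum w {a. (u,a) \<in> N})" by simp
        fix p q assume pq: "(p,q) \<in> N"
        show "p \<in> P \<and> q \<in> P \<and> d^2 \<le> D2 p q \<and> D2 p q < 4 * d^2 \<and> \<bar>Q p q\<bar> \<le> \<kappa> \<and>
          (\<kappa> = 108 * \<delta> * d \<or> 216 * \<delta> * d \<le> \<kappa> \<and> \<kappa> < 2 * \<bar>Q p q\<bar>) \<and> Wv < Wp E p q"
          using x'[OF pq] N(1) pq by blast
      qed
      also have "\<dots> = (10^99 * 128^64) * (16000000^64 * (K^4 / lam)^64) * K^3 * G^2"
        unfolding A_def G_def K power_mult_distrib by simp
      also have "\<dots> \<le> (10^99 * 128^64) * (16000000^64 * (H^4)^64) * H^4 * G^2"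
      proof -
        have KH: "K \<le> H" unfolding H_def using K1 lam by (simp add: field_simps mult_le_cancel_left1)
        have "K^3 \<le> H^3" using KH K1 by (intro power_mono) auto
        also have "\<dots> \<le> H^4" using H1 by (intro power_increasing) auto
        finally have "K^3 \<le> H^4" .
        moreover have "(K^4 / lam)^64 \<le> (H^4)^64" using KL by (intro power_mono) auto
        ultimately show ?thesis using K1 H1 KL(1) by (intro mult_right_mono mult_mono mult_left_mono) auto
      qed
      also have "\<dots> \<le> (10^100 * 128^64) * (16000000^64 * (H^4)^64) * H^4 * G^2"
        using H1 by (intro mult_right_mono) auto
      also have "\<dots> = (scale_const * H^130 * G)^2"
      proof -
        have "(H^4)^64 * H^4 = (H^130)^2" by (simp only: power_mult[symmetric] power_add[symmetric]) simp
        moreover have "(a ^ 100 * b ^ 64) * c ^ 64 = (a ^ 50 * b ^ 32 * c ^ 32)^2" for a b c :: real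
          by (simp only: power_mult_distrib power_mult[symmetric]) simp
        then have "(10^100 * 128^64) * 16000000^64 = scale_const^2" unfolding scale_const_def .
        moreover have "(a * b) * (c * h) * e * g = (a * b * c) * (h * e) * g" for a b c h e g :: real by (simp only: mult_ac)
        ultimately show ?thesis unfolding power_mult_distrib by metis
      qed
      finally have "m1^2 \<le> (scale_const * H^130 * G)^2" .
      then show ?thesis by (rule power2_le_imp_le) (use scale_const_lower H1 G0 in auto)
    qed
  qed
  then show ?thesis unfolding H_def G_def .
qed

end

context circle_scale
begin

theorem single_scale:
  assumes a: "0 \<le> a" "a \<le> 2" and cB: "real (card B) \<le> 4 * 2 powr (real k * a)"
    and lam: "1/2^k \<le> lam" "lam \<le> 1" and tot: "lam \<le> (\<Sum>p\<in>P. w p * (\<Sum>i\<in>B. Wt p i))"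
  shows "2 powr (real k * (1 + t - a)) \<le> 8 * scale_const * CF * (real (k+1) / lam)^131"
proof -
  define K where "K = real (k+1)"
  define nb where "nb = 4 * 2 powr (real k * a)"
  define mm where "mm i = (\<Sum>p\<in>P. w p * Wt p i)" for i
  define cut where "cut = lam / (2 * nb)"
  have lam0: "0 < lam" using lam(1) by (rule less_le_trans[rotated]) simp
  have K1: "1 \<le> K" unfolding K_def by simp
  have nb0: "0 < nb" unfolding nb_def by simp
  have cut0: "0 < cut" unfolding cut_def using lam0 nb0 by simp
  have cut_lower: "1 / 2^(3*k+3) \<le> cut"
  proof -
    have "2 powr (real k * a) \<le> 2 powr (real (2 * k))" using a mult_left_mono[OF a(2), of "real k"] by (intro powr_mono) auto
    also have "\<dots> = 2^(2*k)" by (rule powr_realpow) simp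
    finally have "2 * nb \<le> 8 * 2^(2*k)" unfolding nb_def by simp
    then have "(1/2^k) / (8 * 2^(2*k)) \<le> cut" unfolding cut_def using lam(1) nb0 lam0 by (intro frac_le) auto
    moreover have "(1/2^k) / (8 * 2^(2*k)) = 1 / (2::real)^(3*k+3)"
    proof -
      have "(2::real)^(3*k+3) = 2^(k + (3 + 2*k))" by (rule arg_cong) simp
      also have "\<dots> = 2^k * (8 * 2^(2*k))" by (simp only: power_add) simp
      finally show ?thesis by simp
    qed
    ultimately show ?thesis by linarith
  qed
  have mm0: "0 \<le> mm i" for i unfolding mm_def using w0 Wt_nonneg by (intro sum_nonneg) auto
  have mm1: "mm i \<le> 1" if "i \<in> B" for i
  proof -
    have "mm i \<le> (\<Sum>p\<in>P. w p * 1)" unfolding mm_def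
    proof (intro sum_mono mult_left_mono w0)
      fix p assume "p \<in> P"
      then show "Wt p i \<le> 1" unfolding Wt_def using inc_sub[OF _ that] by (intro fr_le_1) auto
    qed
    then show ?thesis using w1 by simp
  qed
  have "lam \<le> sum mm B"
  proof -
    have "(\<Sum>p\<in>P. w p * (\<Sum>i\<in>B. Wt p i)) = sum mm B"
      unfolding mm_def sum_distrib_left by (rule sum.swap)
    then show ?thesis using tot by simp
  qed
  moreover define B1 where "B1 = {i\<in>B. cut \<le> mm i}"
  moreover have "sum mm B = sum mm B1 + sum mm (B - B1)"
    using finB unfolding B1_def by (subst sum.union_disjoint[symmetric]) (auto intro!: sum.cong)
  moreover have "sum mm (B - B1) \<le> lam / 2"
  proof -
    have "sum mm (B - B1) \<le> (\<Sum>i\<in>B - B1. cut)" unfolding B1_def by (intro sum_mono) auto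
    also have "\<dots> = real (card (B - B1)) * cut" by simp
    also have "\<dots> \<le> nb * cut"
    proof (rule mult_right_mono)
      have "real (card (B - B1)) \<le> real (card B)" using finB by (intro of_nat_mono card_mono) auto
      then show "real (card (B - B1)) \<le> nb" using cB unfolding nb_def by linarith
    qed (use cut0 in simp)
    also have "\<dots> = lam / 2" unfolding cut_def using nb0 by simp
    finally show ?thesis .
  qed
  ultimately have B1: "lam / 2 \<le> sum mm B1" by linarith
  have fB1: "finite B1" unfolding B1_def using finB by simp
  have B1ne: "B1 \<noteq> {}" using B1 lam0 by auto
  have lv: "dyadic_level (mm i) < 4 * (k+1)" if "i \<in> B1" for i
  proof -
    have "1 / 2^(3*k+3+1) < (1 / 2^(3*k+3) :: real)" by (intro divide_strict_left_mono power_strict_increasing) auto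
    then have "1 / 2^(3*k+3+1) < mm i" using cut_lower that unfolding B1_def by simp
    then have "dyadic_level (mm i) \<le> 3*k+3" by (rule dyadic_level_le)
    then show ?thesis by simp
  qed
  obtain v0 where v0: "v0 \<in> {..<4*(k+1)}" "lam / 2 / (4 * K) \<le> sum mm {i\<in>B1. dyadic_level (mm i) = v0}"
  proof (rule weight_pigeonhole[OF fB1 finite_lessThan _ _ _ _ B1 B1ne])
    show "(\<lambda>i. dyadic_level (mm i)) ` B1 \<subseteq> {..<4*(k+1)}" using lv by auto
    show "real (card {..<4*(k+1)}) \<le> 4 * K" unfolding K_def by simp
  qed (use K1 lam0 in auto)
  define E where "E = {i\<in>B1. dyadic_level (mm i) = v0}"
  define m1 where "m1 = 1 / (2::real)^v0"
  have EB: "E \<subseteq> B" unfolding E_def B1_def by auto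
  have m10: "0 < m1" unfolding m1_def by simp
  have Em: "m1 / 2 \<le> mm i" "mm i \<le> m1" "cut \<le> mm i" if "i \<in> E" for i
  proof -
    have i: "i \<in> B" "cut \<le> mm i" "dyadic_level (mm i) = v0" using that unfolding E_def B1_def by auto
    have p: "0 < mm i" using i cut0 by linarith
    show "mm i \<le> m1" using dyadic_level(2)[OF p mm1[OF i(1)]] unfolding i(3) m1_def .
    show "m1 / 2 \<le> mm i" using dyadic_level(1)[OF p mm1[OF i(1)]] unfolding i(3) m1_def by simp
    show "cut \<le> mm i" by (rule i(2))
  qed
  have Esum: "lam / (8 * K) \<le> sum mm E" using v0(2) unfolding E_def by simp
  have "E \<noteq> {}"
  proof
    assume "E = {}"
    then have "lam / (8 * K) \<le> 0" using Esum by simp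
    moreover have "0 < lam / (8 * K)" using lam0 K1 by simp
    ultimately show False by linarith
  qed
  then have cm: "cut \<le> m1" using Em by (metis all_not_in_conv order_trans)
  define \<Theta> where "\<Theta> = m1 * lam / (16 * K)"
  define U where "U x = w (fst x) * w (snd x) * Wp E (fst x) (snd x)" for x
  have "\<Theta> = m1 / 2 * (lam / (8 * K))" unfolding \<Theta>_def by simp
  also have "\<dots> \<le> m1 / 2 * sum mm E" using Esum m10 by (intro mult_left_mono) auto
  also have "\<dots> \<le> sum U (P \<times> P)" unfolding U_def mm_def
    by (rule level_energy[OF EB _ m10]) (use Em(1) in \<open>auto simp: mm_def\<close>)
  finally have U\<Theta>: "\<Theta> \<le> sum U (P \<times> P)" .
  have \<Theta>0: "0 < \<Theta>" unfolding \<Theta>_def using m10 lam0 K1 by simp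
  \<comment> \<open>Pairs with tiny overlap carry at most half of the energy in total. Dropping them
    leaves a number of dyadic overlap levels that is linear in \<open>k\<close>.\<close>
  define G where "G = {x\<in>P \<times> P. \<Theta> / 2 < Wp E (fst x) (snd x)}"
  have fPP: "finite (P \<times> P)" using finP by simp
  have GP: "G \<subseteq> P \<times> P" and fG: "finite G" unfolding G_def using fPP by auto
  have "sum U (P \<times> P) = sum U G + sum U (P \<times> P - G)" using sum.subset_diff[OF GP fPP, of U] by simp
  moreover have "sum U (P \<times> P - G) \<le> \<Theta> / 2 * 1"
    unfolding U_def
  proof (rule sum_near_pairs)
    fix u assume "u \<in> P"
    have "sum w {a. (u,a) \<in> P \<times> P - G} \<le> sum w P" using finP w0 by (intro sum_mono2) auto
    then show "sum w {a. (u,a) \<in> P \<times> P - G} \<le> 1" using w1 by linarith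
  qed (use \<Theta>0 in \<open>auto simp: G_def\<close>)
  ultimately have GU: "\<Theta> / 2 \<le> sum U G" using U\<Theta> by linarith
  have Gne: "G \<noteq> {}" using GU \<Theta>0 by auto
  define cf where "cf x = (if D2 (fst x) (snd x) < (2^16 * \<delta>)^2 then None else Some (dist_level x, tangency_level x, dyadic_level (Wp E (fst x) (snd x))))" for x
  define T where "T = insert None (Some ` ({..k} \<times> {..k} \<times> {..<9*(k+1)}))"
  have "real (card T) \<le> 10 * K^3"
  proof -
    have "card T \<le> 1 + card (Some ` ({..k} \<times> {..k} \<times> {..<9*(k+1)}))" unfolding T_def by (simp add: card_insert_le_m1 card_insert_if)
    also have "card (Some ` ({..k} \<times> {..k} \<times> {..<9*(k+1)})) = (k+1) * ((k+1) * (9*(k+1)))"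
      by (subst card_image) (auto simp: card_cartesian_product)
    finally have "real (card T) \<le> real (1 + (k+1) * ((k+1) * (9*(k+1))))" by (rule of_nat_mono)
    also have "\<dots> = 1 + 9 * K^3" unfolding K_def by (simp add: power3_eq_cube algebra_simps)
    also have "\<dots> \<le> 10 * K^3" using one_le_power[OF K1, of 3] by simp
    finally show ?thesis .
  qed
  moreover have "cf ` G \<subseteq> T"
  proof
    fix y assume "y \<in> cf ` G"
    then obtain x where x: "x \<in> G" "y = cf x" by auto
    show "y \<in> T"
    proof (cases "D2 (fst x) (snd x) < (2^16 * \<delta>)^2")
      case True
      then show ?thesis unfolding x(2) cf_def T_def by simp
    next
      case False
      then have D: "(2^16 * \<delta>)^2 \<le> D2 (fst x) (snd x)" by simp
      have xP: "fst x \<in> P" "snd x \<in> P" using x GP by auto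
      have "1 / 2^(5*k+8) \<le> \<Theta> / 2"
      proof -
        have "K \<le> 2^k" unfolding K_def using less_exp[of k] by (metis Suc_eq_plus1 Suc_leI numeral_power_le_of_nat_cancel_iff of_nat_le_iff of_nat_numeral of_nat_power)
        then have "(1 / 2^(3*k+3)) * (1/2^k) / (32 * 2^k) \<le> m1 * lam / (32 * K)"
          using cut_lower cm lam m10 lam0 K1 by (intro frac_le mult_mono) auto
        moreover have "(1 / 2^(3*k+3)) * (1/2^k) / (32 * 2^k) = 1 / (2::real)^(5*k+8)"
        proof -
          have "(2::real)^(5*k+8) = 2^((3*k+3) + k + 5 + k)" by (rule arg_cong) simp
          also have "\<dots> = 2^(3*k+3) * 2^k * (32 * 2^k)" by (simp only: power_add) simp
          finally show ?thesis by simp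
        qed
        ultimately show ?thesis unfolding \<Theta>_def by simp
      qed
      moreover have "\<Theta> / 2 < Wp E (fst x) (snd x)" using x unfolding G_def by auto
      ultimately have "1 / 2^(5*k+8) < Wp E (fst x) (snd x)" by (rule le_less_trans)
      moreover have "5*k+8 = (5*k+7)+1" by simp
      ultimately have "1 / 2^((5*k+7)+1) < Wp E (fst x) (snd x)" by (simp only:)
      then have "dyadic_level (Wp E (fst x) (snd x)) \<le> 5*k+7" by (rule dyadic_level_le)
      then have "dyadic_level (Wp E (fst x) (snd x)) < 9*(k+1)" by simp
      then show ?thesis using False dist_level(1)[OF xP D] tangency_level(1)[OF xP D refl] unfolding x(2) cf_def T_def by simp
    qed
  qed
  moreover have "finite T" unfolding T_def by simp
  ultimately have T: "finite T" "cf ` G \<subseteq> T" "real (card T) \<le> 10 * K^3" by auto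
  have \<Theta>2: "0 \<le> \<Theta> / 2" "0 < 10 * K^3" using \<Theta>0 K1 by auto
  obtain c where c: "\<Theta> / 2 / (10 * K^3) \<le> sum U {x\<in>G. cf x = c}"
    using weight_pigeonhole[OF fG T \<Theta>2(2,1) GU Gne] by blast
  define N where "N = {x\<in>G. cf x = c}"
  have "m1 \<le> scale_const * (K / lam)^130 * (CF * \<delta> powr (1 + t))"
  proof (rule class_bound[OF EB _ m10, of N c])
    show "(\<Sum>p\<in>P. w p * Wt p i) \<le> m1" if "i \<in> E" for i using Em(2)[OF that] unfolding mm_def .
    show "N \<subseteq> P \<times> P" unfolding N_def using GP by auto
    show "0 < Wp E (fst x) (snd x)" if "x \<in> N" for x using that \<Theta>0 unfolding N_def G_def by auto
    show "(if D2 (fst x) (snd x) < (2^16 * \<delta>)^2 then None else Some (dist_level x, tangency_level x, dyadic_level (Wp E (fst x) (snd x)))) = c" if "x \<in> N" for x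
      using that unfolding N_def cf_def by auto
    show "(q,p) \<in> N" if "(p,q) \<in> N" for p q
    proof -
      have 1: "dist_level (q,p) = dist_level (p,q)" unfolding dist_level_def by (simp add: D2_comm)
      have 2: "tangency_level (q,p) = tangency_level (p,q)" unfolding tangency_level_def 1 by (simp add: Q_comm)
      have "cf (q,p) = cf (p,q)" unfolding cf_def 1 2 fst_conv snd_conv D2_comm[of q p] Wp_comm[of E q p] ..
      then show ?thesis using that Wp_comm[of E p q] unfolding N_def G_def by auto
    qed
    have "m1 * lam / (320 * K^4) = \<Theta> / 2 / (10 * K^3)" unfolding \<Theta>_def by (simp add: power4_eq_xxxx power3_eq_cube)
    then show "m1 * lam / (320 * K^4) \<le> (\<Sum>x\<in>N. w (fst x) * w (snd x) * Wp E (fst x) (snd x))"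
      using c unfolding N_def U_def by simp
  qed (use lam0 lam in \<open>auto simp: K_def\<close>)
  then have "cut \<le> scale_const * (K / lam)^130 * (CF * \<delta> powr (1 + t))" using cm by linarith
  then have "lam \<le> scale_const * (K / lam)^130 * (CF * \<delta> powr (1 + t)) * (2 * nb)" unfolding cut_def using nb0 by (simp add: pos_divide_le_eq)
  then have 1: "1 \<le> scale_const * (K / lam)^130 * (CF * \<delta> powr (1 + t)) * (2 * nb) / lam" using lam0 by simp
  have "\<delta> powr (1 + t) = 2 powr (- (real k * (1 + t)))"
  proof -
    have "\<delta> = 2 powr (- real k)" unfolding \<delta>_def by (simp add: powr_minus powr_realpow divide_inverse)
    then show ?thesis by (simp add: powr_powr)
  qed
  then have e: "\<delta> powr (1 + t) * (2 powr (real k * a)) = 1 / 2 powr (real k * (1 + t - a))"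
    by (simp add: powr_add[symmetric] powr_minus_divide[symmetric] algebra_simps)
  have "scale_const * (K / lam)^130 * (CF * \<delta> powr (1 + t)) * (2 * nb) / lam = 8 * scale_const * CF * ((K / lam)^130 * (1 / lam)) * (\<delta> powr (1 + t) * (2 powr (real k * a)))"
    unfolding nb_def by simp
  also have "\<dots> \<le> 8 * scale_const * CF * (K / lam)^131 * (\<delta> powr (1 + t) * (2 powr (real k * a)))"
  proof -
    have "(K / lam)^130 * (1 / lam) \<le> (K / lam)^130 * (K / lam)" using lam0 K1 by (intro mult_left_mono divide_right_mono) auto
    also have "\<dots> = (K / lam)^(130 + 1)" unfolding power_add by simp
    also have "130 + 1 = (131 :: nat)" by simp
    finally show ?thesis using scale_const_lower CF by (intro mult_right_mono mult_left_mono) auto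
  qed
  finally have "1 \<le> 8 * scale_const * CF * (K / lam)^131 * (\<delta> powr (1 + t) * (2 powr (real k * a)))" by (rule order_trans[OF 1])
  then have "1 \<le> 8 * scale_const * CF * (K / lam)^131 / 2 powr (real k * (1 + t - a))" unfolding e by (simp only: times_divide_eq_right mult_1_right)
  then have "1 * 2 powr (real k * (1 + t - a)) \<le> 8 * scale_const * CF * (K / lam)^131" by (subst (asm) pos_le_divide_eq) auto
  then show ?thesis unfolding K_def by simp
qed

end

section \<open>Discrete Frostman measures\<close>

text \<open>The mass of a cell that is too heavy is scaled down, which makes the cell exactly as heavy as it may be.\<close>
lemma frostman_levels:
  fixes cl :: "nat \<Rightarrow> 'p \<Rightarrow> 'c" and t :: real
  assumes P: "finite P" and mono: "\<And>j k p q. cl k p = cl k q \<Longrightarrow> j \<le> k \<Longrightarrow> cl j p = cl j q"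
    and inj: "inj_on (cl k) P" and ik: "i \<le> k"
  shows "\<exists>\<mu> :: 'p \<Rightarrow> real. (\<forall>p. 0 \<le> \<mu> p) \<and>
    (\<forall>p\<in>P. \<forall>j. i \<le> j \<and> j \<le> k \<longrightarrow> sum \<mu> {q\<in>P. cl j q = cl j p} \<le> (1/2^j) powr t) \<and>
    (\<forall>p\<in>P. \<exists>j. i \<le> j \<and> j \<le> k \<and> sum \<mu> {q\<in>P. cl j q = cl j p} = (1/2^j) powr t)"
  using ik
proof (induction i rule: inc_induct)
  case base
  have s: "sum (\<lambda>_. (1/2^k) powr t) {q\<in>P. cl k q = cl k p} = (1/2^k) powr t" if "p \<in> P" for p
  proof -
    have "{q\<in>P. cl k q = cl k p} = {p}" using inj that by (auto dest: inj_onD)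
    then show ?thesis by simp
  qed
  show ?case
  proof (intro exI[of _ "\<lambda>_. (1/2^k) powr t"] conjI allI ballI impI)
    fix p j assume p: "p \<in> P" and j: "k \<le> j \<and> j \<le> k"
    then have "j = k" by simp
    then show "sum (\<lambda>_. (1/2^k) powr t) {q\<in>P. cl j q = cl j p} \<le> (1/2^j) powr t" using s[OF p] by simp
  next
    fix p assume p: "p \<in> P"
    show "\<exists>j. k \<le> j \<and> j \<le> k \<and> sum (\<lambda>_. (1/2^k) powr t) {q\<in>P. cl j q = cl j p} = (1/2^j) powr t"
      using s[OF p] by (intro exI[of _ k]) simp
  qed simp
next
  case (step i)
  then obtain \<mu> :: "'p \<Rightarrow> real" where \<mu>: "\<And>p. 0 \<le> \<mu> p"
    "\<And>p j. p \<in> P \<Longrightarrow> Suc i \<le> j \<Longrightarrow> j \<le> k \<Longrightarrow> sum \<mu> {q\<in>P. cl j q = cl j p} \<le> (1/2^j) powr t"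
    "\<And>p. p \<in> P \<Longrightarrow> \<exists>j. Suc i \<le> j \<and> j \<le> k \<and> sum \<mu> {q\<in>P. cl j q = cl j p} = (1/2^j) powr t" by blast
  define c where "c = (1/2^i) powr t"
  define m where "m p = sum \<mu> {q\<in>P. cl i q = cl i p}" for p
  define \<nu> where "\<nu> p = (if m p \<le> c then \<mu> p else \<mu> p * (c / m p))" for p
  have c0: "0 < c" unfolding c_def by simp
  have \<nu>: "0 \<le> \<nu> p" "\<nu> p \<le> \<mu> p" for p
  proof -
    show "0 \<le> \<nu> p" unfolding \<nu>_def using \<mu>(1) c0 by auto
    have "\<mu> p * (c / m p) \<le> \<mu> p * 1" if "c < m p" using that c0 \<mu>(1) by (intro mult_left_mono) auto
    then show "\<nu> p \<le> \<mu> p" unfolding \<nu>_def by auto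
  qed
  have mcong: "m q = m p" if "cl i q = cl i p" for p q unfolding m_def that ..
  have lev_i: "sum \<nu> {q\<in>P. cl i q = cl i p} = (if m p \<le> c then m p else c)" for p
  proof (cases "m p \<le> c")
    case True
    have "\<nu> q = \<mu> q" if "q \<in> {q\<in>P. cl i q = cl i p}" for q
    proof -
      have "m q = m p" using that by (intro mcong) auto
      then show ?thesis unfolding \<nu>_def using True by simp
    qed
    then have "sum \<nu> {q\<in>P. cl i q = cl i p} = m p" unfolding m_def[of p] by (rule sum.cong[OF refl])
    then show ?thesis using True by simp
  next
    case False
    have "\<nu> q = \<mu> q * (c / m p)" if "q \<in> {q\<in>P. cl i q = cl i p}" for q
    proof -
      have "m q = m p" using that by (intro mcong) auto
      then show ?thesis unfolding \<nu>_def using False by simp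
    qed
    then have "sum \<nu> {q\<in>P. cl i q = cl i p} = (\<Sum>q\<in>{q\<in>P. cl i q = cl i p}. \<mu> q * (c / m p))"
      by (rule sum.cong[OF refl])
    also have "\<dots> = m p * (c / m p)" unfolding m_def by (rule sum_distrib_right[symmetric])
    finally show ?thesis using False c0 by simp
  qed
  show ?case
  proof (intro exI[of _ \<nu>] conjI allI ballI impI)
    show "0 \<le> \<nu> p" for p by (rule \<nu>)
    fix p j assume p: "p \<in> P" and j: "i \<le> j \<and> j \<le> k"
    show "sum \<nu> {q\<in>P. cl j q = cl j p} \<le> (1/2^j) powr t"
    proof (cases "j = i")
      case True
      then show ?thesis using lev_i[of p] unfolding c_def by auto
    next
      case False
      have "sum \<nu> {q\<in>P. cl j q = cl j p} \<le> sum \<mu> {q\<in>P. cl j q = cl j p}" by (intro sum_mono \<nu>)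
      also have "\<dots> \<le> (1/2^j) powr t" using \<mu>(2)[OF p] j False by simp
      finally show ?thesis .
    qed
  next
    fix p assume p: "p \<in> P"
    show "\<exists>j. i \<le> j \<and> j \<le> k \<and> sum \<nu> {q\<in>P. cl j q = cl j p} = (1/2^j) powr t"
    proof (cases "m p \<le> c")
      case True
      obtain j where j: "Suc i \<le> j" "j \<le> k" "sum \<mu> {q\<in>P. cl j q = cl j p} = (1/2^j) powr t" using \<mu>(3)[OF p] by auto
      have "sum \<nu> {q\<in>P. cl j q = cl j p} = sum \<mu> {q\<in>P. cl j q = cl j p}"
      proof (intro sum.cong refl)
        fix q assume "q \<in> {q\<in>P. cl j q = cl j p}"
        then have "cl i q = cl i p" using mono j(1) by (metis (mono_tags, lifting) Suc_leD mem_Collect_eq)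
        then have "m q = m p" by (rule mcong)
        then show "\<nu> q = \<mu> q" unfolding \<nu>_def using True by simp
      qed
      then show ?thesis using j by (metis Suc_leD)
    next
      case False
      then have "sum \<nu> {q\<in>P. cl i q = cl i p} = (1/2^i) powr t" using lev_i[of p] unfolding c_def by simp
      then show ?thesis using step.hyps by (intro exI[of _ i]) auto
    qed
  qed
qed

text \<open>\<open>P\<close> has one representative in each finest cell. The cells in
  \<open>C\<close> are the coarsest ones around points of \<open>P\<close> in which the mass bound
  is attained; they are disjoint by maximality and contain every point of \<open>E\<close>, so their
  weights add up to the mass of \<mu>.\<close>

lemma discrete_frostman:
  fixes cl :: "nat \<Rightarrow> 'p \<Rightarrow> 'c" and t :: real
  assumes fin: "finite (cl k ` E)" and mono: "\<And>j k p q. cl k p = cl k q \<Longrightarrow> j \<le> k \<Longrightarrow> cl j p = cl j q"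
  obtains P \<mu> C where "finite P" "P \<subseteq> E" "\<And>p. 0 \<le> \<mu> p"
    "\<And>p j. p \<in> P \<Longrightarrow> j \<le> k \<Longrightarrow> sum \<mu> {q\<in>P. cl j q = cl j p} \<le> (1/2^j) powr t"
    "finite C" "\<And>e. e \<in> E \<Longrightarrow> \<exists>j. (j, cl j e) \<in> C" "(\<Sum>x\<in>C. (1/2^(fst x)) powr t) \<le> sum \<mu> P"
proof -
  define P where "P = inv_into E (cl k) ` (cl k ` E)"
  have PE: "P \<subseteq> E" unfolding P_def by (auto intro: inv_into_into)
  have fP: "finite P" unfolding P_def using fin by simp
  have inj: "inj_on (cl k) P" unfolding P_def by (auto simp: inj_on_def f_inv_into_f)
  have rep: "\<exists>p\<in>P. cl k e = cl k p" if "e \<in> E" for e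
    using that unfolding P_def by (intro bexI[of _ "inv_into E (cl k) (cl k e)"]) (auto simp: f_inv_into_f)
  have "\<exists>\<mu> :: 'p \<Rightarrow> real. (\<forall>p. 0 \<le> \<mu> p) \<and>
    (\<forall>p\<in>P. \<forall>j. 0 \<le> j \<and> j \<le> k \<longrightarrow> sum \<mu> {q\<in>P. cl j q = cl j p} \<le> (1/2^j) powr t) \<and>
    (\<forall>p\<in>P. \<exists>j. 0 \<le> j \<and> j \<le> k \<and> sum \<mu> {q\<in>P. cl j q = cl j p} = (1/2^j) powr t)"
    by (rule frostman_levels[where cl = cl and k = k]) (rule fP, erule (1) mono, rule inj, simp)
  then obtain \<mu> :: "'p \<Rightarrow> real" where \<mu>: "\<And>p. 0 \<le> \<mu> p"
    "\<And>p j. p \<in> P \<Longrightarrow> j \<le> k \<Longrightarrow> sum \<mu> {q\<in>P. cl j q = cl j p} \<le> (1/2^j) powr t"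
    "\<And>p. p \<in> P \<Longrightarrow> \<exists>j. j \<le> k \<and> sum \<mu> {q\<in>P. cl j q = cl j p} = (1/2^j) powr t"
    by (simp only: le0 simp_thms) blast
  define sat where "sat j p \<longleftrightarrow> j \<le> k \<and> sum \<mu> {q\<in>P. cl j q = cl j p} = (1/2^j) powr t" for j p
  define J where "J p = (LEAST j. sat j p)" for p
  have J: "sat (J p) p" if "p \<in> P" for p
  proof -
    have "\<exists>j. sat j p" using \<mu>(3)[OF that] unfolding sat_def .
    then show ?thesis unfolding J_def by (rule LeastI_ex)
  qed
  have J_le: "J p \<le> j" if "sat j p" for j p unfolding J_def using that by (rule Least_le)
  have sat_cong: "sat j p \<longleftrightarrow> sat j q" if "cl j p = cl j q" for j p q unfolding sat_def that ..
  have Jeq: "J q = J p" if p: "p \<in> P" "q \<in> P" and c: "cl (J p) q = cl (J p) p" for p q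
  proof -
    have "sat (J p) q" using J[OF p(1)] sat_cong[OF c] by simp
    then have le: "J q \<le> J p" by (rule J_le)
    have "cl (J q) q = cl (J q) p" using c le by (rule mono)
    then have "sat (J q) p" using J[OF p(2)] sat_cong by metis
    then show ?thesis using J_le le by (simp add: le_antisym)
  qed
  define h where "h p = (J p, cl (J p) p)" for p
  define C where "C = h ` P"
  have "sum \<mu> P = (\<Sum>x\<in>C. sum \<mu> {q\<in>P. h q = x})" unfolding C_def
    by (rule sum.group[OF fP finite_imageI[OF fP] subset_refl, symmetric])
  also have "\<dots> = (\<Sum>x\<in>C. (1/2^(fst x)) powr t)"
  proof (intro sum.cong refl)
    fix x assume "x \<in> C"
    then obtain p where p: "p \<in> P" "x = h p" unfolding C_def by auto
    have "{q\<in>P. h q = x} = {q\<in>P. cl (J p) q = cl (J p) p}" unfolding p(2) h_def using Jeq[OF p(1)] by auto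
    then show "sum \<mu> {q\<in>P. h q = x} = (1/2^(fst x)) powr t" using J[OF p(1)] unfolding sat_def p(2) h_def by simp
  qed
  finally have w: "(\<Sum>x\<in>C. (1/2^(fst x)) powr t) \<le> sum \<mu> P" by simp
  have cov: "\<exists>j. (j, cl j e) \<in> C" if e: "e \<in> E" for e
  proof -
    obtain p where p: "p \<in> P" "cl k e = cl k p" using rep[OF e] by auto
    have "J p \<le> k" using J[OF p(1)] unfolding sat_def by simp
    with p(2) have "cl (J p) e = cl (J p) p" by (rule mono)
    then have "(J p, cl (J p) e) \<in> C" unfolding C_def h_def using p(1) by auto
    then show ?thesis by blast
  qed
  have "finite C" unfolding C_def using fP by simp
  then show ?thesis using that[OF fP PE \<mu>(1,2) _ cov w] by blast
qed

section \<open>Null sets of Hausdorff measures\<close>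

text \<open>A bound on the diameters is not needed here, since a small sum forces small diameters.\<close>
definition hnull :: "real \<Rightarrow> 'a::metric_space set \<Rightarrow> bool" where
  "hnull s A \<longleftrightarrow> (\<forall>\<epsilon>>0. \<exists>U::nat \<Rightarrow> 'a set. (\<forall>i. bounded (U i)) \<and> A \<subseteq> (\<Union>i. U i) \<and>
     (\<Sum>i. ennreal (diameter (U i) powr s)) \<le> ennreal \<epsilon>)"

lemma bounded_diameter_le:
  fixes S :: "'a::metric_space set"
  assumes "\<And>x y. x \<in> S \<Longrightarrow> y \<in> S \<Longrightarrow> dist x y \<le> e" "0 \<le> e"
  shows "bounded S" "diameter S \<le> e"
proof -
  show "bounded S" using assms(1) unfolding bounded_def by blast
  show "diameter S \<le> e"
  proof (cases "S = {}")
    case False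
    have "(SUP x\<in>S \<times> S. case_prod dist x) \<le> e"
      by (rule cSUP_least) (use False assms(1) in auto)
    then show ?thesis unfolding diameter_def using False by simp
  qed (use assms(2) in \<open>simp add: diameter_def\<close>)
qed

lemma diameter_pow_eq: "0 < s \<Longrightarrow> diameter_pow s U = ennreal (diameter U powr s)"
  unfolding diameter_pow_def by (cases "U = {}") (simp_all add: diameter_empty)

lemma hnullD:
  assumes "hnull s A" "0 < \<epsilon>"
  obtains U :: "nat \<Rightarrow> 'a::metric_space set" where "\<forall>i. bounded (U i)" "A \<subseteq> (\<Union>i. U i)"
    "(\<Sum>i. ennreal (diameter (U i) powr s)) \<le> ennreal \<epsilon>"
proof -
  have "\<exists>U::nat \<Rightarrow> 'a set. (\<forall>i. bounded (U i)) \<and> A \<subseteq> (\<Union>i. U i) \<and> (\<Sum>i. ennreal (diameter (U i) powr s)) \<le> ennreal \<epsilon>"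
    using assms(1)[unfolded hnull_def, rule_format, OF assms(2)] .
  then show ?thesis
  proof (elim exE conjE)
    fix U :: "nat \<Rightarrow> 'a set"
    assume U: "\<forall>i. bounded (U i)" "A \<subseteq> (\<Union>i. U i)" "(\<Sum>i. ennreal (diameter (U i) powr s)) \<le> ennreal \<epsilon>"
    show ?thesis by (rule that[OF U])
  qed
qed

lemma ennreal_term_le_suminf:
  fixes f :: "nat \<Rightarrow> ennreal"
  shows "f i \<le> (\<Sum>i. f i)"
proof -
  have "sum f {i} \<le> suminf f" by (rule sum_le_suminf) auto
  then show ?thesis by simp
qed

lemma hausdorff_premeasure_le: "0 < \<delta> \<Longrightarrow> hausdorff_premeasure s \<delta> A \<le> hausdorff_measure s A"
  unfolding hausdorff_measure_def by (intro SUP_upper) simp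

lemma hausdorff_null_iff:
  fixes A :: "'a::metric_space set"
  assumes s: "0 < s"
  shows "hausdorff_measure s A = 0 \<longleftrightarrow> hnull s A"
proof
  assume "hausdorff_measure s A = 0"
  then have p: "hausdorff_premeasure s 1 A = 0"
    using hausdorff_premeasure_le[of 1 s A] by simp
  show "hnull s A"
    unfolding hnull_def
  proof (intro allI impI)
    fix \<epsilon> :: real assume "0 < \<epsilon>"
    then have "hausdorff_premeasure s 1 A < ennreal \<epsilon>" using p by simp
    then obtain U where U: "U \<in> delta_covers 1 A" "(\<Sum>i. diameter_pow s (U i)) < ennreal \<epsilon>"
      unfolding hausdorff_premeasure_def INF_less_iff by blast
    then show "\<exists>U::nat \<Rightarrow> 'a set. (\<forall>i. bounded (U i)) \<and> A \<subseteq> (\<Union>i. U i) \<and>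
        (\<Sum>i. ennreal (diameter (U i) powr s)) \<le> ennreal \<epsilon>"
      unfolding delta_covers_def diameter_pow_eq[OF s] by (intro exI[of _ U]) (simp add: less_imp_le)
  qed
next
  assume h: "hnull s A"
  have "hausdorff_premeasure s \<delta> A \<le> 0" if \<delta>: "0 < \<delta>" for \<delta>
  proof (rule ennreal_le_epsilon)
    fix e :: real assume e: "0 < e"
    have "0 < min e (\<delta> powr s)" using e \<delta> by simp
    then obtain U :: "nat \<Rightarrow> 'a set" where U: "\<forall>i. bounded (U i)" "A \<subseteq> (\<Union>i. U i)"
      "(\<Sum>i. ennreal (diameter (U i) powr s)) \<le> ennreal (min e (\<delta> powr s))"
      by (rule hnullD[OF h])
    have "diameter (U i) \<le> \<delta>" for i
    proof (rule ccontr)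
      assume "\<not> diameter (U i) \<le> \<delta>"
      then have "\<delta> powr s < diameter (U i) powr s" using \<delta> s by (intro powr_less_mono2) auto
      then have "ennreal (\<delta> powr s) < ennreal (diameter (U i) powr s)" by (simp add: ennreal_less_iff)
      also have "\<dots> \<le> (\<Sum>i. ennreal (diameter (U i) powr s))" by (rule ennreal_term_le_suminf)
      also have "\<dots> \<le> ennreal (min e (\<delta> powr s))" by (rule U)
      also have "\<dots> \<le> ennreal (\<delta> powr s)" by (intro ennreal_leI) auto
      finally show False by simp
    qed
    then have "U \<in> delta_covers \<delta> A" unfolding delta_covers_def using U(1,2) by simp
    then have "hausdorff_premeasure s \<delta> A \<le> (\<Sum>i. diameter_pow s (U i))"
      unfolding hausdorff_premeasure_def by (rule INF_lower)
    also have "\<dots> \<le> ennreal (min e (\<delta> powr s))" unfolding diameter_pow_eq[OF s] by (rule U)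
    also have "\<dots> \<le> ennreal e" by (intro ennreal_leI) auto
    finally show "hausdorff_premeasure s \<delta> A \<le> 0 + ennreal e" by simp
  qed
  then have "hausdorff_measure s A \<le> 0" unfolding hausdorff_measure_def by (intro SUP_least) simp
  then show "hausdorff_measure s A = 0" by simp
qed

text \<open>With exponent 0 every nonempty covering set counts 1. So for a nonempty set the infimum
  that defines the dimension runs over positive exponents only, where \<open>hnull\<close> describes
  the null sets.\<close>

lemma hausdorff_measure_0:
  assumes "hausdorff_measure 0 A = 0"
  shows "A = {}"
proof (rule ccontr)
  assume "A \<noteq> {}"
  have "hausdorff_premeasure 0 1 A \<le> 0"
    using hausdorff_premeasure_le[of 1 0 A] unfolding assms by linarith
  also have "(0::ennreal) < 1" by simp
  finally have "hausdorff_premeasure 0 1 A < 1" .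
  then obtain U where U: "U \<in> delta_covers 1 A" "(\<Sum>i. diameter_pow 0 (U i)) < 1"
    unfolding hausdorff_premeasure_def INF_less_iff by blast
  obtain i where "U i \<noteq> {}" using U(1) \<open>A \<noteq> {}\<close> unfolding delta_covers_def by blast
  then have "1 = diameter_pow 0 (U i)" unfolding diameter_pow_def by simp
  also have "\<dots> \<le> (\<Sum>i. diameter_pow 0 (U i))" by (rule ennreal_term_le_suminf)
  finally show False using U(2) by simp
qed

lemma hnull_mono: "A \<subseteq> B \<Longrightarrow> hnull s B \<Longrightarrow> hnull s A"
  unfolding hnull_def by (meson order_trans)

lemma double_cover:
  fixes V :: "nat \<Rightarrow> nat \<Rightarrow> 'a::metric_space set"
  assumes "\<And>k l. bounded (V k l)" "A \<subseteq> (\<Union>k. \<Union>l. V k l)"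
    and b: "\<And>k. (\<Sum>l. ennreal (diameter (V k l) powr s)) \<le> ennreal (b k)" "(\<Sum>k. ennreal (b k)) \<le> \<epsilon>"
  shows "\<exists>U::nat \<Rightarrow> 'a set. (\<forall>i. bounded (U i)) \<and> A \<subseteq> (\<Union>i. U i) \<and>
     (\<Sum>i. ennreal (diameter (U i) powr s)) \<le> \<epsilon>"
proof (intro exI[of _ "\<lambda>i. case_prod V (prod_decode i)"] conjI allI)
  show "bounded (case_prod V (prod_decode i))" for i using assms(1) by (simp split: prod.split)
  show "A \<subseteq> (\<Union>i. case_prod V (prod_decode i))"
  proof
    fix x assume "x \<in> A"
    then obtain k l where "x \<in> V k l" using assms(2) by blast
    then have "x \<in> case_prod V (prod_decode (prod_encode (k,l)))" by simp
    then show "x \<in> (\<Union>i. case_prod V (prod_decode i))" by (rule UN_I[OF UNIV_I])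
  qed
  have "(\<Sum>i. ennreal (diameter (case_prod V (prod_decode i)) powr s)) = (\<Sum>k. \<Sum>l. ennreal (diameter (V k l) powr s))"
    by (rule suminf_ennreal_2dimen[of "\<lambda>k. \<Sum>l. ennreal (diameter (V k l) powr s)" "\<lambda>x. ennreal (diameter (case_prod V x) powr s)"])
      (simp only: case_prod_conv)
  also have "\<dots> \<le> (\<Sum>k. ennreal (b k))" by (intro suminf_le b) auto
  also have "\<dots> \<le> \<epsilon>" by (rule b)
  finally show "(\<Sum>i. ennreal (diameter (case_prod V (prod_decode i)) powr s)) \<le> \<epsilon>" .
qed

lemma family_cover:
  fixes V :: "nat \<Rightarrow> 'i \<Rightarrow> 'a::metric_space set"
  assumes fin: "\<And>k. finite (I k)" and bd: "\<And>k i. i \<in> I k \<Longrightarrow> bounded (V k i)" and cov: "A \<subseteq> (\<Union>k. \<Union>i\<in>I k. V k i)"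
    and b: "\<And>k. (\<Sum>i\<in>I k. diameter (V k i) powr s) \<le> b k" "(\<Sum>k. ennreal (b k)) \<le> \<epsilon>"
  shows "\<exists>U::nat \<Rightarrow> 'a set. (\<forall>i. bounded (U i)) \<and> A \<subseteq> (\<Union>i. U i) \<and>
     (\<Sum>i. ennreal (diameter (U i) powr s)) \<le> \<epsilon>"
proof -
  have "\<forall>k. \<exists>h. bij_betw h {..<card (I k)} (I k)" using fin by (metis ex_bij_betw_nat_finite lessThan_atLeast0)
  then obtain h where h: "\<And>k. bij_betw (h k) {..<card (I k)} (I k)" by metis
  define W where "W k l = (if l < card (I k) then V k (h k l) else {})" for k l
  show ?thesis
  proof (rule double_cover[OF _ _ _ b(2)])
    show "bounded (W k l)" for k l unfolding W_def using bd bij_betwE[OF h[of k]] by auto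
    show "A \<subseteq> (\<Union>k. \<Union>l. W k l)"
    proof
      fix x assume "x \<in> A"
      then obtain k i where i: "i \<in> I k" "x \<in> V k i" using cov by blast
      then obtain l where "l < card (I k)" "i = h k l" using h[of k] unfolding bij_betw_def by auto
      then have "x \<in> W k l" unfolding W_def using i by simp
      then show "x \<in> (\<Union>k. \<Union>l. W k l)" by blast
    qed
    fix k
    have "(\<Sum>l. ennreal (diameter (W k l) powr s)) = (\<Sum>l<card (I k). ennreal (diameter (W k l) powr s))"
      by (rule suminf_finite) (auto simp: W_def diameter_def)
    also have "\<dots> = (\<Sum>l<card (I k). ennreal (diameter (V k (h k l)) powr s))" by (intro sum.cong) (auto simp: W_def)
    also have "\<dots> = (\<Sum>i\<in>I k. ennreal (diameter (V k i) powr s))" by (rule sum.reindex_bij_betw[OF h])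
    also have "\<dots> = ennreal (\<Sum>i\<in>I k. diameter (V k i) powr s)" by (rule sum_ennreal) auto
    also have "\<dots> \<le> ennreal (b k)" by (intro ennreal_leI b)
    finally show "(\<Sum>l. ennreal (diameter (W k l) powr s)) \<le> ennreal (b k)" .
  qed
qed

lemma geometric_ennreal:
  assumes "0 \<le> \<epsilon>"
  shows "(\<Sum>n. ennreal (\<epsilon> * (1/2)^(Suc n))) = ennreal \<epsilon>"
proof -
  have "(\<lambda>n. \<epsilon> * (1/2)^(Suc n)) sums (\<epsilon> * 1)" by (intro sums_mult power_half_series)
  then show ?thesis using assms by (intro suminf_ennreal_eq) auto
qed

lemma hnull_UN:
  fixes A :: "nat \<Rightarrow> 'a::metric_space set"
  assumes "\<And>n. hnull s (A n)"
  shows "hnull s (\<Union>n. A n)"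
  unfolding hnull_def
proof (intro allI impI)
  fix \<epsilon> :: real assume \<epsilon>: "0 < \<epsilon>"
  define good :: "nat \<Rightarrow> (nat \<Rightarrow> 'a set) \<Rightarrow> bool" where
    "good n U \<longleftrightarrow> (\<forall>i. bounded (U i)) \<and> A n \<subseteq> (\<Union>i. U i) \<and>
       (\<Sum>i. ennreal (diameter (U i) powr s)) \<le> ennreal (\<epsilon> * (1/2)^(Suc n))" for n U
  have "\<exists>U. good n U" for n
  proof -
    have "0 < \<epsilon> * (1/2)^(Suc n)" using \<epsilon> by simp
    from assms[unfolded hnull_def, rule_format, OF this] show ?thesis unfolding good_def .
  qed
  then have "\<exists>V. \<forall>n. good n (V n)" by (intro choice allI)
  then obtain V where V': "\<And>n. good n (V n)" by blast
  have g: "(\<forall>i. bounded (V n i)) \<and> A n \<subseteq> (\<Union>i. V n i) \<and>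
     (\<Sum>i. ennreal (diameter (V n i) powr s)) \<le> ennreal (\<epsilon> * (1/2)^(Suc n))" for n using V'[of n] unfolding good_def .
  note V = g[THEN conjunct1, THEN spec] g[THEN conjunct2, THEN conjunct1] g[THEN conjunct2, THEN conjunct2]
  show "\<exists>U::nat \<Rightarrow> 'a set. (\<forall>i. bounded (U i)) \<and> (\<Union>n. A n) \<subseteq> (\<Union>i. U i) \<and>
     (\<Sum>i. ennreal (diameter (U i) powr s)) \<le> ennreal \<epsilon>"
  proof (rule double_cover[OF V(1) _ V(3)])
    show "(\<Union>n. A n) \<subseteq> (\<Union>n. \<Union>i. V n i)" using V(2) by (rule UN_mono[OF subset_refl])
    show "(\<Sum>n. ennreal (\<epsilon> * (1/2)^(Suc n))) \<le> ennreal \<epsilon>" using geometric_ennreal[of \<epsilon>] \<epsilon> by (metis less_imp_le order_refl)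
  qed
qed

text \<open>Covering sets may have diameter 0. Positive numbers in place of the diameters, with a
  sum that is still small, can be divided by and have a dyadic scale.\<close>

lemma hnull_positive_cover:
  fixes A :: "'a::metric_space set"
  assumes s: "0 < s" and A: "hnull s A" and \<epsilon>: "0 < \<epsilon>"
  obtains U :: "nat \<Rightarrow> 'a set" and d :: "nat \<Rightarrow> real" where "\<forall>n. 0 < d n \<and> bounded (U n) \<and> diameter (U n) \<le> d n"
    "A \<subseteq> (\<Union>n. U n)" "(\<Sum>n. ennreal (d n powr s)) \<le> ennreal \<epsilon>"
proof -
  have "0 < \<epsilon> / 2" using \<epsilon> by simp
  then obtain U :: "nat \<Rightarrow> 'a set" where U: "\<forall>i. bounded (U i)" "A \<subseteq> (\<Union>i. U i)"
    "(\<Sum>i. ennreal (diameter (U i) powr s)) \<le> ennreal (\<epsilon> / 2)"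
    by (rule hnullD[OF A])
  define \<tau> where "\<tau> n = (\<epsilon> / 2 * (1/2)^(Suc n)) powr (1 / s)" for n
  define d where "d n = max (diameter (U n)) (\<tau> n)" for n
  have \<tau>: "0 < \<tau> n" "\<tau> n powr s = \<epsilon> / 2 * (1/2)^(Suc n)" for n
    unfolding \<tau>_def using \<epsilon> s by (auto simp: powr_powr)
  have "ennreal (d n powr s) \<le> ennreal (diameter (U n) powr s) + ennreal (\<tau> n powr s)" for n
    unfolding d_def max_def by (subst ennreal_plus[symmetric]) (auto intro!: ennreal_leI)
  then have "(\<Sum>n. ennreal (d n powr s)) \<le> (\<Sum>n. ennreal (diameter (U n) powr s) + ennreal (\<tau> n powr s))"
    by (intro suminf_le) auto
  also have "\<dots> = (\<Sum>n. ennreal (diameter (U n) powr s)) + (\<Sum>n. ennreal (\<tau> n powr s))" by (rule suminf_add[symmetric]) auto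
  also have "(\<Sum>n. ennreal (\<tau> n powr s)) = ennreal (\<epsilon> / 2)" unfolding \<tau>(2) using \<epsilon> by (intro geometric_ennreal) simp
  also have "(\<Sum>n. ennreal (diameter (U n) powr s)) + ennreal (\<epsilon> / 2) \<le> ennreal (\<epsilon> / 2) + ennreal (\<epsilon> / 2)" by (intro add_right_mono U)
  also have "\<dots> = ennreal \<epsilon>" using \<epsilon> by (simp add: ennreal_plus[symmetric] del: ennreal_plus)
  finally have fin: "(\<Sum>n. ennreal (d n powr s)) \<le> ennreal \<epsilon>" .
  have "0 < d n" "diameter (U n) \<le> d n" for n unfolding d_def using \<tau>(1)[of n] by auto
  then have "\<forall>n. 0 < d n \<and> bounded (U n) \<and> diameter (U n) \<le> d n" using U(1) by simp
  then show ?thesis using U(2) fin by (rule that)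
qed

lemma hnull_lipschitz_image:
  fixes f :: "'a::metric_space \<Rightarrow> 'b::metric_space"
  assumes s: "0 < s" and L: "0 \<le> L" "\<And>x y. x \<in> A \<Longrightarrow> y \<in> A \<Longrightarrow> dist (f x) (f y) \<le> L * dist x y" and A: "hnull s A"
  shows "hnull s (f ` A)"
  unfolding hnull_def
proof (intro allI impI)
  fix \<epsilon> :: real assume \<epsilon>: "0 < \<epsilon>"
  \<comment> \<open>\<open>L + 1\<close> in place of \<open>L\<close> keeps \<open>C\<close>
    positive when \<open>L = 0\<close>.\<close>
  define C where "C = (L + 1) powr s"
  have C: "0 < C" unfolding C_def using L by simp
  have "0 < \<epsilon> / C" using \<epsilon> C by simp
  then obtain U :: "nat \<Rightarrow> 'a set" and d :: "nat \<Rightarrow> real" where U': "\<forall>n. 0 < d n \<and> bounded (U n) \<and> diameter (U n) \<le> d n"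
    "A \<subseteq> (\<Union>n. U n)" "(\<Sum>n. ennreal (d n powr s)) \<le> ennreal (\<epsilon> / C)"
    by (rule hnull_positive_cover[OF s A])
  have U: "0 < d n" "bounded (U n)" "diameter (U n) \<le> d n" for n using U'(1) by auto
  have dist: "dist u v \<le> (L + 1) * d n" if uv: "u \<in> f ` (U n \<inter> A)" "v \<in> f ` (U n \<inter> A)" for n u v
  proof -
    obtain x y where xy: "x \<in> U n" "x \<in> A" "y \<in> U n" "y \<in> A" "u = f x" "v = f y" using uv by blast
    have "dist x y \<le> d n" using diameter_bounded_bound[OF U(2) xy(1,3)] U(3)[of n] by linarith
    then have "L * dist x y \<le> (L + 1) * d n" using L by (intro mult_mono) auto
    then show ?thesis using L(2)[OF xy(2,4)] xy by simp
  qed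
  have nn: "0 \<le> (L + 1) * d n" for n using L U(1)[of n] by simp
  note bd = bounded_diameter_le[OF dist nn]
  show "\<exists>U::nat \<Rightarrow> 'b set. (\<forall>i. bounded (U i)) \<and> f ` A \<subseteq> (\<Union>i. U i) \<and>
     (\<Sum>i. ennreal (diameter (U i) powr s)) \<le> ennreal \<epsilon>"
  proof (intro exI[of _ "\<lambda>n. f ` (U n \<inter> A)"] conjI allI)
    show "bounded (f ` (U n \<inter> A))" for n by (rule bd(1))
    have "A \<subseteq> (\<Union>n. U n \<inter> A)" using U'(2) by auto
    then show "f ` A \<subseteq> (\<Union>n. f ` (U n \<inter> A))" unfolding image_UN[symmetric] by (rule image_mono)
    have "ennreal (diameter (f ` (U n \<inter> A)) powr s) \<le> ennreal C * ennreal (d n powr s)" for n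
    proof -
      have "0 \<le> diameter (f ` (U n \<inter> A))" using diameter_ge_0[OF bd(1)] .
      then have "diameter (f ` (U n \<inter> A)) powr s \<le> ((L + 1) * d n) powr s" using bd(2) s by (intro powr_mono2) auto
      also have "\<dots> = C * d n powr s" unfolding C_def using L U(1)[of n] by (simp add: powr_mult)
      finally show ?thesis using C by (simp add: ennreal_mult[symmetric] ennreal_leI)
    qed
    then have "(\<Sum>n. ennreal (diameter (f ` (U n \<inter> A)) powr s)) \<le> (\<Sum>n. ennreal C * ennreal (d n powr s))"
      by (intro suminf_le) auto
    also have "\<dots> = ennreal C * (\<Sum>n. ennreal (d n powr s))" by simp
    also have "\<dots> \<le> ennreal C * ennreal (\<epsilon> / C)" by (intro mult_left_mono U') auto
    also have "\<dots> = ennreal \<epsilon>" using C \<epsilon> by (simp add: ennreal_mult[symmetric])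
    finally show "(\<Sum>n. ennreal (diameter (f ` (U n \<inter> A)) powr s)) \<le> ennreal \<epsilon>" .
  qed
qed

section \<open>The upper bound\<close>

lemma dist_real2: "(dist x y)^2 = (x$1 - y$1)^2 + (x$2 - y$2)^2" for x y :: "real^2"
  unfolding dist_vec_def L2_set_def by (simp add: UNIV_2 dist_real_def sum_nonneg)

lemma dist_real2_le: "dist x y \<le> \<bar>x$1 - y$1\<bar> + \<bar>x$2 - y$2\<bar>" for x y :: "real^2"
proof (rule power2_le_imp_le)
  show "(dist x y)^2 \<le> (\<bar>x$1 - y$1\<bar> + \<bar>x$2 - y$2\<bar>)^2"
    unfolding dist_real2 power2_sum by simp
qed simp

lemma abs_sin_diff_le: "\<bar>sin a - sin b\<bar> \<le> \<bar>a - b\<bar>" for a b :: real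
proof -
  have "\<bar>sin a - sin b\<bar> = 2 * (\<bar>sin ((a - b) / 2)\<bar> * \<bar>cos ((a + b) / 2)\<bar>)"
    unfolding sin_diff_sin by (simp add: abs_mult)
  also have "\<dots> \<le> 2 * (\<bar>(a - b) / 2\<bar> * 1)" by (intro mult_left_mono mult_mono abs_sin_x_le_abs_x abs_cos_le_one) auto
  finally show ?thesis by simp
qed

lemma abs_cos_diff_le: "\<bar>cos a - cos b\<bar> \<le> \<bar>a - b\<bar>" for a b :: real
  using abs_sin_diff_le[of "pi / 2 - a" "pi / 2 - b"] by (simp add: sin_diff abs_minus_commute)

definition circle_net :: "real^2 \<Rightarrow> real \<Rightarrow> nat \<Rightarrow> nat \<Rightarrow> real^2" where
  "circle_net x r m l = x + r *\<^sub>R vector [cos (2 * pi * real l / real m), sin (2 * pi * real l / real m)]"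

lemma circle_net:
  assumes r: "0 < r" and m: "0 < m" and y: "y \<in> sphere x r"
  shows "\<exists>l<m. dist y (circle_net x r m l) \<le> 13 * r / real m"
proof -
  define a b where "a = (y$1 - x$1) / r" and "b = (y$2 - x$2) / r"
  have "(dist y x)^2 = r^2" using y by (simp add: dist_commute)
  then have "(y$1 - x$1)^2 + (y$2 - x$2)^2 = r^2" unfolding dist_real2 .
  then have "a^2 + b^2 = 1" unfolding a_def b_def power_divide using r by (simp add: add_divide_distrib[symmetric])
  then obtain \<theta> where \<theta>: "0 \<le> \<theta>" "\<theta> < 2 * pi" "a = cos \<theta>" "b = sin \<theta>" by (rule sincos_total_2pi)
  define l where "l = nat \<lfloor>\<theta> * real m / (2 * pi)\<rfloor>"
  have q0: "0 \<le> \<theta> * real m / (2 * pi)" using \<theta> by simp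
  have q: "real l \<le> \<theta> * real m / (2 * pi)" "\<theta> * real m / (2 * pi) < real l + 1"
    unfolding l_def using q0 by linarith+
  have "\<theta> * real m < 2 * pi * real m" using \<theta> m by (intro mult_strict_right_mono) auto
  then have "\<theta> * real m / (2 * pi) < real m" by (simp add: pos_divide_less_eq mult.commute)
  then have lm: "l < m" using q(1) by linarith
  define \<phi> where "\<phi> = 2 * pi * real l / real m"
  have "2 * pi * real l \<le> \<theta> * real m" using q(1) by (simp add: pos_le_divide_eq mult.commute)
  then have 1: "\<phi> \<le> \<theta>" unfolding \<phi>_def using m by (simp add: pos_divide_le_eq)
  have "\<theta> * real m \<le> 2 * pi * real l + 2 * pi" using q(2) by (simp add: pos_divide_less_eq algebra_simps)
  then have "\<theta> \<le> (2 * pi * real l + 2 * pi) / real m" using m by (simp add: pos_le_divide_eq)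
  then have 2: "\<theta> \<le> \<phi> + 2 * pi / real m" unfolding \<phi>_def by (simp add: add_divide_distrib)
  have \<phi>: "\<bar>\<theta> - \<phi>\<bar> \<le> 2 * pi / real m" using 1 2 by linarith
  let ?N = "circle_net x r m l"
  have c: "y$1 - ?N$1 = r * (cos \<theta> - cos \<phi>)" "y$2 - ?N$2 = r * (sin \<theta> - sin \<phi>)"
  proof -
    have n: "?N$1 = x$1 + r * cos \<phi>" "?N$2 = x$2 + r * sin \<phi>" unfolding circle_net_def \<phi>_def by (simp_all add: vector_2)
    have "y$1 - x$1 = r * cos \<theta>" "y$2 - x$2 = r * sin \<theta>" using \<theta>(3,4) r unfolding a_def b_def by (simp_all add: field_simps)
    then show "y$1 - ?N$1 = r * (cos \<theta> - cos \<phi>)" "y$2 - ?N$2 = r * (sin \<theta> - sin \<phi>)"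
      unfolding n right_diff_distrib by linarith+
  qed
  have "dist y ?N \<le> r * \<bar>cos \<theta> - cos \<phi>\<bar> + r * \<bar>sin \<theta> - sin \<phi>\<bar>"
    using dist_real2_le[of y ?N] unfolding c abs_mult using r by simp
  also have "\<dots> \<le> r * (2 * pi / real m) + r * (2 * pi / real m)"
    using r \<phi> abs_cos_diff_le[of \<theta> \<phi>] abs_sin_diff_le[of \<theta> \<phi>] by (intro add_mono mult_left_mono) linarith+
  also have "\<dots> = r * (4 * pi) / real m" by simp
  \<comment> \<open>13 exceeds \<open>4 * pi\<close>.\<close>
  also have "\<dots> \<le> r * 13 / real m" using r pi_less_4 pi_approx by (intro divide_right_mono mult_left_mono) auto
  finally show ?thesis using lm by (intro exI[of _ l]) (simp add: mult.commute)
qed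

text \<open>A covering set of size \<open>d\<close> is replaced by at most \<open>2 * j / d\<close>
  discs of radius \<open>15 * d\<close>, so \<open>d powr s\<close> becomes a constant times
  \<open>d powr (s + 1) / d\<close>. Of the radius, \<open>2 * d\<close> is for moving to the circle
  of one chosen parameter and \<open>13 * d\<close> for the net on it. The bound \<open>j\<close> on
  the radii makes the size of the net uniform.\<close>

lemma hnull_circles_bounded:
  fixes A :: "((real^2) \<times> real) set"
  assumes s: "0 < s" and A: "hnull s A" and j: "1 \<le> j" and r: "\<And>x r. (x,r) \<in> A \<Longrightarrow> 0 < r \<and> r \<le> j"
  shows "hnull (s + 1) (\<Union>(x,r)\<in>A. sphere x r)"
  unfolding hnull_def
proof (intro allI impI)
  fix \<epsilon> :: real assume \<epsilon>: "0 < \<epsilon>"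
  define C where "C = 2 * j * 30 powr (s + 1)"
  have C: "0 < C" unfolding C_def using j by simp
  have "0 < min 1 (\<epsilon> / C)" using \<epsilon> C by simp
  then obtain U :: "nat \<Rightarrow> ((real^2) \<times> real) set" and d :: "nat \<Rightarrow> real" where U: "\<forall>n. 0 < d n \<and> bounded (U n) \<and> diameter (U n) \<le> d n"
    "A \<subseteq> (\<Union>n. U n)" "(\<Sum>n. ennreal (d n powr s)) \<le> ennreal (min 1 (\<epsilon> / C))"
    by (rule hnull_positive_cover[OF s A])
  have d0: "0 < d n" for n using U(1) by simp
  have d1: "d n \<le> 1" for n
  proof (rule ccontr)
    assume "\<not> d n \<le> 1"
    then have "1 powr s < d n powr s" using s by (intro powr_less_mono2) auto
    then have "ennreal 1 < ennreal (d n powr s)" by (simp add: ennreal_less_iff del: ennreal_1)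
    also have "\<dots> \<le> (\<Sum>n. ennreal (d n powr s))" by (rule ennreal_term_le_suminf)
    also have "\<dots> \<le> ennreal (min 1 (\<epsilon> / C))" by (rule U)
    also have "\<dots> \<le> ennreal 1" by (intro ennreal_leI) auto
    finally show False by simp
  qed
  define z where "z n = (SOME p. p \<in> U n \<inter> A)" for n
  have z: "z n \<in> U n" "z n \<in> A" if "U n \<inter> A \<noteq> {}" for n
  proof -
    have "z n \<in> U n \<inter> A" unfolding z_def some_in_eq by (rule that)
    then show "z n \<in> U n" "z n \<in> A" by auto
  qed
  define m where "m n = nat \<lceil>j / d n\<rceil>" for n
  have m: "j / d n \<le> real (m n)" "real (m n) \<le> 2 * j / d n" "0 < m n" for n
  proof -
    have p: "1 \<le> j / d n" using d0[of n] d1[of n] j by (simp add: pos_le_divide_eq)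
    show "j / d n \<le> real (m n)" unfolding m_def using p by linarith
    then show "0 < m n" using p by linarith
    have "real (m n) \<le> j / d n + 1" unfolding m_def using p by linarith
    also have "\<dots> \<le> 2 * (j / d n)" using p by linarith
    finally show "real (m n) \<le> 2 * j / d n" by simp
  qed
  define I where "I n = (if U n \<inter> A = {} then {} else {..<m n})" for n
  define V where "V n l = cball (circle_net (fst (z n)) (snd (z n)) (m n) l) (15 * d n)" for n l
  have dV: "diameter (V n l) \<le> 30 * d n" for n l
  proof (rule bounded_diameter_le)
    fix x y assume "x \<in> V n l" "y \<in> V n l"
    then show "dist x y \<le> 30 * d n"
      using dist_triangle2[of x y "circle_net (fst (z n)) (snd (z n)) (m n) l"] unfolding V_def by (simp add: dist_commute)
  qed (use d0[of n] in simp)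
  have sumV: "(\<Sum>l\<in>I n. diameter (V n l) powr (s + 1)) \<le> C * d n powr s" for n
  proof -
    have "(\<Sum>l\<in>I n. diameter (V n l) powr (s + 1)) \<le> (\<Sum>l\<in>I n. (30 * d n) powr (s + 1))"
      using s dV by (intro sum_mono powr_mono2 diameter_ge_0) (auto simp: V_def)
    also have "\<dots> = real (card (I n)) * (30 * d n) powr (s + 1)" by simp
    also have "\<dots> \<le> 2 * j / d n * (30 * d n) powr (s + 1)"
    proof (rule mult_right_mono)
      show "real (card (I n)) \<le> 2 * j / d n" using m(2)[of n] d0[of n] j by (simp add: I_def)
    qed simp
    also have "(30 * d n) powr (s + 1) = 30 powr (s + 1) * (d n powr s * d n)"
      using d0[of n] by (simp add: powr_mult powr_add)
    also have "2 * j / d n * (30 powr (s + 1) * (d n powr s * d n)) = C * d n powr s"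
      unfolding C_def using d0[of n] by simp
    finally show ?thesis .
  qed
  show "\<exists>W::nat \<Rightarrow> (real^2) set. (\<forall>i. bounded (W i)) \<and> (\<Union>(x,r)\<in>A. sphere x r) \<subseteq> (\<Union>i. W i) \<and>
     (\<Sum>i. ennreal (diameter (W i) powr (s + 1))) \<le> ennreal \<epsilon>"
  proof (rule family_cover[where I = I and V = V and b = "\<lambda>n. C * d n powr s"])
    show "finite (I n)" for n unfolding I_def by simp
    show "bounded (V n l)" if "l \<in> I n" for n l unfolding V_def by simp
    show "(\<Sum>l\<in>I n. diameter (V n l) powr (s + 1)) \<le> C * d n powr s" for n by (rule sumV)
    have "(\<Sum>n. ennreal (C * d n powr s)) = ennreal C * (\<Sum>n. ennreal (d n powr s))"
      using C by (simp add: ennreal_mult)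
    also have "\<dots> \<le> ennreal C * ennreal (\<epsilon> / C)"
    proof (rule mult_left_mono)
      have "ennreal (min 1 (\<epsilon> / C)) \<le> ennreal (\<epsilon> / C)" by (intro ennreal_leI) simp
      then show "(\<Sum>n. ennreal (d n powr s)) \<le> ennreal (\<epsilon> / C)" using U(3) by (rule order_trans[rotated])
    qed simp
    also have "\<dots> = ennreal \<epsilon>" using C \<epsilon> by (simp add: ennreal_mult[symmetric])
    finally show "(\<Sum>n. ennreal (C * d n powr s)) \<le> ennreal \<epsilon>" .
    show "(\<Union>(x,r)\<in>A. sphere x r) \<subseteq> (\<Union>n. \<Union>l\<in>I n. V n l)"
    proof
      fix y assume "y \<in> (\<Union>(x,r)\<in>A. sphere x r)"
      then obtain x r0 where xr: "(x,r0) \<in> A" "y \<in> sphere x r0" by auto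
      obtain n where n: "(x,r0) \<in> U n" using U(2) xr(1) by blast
      then have ne: "U n \<inter> A \<noteq> {}" using xr(1) by blast
      obtain x' r' where zn: "z n = (x',r')" by (cases "z n")
      have r0: "0 < r0" using r xr(1) by auto
      have r': "0 < r'" "r' \<le> j" using r z(2)[OF ne] zn by auto
      have "dist (x,r0) (x',r') \<le> d n"
        using diameter_bounded_bound[of "U n" "(x,r0)" "(x',r')"] U(1) n z(1)[OF ne] zn by (metis order_trans)
      then have dx: "dist x x' \<le> d n" "\<bar>r0 - r'\<bar> \<le> d n"
        using dist_fst_le[of "(x,r0)" "(x',r')"] dist_snd_le[of "(x,r0)" "(x',r')"] by (auto simp: dist_real_def)
      \<comment> \<open>The point of the circle of \<open>z n\<close> in the same direction from its
        centre as \<open>y\<close> from \<open>x\<close>.\<close>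
      define y' where "y' = x' + (r' / r0) *\<^sub>R (y - x)"
      have ny: "norm (y - x) = r0" using xr(2) by (simp add: dist_norm norm_minus_commute)
      have "dist x' y' = norm ((r' / r0) *\<^sub>R (y - x))" unfolding y'_def by (simp add: dist_norm)
      also have "\<dots> = r'" using ny r0 r' by simp
      finally have "y' \<in> sphere x' r'" by simp
      then obtain l where l: "l < m n" "dist y' (circle_net x' r' (m n) l) \<le> 13 * r' / real (m n)"
        using circle_net[OF r'(1) m(3)] by blast
      have "y - y' = (x - x') + (1 - r' / r0) *\<^sub>R (y - x)" unfolding y'_def by (simp add: algebra_simps)
      then have "dist y y' \<le> norm (x - x') + norm ((1 - r' / r0) *\<^sub>R (y - x))" unfolding dist_norm using norm_triangle_ineq by metis
      also have "norm ((1 - r' / r0) *\<^sub>R (y - x)) = \<bar>r0 - r'\<bar>"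
      proof -
        have "\<bar>1 - r' / r0\<bar> * r0 = \<bar>(1 - r' / r0) * r0\<bar>" using r0 by (simp add: abs_mult)
        also have "(1 - r' / r0) * r0 = r0 - r'" using r0 by (simp add: algebra_simps)
        finally show ?thesis using ny by simp
      qed
      finally have 1: "dist y y' \<le> 2 * d n" using dx by (simp add: dist_norm)
      have "13 * r' / real (m n) \<le> 13 * j / (j / d n)" using m(1)[of n] r' j d0[of n] by (intro frac_le) auto
      also have "\<dots> = 13 * d n" using j by simp
      finally have "dist y (circle_net x' r' (m n) l) \<le> 15 * d n"
        using 1 l(2) dist_triangle[of y "circle_net x' r' (m n) l" y'] by linarith
      then have "y \<in> V n l" unfolding V_def zn by (simp add: dist_commute)
      moreover have "l \<in> I n" unfolding I_def using ne l(1) by simp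
      ultimately show "y \<in> (\<Union>n. \<Union>l\<in>I n. V n l)" by blast
    qed
  qed
qed

lemma hnull_circles:
  fixes A :: "((real^2) \<times> real) set"
  assumes s: "0 < s" and A: "hnull s A" and r: "\<And>x r. (x,r) \<in> A \<Longrightarrow> 0 < r"
  shows "hnull (s + 1) (\<Union>(x,r)\<in>A. sphere x r)"
proof -
  define B where "B n = {p\<in>A. snd p \<le> real n + 1}" for n
  have "hnull (s + 1) (\<Union>(x,r)\<in>B n. sphere x r)" for n
    by (rule hnull_circles_bounded[OF s hnull_mono[OF _ A], of _ "real n + 1"]) (use r in \<open>auto simp: B_def\<close>)
  then have "hnull (s + 1) (\<Union>n. \<Union>(x,r)\<in>B n. sphere x r)" by (rule hnull_UN)
  moreover have "(\<Union>(x,r)\<in>A. sphere x r) \<subseteq> (\<Union>n. \<Union>(x,r)\<in>B n. sphere x r)"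
  proof
    fix y assume "y \<in> (\<Union>(x,r)\<in>A. sphere x r)"
    then obtain x r where xr: "(x,r) \<in> A" "y \<in> sphere x r" by auto
    obtain n where "r \<le> real n" using real_arch_simple by blast
    then have "(x,r) \<in> B n" unfolding B_def using xr by auto
    then show "y \<in> (\<Union>n. \<Union>(x,r)\<in>B n. sphere x r)" using xr(2) by blast
  qed
  ultimately show ?thesis by (rule hnull_mono[rotated])
qed

text \<open>The segment parametrises circles around 0. It serves to derive the bound 2 for the
  dimension of the plane from the bound for unions of circles.\<close>

lemma hnull_segment:
  assumes s: "1 < s"
  shows "hnull s ({0::real^2} \<times> {0<..real N})"
  unfolding hnull_def
proof (intro allI impI)
  fix \<epsilon> :: real assume \<epsilon>: "0 < \<epsilon>"
  \<comment> \<open>Solves \<open>N * m powr (1 - s) \<le> \<epsilon>\<close> for the number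
    \<open>m\<close> of subintervals per unit length.\<close>
  define q where "q = max 1 ((real N / \<epsilon>) powr (1 / (s - 1)))"
  obtain m :: nat where m: "q \<le> real m" using real_arch_simple by blast
  have m1: "1 \<le> real m" using m unfolding q_def by linarith
  have mN: "real N * real m powr (1 - s) \<le> \<epsilon>"
  proof (cases "N = 0")
    case False
    have "(real N / \<epsilon>) powr (1 / (s - 1)) \<le> real m" using m unfolding q_def by linarith
    then have "((real N / \<epsilon>) powr (1 / (s - 1))) powr (s - 1) \<le> real m powr (s - 1)" using s by (intro powr_mono2) auto
    then have "real N / \<epsilon> \<le> real m powr (s - 1)" using s \<epsilon> False by (simp add: powr_powr)
    then have "real N \<le> \<epsilon> * real m powr (s - 1)" using \<epsilon> by (simp add: pos_divide_le_eq mult.commute)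
    then have "real N * real m powr (1 - s) \<le> \<epsilon> * real m powr (s - 1) * real m powr (1 - s)" by (intro mult_right_mono) auto
    also have "\<dots> = \<epsilon> * real m powr 0" by (simp only: mult.assoc powr_add[symmetric]) simp
    finally show ?thesis using m1 by simp
  qed (use \<epsilon> in simp)
  define I where "I k = (if k = (0::nat) then {..<N * m} else {})" for k
  define V where "V k i = {0::real^2} \<times> {real i / real m .. (real i + 1) / real m}" for k i :: nat
  have V: "bounded (V k i)" "diameter (V k i) \<le> 1 / real m" for k i
  proof -
    have "dist p q \<le> 1 / real m" if "p \<in> V k i" "q \<in> V k i" for p q
    proof -
      have "fst p = fst q" "\<bar>snd p - snd q\<bar> \<le> (real i + 1) / real m - real i / real m" using that unfolding V_def by auto
      then show ?thesis by (simp add: dist_prod_def dist_real_def diff_divide_distrib[symmetric])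
    qed
    then show "bounded (V k i)" "diameter (V k i) \<le> 1 / real m"
      by (auto intro!: bounded_diameter_le)
  qed
  show "\<exists>U::nat \<Rightarrow> ((real^2) \<times> real) set. (\<forall>i. bounded (U i)) \<and> {0} \<times> {0<..real N} \<subseteq> (\<Union>i. U i) \<and>
     (\<Sum>i. ennreal (diameter (U i) powr s)) \<le> ennreal \<epsilon>"
  proof (rule family_cover[where I = I and V = V and b = "\<lambda>k. if k = 0 then \<epsilon> else 0"])
    show "finite (I k)" for k unfolding I_def by simp
    show "bounded (V k i)" for k i by (rule V)
    show "(\<Sum>i\<in>I k. diameter (V k i) powr s) \<le> (if k = 0 then \<epsilon> else 0)" for k
    proof (cases "k = 0")
      case True
      have "(\<Sum>i\<in>I k. diameter (V k i) powr s) \<le> (\<Sum>i\<in>I k. (1 / real m) powr s)"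
        using s V by (intro sum_mono powr_mono2 diameter_ge_0) auto
      also have "\<dots> = real N * (real m * (1 / real m) powr s)" unfolding I_def True by simp
      also have "real m * (1 / real m) powr s = real m powr 1 * real m powr (- s)" using m1 by (simp add: powr_minus_divide powr_divide)
      also have "\<dots> = real m powr (1 - s)" by (simp only: powr_add[symmetric] add_uminus_conv_diff)
      finally show ?thesis using mN True by simp
    qed (simp add: I_def)
    have "(\<Sum>k. ennreal (if k = 0 then \<epsilon> else 0)) = (\<Sum>k\<in>{0::nat}. ennreal (if k = 0 then \<epsilon> else 0))"
      by (rule suminf_finite) auto
    then show "(\<Sum>k. ennreal (if k = (0::nat) then \<epsilon> else 0)) \<le> ennreal \<epsilon>" by simp
    show "{0} \<times> {0<..real N} \<subseteq> (\<Union>k. \<Union>i\<in>I k. V k i)"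
    proof
      fix p :: "(real^2) \<times> real" assume "p \<in> {0} \<times> {0<..real N}"
      then obtain r where p: "p = (0,r)" "0 < r" "r \<le> real N" by auto
      define i where "i = nat (\<lceil>r * real m\<rceil> - 1)"
      have pos: "0 < r * real m" using p m1 by simp
      then have i: "real i < r * real m" "r * real m \<le> real i + 1" unfolding i_def by linarith+
      have "r * real m \<le> real N * real m" using p by (intro mult_right_mono) auto
      then have "real i < real (N * m)" using i(1) by (simp only: of_nat_mult)
      then have "i < N * m" by (simp only: of_nat_less_iff)
      then have "i \<in> I 0" unfolding I_def by simp
      moreover have "p \<in> V 0 i" unfolding V_def p(1) using i m1 by (simp add: pos_divide_le_eq pos_le_divide_eq)
      ultimately show "p \<in> (\<Union>k. \<Union>i\<in>I k. V k i)" by blast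
    qed
  qed
qed

text \<open>The plane consists of the origin and the circles around it.\<close>

lemma hnull_plane:
  assumes s: "2 < s"
  shows "hnull s (A :: (real^2) set)"
proof -
  have "hnull (s - 1) (\<Union>N. {0::real^2} \<times> {0<..real N})" using s by (intro hnull_UN hnull_segment) auto
  then have "hnull (s - 1 + 1) (\<Union>(x,r)\<in>(\<Union>N. {0::real^2} \<times> {0<..real N}). sphere x r)"
    using s by (intro hnull_circles) auto
  then have 1: "hnull s (\<Union>(x,r)\<in>(\<Union>N. {0::real^2} \<times> {0<..real N}). sphere x r)" by simp
  have 2: "hnull s {0::real^2}"
    unfolding hnull_def
  proof (intro allI impI exI[of _ "\<lambda>_. {0::real^2}"] conjI)
    fix \<epsilon> :: real assume "0 < \<epsilon>"
    show "(\<Sum>i::nat. ennreal (diameter {0::real^2} powr s)) \<le> ennreal \<epsilon>" by (simp add: diameter_singleton)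
  qed auto
  define B where "B n = (if n = (0::nat) then {0::real^2} else (\<Union>(x,r)\<in>(\<Union>N. {0::real^2} \<times> {0<..real N}). sphere x r))" for n
  have "hnull s (\<Union>n. B n)" using 1 2 by (intro hnull_UN) (simp add: B_def)
  moreover have "A \<subseteq> (\<Union>n. B n)"
  proof
    fix y assume "y \<in> A"
    show "y \<in> (\<Union>n. B n)"
    proof (cases "y = 0")
      case False
      obtain N :: nat where "norm y \<le> real N" using real_arch_simple by blast
      then have "(0, norm y) \<in> {0::real^2} \<times> {0<..real N}" using False by simp
      then have "(0, norm y) \<in> (\<Union>N. {0::real^2} \<times> {0<..real N})" by blast
      moreover have "y \<in> sphere 0 (norm y)" by simp
      ultimately have "y \<in> (\<Union>(x,r)\<in>(\<Union>N. {0::real^2} \<times> {0<..real N}). sphere x r)" by blast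
      then have "y \<in> B 1" unfolding B_def by simp
      then show ?thesis by blast
    next
      case True
      then have "y \<in> B 0" unfolding B_def by simp
      then show ?thesis by blast
    qed
  qed
  ultimately show ?thesis by (rule hnull_mono[rotated])
qed

section \<open>The lower bound\<close>

lemma polynomial_less_exponential:
  fixes C \<eta> :: real
  assumes \<eta>: "0 < \<eta>" and C: "0 < C"
  shows "\<exists>k0. \<forall>k\<ge>k0. C * (real k + 2)^n < 2 powr (real k * \<eta>)"
proof -
  define c where "c = \<eta> * ln 2"
  have c: "0 < c" unfolding c_def using \<eta> by simp
  define e where "e = 1 / (C * (3 / c)^n)"
  have e: "0 < e" unfolding e_def using C c by simp
  have "\<forall>\<^sub>F x in at_top. x ^ n / exp x < e"
    using order_tendstoD(2)[OF tendsto_power_div_exp_0 e] .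
  then obtain x0 where x0: "\<And>x. x0 \<le> x \<Longrightarrow> x ^ n / exp x < e" unfolding eventually_at_top_linorder by blast
  obtain k1 :: nat where k1: "x0 / c \<le> real k1" using real_arch_simple by blast
  show ?thesis
  proof (intro exI[of _ "max 1 k1"] allI impI)
    fix k assume k: "max 1 k1 \<le> k"
    then have "x0 / c \<le> real k" using k1 by simp
    then have "x0 \<le> c * real k" using c by (simp add: pos_divide_le_eq mult.commute)
    then have "(c * real k) ^ n / exp (c * real k) < e" by (rule x0)
    then have "(c * real k) ^ n < e * exp (c * real k)" by (simp add: pos_divide_less_eq)
    then have 1: "C * (3 / c)^n * (c * real k) ^ n < C * (3 / c)^n * (e * exp (c * real k))"
      using C c by (intro mult_strict_left_mono) auto
    have "C * (real k + 2)^n \<le> C * (3 * real k)^n" using C k by (intro mult_left_mono power_mono) auto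
    also have "3 * real k = (3 / c) * (c * real k)" using c by simp
    also have "C * ((3 / c) * (c * real k))^n = C * (3 / c)^n * (c * real k) ^ n" by (simp only: power_mult_distrib mult.assoc)
    also note 1
    also have "C * (3 / c)^n * (e * exp (c * real k)) = exp (c * real k)" unfolding e_def using C c by simp
    also have "\<dots> = 2 powr (real k * \<eta>)" unfolding powr_def c_def by (simp add: mult_ac)
    finally show "C * (real k + 2)^n < 2 powr (real k * \<eta>)" .
  qed
qed

lemma telescoping_half: "(\<lambda>k. 1 / (2 * (real k + 1) * (real k + 2))) sums (1/2)"
proof -
  have "(\<lambda>k. (1/2) / (real k + 1)) \<longlonglongrightarrow> 0"
  proof -
    have "(\<lambda>k. (1/2) * inverse (real (Suc k))) \<longlonglongrightarrow> (1/2) * 0" by (intro tendsto_intros LIMSEQ_inverse_real_of_nat)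
    moreover have "(1/2) * inverse (real (Suc k)) = (1/2) / (real k + 1)" for k by (simp add: field_simps)
    ultimately show ?thesis by (simp only: mult_zero_right)
  qed
  from telescope_sums'[OF this] have "(\<lambda>k. (1/2) / (real k + 1) - (1/2) / (real (Suc k) + 1)) sums (1/2)" by simp
  moreover have "(1/2) / (real k + 1) - (1/2) / (real (Suc k) + 1) = 1 / (2 * (real k + 1) * (real k + 2))" for k
  proof -
    have "(1/2) / x - (1/2) / (x + 1) = 1 / (2 * x * (x + 1))" if "0 < x" for x :: real
    proof -
      have "(1/2) / x - (1/2) / (x + 1) = ((1/2) * (x + 1) - (1/2) * x) / (x * (x + 1))"
        by (rule diff_frac_eq) (use that in auto)
      also have "(1/2) * (x + 1) - (1/2) * x = 1/2" by (simp add: algebra_simps)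
      finally show ?thesis by simp
    qed
    from this[of "real k + 1"] show ?thesis by (simp add: add.assoc add.commute)
  qed
  ultimately show ?thesis by simp
qed

text \<open>If all proportions were smaller, the intervals would cover the unit interval with total
  Lebesgue measure at most 1/2.\<close>

lemma interval_pigeonhole:
  fixes S :: "nat \<Rightarrow> nat set" and J :: "nat \<Rightarrow> nat"
  assumes S: "\<And>k. finite (S k)" and J: "\<And>k. 0 < J k"
    and cov: "\<And>u::real. 0 \<le> u \<Longrightarrow> u \<le> 1 \<Longrightarrow> \<exists>k. \<exists>j\<in>S k. real j / real (J k) \<le> u \<and> u \<le> (real j + 1) / real (J k)"
  shows "\<exists>k. 1 / (2 * (real k + 1) * (real k + 2)) \<le> real (card (S k)) / real (J k)"
proof (rule ccontr)
  assume "\<not> ?thesis"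
  then have lt: "real (card (S k)) / real (J k) \<le> 1 / (2 * (real k + 1) * (real k + 2))" for k by (meson less_imp_le not_le)
  define E where "E k = (\<Union>j\<in>S k. {real j / real (J k) .. (real j + 1) / real (J k)})" for k
  have Em: "E k \<in> sets lborel" for k unfolding E_def using S by (intro sets.finite_UN) auto
  have E: "emeasure lborel (E k) \<le> ennreal (1 / (2 * (real k + 1) * (real k + 2)))" for k
  proof -
    have "emeasure lborel (E k) \<le> (\<Sum>j\<in>S k. emeasure lborel {real j / real (J k) .. (real j + 1) / real (J k)})"
      unfolding E_def using S by (intro emeasure_subadditive_finite) auto
    also have "\<dots> = (\<Sum>j\<in>S k. ennreal (1 / real (J k)))"
      by (intro sum.cong refl) (simp add: divide_right_mono diff_divide_distrib[symmetric])
    also have "\<dots> = ennreal (\<Sum>j\<in>S k. 1 / real (J k))" by (rule sum_ennreal) simp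
    also have "(\<Sum>j\<in>S k. 1 / real (J k)) = real (card (S k)) / real (J k)" by simp
    finally show ?thesis using lt[of k] by (meson ennreal_leI order_trans)
  qed
  have "ennreal 1 = emeasure lborel {0..1::real}" by simp
  also have "\<dots> \<le> emeasure lborel (\<Union>k. E k)"
  proof (rule emeasure_mono)
    show "{0..1} \<subseteq> (\<Union>k. E k)"
    proof
      fix u :: real assume "u \<in> {0..1}"
      then obtain k j where "j \<in> S k" "real j / real (J k) \<le> u" "u \<le> (real j + 1) / real (J k)" using cov[of u] by auto
      then have "u \<in> E k" unfolding E_def by auto
      then show "u \<in> (\<Union>k. E k)" by blast
    qed
    show "(\<Union>k. E k) \<in> sets lborel" using Em by (intro sets.countable_UN) auto
  qed
  also have "\<dots> \<le> (\<Sum>k. emeasure lborel (E k))" using Em by (intro emeasure_subadditive_countably) auto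
  also have "\<dots> \<le> (\<Sum>k. ennreal (1 / (2 * (real k + 1) * (real k + 2))))" using E by (intro suminf_le) auto
  also have "\<dots> = ennreal (1/2)" using telescoping_half by (intro suminf_ennreal_eq) auto
  finally have "(1::real) \<le> 1/2" by (subst (asm) ennreal_le_iff) auto
  then show False by simp
qed

lemma term_le_of_suminf_le:
  assumes "(\<Sum>n. ennreal (f n)) \<le> ennreal \<epsilon>" "0 \<le> \<epsilon>"
  shows "f n \<le> \<epsilon>"
  using order_trans[OF ennreal_term_le_suminf[of "\<lambda>n. ennreal (f n)" n] assms(1)] assms(2) by (simp add: ennreal_le_iff)

text \<open>Markov's inequality with threshold \<open>1 / 2^(k+3)\<close>. The bound 1/16 on the sum
  brings the factor \<open>2 powr (3 * s)\<close>, at most 64, down to the 4 that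
  \<open>single_scale\<close> admits.\<close>

lemma card_large_terms:
  fixes d :: "nat \<Rightarrow> real"
  assumes s: "0 < s" "s \<le> 2" and sum: "(\<Sum>n. ennreal (d n powr s)) \<le> ennreal (1/16)"
    and F: "\<And>n. n \<in> F \<Longrightarrow> 1 / 2^(k+3) \<le> d n"
  shows "finite F \<and> real (card F) \<le> 4 * 2 powr (real k * s)"
proof -
  define X where "X = 4 * 2 powr (real k * s)"
  have bd: "real (card G) \<le> X" if G: "G \<subseteq> F" "finite G" for G
  proof -
    have q: "(1 / 2^(k+3)) powr s = 2 powr (- ((real k + 3) * s))"
    proof -
      have "1 / 2^(k+3) = 2 powr (- (real k + 3))"
      proof -
        have "2 powr (real (k + 3)) = 2^(k+3)" by (rule powr_realpow) simp
        moreover have "real (k + 3) = real k + 3" by simp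
        ultimately show ?thesis by (simp only: powr_minus_divide)
      qed
      then show ?thesis by (simp only: powr_powr mult_minus_left)
    qed
    have "ennreal (real (card G) * (1 / 2^(k+3)) powr s) = ennreal (\<Sum>n\<in>G. (1 / 2^(k+3)) powr s)" by simp
    also have "\<dots> \<le> ennreal (\<Sum>n\<in>G. d n powr s)"
      using F G s by (intro ennreal_leI sum_mono powr_mono2) auto
    also have "\<dots> = (\<Sum>n\<in>G. ennreal (d n powr s))" by (rule sum_ennreal[symmetric]) simp
    also have "\<dots> \<le> (\<Sum>n. ennreal (d n powr s))" using G by (intro sum_le_suminf) auto
    also note sum
    finally have "real (card G) * (1 / 2^(k+3)) powr s \<le> 1/16" by (subst (asm) ennreal_le_iff) auto
    then have "real (card G) * 2 powr (- ((real k + 3) * s)) * 2 powr ((real k + 3) * s) \<le> 1/16 * 2 powr ((real k + 3) * s)"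
      unfolding q by (intro mult_right_mono) auto
    then have "real (card G) \<le> 1/16 * 2 powr ((real k + 3) * s)" by (simp add: mult.assoc powr_add[symmetric])
    also have "2 powr ((real k + 3) * s) = 2 powr (real k * s) * 2 powr (3 * s)" by (simp add: powr_add[symmetric] distrib_right)
    also have "2 powr (3 * s) \<le> 2 powr (6::real)" using s by (intro powr_mono) auto
    also have "2 powr (6::real) = 64" by simp
    finally show ?thesis unfolding X_def by (simp add: mult_left_mono)
  qed
  have "finite F \<and> card F \<le> nat \<lfloor>X\<rfloor>"
  proof (rule finite_if_finite_subsets_card_bdd)
    fix G assume "G \<subseteq> F" "finite G"
    then have "real (card G) \<le> X" by (rule bd)
    then show "card G \<le> nat \<lfloor>X\<rfloor>" by linarith
  qed
  then show ?thesis using bd[of F] unfolding X_def by blast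
qed

lemma arc_point_close:
  fixes X Y R :: real and z1 z2 v \<sigma> q :: real
  assumes R: "0 \<le> R" "R \<le> 17/16" and v: "\<bar>v\<bar> \<le> 1/2" "\<bar>\<sigma>\<bar> \<le> 1/2" "\<bar>v - \<sigma>\<bar> \<le> q"
    and z: "\<bar>X + R * v - z1\<bar> \<le> q" "\<bar>Y + R * sqrt (1 - v^2) - z2\<bar> \<le> q"
  shows "(X + R * \<sigma> - z1)^2 + (Y + R * sqrt (1 - \<sigma>^2) - z2)^2 \<le> (4 * q)^2"
proof -
  have sq: "x^2 \<le> 1/4" if "\<bar>x\<bar> \<le> 1/2" for x :: real using power2_le_of_abs_le[OF that] by (simp add: power_divide)
  have sv: "v^2 \<le> 1/4" "\<sigma>^2 \<le> 1/4" using sq v by auto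
  define a b where "a = sqrt (1 - v^2)" and "b = sqrt (1 - \<sigma>^2)"
  have half: "1/2 \<le> sqrt (1 - x)" if "x \<le> 1/4" for x :: real
    by (rule real_le_rsqrt) (use that in \<open>simp add: power_divide\<close>)
  have ab: "a^2 = 1 - v^2" "b^2 = 1 - \<sigma>^2" "1/2 \<le> a" "1/2 \<le> b"
    unfolding a_def b_def using sv half by auto
  have "(a - b) * (a + b) = (\<sigma> - v) * (\<sigma> + v)" using ab(1,2) by (simp add: power2_eq_square algebra_simps)
  then have "\<bar>a - b\<bar> * \<bar>a + b\<bar> = \<bar>\<sigma> - v\<bar> * \<bar>\<sigma> + v\<bar>" by (metis abs_mult)
  moreover have "\<bar>\<sigma> - v\<bar> * \<bar>\<sigma> + v\<bar> \<le> q * 1" using v by (intro mult_mono) auto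
  moreover have "\<bar>a - b\<bar> * 1 \<le> \<bar>a - b\<bar> * \<bar>a + b\<bar>" using ab by (intro mult_left_mono) auto
  ultimately have d: "\<bar>a - b\<bar> \<le> q" by linarith
  have q0: "0 \<le> q" using v by linarith
  have m: "\<bar>R * e\<bar> \<le> 17/16 * q" if "\<bar>e\<bar> \<le> q" for e using R that by (intro abs_mult_le) auto
  have "X + R * \<sigma> - z1 = (X + R * v - z1) + R * (\<sigma> - v)" by (simp add: algebra_simps)
  then have 1: "\<bar>X + R * \<sigma> - z1\<bar> \<le> 33/16 * q" using z(1) m[of "\<sigma> - v"] v(3) by linarith
  have "Y + R * b - z2 = (Y + R * a - z2) + R * (b - a)" by (simp add: algebra_simps)
  then have 2: "\<bar>Y + R * b - z2\<bar> \<le> 33/16 * q" using z(2) m[of "b - a"] d unfolding a_def[symmetric] by linarith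
  have "(X + R * \<sigma> - z1)^2 + (Y + R * b - z2)^2 \<le> (33/16 * q)^2 + (33/16 * q)^2"
    using 1 2 by (intro add_mono power2_le_of_abs_le)
  also have "\<dots> \<le> (4 * q)^2" by (simp add: power_mult_distrib power_divide)
  finally show ?thesis unfolding b_def .
qed

section \<open>From a cover to a single scale\<close>

definition coords :: "(real^2) \<times> real \<Rightarrow> real \<times> real \<times> real" where
  "coords p = (fst p $ 1, fst p $ 2, snd p)"

text \<open>
  A cover splits into the families \<open>C k\<close>, the \<open>k\<close>-th of which will be used for the circles that are rich at scale
  \<open>2\<^sup>-\<^sup>k\<close>; the weights \<open>1 / (2 (k + 1) (k + 2))\<close> have sum 1/2.
\<close>
definition content_ge :: "real \<Rightarrow> real \<Rightarrow> ((real^2) \<times> real) set \<Rightarrow> bool" where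
  "content_ge c t A \<longleftrightarrow> (\<forall>C :: nat \<Rightarrow> (nat \<times> int \<times> int \<times> int) set.
     (\<forall>k. finite (C k) \<and> (\<Sum>x\<in>C k. (1/2^(fst x)) powr t) \<le> c / (2 * (real k + 1) * (real k + 2))) \<longrightarrow>
     \<not> (\<forall>p\<in>A. \<exists>k j. (j, dcell j (coords p)) \<in> C k))"

text \<open>If the Frostman measure on \<open>E k\<close> were too light for every \<open>k\<close>,
  the cells in which its bound is attained, taken over all \<open>k\<close>, would form a cover of
  \<open>A\<close> that the content forbids.\<close>

lemma content_frostman:
  assumes A: "content_ge c t A" and cov: "\<And>p. p \<in> A \<Longrightarrow> \<exists>k. p \<in> E k"
    and fin: "\<And>k. finite ((\<lambda>p. dcell k (coords p)) ` E k)"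
  shows "\<exists>k P \<mu>. finite P \<and> P \<subseteq> E k \<and> (\<forall>p. 0 \<le> \<mu> p) \<and>
    (\<forall>p\<in>P. \<forall>j\<le>k. sum \<mu> {q\<in>P. dcell j (coords q) = dcell j (coords p)} \<le> (1/2^j) powr t) \<and>
    c / (2 * (real k + 1) * (real k + 2)) < sum \<mu> P"
proof -
  have c: "\<not> (\<forall>p\<in>A. \<exists>k j. (j, dcell j (coords p)) \<in> C k)"
    if "\<And>k. finite (C k) \<and> (\<Sum>x\<in>C k. (1/2^(fst x)) powr t) \<le> c / (2 * (real k + 1) * (real k + 2))"
    for C :: "nat \<Rightarrow> (nat \<times> int \<times> int \<times> int) set"
    using A that unfolding content_ge_def by blast
  define good where "good k P \<mu> \<longleftrightarrow> finite P \<and> P \<subseteq> E k \<and> (\<forall>p. 0 \<le> \<mu> p) \<and>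
    (\<forall>p\<in>P. \<forall>j\<le>k. sum \<mu> {q\<in>P. dcell j (coords q) = dcell j (coords p)} \<le> (1/2^j) powr t) \<and>
    c / (2 * (real k + 1) * (real k + 2)) < sum \<mu> P" for k P \<mu>
  have "\<exists>k P \<mu>. good k P \<mu>"
  proof (rule ccontr)
    assume no: "\<not> ?thesis"
    define cover where "cover k C \<longleftrightarrow> finite C \<and> (\<Sum>x\<in>C. (1/2^(fst x)) powr t) \<le> c / (2 * (real k + 1) * (real k + 2)) \<and>
      (\<forall>e\<in>E k. \<exists>j. (j, dcell j (coords e)) \<in> C)" for k and C :: "(nat \<times> int \<times> int \<times> int) set"
    have "\<exists>C. cover k C" for k
    proof -
      let ?cl = "\<lambda>j p. dcell j (coords p)"
      show ?thesis
      proof (rule discrete_frostman[where cl = ?cl and E = "E k" and k = k and t = t, OF fin[of k]])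
        show "?cl j p = ?cl j q" if "?cl k' p = ?cl k' q" "j \<le> k'" for j k' p q
          using that by (rule dcell_mono_eq)
      next
      fix P and \<mu> :: "(real^2) \<times> real \<Rightarrow> real" and C
      assume h: "finite P" "P \<subseteq> E k" "\<And>p. 0 \<le> \<mu> p"
        "\<And>p j. p \<in> P \<Longrightarrow> j \<le> k \<Longrightarrow> sum \<mu> {q\<in>P. ?cl j q = ?cl j p} \<le> (1/2^j) powr t"
        "finite C" "\<And>e. e \<in> E k \<Longrightarrow> \<exists>j. (j, ?cl j e) \<in> C" "(\<Sum>x\<in>C. (1/2^(fst x)) powr t) \<le> sum \<mu> P"
      have "\<not> good k P \<mu>" using no by blast
      then have "sum \<mu> P \<le> c / (2 * (real k + 1) * (real k + 2))" unfolding good_def using h by (simp add: not_less)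
      then have "(\<Sum>x\<in>C. (1/2^(fst x)) powr t) \<le> c / (2 * (real k + 1) * (real k + 2))" using h(7) by linarith
      then have "cover k C" unfolding cover_def using h(5,6) by blast
      then show ?thesis by blast
      qed
    qed
    then have "\<exists>C. \<forall>k. cover k (C k)" by (intro choice allI)
    then obtain C where C: "\<And>k. cover k (C k)" by blast
    have "\<not> (\<forall>p\<in>A. \<exists>k j. (j, dcell j (coords p)) \<in> C k)" using C unfolding cover_def by (intro c) blast
    moreover have "\<forall>p\<in>A. \<exists>k j. (j, dcell j (coords p)) \<in> C k" using cov C unfolding cover_def by blast
    ultimately show False by blast
  qed
  then show ?thesis unfolding good_def .
qed

lemma finite_dcell_box:
  assumes "\<And>p. p \<in> A \<Longrightarrow> \<bar>fst p $ 1\<bar> \<le> b \<and> \<bar>fst p $ 2\<bar> \<le> b \<and> \<bar>snd p\<bar> \<le> b"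
  shows "finite ((\<lambda>p. dcell k (coords p)) ` A)"
proof -
  let ?I = "{\<lfloor>2^k * (- b)\<rfloor> .. \<lfloor>2^k * b\<rfloor>}"
  have f: "\<lfloor>2^k * x\<rfloor> \<in> ?I" if "\<bar>x\<bar> \<le> b" for x :: real
  proof -
    have "- b \<le> x" "x \<le> b" using that by auto
    then have "2^k * (- b) \<le> 2^k * x" "2^k * x \<le> 2^k * b" by - (rule mult_left_mono, assumption, simp)+
    then show ?thesis by (auto intro!: floor_mono simp del: mult_minus_right)
  qed
  have "(\<lambda>p. dcell k (coords p)) ` A \<subseteq> ?I \<times> ?I \<times> ?I"
  proof
    fix c assume "c \<in> (\<lambda>p. dcell k (coords p)) ` A"
    then obtain p where p: "p \<in> A" "c = dcell k (coords p)" by auto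
    show "c \<in> ?I \<times> ?I \<times> ?I" unfolding p(2) coords_def dcell_def using f assms[OF p(1)] by simp
  qed
  then show ?thesis by (rule finite_subset) simp
qed

lemma scale_const_pos: "0 < scale_const"
  unfolding scale_const_def by simp

text \<open>A cover with small sum uses only scales \<open>k \<ge> k0\<close>. For every circle some
  scale catches the proportion \<open>lam k\<close> of the arc, and for some scale the circles for
  which this happens carry a Frostman measure of mass more than \<open>c * lam k\<close>. At that
  scale there are at most \<open>4 * 2 powr (k * s)\<close> discs. This contradicts
  \<open>single_scale\<close> for large \<open>k\<close>, since \<open>1 + t - s\<close> is positive
  and all other factors are constants or powers of \<open>k\<close>.\<close>

theorem circles_not_null:
  fixes A :: "((real^2) \<times> real) set"
  assumes box: "\<And>p q. p \<in> A \<Longrightarrow> q \<in> A \<Longrightarrow> \<bar>fst p $ 1 - fst q $ 1\<bar> \<le> 1/8 \<and> \<bar>fst p $ 2 - fst q $ 2\<bar> \<le> 1/8 \<and> \<bar>snd p - snd q\<bar> \<le> 1/16"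
    and r: "\<And>p. p \<in> A \<Longrightarrow> 1 \<le> snd p \<and> snd p \<le> 17/16"
    and t: "0 \<le> t" "t \<le> 1" and s: "0 < s" "s < 1 + t" and c: "0 < c" and A: "content_ge c t A"
  shows "\<not> hnull s (\<Union>(x,r)\<in>A. sphere x r)"
proof
  assume null: "hnull s (\<Union>(x,r)\<in>A. sphere x r)"
  define \<eta> where "\<eta> = 1 + t - s"
  have \<eta>: "0 < \<eta>" unfolding \<eta>_def using s by simp
  have s2: "s \<le> 2" using s t by simp
  \<comment> \<open>The arc above the centre, parametrised by the sine as the grid is.\<close>
  define \<Gamma> where "\<Gamma> p v = (vector [fst p $ 1 + snd p * v, fst p $ 2 + snd p * sqrt (1 - v^2)] :: real^2)" for p :: "(real^2) \<times> real" and v :: real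
  have \<Gamma>12: "\<Gamma> p v $ 1 = fst p $ 1 + snd p * v" "\<Gamma> p v $ 2 = fst p $ 2 + snd p * sqrt (1 - v^2)" for p v
    unfolding \<Gamma>_def by (simp_all add: vector_2)
  have \<Gamma>F: "\<Gamma> p v \<in> (\<Union>(x,r)\<in>A. sphere x r)" if p: "p \<in> A" and v: "\<bar>v\<bar> \<le> 1/2" for p v
  proof -
    have v2: "v^2 \<le> 1" using power2_le_of_abs_le[OF v] by (simp add: power_divide)
    have "(dist (fst p) (\<Gamma> p v))^2 = (snd p)^2 * v^2 + (snd p)^2 * (1 - v^2)"
      unfolding dist_real2 \<Gamma>12 using v2 by (simp add: power_mult_distrib)
    then have "(dist (fst p) (\<Gamma> p v))^2 = (snd p)^2" by (simp add: algebra_simps)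
    then have "dist (fst p) (\<Gamma> p v) = snd p" using r[OF p] by (simp add: power2_eq_iff_nonneg)
    then have "\<Gamma> p v \<in> sphere (fst p) (snd p)" by simp
    then show ?thesis using p by (intro UN_I[of p]) (auto split: prod.split)
  qed
  define lam where "lam k = 1 / (2 * (real k + 1) * (real k + 2))" for k
  have C0: "0 < 8 * scale_const / c" using c scale_const_pos by simp
  \<comment> \<open>\<open>527 = 3 + 4 * 131\<close>: degree 3 from the Frostman constant, and
    \<open>real (k+1) / lam k\<close> is at most \<open>(real k + 2)^4\<close> and occurs with
    exponent 131.\<close>
  obtain k1 where k1: "\<And>k. k1 \<le> k \<Longrightarrow> 8 * scale_const / c * (real k + 2)^527 < 2 powr (real k * \<eta>)"
    using polynomial_less_exponential[OF \<eta> C0] by blast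
  obtain k2 where k2: "\<And>k. k2 \<le> k \<Longrightarrow> 2 * (real k + 2)^2 < 2 powr (real k * 1)"
    using polynomial_less_exponential[of 1 2] by force
  define k0 where "k0 = max 3 (max k1 k2)"
  have "0 < min (1/16) ((1/2^(k0+3)) powr s)" by simp
  then obtain U :: "nat \<Rightarrow> (real^2) set" and d :: "nat \<Rightarrow> real" where U: "\<forall>n. 0 < d n \<and> bounded (U n) \<and> diameter (U n) \<le> d n"
    "(\<Union>(x,r)\<in>A. sphere x r) \<subseteq> (\<Union>n. U n)" "(\<Sum>n. ennreal (d n powr s)) \<le> ennreal (min (1/16) ((1/2^(k0+3)) powr s))"
    by (rule hnull_positive_cover[OF s(1) null])
  have d0: "0 < d n" for n using U(1) by simp
  have sum16: "(\<Sum>n. ennreal (d n powr s)) \<le> ennreal (1/16)"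
    by (rule order_trans[OF U(3)]) (intro ennreal_leI, simp)
  have dk0: "d n \<le> 1 / 2^(k0+3)" for n
  proof (rule ccontr)
    assume "\<not> d n \<le> 1 / 2^(k0+3)"
    then have "(1 / 2^(k0+3)) powr s < d n powr s" using s by (intro powr_less_mono2) auto
    moreover have "d n powr s \<le> min (1/16) ((1/2^(k0+3)) powr s)" by (rule term_le_of_suminf_le[OF U(3)]) simp
    ultimately show False by simp
  qed
  \<comment> \<open>The factor 4 matches \<open>J k = 2^(k+2)\<close>: a covering set of scale
    \<open>k\<close> has diameter at most \<open>1 / J k\<close>, and the factor 4 lost in
    \<open>arc_point_close\<close> leads to \<open>1 / 2^k\<close>.\<close>
  define kk where "kk n = dyadic_level (4 * d n)" for n
  have d1: "0 < 4 * d n" "4 * d n \<le> 1 / 2^(k0+1)" "4 * d n \<le> 1" for n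
  proof -
    show "0 < 4 * d n" using d0[of n] by simp
    have "(2::real)^(k0+3) = 2^(k0+1) * 4" by (simp add: power_add)
    then show 1: "4 * d n \<le> 1 / 2^(k0+1)" using dk0[of n] by (simp add: field_simps)
    have "1 / 2^(k0+1) \<le> (1::real) / 1" by (rule divide_left_mono) (rule one_le_power, simp_all)
    then show "4 * d n \<le> 1" using 1 by linarith
  qed
  have kk: "1 / 2^(kk n + 1) < 4 * d n" "4 * d n \<le> 1 / 2^(kk n)" "k0 \<le> kk n" for n
  proof -
    show 1: "1 / 2^(kk n + 1) < 4 * d n" "4 * d n \<le> 1 / 2^(kk n)" unfolding kk_def by (rule dyadic_level[OF d1(1,3)])+
    have "1 / (2::real)^(kk n + 1) < 1 / 2^(k0+1)" using 1(1) d1(2)[of n] by linarith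
    then have "(2::real)^(k0+1) < 2^(kk n + 1)" by (simp add: divide_less_cancel frac_less2 field_simps)
    then have "k0 + 1 < kk n + 1" by (simp only: power_strict_increasing_iff one_less_numeral_iff semiring_norm)
    then show "k0 \<le> kk n" by simp
  qed
  define z where "z n = (SOME y. y \<in> U n)" for n
  have zd: "dist y (z n) \<le> d n" if "y \<in> U n" for y n
  proof -
    have "z n \<in> U n" unfolding z_def using that by (rule someI)
    then show ?thesis using diameter_bounded_bound[of "U n" y "z n"] U(1) that by (metis order_trans)
  qed
  define J where "J k = (2::nat)^(k+2)" for k
  have J0: "0 < J k" "real (J k) = 2^(k+2)" for k unfolding J_def by auto
  define hit where "hit k p j n \<longleftrightarrow> kk n = k \<and> (\<exists>u. real j / real (J k) \<le> u \<and> u \<le> (real j + 1) / real (J k) \<and> \<Gamma> p (u - 1/2) \<in> U n)" for k p j n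
  define S where "S k p = {j. j < J k \<and> (\<exists>n. hit k p j n)}" for k p
  have Sfin: "finite (S k p)" "S k p \<subseteq> {..<J k}" for k p unfolding S_def by auto
  define E where "E k = {p\<in>A. lam k \<le> real (card (S k p)) / real (J k)}" for k
  have Ecov: "\<exists>k. p \<in> E k" if p: "p \<in> A" for p
  proof -
    have "\<exists>k. 1 / (2 * (real k + 1) * (real k + 2)) \<le> real (card (S k p)) / real (J k)"
    proof (rule interval_pigeonhole[OF Sfin(1) J0(1)])
      fix u :: real assume u: "0 \<le> u" "u \<le> 1"
      have "\<Gamma> p (u - 1/2) \<in> (\<Union>(x,r)\<in>A. sphere x r)" by (rule \<Gamma>F[OF p]) (use u in linarith)
      then obtain n where n: "\<Gamma> p (u - 1/2) \<in> U n" using U(2) by blast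
      define k where "k = kk n"
      define j where "j = (if u = 1 then J k - 1 else nat \<lfloor>u * real (J k)\<rfloor>)"
      have j: "real j \<le> u * real (J k)" "u * real (J k) \<le> real j + 1" "j < J k"
      proof -
        have "real j \<le> u * real (J k) \<and> u * real (J k) \<le> real j + 1 \<and> j < J k"
        proof (cases "u = 1")
          case True
          then show ?thesis using J0(1)[of k] unfolding j_def by (simp add: of_nat_diff)
        next
          case False
          have "0 \<le> u * real (J k)" using u by simp
          moreover have "u * real (J k) < real (J k)" using u False J0(1)[of k] by simp
          ultimately show ?thesis unfolding j_def using False by (simp add: nat_less_iff floor_less_iff)
        qed
        then show "real j \<le> u * real (J k)" "u * real (J k) \<le> real j + 1" "j < J k" by auto
      qed
      have ju: "real j / real (J k) \<le> u" "u \<le> (real j + 1) / real (J k)"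
        using j J0(1)[of k] by (simp_all add: pos_divide_le_eq pos_le_divide_eq)
      then have "hit k p j n" unfolding hit_def k_def using n by blast
      then have "j \<in> S k p" unfolding S_def using j(3) by blast
      then show "\<exists>k. \<exists>j\<in>S k p. real j / real (J k) \<le> u \<and> u \<le> (real j + 1) / real (J k)" using ju by blast
    qed
    then show ?thesis unfolding E_def lam_def using p by blast
  qed
  have Efin: "finite ((\<lambda>p. dcell k (coords p)) ` E k)" for k
  proof (cases "A = {}")
    case False
    then obtain p0 where p0: "p0 \<in> A" by blast
    define b where "b = \<bar>fst p0 $ 1\<bar> + \<bar>fst p0 $ 2\<bar> + \<bar>snd p0\<bar> + 1"
    show ?thesis
    proof (rule finite_dcell_box)
      fix p assume "p \<in> E k"
      then have "p \<in> A" unfolding E_def by simp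
      from box[OF this p0] show "\<bar>fst p $ 1\<bar> \<le> b \<and> \<bar>fst p $ 2\<bar> \<le> b \<and> \<bar>snd p\<bar> \<le> b" unfolding b_def by linarith
    qed
  qed (simp add: E_def)
  have "\<exists>k P \<mu>. finite P \<and> P \<subseteq> E k \<and> (\<forall>p. 0 \<le> \<mu> p) \<and>
    (\<forall>p\<in>P. \<forall>j\<le>k. sum \<mu> {q\<in>P. dcell j (coords q) = dcell j (coords p)} \<le> (1/2^j) powr t) \<and>
    c / (2 * (real k + 1) * (real k + 2)) < sum \<mu> P"
    by (rule content_frostman[where E = E, OF A]) (rule Ecov, assumption, rule Efin)
  then obtain k P \<mu> where PP: "finite P \<and> P \<subseteq> E k \<and> (\<forall>p. 0 \<le> \<mu> p) \<and>
    (\<forall>p\<in>P. \<forall>j\<le>k. sum \<mu> {q\<in>P. dcell j (coords q) = dcell j (coords p)} \<le> (1/2^j) powr t) \<and>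
    c / (2 * (real k + 1) * (real k + 2)) < sum \<mu> P"
    by (elim exE) (rule that)
  note P = PP[THEN conjunct1] PP[THEN conjunct2, THEN conjunct1] PP[THEN conjunct2, THEN conjunct2, THEN conjunct1]
    PP[THEN conjunct2, THEN conjunct2, THEN conjunct2, THEN conjunct1] PP[THEN conjunct2, THEN conjunct2, THEN conjunct2, THEN conjunct2]
  have \<mu>0: "0 \<le> \<mu> p" for p using P(3) by (rule spec)
  define \<tau> where "\<tau> = sum \<mu> P"
  have PA: "p \<in> A" "lam k \<le> real (card (S k p)) / real (J k)" if "p \<in> P" for p using that P(2) unfolding E_def by auto
  have lam0: "0 < lam k" unfolding lam_def by simp
  have c\<tau>: "c * lam k < \<tau>" using P(5) unfolding \<tau>_def lam_def by simp
  then have \<tau>0: "0 < \<tau>" using c lam0 by (metis less_trans mult_pos_pos)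
  have kk0: "k0 \<le> k"
  proof -
    have "P \<noteq> {}" using \<tau>0 unfolding \<tau>_def by auto
    then obtain p where "p \<in> P" by blast
    then have "0 < real (card (S k p)) / real (J k)" using PA(2) lam0 by (meson less_le_trans)
    then have "S k p \<noteq> {}" by auto
    then obtain j n where "hit k p j n" unfolding S_def by blast
    then show ?thesis using kk(3)[of n] unfolding hit_def by simp
  qed
  \<comment> \<open>One covering set is chosen for each grid interval that is hit, which makes the
    sets \<open>inc p n\<close> disjoint for fixed \<open>p\<close>.\<close>
  define g where "g p j = (SOME n. hit k p j n)" for p j
  have g: "hit k p j (g p j)" if "j \<in> S k p" for p j
  proof -
    have "\<exists>n. hit k p j n" using that unfolding S_def by simp
    then show ?thesis unfolding g_def by (rule someI_ex)
  qed
  define inc where "inc p n = {j\<in>S k p. g p j = n}" for p n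
  define B where "B = {n. kk n = k}"
  have B: "finite B \<and> real (card B) \<le> 4 * 2 powr (real k * s)"
  proof (rule card_large_terms[OF s(1) s2 sum16])
    fix n assume "n \<in> B"
    then have "1 / 2^(k+1) < 4 * d n" using kk(1)[of n] unfolding B_def by simp
    moreover have "(2::real)^(k+3) = 2^(k+1) * 4" by (simp add: power_add)
    ultimately show "1 / 2^(k+3) \<le> d n" by (simp add: field_simps)
  qed
  \<comment> \<open>Normalising the weights to mass 1 turns the Frostman constant into
    \<open>1 / \<tau>\<close>, and \<tau> exceeds \<open>c * lam k\<close>.\<close>
  interpret cs: circle_scale P "\<lambda>p. \<mu> p / \<tau>" "\<lambda>p. fst p $ 1" "\<lambda>p. fst p $ 2" "snd" k "J k" B inc "\<lambda>n. z n $ 1" "\<lambda>n. z n $ 2" t "1 / \<tau>"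
  proof unfold_locales
    show "finite P" "finite B" using P B by auto
    show "0 \<le> \<mu> p / \<tau>" for p using \<mu>0[of p] \<tau>0 by simp
    show "(\<Sum>p\<in>P. \<mu> p / \<tau>) \<le> 1" using \<tau>0 unfolding \<tau>_def by (simp add: sum_divide_distrib[symmetric])
    show "\<bar>fst p $ 1 - fst q $ 1\<bar> \<le> 1/8 \<and> \<bar>fst p $ 2 - fst q $ 2\<bar> \<le> 1/8 \<and> \<bar>snd p - snd q\<bar> \<le> 1/16" if "p \<in> P" "q \<in> P" for p q
      using box PA(1) that by blast
    show "1 \<le> snd p \<and> snd p \<le> 17/16" if "p \<in> P" for p using r PA(1) that by blast
    show "3 \<le> k" using kk0 unfolding k0_def by simp
    show "2^k \<le> J k" unfolding J_def by (simp add: power_add)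
    show "inc p n \<subseteq> {..<J k}" for p n using Sfin(2) unfolding inc_def by blast
    show "inc p n \<inter> inc p n' = {}" if "n \<noteq> n'" for p n n' using that unfolding inc_def by blast
    show "(fst p $ 1 + snd p * grid_sin (J k) j - z n $ 1)^2 + (fst p $ 2 + snd p * grid_cos (J k) j - z n $ 2)^2 \<le> (1/2^k)^2"
      if p: "p \<in> P" and j: "j \<in> inc p n" for p n j
    proof -
      have jS: "j \<in> S k p" "g p j = n" using j unfolding inc_def by auto
      have jJ: "j < J k" using jS(1) unfolding S_def by simp
      obtain u where u: "kk n = k" "real j / real (J k) \<le> u" "u \<le> (real j + 1) / real (J k)" "\<Gamma> p (u - 1/2) \<in> U n"
        using g[OF jS(1)] unfolding jS(2) hit_def by blast
      define q where "q = 1 / real (J k)"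
      have q4: "4 * q = 1 / 2^k" unfolding q_def J0(2) by (simp add: power_add)
      have dq: "d n \<le> q" using kk(2)[of n] u(1) q4 by simp
      have uq: "u \<le> real j / real (J k) + q" using u(3) unfolding q_def by (simp add: add_divide_distrib)
      have "real j + 1 \<le> real (J k)" using jJ by linarith
      then have "(real j + 1) / real (J k) \<le> 1" using J0(1)[of k] by (simp add: pos_divide_le_eq)
      moreover have "0 \<le> real j / real (J k)" by simp
      ultimately have u01: "0 \<le> u" "u \<le> 1" using u(2,3) by linarith+
      have dd: "dist (\<Gamma> p (u - 1/2)) (z n) \<le> q" using zd[OF u(4)] dq by linarith
      have comp: "\<bar>\<Gamma> p (u - 1/2) $ i - z n $ i\<bar> \<le> q" for i
        using dist_vec_nth_le[of "\<Gamma> p (u - 1/2)" i "z n"] dd by (simp add: dist_real_def)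
      have "(fst p $ 1 + snd p * grid_sin (J k) j - z n $ 1)^2 + (fst p $ 2 + snd p * sqrt (1 - (grid_sin (J k) j)^2) - z n $ 2)^2 \<le> (4 * q)^2"
      proof (rule arc_point_close)
        show "0 \<le> snd p" "snd p \<le> 17/16" using r[OF PA(1)[OF p]] by auto
        show "\<bar>u - 1/2\<bar> \<le> 1/2" using u01 by linarith
        show "\<bar>grid_sin (J k) j\<bar> \<le> 1/2" by (rule grid_sin_bound[OF jJ])
        show "\<bar>u - 1/2 - grid_sin (J k) j\<bar> \<le> q" unfolding grid_sin_def using u(2) uq by linarith
        show "\<bar>fst p $ 1 + snd p * (u - 1/2) - z n $ 1\<bar> \<le> q" using comp[of 1] unfolding \<Gamma>12 .
        show "\<bar>fst p $ 2 + snd p * sqrt (1 - (u - 1/2)^2) - z n $ 2\<bar> \<le> q" using comp[of 2] unfolding \<Gamma>12 .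
      qed
      then show ?thesis unfolding grid_cos_def q4 .
    qed
    show "(\<Sum>q\<in>{q\<in>P. dcell j (fst q $ 1, fst q $ 2, snd q) = dcell j (fst p $ 1, fst p $ 2, snd p)}. \<mu> q / \<tau>) \<le> 1 / \<tau> * (1/2^j) powr t"
      if "j \<le> k" "p \<in> P" for j p
    proof -
      have "sum \<mu> {q\<in>P. dcell j (coords q) = dcell j (coords p)} / \<tau> \<le> (1/2^j) powr t / \<tau>"
        using P(4) that \<tau>0 by (intro divide_right_mono) auto
      then show ?thesis unfolding coords_def by (simp add: sum_divide_distrib)
    qed
    show "0 \<le> t" "t \<le> 1" "0 \<le> 1 / \<tau>" using t \<tau>0 by auto
  qed
  have k2': "2 * (real k + 2)^2 < 2^k"
    using k2[of k] kk0 unfolding k0_def by (simp add: powr_realpow)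
  have lamk: "1/2^k \<le> lam k" "lam k \<le> 1"
  proof -
    have "2 * (real k + 1) * (real k + 2) \<le> 2 * (real k + 2) * (real k + 2)" by (intro mult_right_mono) auto
    also have "\<dots> = 2 * (real k + 2)^2" by (simp add: power2_eq_square)
    finally have "2 * (real k + 1) * (real k + 2) \<le> 2^k" using k2' by linarith
    then show "1/2^k \<le> lam k" unfolding lam_def by (intro divide_left_mono) auto
    have "1 * 1 * 1 \<le> 2 * (real k + 1) * (real k + 2)" by (intro mult_mono) auto
    then show "lam k \<le> 1" unfolding lam_def by simp
  qed
  have tot: "lam k \<le> (\<Sum>p\<in>P. \<mu> p / \<tau> * (\<Sum>n\<in>B. cs.Wt p n))"
  proof -
    have "lam k = (\<Sum>p\<in>P. \<mu> p / \<tau>) * lam k" using \<tau>0 unfolding \<tau>_def by (simp add: sum_divide_distrib[symmetric])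
    also have "\<dots> = (\<Sum>p\<in>P. \<mu> p / \<tau> * lam k)" by (rule sum_distrib_right)
    also have "\<dots> \<le> (\<Sum>p\<in>P. \<mu> p / \<tau> * (\<Sum>n\<in>B. cs.Wt p n))"
    proof (intro sum_mono mult_left_mono)
      fix p assume p: "p \<in> P"
      have "(\<Union>n\<in>B. inc p n) = S k p"
      proof
        show "(\<Union>n\<in>B. inc p n) \<subseteq> S k p" unfolding inc_def by blast
        show "S k p \<subseteq> (\<Union>n\<in>B. inc p n)"
        proof
          fix j assume j: "j \<in> S k p"
          have "kk (g p j) = k" using g[OF j] unfolding hit_def by simp
          then show "j \<in> (\<Union>n\<in>B. inc p n)" unfolding inc_def B_def using j by blast
        qed
      qed
      then show "lam k \<le> (\<Sum>n\<in>B. cs.Wt p n)" using PA(2)[OF p] cs.Wt_sum[OF p order_refl] unfolding cs.fr_def by simp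
      show "0 \<le> \<mu> p / \<tau>" using \<mu>0[of p] \<tau>0 by simp
    qed
    finally show ?thesis .
  qed
  have "2 powr (real k * \<eta>) \<le> 8 * scale_const * (1 / \<tau>) * (real (k+1) / lam k)^131"
    unfolding \<eta>_def by (rule cs.single_scale[OF _ s2 conjunct2[OF B] lamk tot]) (use s in simp)
  also have "\<dots> \<le> 8 * scale_const * ((real k + 2)^3 / c) * ((real k + 2)^4)^131"
  proof (intro mult_mono power_mono mult_left_mono)
    have "1 / \<tau> \<le> 1 / (c * lam k)" using c\<tau> \<tau>0 c lam0 by (intro divide_left_mono) auto
    also have "\<dots> = 2 * (real k + 1) * (real k + 2) / c" unfolding lam_def by simp
    also have "\<dots> \<le> (real k + 2) * (real k + 2) * (real k + 2) / c" using c by (intro divide_right_mono mult_right_mono mult_mono) auto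
    finally show "1 / \<tau> \<le> (real k + 2)^3 / c" by (simp add: power3_eq_cube)
    have "real (k+1) / lam k = (real k + 1) * (2 * (real k + 1) * (real k + 2))" unfolding lam_def by simp
    also have "\<dots> \<le> (real k + 2) * ((real k + 2) * (real k + 2) * (real k + 2))" by (intro mult_mono) auto
    finally show "real (k+1) / lam k \<le> (real k + 2)^4" by (simp add: power4_eq_xxxx mult_ac)
    show "0 \<le> real (k+1) / lam k" using lam0 by simp
  qed (use scale_const_pos c lam0 \<tau>0 in auto)
  also have "\<dots> = 8 * scale_const / c * (real k + 2)^527"
  proof -
    have "(real k + 2)^3 * ((real k + 2)^4)^131 = (real k + 2)^527" by (simp only: power_mult[symmetric] power_add[symmetric]) simp
    then show ?thesis by simp
  qed
  also have "\<dots> < 2 powr (real k * \<eta>)" using k1[of k] kk0 unfolding k0_def by simp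
  finally show False by simp
qed

section \<open>The dimension of a union of circles\<close>

lemma dist_le_coords:
  "dist p q \<le> \<bar>fst p $ 1 - fst q $ 1\<bar> + \<bar>fst p $ 2 - fst q $ 2\<bar> + \<bar>snd p - snd q\<bar>" for p q :: "(real^2) \<times> real"
proof -
  have "dist p q \<le> dist (fst p) (fst q) + dist (snd p) (snd q)"
    using sqrt_sum_squares_le_sum[of "dist (fst p) (fst q)" "dist (snd p) (snd q)"] unfolding dist_prod_def by simp
  then show ?thesis using dist_real2_le[of "fst p" "fst q"] by (simp add: dist_real_def)
qed

lemma content_ge_of_not_hnull:
  assumes t: "0 < t" and A: "\<not> hnull t A"
  shows "\<exists>c>0. content_ge c t A"
proof -
  obtain \<epsilon> where \<epsilon>: "0 < \<epsilon>" "\<not> (\<exists>U::nat \<Rightarrow> ((real^2) \<times> real) set. (\<forall>i. bounded (U i)) \<and> A \<subseteq> (\<Union>i. U i) \<and>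
     (\<Sum>i. ennreal (diameter (U i) powr t)) \<le> ennreal \<epsilon>)"
    using A unfolding hnull_def by blast
  \<comment> \<open>A dyadic cell of level \<open>j\<close> has diameter at most
    \<open>3 / 2^j\<close>.\<close>
  define D where "D = (3::real) powr t"
  have D: "0 < D" unfolding D_def by simp
  define c where "c = \<epsilon> / D"
  have c: "0 < c" unfolding c_def using \<epsilon> D by simp
  have "content_ge c t A"
    unfolding content_ge_def
  proof (intro allI impI notI)
    fix C :: "nat \<Rightarrow> (nat \<times> int \<times> int \<times> int) set"
    assume C: "\<forall>k. finite (C k) \<and> (\<Sum>x\<in>C k. (1/2^(fst x)) powr t) \<le> c / (2 * (real k + 1) * (real k + 2))"
      and cov: "\<forall>p\<in>A. \<exists>k j. (j, dcell j (coords p)) \<in> C k"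
    define V where "V k x = {p. dcell (fst x) (coords p) = snd x}" for k :: nat and x :: "nat \<times> int \<times> int \<times> int"
    have V: "bounded (V k x)" "diameter (V k x) \<le> 3 * (1/2^(fst x))" for k x
    proof -
      have "dist p q \<le> 3 * (1/2^(fst x))" if "p \<in> V k x" "q \<in> V k x" for p q
      proof -
        have "dcell (fst x) (coords p) = dcell (fst x) (coords q)" using that unfolding V_def by simp
        from dcell_eq_imp_close[OF this[unfolded coords_def]] show ?thesis using dist_le_coords[of p q] by linarith
      qed
      then show "bounded (V k x)" "diameter (V k x) \<le> 3 * (1/2^(fst x))" by (auto intro!: bounded_diameter_le)
    qed
    have "\<exists>U::nat \<Rightarrow> ((real^2) \<times> real) set. (\<forall>i. bounded (U i)) \<and> A \<subseteq> (\<Union>i. U i) \<and>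
     (\<Sum>i. ennreal (diameter (U i) powr t)) \<le> ennreal \<epsilon>"
    proof (rule family_cover[where I = C and V = V and b = "\<lambda>k. \<epsilon> * (1 / (2 * (real k + 1) * (real k + 2)))"])
      show "finite (C k)" for k using C by simp
      show "bounded (V k x)" for k x by (rule V)
      show "A \<subseteq> (\<Union>k. \<Union>x\<in>C k. V k x)"
      proof
        fix p assume "p \<in> A"
        then obtain k j where kj: "(j, dcell j (coords p)) \<in> C k" using cov by blast
        moreover have "p \<in> V k (j, dcell j (coords p))" unfolding V_def by simp
        ultimately show "p \<in> (\<Union>k. \<Union>x\<in>C k. V k x)" by blast
      qed
      show "(\<Sum>x\<in>C k. diameter (V k x) powr t) \<le> \<epsilon> * (1 / (2 * (real k + 1) * (real k + 2)))" for k
      proof -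
        have "(\<Sum>x\<in>C k. diameter (V k x) powr t) \<le> (\<Sum>x\<in>C k. (3 * (1/2^(fst x))) powr t)"
          using t V by (intro sum_mono powr_mono2 diameter_ge_0) auto
        also have "\<dots> = (\<Sum>x\<in>C k. D * (1/2^(fst x)) powr t)" unfolding D_def by (intro sum.cong refl powr_mult)
        also have "\<dots> = D * (\<Sum>x\<in>C k. (1/2^(fst x)) powr t)" by (rule sum_distrib_left[symmetric])
        also have "\<dots> \<le> D * (c / (2 * (real k + 1) * (real k + 2)))" using C D by (intro mult_left_mono) auto
        also have "\<dots> = \<epsilon> * (1 / (2 * (real k + 1) * (real k + 2)))" unfolding c_def using D by simp
        finally show ?thesis .
      qed
      have "(\<lambda>k. \<epsilon> * (1 / (2 * (real k + 1) * (real k + 2)))) sums (\<epsilon> * (1/2))" by (intro sums_mult telescoping_half)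
      then have "(\<Sum>k. ennreal (\<epsilon> * (1 / (2 * (real k + 1) * (real k + 2))))) = ennreal (\<epsilon> * (1/2))"
        using \<epsilon>(1) by (intro suminf_ennreal_eq) auto
      also have "\<dots> \<le> ennreal \<epsilon>" using \<epsilon>(1) by (intro ennreal_leI) auto
      finally show "(\<Sum>k. ennreal (\<epsilon> * (1 / (2 * (real k + 1) * (real k + 2))))) \<le> ennreal \<epsilon>" .
    qed
    then show False using \<epsilon>(2) by (rule notE[rotated])
  qed
  then show ?thesis using c by blast
qed

text \<open>With exponent 0 every cell has weight 1, more than any \<open>C k\<close> may have.
  Through this the bound from one single circle, dimension at least 1, is the case
  \<open>t = 0\<close> of the general argument.\<close>

lemma content_ge_point: "content_ge 1 0 {p}"
  unfolding content_ge_def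
proof (intro allI impI notI)
  fix C :: "nat \<Rightarrow> (nat \<times> int \<times> int \<times> int) set"
  assume C: "\<forall>k. finite (C k) \<and> (\<Sum>x\<in>C k. (1/2^(fst x)) powr 0) \<le> 1 / (2 * (real k + 1) * (real k + 2))"
    and cov: "\<forall>p\<in>{p}. \<exists>k j. (j, dcell j (coords p)) \<in> C k"
  then obtain k x where x: "x \<in> C k" by blast
  have "real (card (C k)) \<le> 1 / (2 * (real k + 1) * (real k + 2))" using C by simp
  moreover have "1 \<le> card (C k)" using x C by (metis One_nat_def Suc_leI card_gt_0_iff empty_iff)
  moreover have "1 / (2 * (real k + 1) * (real k + 2)) \<le> 1 / 2"
  proof (rule divide_left_mono)
    have "2 * 1 * 1 \<le> 2 * (real k + 1) * (real k + 2)" by (intro mult_mono) auto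
    then show "2 \<le> 2 * (real k + 1) * (real k + 2)" by simp
  qed auto
  ultimately show False by linarith
qed

text \<open>Dilation by \<open>1 / b\<close> brings the piece \<open>A'\<close> to the normalised
  size, and the image of a null set under a dilation is null.\<close>

lemma circles_not_null_scaled:
  fixes A :: "((real^2) \<times> real) set"
  assumes b: "0 < b" and sub: "A' \<subseteq> A"
    and box: "\<And>p q. p \<in> A' \<Longrightarrow> q \<in> A' \<Longrightarrow> \<bar>fst p $ 1 - fst q $ 1\<bar> \<le> b/8 \<and> \<bar>fst p $ 2 - fst q $ 2\<bar> \<le> b/8"
    and r: "\<And>p. p \<in> A' \<Longrightarrow> b \<le> snd p \<and> snd p \<le> 17/16 * b"
    and t: "0 \<le> t" "t \<le> 1" and s: "0 < s" "s < 1 + t" and c: "0 < c" and A': "content_ge c t ((\<lambda>p. (1/b) *\<^sub>R p) ` A')"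
  shows "\<not> hnull s (\<Union>(x,r)\<in>A. sphere x r)"
proof
  assume null: "hnull s (\<Union>(x,r)\<in>A. sphere x r)"
  let ?A = "(\<lambda>p. (1/b) *\<^sub>R p) ` A'"
  have sc: "\<bar>x / b - y / b\<bar> = \<bar>x - y\<bar> / b" for x y using b by (simp add: diff_divide_distrib[symmetric])
  have "\<not> hnull s (\<Union>(x,r)\<in>?A. sphere x r)"
  proof (rule circles_not_null[OF _ _ t s c A'])
    fix p assume "p \<in> ?A"
    then obtain p' where p': "p' \<in> A'" "p = (1/b) *\<^sub>R p'" by blast
    show "1 \<le> snd p \<and> snd p \<le> 17/16" using r[OF p'(1)] b unfolding p'(2) by (simp add: pos_divide_le_eq pos_le_divide_eq)
    fix q assume "q \<in> ?A"
    then obtain q' where q': "q' \<in> A'" "q = (1/b) *\<^sub>R q'" by blast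
    have "\<bar>snd p' - snd q'\<bar> \<le> b / 16" using r[OF p'(1)] r[OF q'(1)] by linarith
    then show "\<bar>fst p $ 1 - fst q $ 1\<bar> \<le> 1/8 \<and> \<bar>fst p $ 2 - fst q $ 2\<bar> \<le> 1/8 \<and> \<bar>snd p - snd q\<bar> \<le> 1/16"
      using box[OF p'(1) q'(1)] b unfolding p'(2) q'(2) by (simp add: sc pos_divide_le_eq)
  qed
  moreover have "hnull s (\<Union>(x,r)\<in>?A. sphere x r)"
  proof (rule hnull_mono)
    show "hnull s ((\<lambda>y. (1/b) *\<^sub>R y) ` (\<Union>(x,r)\<in>A. sphere x r))"
      by (rule hnull_lipschitz_image[OF s(1) _ _ null, of "1/b"]) (use b in \<open>simp_all add: dist_norm scaleR_diff_right[symmetric]\<close>)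
    show "(\<Union>(x,r)\<in>?A. sphere x r) \<subseteq> (\<lambda>y. (1/b) *\<^sub>R y) ` (\<Union>(x,r)\<in>A. sphere x r)"
    proof
      fix y assume "y \<in> (\<Union>(x,r)\<in>?A. sphere x r)"
      then obtain p where p: "p \<in> A'" "y \<in> sphere (fst ((1/b) *\<^sub>R p)) (snd ((1/b) *\<^sub>R p))" by (auto split: prod.splits)
      have "dist (fst p) (b *\<^sub>R y) = b * dist ((1/b) *\<^sub>R fst p) y"
      proof -
        have "fst p - b *\<^sub>R y = b *\<^sub>R ((1/b) *\<^sub>R fst p - y)" using b by (simp add: scaleR_diff_right)
        then show ?thesis unfolding dist_norm using b by simp
      qed
      also have "\<dots> = snd p" using p(2) b by simp
      finally have "b *\<^sub>R y \<in> (\<Union>(x,r)\<in>A. sphere x r)" using p(1) sub by (intro UN_I[of p]) (auto split: prod.splits)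
      moreover have "y = (1/b) *\<^sub>R (b *\<^sub>R y)" using b by simp
      ultimately show "y \<in> (\<lambda>y. (1/b) *\<^sub>R y) ` (\<Union>(x,r)\<in>A. sphere x r)" by (rule rev_image_eqI)
    qed
  qed
  ultimately show False by (rule notE)
qed

lemma circles_not_null_below_1:
  fixes A :: "((real^2) \<times> real) set"
  assumes A: "A \<noteq> {}" "\<And>x r. (x,r) \<in> A \<Longrightarrow> 0 < r" and s: "0 < s" "s < 1"
  shows "\<not> hnull s (\<Union>(x,r)\<in>A. sphere x r)"
proof -
  obtain x r where xr: "(x,r) \<in> A" using A(1) by fast
  show ?thesis
  proof (rule circles_not_null_scaled[where b = r and A' = "{(x,r)}" and t = 0 and c = 1])
    show "content_ge 1 0 ((\<lambda>p. (1/r) *\<^sub>R p) ` {(x,r)})" using content_ge_point by simp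
  qed (use xr A(2)[OF xr] s in auto)
qed

lemma circles_not_null_above:
  fixes A :: "((real^2) \<times> real) set"
  assumes pos: "\<And>x r. (x,r) \<in> A \<Longrightarrow> 0 < r" and t: "0 < t" "t \<le> 1" and A: "\<not> hnull t A" and s: "0 < s" "s < 1 + t"
  shows "\<not> hnull s (\<Union>(x,r)\<in>A. sphere x r)"
proof -
  \<comment> \<open>The pieces are boxes of size proportional to the radius, so each of them becomes
    admissible after a dilation. There are countably many, and since countable unions of null sets
    are null, one of them is not null.\<close>
  define \<beta> where "\<beta> m = (17/16 :: real) powi m" for m :: int
  have \<beta>: "0 < \<beta> m" for m unfolding \<beta>_def by simp
  define P where "P u = (case u of (m,i,j) \<Rightarrow> {p\<in>A. \<beta> m \<le> snd p \<and> snd p \<le> 17/16 * \<beta> m \<and>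
    of_int i * (\<beta> m / 8) \<le> fst p $ 1 \<and> fst p $ 1 \<le> (of_int i + 1) * (\<beta> m / 8) \<and>
    of_int j * (\<beta> m / 8) \<le> fst p $ 2 \<and> fst p $ 2 \<le> (of_int j + 1) * (\<beta> m / 8)})" for u :: "int \<times> int \<times> int"
  have cov: "\<exists>u. p \<in> P u" if p: "p \<in> A" for p
  proof -
    have r0: "0 < snd p" using pos[of "fst p" "snd p"] p by simp
    define m where "m = \<lfloor>log (17/16) (snd p)\<rfloor>"
    have "of_int m \<le> log (17/16) (snd p)" "log (17/16) (snd p) \<le> of_int m + 1" unfolding m_def by linarith+
    then have "(17/16) powr (of_int m) \<le> snd p" "snd p \<le> (17/16) powr (of_int m + 1)"
      using r0 by (simp_all add: powr_le_iff le_powr_iff)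
    then have m: "\<beta> m \<le> snd p" "snd p \<le> 17/16 * \<beta> m" unfolding \<beta>_def by (simp_all add: powr_real_of_int' powr_add mult.commute)
    have fl: "\<exists>i::int. of_int i * (\<beta> m / 8) \<le> x \<and> x \<le> (of_int i + 1) * (\<beta> m / 8)" for x
    proof -
      have "0 < \<beta> m / 8" using \<beta>[of m] by simp
      from floor_divide_lower[OF this, of x] floor_divide_upper[OF this, of x] show ?thesis by (meson less_imp_le)
    qed
    obtain i j where ij: "of_int i * (\<beta> m / 8) \<le> fst p $ 1 \<and> fst p $ 1 \<le> (of_int i + 1) * (\<beta> m / 8)"
      "of_int j * (\<beta> m / 8) \<le> fst p $ 2 \<and> fst p $ 2 \<le> (of_int j + 1) * (\<beta> m / 8)" using fl by blast
    then have "p \<in> P (m,i,j)" unfolding P_def using p m by simp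
    then show ?thesis by blast
  qed
  have "\<exists>u. \<not> hnull t (P u)"
  proof (rule ccontr)
    assume "\<not> ?thesis"
    then have "hnull t (\<Union>n. P (from_nat n))" by (intro hnull_UN) blast
    moreover have "A \<subseteq> (\<Union>n. P (from_nat n))"
    proof
      fix p assume "p \<in> A"
      then obtain u where "p \<in> P u" using cov by blast
      then have "p \<in> P (from_nat (to_nat u))" by simp
      then show "p \<in> (\<Union>n. P (from_nat n))" by blast
    qed
    ultimately show False using A hnull_mono by blast
  qed
  then obtain m i j where nn: "\<not> hnull t (P (m,i,j))" by auto
  define b where "b = \<beta> m"
  have b: "0 < b" unfolding b_def by (rule \<beta>)
  let ?A' = "P (m,i,j)"
  have "\<not> hnull t ((\<lambda>p. (1/b) *\<^sub>R p) ` ?A')"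
  proof
    assume "hnull t ((\<lambda>p. (1/b) *\<^sub>R p) ` ?A')"
    then have "hnull t ((\<lambda>p. b *\<^sub>R p) ` (\<lambda>p. (1/b) *\<^sub>R p) ` ?A')"
      by (rule hnull_lipschitz_image[OF t(1), of b, rotated 2]) (use b in \<open>simp_all add: dist_norm scaleR_diff_right[symmetric]\<close>)
    moreover have "(\<lambda>p. b *\<^sub>R p) ` (\<lambda>p. (1/b) *\<^sub>R p) ` ?A' = ?A'" using b by (simp add: image_image)
    ultimately show False using nn by simp
  qed
  then obtain c where c: "0 < c" "content_ge c t ((\<lambda>p. (1/b) *\<^sub>R p) ` ?A')" using content_ge_of_not_hnull[OF t(1)] by blast
  show ?thesis
  proof (rule circles_not_null_scaled[OF b _ _ _ _ t(2) s c])
    show "?A' \<subseteq> A" unfolding P_def by auto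
    show "b \<le> snd p \<and> snd p \<le> 17/16 * b" if "p \<in> ?A'" for p using that unfolding P_def b_def by simp
    show "\<bar>fst p $ 1 - fst q $ 1\<bar> \<le> b/8 \<and> \<bar>fst p $ 2 - fst q $ 2\<bar> \<le> b/8" if "p \<in> ?A'" "q \<in> ?A'" for p q
    proof -
      have strip: "\<bar>x - y\<bar> \<le> e" if "n * e \<le> x" "x \<le> (n + 1) * e" "n * e \<le> y" "y \<le> (n + 1) * e" for n e x y :: real
        using that unfolding distrib_right by linarith
      show ?thesis using that unfolding P_def prod.case mem_Collect_eq b_def by (blast intro: strip)
    qed
  qed (use t in simp)
qed

theorem theorem1p6:
  fixes \<S> :: "(real^2) set set"
  assumes "analytic_circle_family \<S>" and "\<S> \<noteq> {}"
  shows "hausdorff_dim (\<Union>\<S>) = min (circle_family_dim \<S> + 1) 2"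
proof -
  define A where "A = circle_parameters \<S>"
  have sub: "\<S> \<subseteq> planar_circles" using assms(1) unfolding analytic_circle_family_def by blast
  have pos: "0 < r" if "(x,r) \<in> A" for x r using that unfolding A_def circle_parameters_def by simp
  have U: "\<Union>\<S> = (\<Union>(x,r)\<in>A. sphere x r)"
  proof
    show "\<Union>\<S> \<subseteq> (\<Union>(x,r)\<in>A. sphere x r)"
    proof
      fix y assume "y \<in> \<Union>\<S>"
      then obtain T where T: "T \<in> \<S>" "y \<in> T" by blast
      then obtain x r where xr: "T = sphere x r" "0 < r" using sub unfolding planar_circles_def by blast
      then have "(x,r) \<in> A" unfolding A_def circle_parameters_def using T by simp
      then show "y \<in> (\<Union>(x,r)\<in>A. sphere x r)" using T xr by blast
    qed
    show "(\<Union>(x,r)\<in>A. sphere x r) \<subseteq> \<Union>\<S>" unfolding A_def circle_parameters_def by blast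
  qed
  have A_ne: "A \<noteq> {}"
  proof -
    obtain T where T: "T \<in> \<S>" using assms(2) by blast
    then obtain x r where "T = sphere x r" "0 < r" using sub unfolding planar_circles_def by blast
    then have "(x,r) \<in> A" unfolding A_def circle_parameters_def using T by simp
    then show ?thesis by blast
  qed
  have U_ne: "\<Union>\<S> \<noteq> {}"
  proof -
    obtain x r where xr: "(x,r) \<in> A" using A_ne by fast
    have "x + r *\<^sub>R axis 1 1 \<in> sphere x r" using pos[OF xr] by (simp add: dist_norm norm_axis_1)
    then show ?thesis unfolding U using xr by blast
  qed
  have dim_le: "hausdorff_dim B \<le> ennreal s" if "0 \<le> s" "hausdorff_measure s B = 0" for B :: "'x::metric_space set" and s
    unfolding hausdorff_dim_def using that by (intro INF_lower) simp
  have F_le: "hausdorff_dim (\<Union>\<S>) \<le> ennreal s" if "0 < s" "hnull s (\<Union>\<S>)" for s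
    using that by (intro dim_le) (simp_all add: hausdorff_null_iff)
  have "hausdorff_dim (\<Union>\<S>) \<le> 2"
  proof (rule ennreal_le_epsilon)
    fix e :: real assume e: "0 < e"
    have "hausdorff_dim (\<Union>\<S>) \<le> ennreal (2 + e)" using e by (intro F_le hnull_plane) auto
    then show "hausdorff_dim (\<Union>\<S>) \<le> 2 + ennreal e" using e by (simp add: ennreal_plus)
  qed
  moreover have "hausdorff_dim (\<Union>\<S>) \<le> hausdorff_dim A + 1"
  proof (rule ennreal_le_epsilon)
    fix e :: real assume e: "0 < e" and fin: "hausdorff_dim A + 1 < top"
    obtain a where a: "hausdorff_dim A = ennreal a" "0 \<le> a" using fin by (cases "hausdorff_dim A") auto
    have "hausdorff_dim A < hausdorff_dim A + ennreal e"
      unfolding a(1) using e a(2) by (simp add: ennreal_plus[symmetric] ennreal_less_iff del: ennreal_plus)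
    then obtain s where s: "0 \<le> s" "hausdorff_measure s A = 0" "ennreal s < hausdorff_dim A + ennreal e"
      unfolding hausdorff_dim_def[of A] INF_less_iff by blast
    have "s \<noteq> 0" using s(2) A_ne hausdorff_measure_0 by blast
    then have s0: "0 < s" using s(1) by simp
    then have "hnull s A" using s(2) hausdorff_null_iff by blast
    then have "hnull (s + 1) (\<Union>\<S>)" unfolding U using s0 pos by (intro hnull_circles)
    then have "hausdorff_dim (\<Union>\<S>) \<le> ennreal (s + 1)" using s0 by (intro F_le) auto
    also have "\<dots> = ennreal s + 1" using s0 by (simp add: ennreal_plus)
    also have "\<dots> \<le> (hausdorff_dim A + ennreal e) + 1" using s(3) by (intro add_right_mono) simp
    finally show "hausdorff_dim (\<Union>\<S>) \<le> hausdorff_dim A + 1 + ennreal e" by (simp add: add_ac)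
  qed
  moreover have "min (hausdorff_dim A + 1) 2 \<le> hausdorff_dim (\<Union>\<S>)"
    unfolding hausdorff_dim_def[of "\<Union>\<S>"]
  proof (rule INF_greatest)
    fix s assume "s \<in> {s. 0 \<le> s \<and> hausdorff_measure s (\<Union>\<S>) = 0}"
    then have s: "0 \<le> s" "hausdorff_measure s (\<Union>\<S>) = 0" by auto
    have "s \<noteq> 0" using s(2) U_ne hausdorff_measure_0 by blast
    then have s0: "0 < s" using s(1) by simp
    then have null: "hnull s (\<Union>(x,r)\<in>A. sphere x r)" using s(2) hausdorff_null_iff unfolding U by blast
    show "min (hausdorff_dim A + 1) 2 \<le> ennreal s"
    proof (rule ccontr)
      assume "\<not> ?thesis"
      then have "ennreal s < min (hausdorff_dim A + 1) 2" unfolding not_le .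
      then have lt: "ennreal s < hausdorff_dim A + 1" "ennreal s < 2" unfolding min_less_iff_conj by blast+
      have s2: "s < 2" using lt(2) s0 by (metis ennreal_less_iff ennreal_numeral less_imp_le)
      \<comment> \<open>One circle already excludes exponents below 1, so \<open>s - 1\<close> is a
        legitimate exponent for parameters.\<close>
      have s1: "1 \<le> s" using circles_not_null_below_1[OF A_ne pos s0] null by (meson not_le)
      have "ennreal (s - 1) < hausdorff_dim A"
      proof (rule ccontr)
        assume "\<not> ?thesis"
        then have "hausdorff_dim A + 1 \<le> ennreal (s - 1) + 1" by (intro add_right_mono) simp
        also have "\<dots> = ennreal s" using s1 by (simp add: ennreal_plus[symmetric] ennreal_1[symmetric] del: ennreal_plus ennreal_1)
        finally show False using lt(1) by simp
      qed
      moreover have "ennreal (s - 1) < 1" using s1 s2 by (simp add: ennreal_less_iff ennreal_1[symmetric] del: ennreal_1)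
      ultimately have "ennreal (s - 1) < min (hausdorff_dim A) 1" by simp
      \<comment> \<open>This provides an exponent \<open>t\<close> above \<open>s - 1\<close> and
        below both the dimension of \<open>A\<close> and 1. The cap at 1, needed for
        \<open>circles_not_null_above\<close>, corresponds to the 2 in the minimum.\<close>
      then obtain x where x: "ennreal (s - 1) < x" "x < min (hausdorff_dim A) 1" using dense by blast
      then obtain t where t: "x = ennreal t" "0 \<le> t" by (cases x) auto
      have t1: "s - 1 < t" using x(1) s1 unfolding t(1) by (simp add: ennreal_less_iff)
      have t2: "t \<le> 1" using x(2) t(2) unfolding t(1) by (simp add: ennreal_less_iff ennreal_1[symmetric] del: ennreal_1)
      have t0: "0 < t" using t1 s1 by simp
      have "\<not> hnull t A"
      proof
        assume "hnull t A"
        then have "hausdorff_measure t A = 0" using hausdorff_null_iff[OF t0] by blast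
        then have "hausdorff_dim A \<le> ennreal t" using t0 by (intro dim_le) auto
        also have "\<dots> < hausdorff_dim A" using x(2) unfolding t(1) by simp
        finally show False by simp
      qed
      then have "\<not> hnull s (\<Union>(x,r)\<in>A. sphere x r)"
        using t1 by (intro circles_not_null_above[OF pos t0 t2 _ s0]) auto
      then show False using null by blast
    qed
  qed
  ultimately show ?thesis unfolding circle_family_dim_def A_def[symmetric] by (intro antisym) auto
qed

end
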